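(* Let $K_0$ be a $1$-connected CW complex (with $\dim_{\mathbb{Q}} H_p(K_0;\mathbb{Q})<\infty$ for all $p$) and let $N>0$ be an integer. For all $0<i\le N$, let $K_i=K_{i-1}\vee\mathbb{S}^{n_i}$ for some $n_i>1$. Then there exists, for each $0\le i\le N$, a transferred $A_\infty$-coalgebra $\bigl(\widetilde H_*(K_i;\mathbb{Q}),\{\Delta^i_n\}_n\bigr)$ on the reduced rational homology of $K_i$ such that, for every $n\ge 1$, $p\ge 0$ and $0\le i<N$, $$f_p^{i,i+1}\Bigl(\operatorname{Ker}\bigl(\Delta^i_n|_{\widetilde H_p(K_i;\mathbb{Q})}\bigr)\Bigr)\subseteq\operatorname{Ker}\bigl(\Delta^{i+1}_n|_{\widetilde H_p(K_{i+1};\mathbb{Q})}\bigr),$$ where $f_p^{i,i+1}\colon\widetilde H_p(K_i;\mathbb{Q})\to\widetilde H_p(K_{i+1};\mathbb{Q})$ is the map induced by the inclusion $K_i\hookrightarrow K_{i+1}$.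
   Context: All vector spaces are over $\mathbb{Q}$, and tensor products of graded maps follow the Koszul sign rule. An $A_\infty$-coalgebra structure on a graded vector space $C$ is a family of linear maps $\Delta_n\colon C\to C^{\otimes n}$ ($n\ge 1$) of degree $n-2$ such that for every $n\ge 1$ $$\sum_{i=1}^n\sum_{j=0}^{n-i}(-1)^{i+j+ij}\bigl(1^{\otimes (n-i-j)}\otimes\Delta_i\otimes 1^{\otimes j}\bigr)\Delta_{n-i+1}=0 .$$ It is minimal if $\Delta_1=0$. A differential graded coalgebra $(C,\partial,\Delta)$ is an $A_\infty$-coalgebra with $\Delta_1=\partial$, $\Delta_2=\Delta$, $\Delta_n=0$ for $n>2$. Equivalently, writing $s^{-1}C$ for the desuspension, $(s^{-1}C)_p=C_{p+1}$, the maps $d_n=-(s^{-1})^{\otimes n}\circ\Delta_n\circ s$ assemble into a degree $-1$ derivation $d=\sum_n d_n$ with $d^2=0$ on the complete tensor algebra $\widehat T(s^{-1}C)=\prod_{n\ge 1}(s^{-1}C)^{\otimes n}$ (product taken in each degree). A morphism of $A_\infty$-coalgebras $(C,\{\Delta_n\})\to(C',\{\Delta'_n\})$ is a family of linear maps $f_{(k)}\colon C\to (C')^{\otimes k}$, $k\ge 1$, of degree $k-1$, such that the algebra morphism $\widehat T(s^{-1}C)\to\widehat T(s^{-1}C')$ determined by $s^{-1}c\mapsto\sum_{k\ge 1}(s^{-1})^{\otimes k}f_{(k)}(c)$ commutes with the differentials. It is a quasi-isomorphism if $f_{(1)}$ induces an isomorphism in homology (with respect to $\Delta_1,\Delta'_1$).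 Reduced chains of a space $X$: $\widetilde C_*(X)$ is the kernel of the augmentation $C_*(X;\mathbb{Q})\to\mathbb{Q}$ of the singular chain complex, with the restricted differential $\widetilde\partial$ and the reduced comultiplication $\widetilde\Delta(c)=\Delta(c)-x_0\otimes c-c\otimes x_0$, where $x_0$ is a base point (as a $0$-chain) and $\Delta$ is a (coassociative) approximation to the diagonal, e.g. the Alexander–Whitney comultiplication. A transferred $A_\infty$-coalgebra on $\widetilde H_*(X;\mathbb{Q})$ (induced by $X$) is a minimal $A_\infty$-coalgebra structure on the graded vector space $\widetilde H_*(X;\mathbb{Q})$ that is quasi-isomorphic to $(\widetilde C_*(X),\{\widetilde\partial,\widetilde\Delta,0,0,\dots\})$. *)

theory Defs
  imports
    "HOL-Homology.Homology"
    "HOL-Algebra.Module"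
    "HOL-Library.Function_Algebras"
begin

section \<open>Graded rational vector spaces\<close>

definition rat_ring :: "rat ring"
  where "rat_ring = \<lparr>carrier = UNIV, mult = (*), one = 1, zero = 0, add = (+)\<rparr>"

text \<open>The fields \<^term>\<open>mult\<close> and \<^term>\<open>one\<close> that a module record inherits from the ring record
  play no role in the locale \<^locale>\<open>module\<close>; below they are left undefined.\<close>

type_synonym 'b gvs = "int \<Rightarrow> (rat, 'b) module"

definition graded_vector_space :: "'b gvs \<Rightarrow> bool"
  where "graded_vector_space V \<longleftrightarrow> (\<forall>p. module rat_ring (V p))"

definition finite_dimensional :: "(rat, 'b) module \<Rightarrow> bool"
  where "finite_dimensional M \<longleftrightarrow>
    (\<exists>B. finite B \<and> B \<subseteq> carrier M \<and>
      (\<forall>x\<in>carrier M. \<exists>c. x = finsum M (\<lambda>b. c b \<odot>\<^bsub>M\<^esub> b) B))"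

definition desuspension :: "'b gvs \<Rightarrow> 'b gvs"
  where "desuspension V p = V (p + 1)"

subsection \<open>Homology of a graded vector space with a differential of degree -1\<close>

definition cycles :: "'b gvs \<Rightarrow> (int \<Rightarrow> 'b \<Rightarrow> 'b) \<Rightarrow> int \<Rightarrow> 'b set"
  where "cycles V \<delta> p = {z \<in> carrier (V p). \<delta> p z = \<zero>\<^bsub>V (p - 1)\<^esub>}"

definition boundaries :: "'b gvs \<Rightarrow> (int \<Rightarrow> 'b \<Rightarrow> 'b) \<Rightarrow> int \<Rightarrow> 'b set"
  where "boundaries V \<delta> p = \<delta> (p + 1) ` carrier (V (p + 1))"

text \<open>The coset representing \<open>c \<cdot> [z]\<close> is written \<open>B + c Z\<close> rather than \<open>c Z\<close> so that it is
  also right for \<open>c = 0\<close>.\<close>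

definition homology :: "'b gvs \<Rightarrow> (int \<Rightarrow> 'b \<Rightarrow> 'b) \<Rightarrow> 'b set gvs"
  where "homology V \<delta> p =
    \<lparr>carrier = (\<lambda>z. boundaries V \<delta> p +>\<^bsub>V p\<^esub> z) ` cycles V \<delta> p,
     mult = undefined, one = undefined,
     zero = boundaries V \<delta> p,
     add = (\<lambda>Z Z'. Z <+>\<^bsub>V p\<^esub> Z'),
     smult = (\<lambda>c Z. boundaries V \<delta> p <+>\<^bsub>V p\<^esub> (\<lambda>z. c \<odot>\<^bsub>V p\<^esub> z) ` Z)\<rparr>"

text \<open>The map \<open>[z] \<mapsto> [f z]\<close> into \<open>H\<^sub>p(W, \<delta>)\<close>; for a chain map \<open>f\<close> all members of the union agree.\<close>

definition homology_map ::
  "'c gvs \<Rightarrow> (int \<Rightarrow> 'c \<Rightarrow> 'c) \<Rightarrow> (int \<Rightarrow> 'b \<Rightarrow> 'c) \<Rightarrow> int \<Rightarrow> 'b set \<Rightarrow> 'c set"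
  where "homology_map W \<delta> f p Z = (\<Union>z\<in>Z. boundaries W \<delta> p +>\<^bsub>W p\<^esub> f p z)"

section \<open>Tensor powers\<close>

text \<open>A pair \<open>(p, x)\<close> is a homogeneous element \<open>x \<in> V\<^sub>p\<close>.  A multilinear form family on \<open>V\<close> assigns
  a rational to each list of homogeneous elements, multilinearly for every length and every
  tuple of degrees.  The pure tensor \<open>x\<^sub>1 \<otimes> \<dots> \<otimes> x\<^sub>n\<close> is modelled as the evaluation functional
  \<open>\<phi> \<mapsto> \<phi> [x\<^sub>1, \<dots>, x\<^sub>n]\<close> on such families.  Over a field the span of these functionals is the
  tensor power: it has no relations beyond multilinearity, see \<open>tens_add\<close>, \<open>tens_smult\<close> and
  \<open>tens_universal\<close> below.  Forms may be prescribed separately for each length and each tuple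
  of degrees, so tensors of different lengths or multidegrees are linearly independent.\<close>

type_synonym 'b tensor = "((int \<times> 'b) list \<Rightarrow> rat) \<Rightarrow> rat"

definition hom_lists :: "'b gvs \<Rightarrow> (int \<times> 'b) list set"
  where "hom_lists V = {xs. \<forall>(p, x)\<in>set xs. x \<in> carrier (V p)}"

definition multiforms :: "'b gvs \<Rightarrow> ((int \<times> 'b) list \<Rightarrow> rat) set"
  where "multiforms V = {\<phi>. \<forall>us\<in>hom_lists V. \<forall>vs\<in>hom_lists V. \<forall>p. \<forall>x\<in>carrier (V p).
    (\<forall>y\<in>carrier (V p). \<phi> (us @ (p, x \<oplus>\<^bsub>V p\<^esub> y) # vs) = \<phi> (us @ (p, x) # vs) + \<phi> (us @ (p, y) # vs)) \<and>
    (\<forall>c. \<phi> (us @ (p, c \<odot>\<^bsub>V p\<^esub> x) # vs) = c * \<phi> (us @ (p, x) # vs))}"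

definition tens :: "'b gvs \<Rightarrow> (int \<times> 'b) list \<Rightarrow> 'b tensor"
  where "tens V xs = (\<lambda>\<phi>. if \<phi> \<in> multiforms V then \<phi> xs else 0)"

definition tscale :: "rat \<Rightarrow> 'b tensor \<Rightarrow> 'b tensor"
  where "tscale c T = (\<lambda>\<phi>. c * T \<phi>)"

text \<open>The degree \<open>p\<close> part of \<open>V\<^sup>\<otimes>\<^sup>n\<close>.\<close>

definition tensor_power :: "'b gvs \<Rightarrow> nat \<Rightarrow> int \<Rightarrow> 'b tensor set"
  where "tensor_power V n p =
    {\<Sum>xs\<in>A. tscale (c xs) (tens V xs) | A c.
       finite A \<and> A \<subseteq> {xs \<in> hom_lists V. length xs = n \<and> sum_list (map fst xs) = p}}"

text \<open>Concatenation product \<open>V\<^sup>\<otimes>\<^sup>m \<times> V\<^sup>\<otimes>\<^sup>n \<rightarrow> V\<^sup>\<otimes>\<^sup>(\<^sup>m\<^sup>+\<^sup>n\<^sup>)\<close>.\<close>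

definition tprod :: "'b gvs \<Rightarrow> 'b tensor \<Rightarrow> 'b tensor \<Rightarrow> 'b tensor"
  where "tprod V S T =
    (\<lambda>\<phi>. if \<phi> \<in> multiforms V then S (\<lambda>xs. T (\<lambda>ys. \<phi> (xs @ ys))) else 0)"

lemma tens_add:
  assumes "us \<in> hom_lists V" "vs \<in> hom_lists V" "x \<in> carrier (V p)" "y \<in> carrier (V p)"
  shows "tens V (us @ (p, x \<oplus>\<^bsub>V p\<^esub> y) # vs) = tens V (us @ (p, x) # vs) + tens V (us @ (p, y) # vs)"
  using assms by (auto simp: tens_def multiforms_def fun_eq_iff)

lemma tens_smult:
  assumes "us \<in> hom_lists V" "vs \<in> hom_lists V" "x \<in> carrier (V p)"
  shows "tens V (us @ (p, c \<odot>\<^bsub>V p\<^esub> x) # vs) = tscale c (tens V (us @ (p, x) # vs))"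
  using assms by (auto simp: tens_def tscale_def multiforms_def fun_eq_iff)

text \<open>Every multilinear map \<open>G\<close> into a rational vector space respects all linear relations between
  pure tensors, that is, it factors through their span.\<close>

lemma tens_universal:
  fixes scl :: "rat \<Rightarrow> 'd::ab_group_add \<Rightarrow> 'd" and G :: "(int \<times> 'b) list \<Rightarrow> 'd"
  assumes vs: "vector_space scl"
    and add: "\<And>us vs p x y. \<lbrakk>us \<in> hom_lists V; vs \<in> hom_lists V; x \<in> carrier (V p); y \<in> carrier (V p)\<rbrakk>
      \<Longrightarrow> G (us @ (p, x \<oplus>\<^bsub>V p\<^esub> y) # vs) = G (us @ (p, x) # vs) + G (us @ (p, y) # vs)"
    and smult: "\<And>us vs p x c. \<lbrakk>us \<in> hom_lists V; vs \<in> hom_lists V; x \<in> carrier (V p)\<rbrakk>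
      \<Longrightarrow> G (us @ (p, c \<odot>\<^bsub>V p\<^esub> x) # vs) = scl c (G (us @ (p, x) # vs))"
    and rel: "(\<Sum>xs\<in>A. tscale (c xs) (tens V xs)) = 0"
  shows "(\<Sum>xs\<in>A. scl (c xs) (G xs)) = 0"
proof (rule ccontr)
  let ?v = "\<Sum>xs\<in>A. scl (c xs) (G xs)"
  assume nz: "?v \<noteq> 0"
  interpret vector_space scl by (rule vs)
  interpret vector_space_pair scl "(*) :: rat \<Rightarrow> rat \<Rightarrow> rat"
    by unfold_locales (auto simp: algebra_simps)
  have "\<not> dependent {?v}" using nz by simp
  then obtain g where g: "Vector_Spaces.linear scl (*) g" and gv: "g ?v = (1::rat)"
    using linear_independent_extend[of "{?v}" "\<lambda>_. 1"] by auto
  interpret g: Vector_Spaces.linear scl "(*)" g by (rule g)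
  have form: "(\<lambda>xs. g (G xs)) \<in> multiforms V"
    using add smult by (auto simp: multiforms_def g.add g.scale)
  have "(\<Sum>xs\<in>A. tscale (c xs) (tens V xs)) \<phi> = (\<Sum>xs\<in>A. c xs * tens V xs \<phi>)" for \<phi>
    by (induction A rule: infinite_finite_induct) (auto simp: tscale_def)
  from this[of "\<lambda>xs. g (G xs)"] have "(\<Sum>xs\<in>A. c xs * g (G xs)) = 0"
    unfolding rel using form by (simp add: tens_def)
  moreover have "g ?v = (\<Sum>xs\<in>A. c xs * g (G xs))"
    by (simp add: g.sum g.scale)
  ultimately show False using gv by simp
qed

subsection \<open>Tensor products of graded maps\<close>

text \<open>A graded map \<open>V \<rightarrow> W\<^sup>\<otimes>\<^sup>k\<close> is given together with its degree.\<close>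

type_synonym ('b, 'c) graded_map = "int \<times> (int \<Rightarrow> 'b \<Rightarrow> 'c tensor)"

definition tensor_linear :: "'b gvs \<Rightarrow> 'c gvs \<Rightarrow> nat \<Rightarrow> int \<Rightarrow> (int \<Rightarrow> 'b \<Rightarrow> 'c tensor) \<Rightarrow> bool"
  where "tensor_linear V W k d g \<longleftrightarrow>
    (\<forall>p. \<forall>x\<in>carrier (V p).
       g p x \<in> tensor_power W k (p + d) \<and>
       (\<forall>y\<in>carrier (V p). g p (x \<oplus>\<^bsub>V p\<^esub> y) = g p x + g p y) \<and>
       (\<forall>c. g p (c \<odot>\<^bsub>V p\<^esub> x) = tscale c (g p x)))"

definition ksign :: "int \<Rightarrow> rat"
  where "ksign m = (if even m then 1 else -1)"

text \<open>\<open>(g\<^sub>1 \<otimes> \<dots> \<otimes> g\<^sub>n) (x\<^sub>1 \<otimes> \<dots> \<otimes> x\<^sub>n)\<close> with the Koszul sign: \<open>g\<^sub>2 \<otimes> \<dots> \<otimes> g\<^sub>n\<close> moves past \<open>x\<^sub>1\<close>, and so on.\<close>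

fun tensor_of_maps :: "'c gvs \<Rightarrow> ('b, 'c) graded_map list \<Rightarrow> (int \<times> 'b) list \<Rightarrow> 'c tensor"
  where
    "tensor_of_maps W [] [] = tens W []"
  | "tensor_of_maps W ((d, g) # gs) ((p, x) # xs) =
       tscale (ksign (sum_list (map fst gs) * p)) (tprod W (g p x) (tensor_of_maps W gs xs))"
  | "tensor_of_maps W [] (_ # _) = 0"
  | "tensor_of_maps W (_ # _) [] = 0"

text \<open>Linear extension of the above to all tensors: since \<open>T\<close> is a combination of evaluations,
  evaluating it at \<open>xs \<mapsto> G xs \<phi>\<close> replaces every pure tensor \<open>xs\<close> in \<open>T\<close> by \<open>G xs\<close>.\<close>

definition map_tensor :: "'c gvs \<Rightarrow> ('b, 'c) graded_map list \<Rightarrow> 'b tensor \<Rightarrow> 'c tensor"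
  where "map_tensor W gs T = (\<lambda>\<phi>. T (\<lambda>xs. tensor_of_maps W gs xs \<phi>))"

text \<open>The identity of \<open>V\<close>, or the inclusion of a graded subspace into \<open>V\<close>.\<close>

definition id_map :: "'b gvs \<Rightarrow> ('b, 'b) graded_map"
  where "id_map V = (0, \<lambda>p x. tens V [(p, x)])"

definition desusp_map :: "'b gvs \<Rightarrow> ('b, 'b) graded_map"
  where "desusp_map V = (-1, \<lambda>p x. tens (desuspension V) [(p - 1, x)])"

text \<open>The isomorphism \<open>V\<^sup>\<otimes>\<^sup>1 \<cong> V\<close> in degree \<open>p\<close>.\<close>

definition untens :: "'b gvs \<Rightarrow> int \<Rightarrow> 'b tensor \<Rightarrow> 'b"
  where "untens V p T = (THE x. x \<in> carrier (V p) \<and> T = tens V [(p, x)])"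

section \<open>\<open>A\<^sub>\<infinity>\<close>-coalgebras\<close>

definition ainf_coalgebra :: "'b gvs \<Rightarrow> (nat \<Rightarrow> int \<Rightarrow> 'b \<Rightarrow> 'b tensor) \<Rightarrow> bool"
  where "ainf_coalgebra V \<Delta> \<longleftrightarrow>
    graded_vector_space V \<and>
    (\<forall>n\<ge>1. tensor_linear V V n (int n - 2) (\<Delta> n)) \<and>
    (\<forall>n\<ge>1. \<forall>p. \<forall>x\<in>carrier (V p).
      (\<Sum>i=1..n. \<Sum>j=0..n-i. tscale ((-1) ^ (i + j + i * j))
         (map_tensor V
            (replicate (n - i - j) (id_map V) @ [(int i - 2, \<Delta> i)] @ replicate j (id_map V))
            (\<Delta> (n - i + 1) p x))) = 0)"

definition ainf_minimal :: "'b gvs \<Rightarrow> (nat \<Rightarrow> int \<Rightarrow> 'b \<Rightarrow> 'b tensor) \<Rightarrow> bool"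
  where "ainf_minimal V \<Delta> \<longleftrightarrow> (\<forall>p. \<forall>x\<in>carrier (V p). \<Delta> 1 p x = 0)"

definition dg_coalgebra_ops ::
  "'b gvs \<Rightarrow> (int \<Rightarrow> 'b \<Rightarrow> 'b) \<Rightarrow> (int \<Rightarrow> 'b \<Rightarrow> 'b tensor) \<Rightarrow> nat \<Rightarrow> int \<Rightarrow> 'b \<Rightarrow> 'b tensor"
  where "dg_coalgebra_ops V \<delta> \<Delta>2 n p x =
    (if n = 1 then tens V [(p - 1, \<delta> p x)] else if n = 2 then \<Delta>2 p x else 0)"

subsection \<open>Morphisms, via the completed tensor algebra\<close>

text \<open>The degree \<open>p\<close> part of \<open>\<Prod>n\<ge>1. V\<^sup>\<otimes>\<^sup>n\<close>.\<close>

definition complete_tensor_algebra :: "'b gvs \<Rightarrow> int \<Rightarrow> (nat \<Rightarrow> 'b tensor) set"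
  where "complete_tensor_algebra V p = {t. t 0 = 0 \<and> (\<forall>n\<ge>1. t n \<in> tensor_power V n p)}"

text \<open>\<open>d\<^sub>n = - (s\<^sup>-\<^sup>1)\<^sup>\<otimes>\<^sup>n \<circ> \<Delta>\<^sub>n \<circ> s\<close> on generators.\<close>

definition cobar_gen ::
  "'b gvs \<Rightarrow> (nat \<Rightarrow> int \<Rightarrow> 'b \<Rightarrow> 'b tensor) \<Rightarrow> nat \<Rightarrow> ('b, 'b) graded_map"
  where "cobar_gen V \<Delta> n =
    (-1, \<lambda>p x. tscale (-1) (map_tensor (desuspension V) (replicate n (desusp_map V)) (\<Delta> n (p + 1) x)))"

text \<open>The derivation of the completed tensor algebra of the desuspension extending \<open>\<Sum>n. d\<^sub>n\<close>;
  its length \<open>m\<close> component collects \<open>1\<^sup>\<otimes>\<^sup>a \<otimes> d\<^sub>m\<^sub>-\<^sub>n\<^sub>+\<^sub>1 \<otimes> 1\<^sup>\<otimes>\<^sup>(\<^sup>n\<^sup>-\<^sup>1\<^sup>-\<^sup>a\<^sup>)\<close> applied to the length \<open>n\<close> component.\<close>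

definition cobar_differential ::
  "'b gvs \<Rightarrow> (nat \<Rightarrow> int \<Rightarrow> 'b \<Rightarrow> 'b tensor) \<Rightarrow> (nat \<Rightarrow> 'b tensor) \<Rightarrow> nat \<Rightarrow> 'b tensor"
  where "cobar_differential V \<Delta> t m =
    (\<Sum>n=1..m. \<Sum>a<n.
       map_tensor (desuspension V)
         (replicate a (id_map (desuspension V)) @ [cobar_gen V \<Delta> (m - n + 1)]
           @ replicate (n - 1 - a) (id_map (desuspension V)))
         (t n))"

definition cobar_map_gen ::
  "'c gvs \<Rightarrow> (nat \<Rightarrow> int \<Rightarrow> 'b \<Rightarrow> 'c tensor) \<Rightarrow> nat \<Rightarrow> ('b, 'c) graded_map"
  where "cobar_map_gen W f k =
    (0, \<lambda>p x. map_tensor (desuspension W) (replicate k (desusp_map W)) (f k (p + 1) x))"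

text \<open>The algebra morphism determined by \<open>s\<^sup>-\<^sup>1 c \<mapsto> \<Sum>k\<ge>1. (s\<^sup>-\<^sup>1)\<^sup>\<otimes>\<^sup>k f\<^sub>k(c)\<close>, by length components.\<close>

definition cobar_map ::
  "'c gvs \<Rightarrow> (nat \<Rightarrow> int \<Rightarrow> 'b \<Rightarrow> 'c tensor) \<Rightarrow> (nat \<Rightarrow> 'b tensor) \<Rightarrow> nat \<Rightarrow> 'c tensor"
  where "cobar_map W f t m =
    (\<Sum>n=1..m. \<Sum>ks | length ks = n \<and> sum_list ks = m \<and> (\<forall>k\<in>set ks. 1 \<le> k).
       map_tensor (desuspension W) (map (cobar_map_gen W f) ks) (t n))"

definition ainf_morphism ::
  "'b gvs \<Rightarrow> (nat \<Rightarrow> int \<Rightarrow> 'b \<Rightarrow> 'b tensor) \<Rightarrow> 'c gvs \<Rightarrow> (nat \<Rightarrow> int \<Rightarrow> 'c \<Rightarrow> 'c tensor) \<Rightarrow>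
   (nat \<Rightarrow> int \<Rightarrow> 'b \<Rightarrow> 'c tensor) \<Rightarrow> bool"
  where "ainf_morphism V \<Delta> W \<Delta>' f \<longleftrightarrow>
    ainf_coalgebra V \<Delta> \<and> ainf_coalgebra W \<Delta>' \<and>
    (\<forall>k\<ge>1. tensor_linear V W k (int k - 1) (f k)) \<and>
    (\<forall>p. \<forall>t\<in>complete_tensor_algebra (desuspension V) p.
       cobar_map W f (cobar_differential V \<Delta> t) = cobar_differential W \<Delta>' (cobar_map W f t))"

definition ainf_differential ::
  "'b gvs \<Rightarrow> (nat \<Rightarrow> int \<Rightarrow> 'b \<Rightarrow> 'b tensor) \<Rightarrow> int \<Rightarrow> 'b \<Rightarrow> 'b"
  where "ainf_differential V \<Delta> p x = untens V (p - 1) (\<Delta> 1 p x)"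

definition ainf_quasi_isomorphism ::
  "'b gvs \<Rightarrow> (nat \<Rightarrow> int \<Rightarrow> 'b \<Rightarrow> 'b tensor) \<Rightarrow> 'c gvs \<Rightarrow> (nat \<Rightarrow> int \<Rightarrow> 'c \<Rightarrow> 'c tensor) \<Rightarrow>
   (nat \<Rightarrow> int \<Rightarrow> 'b \<Rightarrow> 'c tensor) \<Rightarrow> bool"
  where "ainf_quasi_isomorphism V \<Delta> W \<Delta>' f \<longleftrightarrow>
    ainf_morphism V \<Delta> W \<Delta>' f \<and>
    (\<forall>p. bij_betw (homology_map W (ainf_differential W \<Delta>') (\<lambda>p x. untens W p (f 1 p x)) p)
           (carrier (homology V (ainf_differential V \<Delta>) p))
           (carrier (homology W (ainf_differential W \<Delta>') p)))"

definition ainf_quasi_isomorphic ::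
  "'b gvs \<Rightarrow> (nat \<Rightarrow> int \<Rightarrow> 'b \<Rightarrow> 'b tensor) \<Rightarrow> 'c gvs \<Rightarrow> (nat \<Rightarrow> int \<Rightarrow> 'c \<Rightarrow> 'c tensor) \<Rightarrow> bool"
  where "ainf_quasi_isomorphic V \<Delta> W \<Delta>' \<longleftrightarrow> (\<exists>f. ainf_quasi_isomorphism V \<Delta> W \<Delta>' f)"

section \<open>Rational singular chains\<close>

text \<open>\<^theory>\<open>HOL-Homology.Simplices\<close> has integral chains only; the simplices, faces and induced maps
  of simplices are taken from there.\<close>

type_synonym 'a qchain = "((nat \<Rightarrow> real) \<Rightarrow> 'a) \<Rightarrow>\<^sub>0 rat"

definition qscale :: "rat \<Rightarrow> ('x \<Rightarrow>\<^sub>0 rat) \<Rightarrow> ('x \<Rightarrow>\<^sub>0 rat)"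
  where "qscale c = Poly_Mapping.map ((*) c)"

definition qextend :: "('x \<Rightarrow> ('y \<Rightarrow>\<^sub>0 rat)) \<Rightarrow> ('x \<Rightarrow>\<^sub>0 rat) \<Rightarrow> ('y \<Rightarrow>\<^sub>0 rat)"
  where "qextend h c = (\<Sum>\<sigma>\<in>Poly_Mapping.keys c. qscale (Poly_Mapping.lookup c \<sigma>) (h \<sigma>))"

definition chains :: "'a topology \<Rightarrow> 'a qchain gvs"
  where "chains X p =
    \<lparr>carrier = {c. Poly_Mapping.keys c \<subseteq> singular_simplex_set (nat p) X \<and> (p < 0 \<longrightarrow> c = 0)},
     mult = undefined, one = undefined,
     zero = 0, add = (+), smult = qscale\<rparr>"

definition boundary :: "int \<Rightarrow> 'a qchain \<Rightarrow> 'a qchain"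
  where "boundary p = (if p \<le> 0 then (\<lambda>c. 0) else
    qextend (\<lambda>\<sigma>. \<Sum>k\<le>nat p. Poly_Mapping.single (singular_face (nat p) k \<sigma>) ((-1) ^ k)))"

definition chain_push :: "('a \<Rightarrow> 'b) \<Rightarrow> int \<Rightarrow> 'a qchain \<Rightarrow> 'b qchain"
  where "chain_push g p = qextend (\<lambda>\<sigma>. Poly_Mapping.single (simplex_map (nat p) g \<sigma>) 1)"

definition augmentation :: "'a qchain \<Rightarrow> rat"
  where "augmentation c = (\<Sum>\<sigma>\<in>Poly_Mapping.keys c. Poly_Mapping.lookup c \<sigma>)"

definition reduced_chains :: "'a topology \<Rightarrow> 'a qchain gvs"
  where "reduced_chains X p =
    chains X p \<lparr>carrier := {c \<in> carrier (chains X p). p = 0 \<longrightarrow> augmentation c = 0}\<rparr>"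

definition rational_homology :: "'a topology \<Rightarrow> 'a qchain set gvs"
  where "rational_homology X = homology (chains X) boundary"

definition reduced_homology :: "'a topology \<Rightarrow> 'a qchain set gvs"
  where "reduced_homology X = homology (reduced_chains X) boundary"

definition reduced_homology_map ::
  "'b topology \<Rightarrow> ('a \<Rightarrow> 'b) \<Rightarrow> int \<Rightarrow> 'a qchain set \<Rightarrow> 'b qchain set"
  where "reduced_homology_map Y g = homology_map (reduced_chains Y) boundary (chain_push g)"

subsection \<open>The Alexander-Whitney comultiplication\<close>

text \<open>Front \<open>k\<close>-face \<open>[v\<^sub>0,\<dots>,v\<^sub>k]\<close> and back \<open>(p-k)\<close>-face \<open>[v\<^sub>k,\<dots>,v\<^sub>p]\<close> of a singular \<open>p\<close>-simplex; note
  that \<^term>\<open>standard_simplex k \<subseteq> standard_simplex p\<close> for \<open>k \<le> p\<close>.\<close>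

definition front_face :: "nat \<Rightarrow> ((nat \<Rightarrow> real) \<Rightarrow> 'a) \<Rightarrow> (nat \<Rightarrow> real) \<Rightarrow> 'a"
  where "front_face k \<sigma> = restrict \<sigma> (standard_simplex k)"

definition back_face :: "nat \<Rightarrow> nat \<Rightarrow> ((nat \<Rightarrow> real) \<Rightarrow> 'a) \<Rightarrow> (nat \<Rightarrow> real) \<Rightarrow> 'a"
  where "back_face p k \<sigma> =
    restrict (\<lambda>x. \<sigma> (\<lambda>i. if i < k then 0 else x (i - k))) (standard_simplex (p - k))"

definition aw_comult :: "'a topology \<Rightarrow> int \<Rightarrow> 'a qchain \<Rightarrow> 'a qchain tensor"
  where "aw_comult X p c =
    (\<Sum>\<sigma>\<in>Poly_Mapping.keys c. \<Sum>k\<le>nat p. tscale (Poly_Mapping.lookup c \<sigma>)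
       (tens (chains X)
          [(int k, Poly_Mapping.single (front_face k \<sigma>) 1),
           (p - int k, Poly_Mapping.single (back_face (nat p) k \<sigma>) 1)]))"

definition point_chain :: "'a \<Rightarrow> 'a qchain"
  where "point_chain x0 = Poly_Mapping.single (restrict (\<lambda>_. x0) (standard_simplex 0)) 1"

text \<open>\<open>\<Delta>(c) - x\<^sub>0 \<otimes> c - c \<otimes> x\<^sub>0\<close> is an element of the tensor square of all chains that lies in
  the tensor square of the reduced chains; the latter element is picked out through the injection
  of tensor squares induced by the inclusion.\<close>

definition reduced_comult :: "'a topology \<Rightarrow> 'a \<Rightarrow> int \<Rightarrow> 'a qchain \<Rightarrow> 'a qchain tensor"
  where "reduced_comult X x0 p c =
    (THE T. T \<in> tensor_power (reduced_chains X) 2 p \<and>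
       map_tensor (chains X) [id_map (chains X), id_map (chains X)] T =
         aw_comult X p c
         + tscale (-1) (tens (chains X) [(0, point_chain x0), (p, c)])
         + tscale (-1) (tens (chains X) [(p, c), (0, point_chain x0)]))"

definition transferred_coalgebra ::
  "'a topology \<Rightarrow> 'a \<Rightarrow> (nat \<Rightarrow> int \<Rightarrow> 'a qchain set \<Rightarrow> 'a qchain set tensor) \<Rightarrow> bool"
  where "transferred_coalgebra X x0 \<Delta> \<longleftrightarrow>
    ainf_coalgebra (reduced_homology X) \<Delta> \<and>
    ainf_minimal (reduced_homology X) \<Delta> \<and>
    ainf_quasi_isomorphic (reduced_homology X) \<Delta>
      (reduced_chains X) (dg_coalgebra_ops (reduced_chains X) boundary (reduced_comult X x0))"

section \<open>Spaces\<close>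

definition disk :: "nat \<Rightarrow> (nat \<Rightarrow> real) topology"
  where "disk n = subtopology (Euclidean_space n) {x. (\<Sum>i<n. (x i)\<^sup>2) \<le> 1}"

text \<open>\<open>E n\<close> is the set of open \<open>n\<close>-cells and \<open>\<Phi> e\<close> the characteristic map of \<open>e\<close>.\<close>

definition CW_complex :: "'a topology \<Rightarrow> bool"
  where "CW_complex X \<longleftrightarrow> Hausdorff_space X \<and>
    (\<exists>(E :: nat \<Rightarrow> 'a set set) (\<Phi> :: 'a set \<Rightarrow> (nat \<Rightarrow> real) \<Rightarrow> 'a).
       (\<Union>n. \<Union>(E n)) = topspace X \<and>
       (\<forall>m n. \<forall>e\<in>E m. \<forall>e'\<in>E n. (m, e) \<noteq> (n, e') \<longrightarrow> e \<inter> e' = {}) \<and>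
       (\<forall>n. \<forall>e\<in>E n.
          continuous_map (disk n) X (\<Phi> e) \<and>
          homeomorphic_map (subtopology (disk n) {x. (\<Sum>i<n. (x i)\<^sup>2) < 1}) (subtopology X e) (\<Phi> e) \<and>
          (\<exists>F. finite F \<and> F \<subseteq> (\<Union>m<n. E m) \<and>
            \<Phi> e ` (topspace (disk n) \<inter> {x. (\<Sum>i<n. (x i)\<^sup>2) = 1}) \<subseteq> \<Union>F)) \<and>
       (\<forall>A\<subseteq>topspace X. closedin X A \<longleftrightarrow> (\<forall>n. \<forall>e\<in>E n. closedin X (A \<inter> X closure_of e))))"

text \<open>Nonempty, path connected, and every loop is homotopic to a constant relative to its end points.\<close>

definition one_connected :: "'a topology \<Rightarrow> bool"
  where "one_connected X \<longleftrightarrow>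
    topspace X \<noteq> {} \<and> path_connected_space X \<and>
    (\<forall>x g. pathin X g \<and> g 0 = x \<and> g 1 = x \<longrightarrow>
       homotopic_with (\<lambda>h. h 0 = x \<and> h 1 = x) (top_of_set {0..1}) X g (\<lambda>_. x))"

text \<open>The wedge of two spaces that already share exactly their base point: the union of the point
  sets, glued with the final topology for the two inclusions.\<close>

definition wedge :: "'a topology \<Rightarrow> 'a topology \<Rightarrow> 'a topology"
  where "wedge X Y = topology (\<lambda>U. U \<subseteq> topspace X \<union> topspace Y \<and>
    openin X (U \<inter> topspace X) \<and> openin Y (U \<inter> topspace Y))"

lemma openin_wedge:
  "openin (wedge X Y) U \<longleftrightarrow> U \<subseteq> topspace X \<union> topspace Y \<and>
    openin X (U \<inter> topspace X) \<and> openin Y (U \<inter> topspace Y)"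
proof -
  have "istopology (\<lambda>U. U \<subseteq> topspace X \<union> topspace Y \<and>
    openin X (U \<inter> topspace X) \<and> openin Y (U \<inter> topspace Y))"
    unfolding istopology_def
  proof (intro conjI allI impI)
    fix S T assume "S \<subseteq> topspace X \<union> topspace Y \<and> openin X (S \<inter> topspace X) \<and> openin Y (S \<inter> topspace Y)"
      and "T \<subseteq> topspace X \<union> topspace Y \<and> openin X (T \<inter> topspace X) \<and> openin Y (T \<inter> topspace Y)"
    then have o: "openin X ((S \<inter> topspace X) \<inter> (T \<inter> topspace X))"
        "openin Y ((S \<inter> topspace Y) \<inter> (T \<inter> topspace Y))" and sub: "S \<subseteq> topspace X \<union> topspace Y"
      by (simp_all only: openin_Int)
    have "(S \<inter> Z) \<inter> (T \<inter> Z) = S \<inter> T \<inter> Z" for Z by blast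
    then show "S \<inter> T \<subseteq> topspace X \<union> topspace Y" "openin X (S \<inter> T \<inter> topspace X)"
      "openin Y (S \<inter> T \<inter> topspace Y)"
      using o sub by (auto simp only:)
  next
    fix K assume *: "\<forall>U\<in>K. U \<subseteq> topspace X \<union> topspace Y \<and> openin X (U \<inter> topspace X) \<and> openin Y (U \<inter> topspace Y)"
    then show "\<Union>K \<subseteq> topspace X \<union> topspace Y" by blast
    have eq: "\<Union>K \<inter> Z = \<Union>((\<lambda>U. U \<inter> Z) ` K)" for Z by blast
    show "openin X (\<Union>K \<inter> topspace X)"
      unfolding eq by (rule openin_Union) (use * in blast)
    show "openin Y (\<Union>K \<inter> topspace Y)"
      unfolding eq by (rule openin_Union) (use * in blast)
  qed
  then show ?thesis by (simp add: wedge_def topology_inverse')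
qed

end

theory Submission
  imports Defs
begin

text \<open>
  Collapsing the added sphere to the base point is a retraction of \<open>K\<^sub>i\<^sub>+\<^sub>1\<close> onto \<open>K\<^sub>i\<close>, so the reduced
  chains of \<open>K\<^sub>i\<close> are a direct summand of those of \<open>K\<^sub>i\<^sub>+\<^sub>1\<close> as a complex and a sub-dg-coalgebra.
  Hence a linear contraction of the reduced chains of \<open>K\<^sub>i\<close> onto homology extends to one for \<open>K\<^sub>i\<^sub>+\<^sub>1\<close>.
  Homotopy transfer is carried out on the cobar construction by a recursion on the tensor length that
  is an explicit formula in the contraction.  It is therefore natural for maps of contractions: the
  inclusion induces a strict morphism of the transferred coalgebras, which preserves the kernels.
\<close>

text \<open>Kernels of the operations are not invariant under isomorphisms of
  \<open>A_infinity\<close>-structures, so structures transferred independently for each space could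
  not be compared. All choices are therefore put into linear splittings of the chain complexes,
  which are made to agree on the smaller space before any transfer happens. On the cobar side the
  Stasheff identities become \<open>d d = 0\<close> for a derivation, and a morphism becomes a chain
  map of tensor algebras: all operations are treated at once and their signs enter only through
  desuspension. Sequences in the completed algebra are cut off, since a component of given length
  depends on finitely many components; each identity is checked on finite tensors modulo longer
  ones. The transfer is obstruction theory in this length filtration. The obstruction of lowest
  length is a cycle for the linear part of the differential; its projection to homology is the next
  operation and its image under the tensor homotopy the next component of the morphism. That it is a
  cycle is seen by projecting to homology, where boundaries vanish.\<close>

text \<open>Tensors are functions; the pointwise rules would rewrite below their eta-expansions.\<close>

declare zero_fun_apply [simp del] plus_fun_apply [simp del] minus_apply [simp del] uminus_apply [simp del]

lemmas fun_applies = zero_fun_apply plus_fun_apply minus_apply uminus_apply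

section \<open>Words, degrees and the vector space of tensors\<close>

abbreviation deg :: "(int \<times> 'b) list \<Rightarrow> int"
  where "deg xs \<equiv> sum_list (map fst xs)"

interpretation tn: vector_space "tscale :: rat \<Rightarrow> 'b tensor \<Rightarrow> 'b tensor"
  by unfold_locales (auto simp: fun_applies tscale_def fun_eq_iff algebra_simps)

lemma tscale_apply: "tscale c T \<phi> = c * T \<phi>"
  by (simp add: tscale_def)

lemma hom_lists_simps [simp]:
  "[] \<in> hom_lists V"
  "a # xs \<in> hom_lists V \<longleftrightarrow> snd a \<in> carrier (V (fst a)) \<and> xs \<in> hom_lists V"
  "xs @ ys \<in> hom_lists V \<longleftrightarrow> xs \<in> hom_lists V \<and> ys \<in> hom_lists V"
  by (auto simp: hom_lists_def)

lemma gvs_closed: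
  assumes "graded_vector_space V" "x \<in> carrier (V p)"
  shows "y \<in> carrier (V p) \<Longrightarrow> x \<oplus>\<^bsub>V p\<^esub> y \<in> carrier (V p)"
    and "c \<odot>\<^bsub>V p\<^esub> x \<in> carrier (V p)"
    and "0 \<odot>\<^bsub>V p\<^esub> x = \<zero>\<^bsub>V p\<^esub>"
    and "1 \<odot>\<^bsub>V p\<^esub> x = x"
proof -
  interpret module rat_ring "V p" using assms(1) by (simp add: graded_vector_space_def)
  show "y \<in> carrier (V p) \<Longrightarrow> x \<oplus>\<^bsub>V p\<^esub> y \<in> carrier (V p)" using assms by simp
  show "c \<odot>\<^bsub>V p\<^esub> x \<in> carrier (V p)" using smult_closed[of c x] assms by (simp add: rat_ring_def)
  show "0 \<odot>\<^bsub>V p\<^esub> x = \<zero>\<^bsub>V p\<^esub>" using smult_l_null[of x] assms by (simp add: rat_ring_def)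
  show "1 \<odot>\<^bsub>V p\<^esub> x = x" using smult_one[of x] assms by (simp add: rat_ring_def)
qed

lemma gvs_zero_closed: "graded_vector_space V \<Longrightarrow> \<zero>\<^bsub>V p\<^esub> \<in> carrier (V p)"
  by (simp add: graded_vector_space_def module_def abelian_group_def abelian_monoid.zero_closed)

subsection \<open>Spans of pure tensors\<close>

text \<open>The predicate \<open>Q\<close> on (length, degree) makes one notion serve for the
  homogeneous tensor powers, the length filtration and all tensors, so that closure properties and
  inductions are stated once.\<close>

definition tspan :: "'b gvs \<Rightarrow> (nat \<Rightarrow> int \<Rightarrow> bool) \<Rightarrow> 'b tensor set"
  where "tspan V Q = tn.span (tens V ` {xs \<in> hom_lists V. Q (length xs) (deg xs)})"

abbreviation "tensors V \<equiv> tspan V (\<lambda>_ _. True)"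

text \<open>The descending length filtration in degree \<open>p\<close>. Two tensors agree up to
  length \<open>n\<close> if their difference lies in \<open>tfil V (Suc n) p\<close>; this replaces
  convergence in the completed tensor algebra.\<close>

abbreviation "tfil V L p \<equiv> tspan V (\<lambda>n q. L \<le> n \<and> q = p)"

lemma tspan_0: "0 \<in> tspan V Q"
  and tspan_add: "S \<in> tspan V Q \<Longrightarrow> T \<in> tspan V Q \<Longrightarrow> S + T \<in> tspan V Q"
  and tspan_diff: "S \<in> tspan V Q \<Longrightarrow> T \<in> tspan V Q \<Longrightarrow> S - T \<in> tspan V Q"
  and tspan_neg: "S \<in> tspan V Q \<Longrightarrow> - S \<in> tspan V Q"
  and tspan_scale: "S \<in> tspan V Q \<Longrightarrow> tscale c S \<in> tspan V Q"
  and tspan_sum: "(\<And>i. i \<in> I \<Longrightarrow> f i \<in> tspan V Q) \<Longrightarrow> sum f I \<in> tspan V Q"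
  unfolding tspan_def
  by (auto intro: tn.span_zero tn.span_add tn.span_diff tn.span_neg tn.span_scale tn.span_sum)

lemmas tspan_intros = tspan_0 tspan_add tspan_diff tspan_neg tspan_scale tspan_sum

lemma tspan_tens: "xs \<in> hom_lists V \<Longrightarrow> Q (length xs) (deg xs) \<Longrightarrow> tens V xs \<in> tspan V Q"
  unfolding tspan_def by (auto intro: tn.span_base)

lemma tspan_mono:
  assumes "T \<in> tspan V Q" "\<And>n q. Q n q \<Longrightarrow> Q' n q"
  shows "T \<in> tspan V Q'"
  using assms(1) unfolding tspan_def
  by (rule subsetD[OF tn.span_mono, rotated]) (use assms(2) in auto)

lemma tspan_all: "T \<in> tspan V Q \<Longrightarrow> T \<in> tensors V"
  by (erule tspan_mono) simp

text \<open>Linear statements about tensors reduce to words. Membership is carried through the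
  induction along with \<open>P\<close>, so that the additive cases may use facts that hold for
  tensors only.\<close>

lemma tspan_induct [consumes 1, case_names zero add scale tens]:
  assumes T: "T \<in> tspan V Q" and z: "P 0"
    and a: "\<And>S T. S \<in> tspan V Q \<Longrightarrow> T \<in> tspan V Q \<Longrightarrow> P S \<Longrightarrow> P T \<Longrightarrow> P (S + T)"
    and s: "\<And>c S. S \<in> tspan V Q \<Longrightarrow> P S \<Longrightarrow> P (tscale c S)"
    and t: "\<And>xs. xs \<in> hom_lists V \<Longrightarrow> Q (length xs) (deg xs) \<Longrightarrow> P (tens V xs)"
  shows "P T"
proof -
  have "T \<in> tspan V Q \<and> P T"
    using T[unfolded tspan_def]
  proof (induction rule: tn.span_induct_alt)
    case base
    then show ?case using z by (auto intro: tspan_intros)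
  next
    case (step c x y)
    then obtain xs where xs: "xs \<in> hom_lists V" "Q (length xs) (deg xs)" "x = tens V xs" by auto
    with tspan_tens[of xs V Q] t have "x \<in> tspan V Q" "P x" by auto
    then show ?case using a s step by (auto intro: tspan_intros)
  qed
  then show ?thesis by simp
qed

lemma tensor_power_tspan: "tensor_power V n p = tspan V (\<lambda>m q. m = n \<and> q = p)"
proof
  show "tensor_power V n p \<subseteq> tspan V (\<lambda>m q. m = n \<and> q = p)"
    unfolding tensor_power_def by (auto intro!: tspan_sum tspan_scale tspan_tens)
next
  let ?X = "{xs \<in> hom_lists V. length xs = n \<and> deg xs = p}"
  show "tspan V (\<lambda>m q. m = n \<and> q = p) \<subseteq> tensor_power V n p"
  proof
    fix T assume "T \<in> tspan V (\<lambda>m q. m = n \<and> q = p)"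
    then obtain t r where t: "finite t" "t \<subseteq> tens V ` ?X" and T: "T = (\<Sum>a\<in>t. tscale (r a) a)"
      unfolding tspan_def tn.span_explicit by auto
    \<comment> \<open>Different words can give the same tensor, while \<open>tensor_power\<close>
      sums over words; one word is chosen for each tensor of the combination.\<close>
    then obtain A where A: "A \<subseteq> ?X" "inj_on (tens V) A" "t = tens V ` A"
      by (meson subset_image_inj)
    with t have "finite A" by (simp add: finite_image_iff)
    moreover have "T = (\<Sum>xs\<in>A. tscale (r (tens V xs)) (tens V xs))"
      using A by (simp add: T sum.reindex)
    moreover note A(1)
    ultimately show "T \<in> tensor_power V n p"
      unfolding tensor_power_def mem_Collect_eq
      by (intro exI[of _ A] exI[of _ "\<lambda>xs. r (tens V xs)"] conjI)
  qed
qed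

subsection \<open>Multilinear forms\<close>

lemma multiforms_0: "(\<lambda>xs. 0) \<in> multiforms V"
  and multiforms_add: "\<phi> \<in> multiforms V \<Longrightarrow> \<psi> \<in> multiforms V \<Longrightarrow> (\<lambda>xs. \<phi> xs + \<psi> xs) \<in> multiforms V"
  and multiforms_scale: "\<phi> \<in> multiforms V \<Longrightarrow> (\<lambda>xs. c * \<phi> xs) \<in> multiforms V"
  by (auto simp: multiforms_def algebra_simps)

lemma multiforms_shift:
  assumes "\<phi> \<in> multiforms V" "us \<in> hom_lists V" "vs \<in> hom_lists V"
  shows "(\<lambda>xs. \<phi> (us @ xs @ vs)) \<in> multiforms V"
proof -
  have "\<phi> (us @ (us' @ (p, x \<oplus>\<^bsub>V p\<^esub> y) # vs') @ vs) =
      \<phi> (us @ (us' @ (p, x) # vs') @ vs) + \<phi> (us @ (us' @ (p, y) # vs') @ vs)"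
    if "us' \<in> hom_lists V" "vs' \<in> hom_lists V" "x \<in> carrier (V p)" "y \<in> carrier (V p)" for us' vs' p x y
    using assms(1)[unfolded multiforms_def, simplified, rule_format, of "us @ us'" "vs' @ vs" x p] that assms
    by simp
  moreover have "\<phi> (us @ (us' @ (p, c \<odot>\<^bsub>V p\<^esub> x) # vs') @ vs) = c * \<phi> (us @ (us' @ (p, x) # vs') @ vs)"
    if "us' \<in> hom_lists V" "vs' \<in> hom_lists V" "x \<in> carrier (V p)" for us' vs' p x c
    using assms(1)[unfolded multiforms_def, simplified, rule_format, of "us @ us'" "vs' @ vs" x p] that assms
    by simp
  ultimately show ?thesis by (simp add: multiforms_def)
qed

lemma tensors_form_add:
  "T \<in> tensors V \<Longrightarrow> \<phi> \<in> multiforms V \<Longrightarrow> \<psi> \<in> multiforms V \<Longrightarrow> T (\<lambda>xs. \<phi> xs + \<psi> xs) = T \<phi> + T \<psi>"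
  by (induction rule: tspan_induct) (auto simp: fun_applies tens_def tscale_def multiforms_add algebra_simps)

lemma tensors_form_scale:
  "T \<in> tensors V \<Longrightarrow> \<phi> \<in> multiforms V \<Longrightarrow> T (\<lambda>xs. c * \<phi> xs) = c * T \<phi>"
  by (induction rule: tspan_induct) (auto simp: fun_applies tens_def tscale_def multiforms_scale algebra_simps)

lemma tensors_form_cong:
  "T \<in> tensors V \<Longrightarrow> \<phi> \<in> multiforms V \<Longrightarrow> \<psi> \<in> multiforms V \<Longrightarrow>
    (\<And>xs. xs \<in> hom_lists V \<Longrightarrow> \<phi> xs = \<psi> xs) \<Longrightarrow> T \<phi> = T \<psi>"
  by (induction rule: tspan_induct) (auto simp: fun_applies tens_def tscale_def)

text \<open>\<open>tprod\<close> feeds this function to its left factor. A pure tensor vanishes off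
  the multilinear forms, so the nested evaluation computes a product only because the inner function
  is again such a form.\<close>

lemma multiforms_tensor:
  assumes gv: "graded_vector_space V" and T: "T \<in> tensors V" and \<phi>: "\<phi> \<in> multiforms V"
  shows "(\<lambda>xs. T (\<lambda>ys. \<phi> (xs @ ys))) \<in> multiforms V"
proof -
  have m: "(\<lambda>ys. \<phi> (xs @ ys)) \<in> multiforms V" if "xs \<in> hom_lists V" for xs
    using multiforms_shift[OF \<phi> that, of "[]"] by simp
  have "T (\<lambda>ys. \<phi> ((us @ (p, x \<oplus>\<^bsub>V p\<^esub> y) # vs) @ ys)) =
      T (\<lambda>ys. \<phi> ((us @ (p, x) # vs) @ ys)) + T (\<lambda>ys. \<phi> ((us @ (p, y) # vs) @ ys))"
    if "us \<in> hom_lists V" "vs \<in> hom_lists V" "x \<in> carrier (V p)" "y \<in> carrier (V p)" for us vs p x y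
  proof -
    note c = gvs_closed[OF gv]
    have "T (\<lambda>ys. \<phi> ((us @ (p, x \<oplus>\<^bsub>V p\<^esub> y) # vs) @ ys)) =
      T (\<lambda>ys. \<phi> ((us @ (p, x) # vs) @ ys) + \<phi> ((us @ (p, y) # vs) @ ys))"
      by (rule tensors_form_cong[OF T])
        (use that c \<phi> in \<open>auto intro!: m multiforms_add simp del: append_assoc\<close>,
          simp add: multiforms_def)
    also have "\<dots> = T (\<lambda>ys. \<phi> ((us @ (p, x) # vs) @ ys)) + T (\<lambda>ys. \<phi> ((us @ (p, y) # vs) @ ys))"
      by (rule tensors_form_add[OF T]) (use that in \<open>auto intro!: m simp del: append_assoc\<close>)
    finally show ?thesis .
  qed
  moreover have "T (\<lambda>ys. \<phi> ((us @ (p, c \<odot>\<^bsub>V p\<^esub> x) # vs) @ ys)) =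
      c * T (\<lambda>ys. \<phi> ((us @ (p, x) # vs) @ ys))"
    if "us \<in> hom_lists V" "vs \<in> hom_lists V" "x \<in> carrier (V p)" for us vs p x c
  proof -
    note c = gvs_closed[OF gv]
    have "T (\<lambda>ys. \<phi> ((us @ (p, c \<odot>\<^bsub>V p\<^esub> x) # vs) @ ys)) =
      T (\<lambda>ys. c * \<phi> ((us @ (p, x) # vs) @ ys))"
      by (rule tensors_form_cong[OF T])
        (use that c \<phi> in \<open>auto intro!: m multiforms_scale simp del: append_assoc\<close>,
          simp add: multiforms_def)
    also have "\<dots> = c * T (\<lambda>ys. \<phi> ((us @ (p, x) # vs) @ ys))"
      by (rule tensors_form_scale[OF T]) (use that in \<open>auto intro!: m simp del: append_assoc\<close>)
    finally show ?thesis .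
  qed
  ultimately show ?thesis unfolding multiforms_def by blast
qed

subsection \<open>The concatenation product\<close>

lemma tprod_0_left [simp]: "tprod V 0 T = 0"
  and tprod_add_left: "tprod V (S + S') T = tprod V S T + tprod V S' T"
  and tprod_diff_left: "tprod V (S - S') T = tprod V S T - tprod V S' T"
  and tprod_neg_left: "tprod V (- S) T = - tprod V S T"
  and tprod_scale_left: "tprod V (tscale c S) T = tscale c (tprod V S T)"
  by (auto simp: fun_applies tprod_def tscale_def fun_eq_iff)

text \<open>On the left, linearity is pointwise addition of functionals. On the right the sum
  appears inside the argument of \<open>S\<close>, so \<open>S\<close> has to be linear on forms;
  this is where membership in \<open>tensors V\<close> enters.\<close>

lemma
  assumes gv: "graded_vector_space V" and S: "S \<in> tensors V" and T: "T \<in> tensors V"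
  shows tprod_scale_right: "tprod V S (tscale c T) = tscale c (tprod V S T)"
    and tprod_add_right: "T' \<in> tensors V \<Longrightarrow> tprod V S (T + T') = tprod V S T + tprod V S T'"
proof -
  show "tprod V S (tscale c T) = tscale c (tprod V S T)"
    using tensors_form_scale[OF S multiforms_tensor[OF gv T]] by (auto simp: tprod_def tscale_def fun_eq_iff)
  show "tprod V S (T + T') = tprod V S T + tprod V S T'" if "T' \<in> tensors V"
    using tensors_form_add[OF S multiforms_tensor[OF gv T] multiforms_tensor[OF gv that]]
    by (auto simp: tprod_def fun_applies fun_eq_iff)
qed

lemma tprod_0_right [simp]: "S \<in> tensors V \<Longrightarrow> tprod V S 0 = 0"
  using tensors_form_scale[of S V "\<lambda>_. 0" 0] by (auto simp: fun_applies tprod_def fun_eq_iff multiforms_0)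

lemma tprod_tens:
  assumes gv: "graded_vector_space V" and "xs \<in> hom_lists V" "ys \<in> hom_lists V"
  shows "tprod V (tens V xs) (tens V ys) = tens V (xs @ ys)"
proof
  fix \<phi>
  have m: "(\<lambda>ys. \<phi> (xs @ ys)) \<in> multiforms V" if "\<phi> \<in> multiforms V"
    using multiforms_shift[OF that assms(2), of "[]"] by simp
  have "(\<lambda>xs. tens V ys (\<lambda>ys. \<phi> (xs @ ys))) \<in> multiforms V" if "\<phi> \<in> multiforms V"
    by (rule multiforms_tensor[OF gv _ that]) (use assms in \<open>auto intro: tspan_tens\<close>)
  with m show "tprod V (tens V xs) (tens V ys) \<phi> = tens V (xs @ ys) \<phi>"
    by (auto simp: fun_applies tprod_def tens_def)
qed

lemma tprod_tspan:
  assumes gv: "graded_vector_space V" and S: "S \<in> tspan V Q1" and T: "T \<in> tspan V Q2"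
    and Q: "\<And>m p n q. Q1 m p \<Longrightarrow> Q2 n q \<Longrightarrow> Q (m + n) (p + q)"
  shows "tprod V S T \<in> tspan V Q"
  using S
proof (induction rule: tspan_induct)
  case (tens xs)
  note xs = tens
  show ?case using T
  proof (induction rule: tspan_induct)
    case (tens ys)
    then show ?case using xs Q by (auto simp: tprod_tens[OF gv] intro!: tspan_tens)
  qed (use xs in \<open>auto simp: tspan_tens tprod_scale_right[OF gv] tprod_add_right[OF gv]
    tspan_all[of _ V Q2] intro!: tspan_intros\<close>)
qed (auto simp: tprod_scale_left tprod_add_left intro!: tspan_intros)

lemma tprod_tensors: "graded_vector_space V \<Longrightarrow> S \<in> tensors V \<Longrightarrow> T \<in> tensors V \<Longrightarrow> tprod V S T \<in> tensors V"
  by (rule tprod_tspan)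

lemma tprod_tfil:
  "graded_vector_space V \<Longrightarrow> S \<in> tfil V L p \<Longrightarrow> T \<in> tfil V M q \<Longrightarrow> K \<le> L + M \<Longrightarrow> r = p + q \<Longrightarrow>
    tprod V S T \<in> tfil V K r"
  by (erule tprod_tspan, assumption, assumption) auto

lemma tprod_diff_right:
  assumes gv: "graded_vector_space V" and "S \<in> tensors V" "T \<in> tensors V" "T' \<in> tensors V"
  shows "tprod V S (T - T') = tprod V S T - tprod V S T'"
proof -
  have "tprod V S (T - T') + tprod V S T' = tprod V S T"
    using assms by (subst tprod_add_right[OF gv, symmetric]) (auto intro: tspan_intros)
  then show ?thesis by (simp add: algebra_simps)
qed

lemma tprod_assoc:
  assumes gv: "graded_vector_space V" and "R \<in> tensors V" "S \<in> tensors V" "T \<in> tensors V"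
  shows "tprod V (tprod V R S) T = tprod V R (tprod V S T)"
  using assms(2)
proof (induction rule: tspan_induct)
  case (tens xs)
  note xs = tens tspan_tens[OF tens]
  show ?case using assms(3)
  proof (induction rule: tspan_induct)
    case (tens ys)
    note ys = tens tspan_tens[OF tens]
    show ?case using assms(4)
      by (induction rule: tspan_induct)
        (use xs ys in \<open>auto simp: tprod_tens[OF gv] tspan_tens tprod_scale_right[OF gv]
          tprod_add_right[OF gv] tprod_tensors[OF gv]\<close>)
  qed (use xs in \<open>auto simp: assms tprod_tensors[OF gv] tprod_scale_left tprod_add_left tprod_scale_right[OF gv]
          tprod_add_right[OF gv]\<close>)
qed (auto simp: tprod_scale_left tprod_add_left)

lemma tprod_unit_left:
  assumes gv: "graded_vector_space V" and "T \<in> tensors V"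
  shows "tprod V (tens V []) T = T"
  using assms(2)
  by (induction rule: tspan_induct)
    (auto simp: tprod_tens[OF gv] tspan_tens tprod_scale_right[OF gv] tprod_add_right[OF gv])

lemma tprod_unit_right:
  assumes gv: "graded_vector_space V" and "T \<in> tensors V"
  shows "tprod V T (tens V []) = T"
  using assms(2)
  by (induction rule: tspan_induct)
    (auto simp: tprod_tens[OF gv] tprod_scale_left tprod_add_left)

subsection \<open>Linear extension of multilinear functions of words\<close>

definition word_linear :: "'b gvs \<Rightarrow> ((int \<times> 'b) list \<Rightarrow> 'c tensor) \<Rightarrow> bool"
  where "word_linear V G \<longleftrightarrow> (\<forall>\<phi>. (\<lambda>xs. G xs \<phi>) \<in> multiforms V)"

text \<open>The mechanism of \<open>map_tensor\<close> for an arbitrary function of words. Linearity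
  in \<open>T\<close> is automatic because \<open>T\<close> is only evaluated; multilinearity of
  \<open>G\<close> is what gives the value \<open>G xs\<close> on a pure tensor.\<close>

definition lin_ext :: "((int \<times> 'b) list \<Rightarrow> 'c tensor) \<Rightarrow> 'b tensor \<Rightarrow> 'c tensor"
  where "lin_ext G T = (\<lambda>\<phi>. T (\<lambda>xs. G xs \<phi>))"

lemma word_linear_iff:
  "word_linear V G \<longleftrightarrow> (\<forall>us\<in>hom_lists V. \<forall>vs\<in>hom_lists V. \<forall>p. \<forall>x\<in>carrier (V p).
    (\<forall>y\<in>carrier (V p). G (us @ (p, x \<oplus>\<^bsub>V p\<^esub> y) # vs) = G (us @ (p, x) # vs) + G (us @ (p, y) # vs)) \<and>
    (\<forall>c. G (us @ (p, c \<odot>\<^bsub>V p\<^esub> x) # vs) = tscale c (G (us @ (p, x) # vs))))"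
  unfolding word_linear_def multiforms_def mem_Collect_eq fun_eq_iff plus_fun_apply tscale_apply by metis

lemma lin_ext_0 [simp]: "lin_ext G 0 = 0"
  and lin_ext_add: "lin_ext G (S + T) = lin_ext G S + lin_ext G T"
  and lin_ext_diff: "lin_ext G (S - T) = lin_ext G S - lin_ext G T"
  and lin_ext_neg: "lin_ext G (- S) = - lin_ext G S"
  and lin_ext_scale: "lin_ext G (tscale c S) = tscale c (lin_ext G S)"
  by (auto simp: fun_applies lin_ext_def tscale_def fun_eq_iff)

lemma lin_ext_sum: "lin_ext G (sum f I) = (\<Sum>i\<in>I. lin_ext G (f i))"
  by (induction I rule: infinite_finite_induct) (auto simp: lin_ext_add)

lemma lin_ext_tens: "word_linear V G \<Longrightarrow> lin_ext G (tens V xs) = G xs"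
  by (auto simp: fun_applies lin_ext_def tens_def word_linear_def)

lemma word_linear_tens: "word_linear V (tens V)"
  by (auto simp: word_linear_iff tens_add tens_smult)

lemma word_linear_0: "word_linear V (\<lambda>_. 0)"
  by (auto simp: fun_applies word_linear_def multiforms_0)

lemma lin_ext_tspan:
  assumes "word_linear V G" "T \<in> tspan V Q"
    and "\<And>xs. xs \<in> hom_lists V \<Longrightarrow> Q (length xs) (deg xs) \<Longrightarrow> G xs \<in> tspan W Q'"
  shows "lin_ext G T \<in> tspan W Q'"
  using assms(2) by (induction rule: tspan_induct)
    (auto simp: lin_ext_add lin_ext_scale lin_ext_tens[OF assms(1)] assms(3) intro: tspan_intros)

lemma lin_ext_cong:
  assumes "word_linear V G" "word_linear V G'" "T \<in> tspan V Q"
    and "\<And>xs. xs \<in> hom_lists V \<Longrightarrow> Q (length xs) (deg xs) \<Longrightarrow> G xs = G' xs"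
  shows "lin_ext G T = lin_ext G' T"
  using assms(3) by (induction rule: tspan_induct)
    (auto simp: lin_ext_add lin_ext_scale lin_ext_tens[OF assms(1)] lin_ext_tens[OF assms(2)] assms(4))

lemma lin_ext_id: "T \<in> tensors V \<Longrightarrow> lin_ext (tens V) T = T"
  by (induction rule: tspan_induct) (auto simp: lin_ext_add lin_ext_scale lin_ext_tens[OF word_linear_tens])

lemma ksign_0 [simp]: "ksign 0 = 1"
  and ksign_add: "ksign (m + n) = ksign m * ksign n"
  and ksign_minus [simp]: "ksign (- m) = ksign m"
  and ksign_diff: "ksign (m - n) = ksign m * ksign n"
  and ksign_square [simp]: "ksign m * ksign m = 1"
  and ksign_square_left [simp]: "ksign m * (ksign m * c) = c"
  and ksign_1 [simp]: "ksign 1 = -1"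
  by (auto simp: ksign_def)

subsection \<open>Algebra maps and twisted derivations\<close>

text \<open>Weakens \<open>tensor_linear\<close> from values of one exact length to values of length
  at least \<open>L\<close>, as partial sums of the differential and of the morphism have components
  of several lengths. The bound \<open>L\<close> drives all filtration estimates.\<close>

definition glin :: "'b gvs \<Rightarrow> 'c gvs \<Rightarrow> nat \<Rightarrow> int \<Rightarrow> (int \<Rightarrow> 'b \<Rightarrow> 'c tensor) \<Rightarrow> bool"
  where "glin V W L e A \<longleftrightarrow> (\<forall>p. \<forall>x\<in>carrier (V p).
    A p x \<in> tfil W L (p + e) \<and>
    (\<forall>y\<in>carrier (V p). A p (x \<oplus>\<^bsub>V p\<^esub> y) = A p x + A p y) \<and>
    (\<forall>c. A p (c \<odot>\<^bsub>V p\<^esub> x) = tscale c (A p x)))"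

lemma glinD:
  assumes "glin V W L e A" "x \<in> carrier (V p)"
  shows "A p x \<in> tfil W L (p + e)" "A p x \<in> tensors W"
    and "y \<in> carrier (V p) \<Longrightarrow> A p (x \<oplus>\<^bsub>V p\<^esub> y) = A p x + A p y"
    and "A p (c \<odot>\<^bsub>V p\<^esub> x) = tscale c (A p x)"
  using assms by (auto simp: glin_def intro: tspan_all)

lemma glin_0: "glin V W L e (\<lambda>p x. 0)"
  by (auto simp: glin_def intro: tspan_intros)

lemma glin_add: "glin V W L e A \<Longrightarrow> glin V W L e B \<Longrightarrow> glin V W L e (\<lambda>p x. A p x + B p x)"
  by (auto simp: glin_def tn.scale_right_distrib intro: tspan_intros)

lemma glin_diff: "glin V W L e A \<Longrightarrow> glin V W L e B \<Longrightarrow> glin V W L e (\<lambda>p x. A p x - B p x)"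
  by (auto simp: glin_def tn.scale_right_diff_distrib intro: tspan_intros)

lemma glin_sum: "(\<And>i. i \<in> I \<Longrightarrow> glin V W L e (A i)) \<Longrightarrow> glin V W L e (\<lambda>p x. \<Sum>i\<in>I. A i p x)"
  by (induction I rule: infinite_finite_induct) (auto intro: glin_add glin_0)

lemma glin_mono: "glin V W L e A \<Longrightarrow> K \<le> L \<Longrightarrow> glin V W K e A"
  unfolding glin_def by (blast intro: tspan_mono[where Q = "\<lambda>n q. L \<le> n \<and> q = _ + e"] order_trans)

lemma glin_tens: "glin V V 1 0 (\<lambda>p x. tens V [(p, x)])"
  using tens_add[of "[]" V "[]"] tens_smult[of "[]" V "[]"] by (auto simp: glin_def intro!: tspan_tens)

lemma glin_sign: "glin V W L e A \<Longrightarrow> glin V W L e (\<lambda>p x. tscale (c p) (A p x))"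
  by (auto simp: glin_def tn.scale_right_distrib mult.commute intro: tspan_intros)

lemma glin_tensor_linear: "tensor_linear V W k e g \<Longrightarrow> L \<le> k \<Longrightarrow> glin V W L e g"
  unfolding tensor_linear_def glin_def tensor_power_tspan by (auto elim!: tspan_mono)

text \<open>The common recursion scheme of algebra maps, derivations and tensor homotopies on words.\<close>

fun word_rec :: "'c gvs \<Rightarrow> 'c tensor \<Rightarrow> (int \<Rightarrow> 'b \<Rightarrow> 'c tensor) \<Rightarrow> ((int \<times> 'b) list \<Rightarrow> 'c tensor) \<Rightarrow>
    (int \<Rightarrow> 'b \<Rightarrow> 'c tensor) \<Rightarrow> (int \<times> 'b) list \<Rightarrow> 'c tensor"
  where
    "word_rec W c A G B [] = c"
  | "word_rec W c A G B ((p, x) # xs) = tprod W (A p x) (G xs) + tprod W (B p x) (word_rec W c A G B xs)"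

lemma word_rec_tensors:
  assumes gv: "graded_vector_space W" and A: "glin V W K a A" and B: "glin V W L b B"
    and G: "\<And>xs. xs \<in> hom_lists V \<Longrightarrow> G xs \<in> tensors W" and c: "c \<in> tensors W"
  shows "xs \<in> hom_lists V \<Longrightarrow> word_rec W c A G B xs \<in> tensors W"
proof (induction xs)
  case (Cons u us)
  then show ?case using glinD(2)[OF A] glinD(2)[OF B] G
    by (cases u) (auto intro!: tspan_add tprod_tensors[OF gv])
qed (simp add: c)

lemma word_linear_word_rec:
  assumes gv: "graded_vector_space W" and A: "glin V W K a A" and B: "glin V W L b B"
    and G: "\<And>xs. xs \<in> hom_lists V \<Longrightarrow> G xs \<in> tensors W" "word_linear V G" and c: "c \<in> tensors W"
  shows "word_linear V (word_rec W c A G B)"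
proof -
  let ?R = "word_rec W c A G B"
  note R = word_rec_tensors[OF gv A B G(1) c]
  note Gl = G(2)[unfolded word_linear_iff]
  note A' = glinD[OF A] and B' = glinD[OF B]
  note lin = tprod_add_left tprod_scale_left tprod_add_right[OF gv] tprod_scale_right[OF gv]
    tn.scale_right_distrib
  have "(\<forall>y\<in>carrier (V p). ?R (us @ (p, x \<oplus>\<^bsub>V p\<^esub> y) # vs) = ?R (us @ (p, x) # vs) + ?R (us @ (p, y) # vs)) \<and>
    (\<forall>c. ?R (us @ (p, c \<odot>\<^bsub>V p\<^esub> x) # vs) = tscale c (?R (us @ (p, x) # vs)))"
    if "us \<in> hom_lists V" "vs \<in> hom_lists V" "x \<in> carrier (V p)" for us vs p x
    using that(1)
  proof (induction us)
    case Nil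
    then show ?case using that by (auto simp: A' B' lin algebra_simps)
  next
    case (Cons u us)
    obtain q z where u: "u = (q, z)" by force
    with Cons.prems have us: "us \<in> hom_lists V" "z \<in> carrier (V q)" by auto
    show ?case using Cons.IH[OF us(1)] Gl[rule_format, OF us(1) that(2,3)] us that
      by (auto simp: u A' B' lin G(1) R algebra_simps)
  qed
  then show ?thesis unfolding word_linear_iff by blast
qed

definition alg_word :: "'c gvs \<Rightarrow> (int \<Rightarrow> 'b \<Rightarrow> 'c tensor) \<Rightarrow> (int \<times> 'b) list \<Rightarrow> 'c tensor"
  where "alg_word W F = word_rec W (tens W []) (\<lambda>_ _. 0) (\<lambda>_. 0) F"

text \<open>\<open>\<Sum> 1 \<otimes> \<dots> \<otimes> 1 \<otimes> h \<otimes> E \<otimes> \<dots> \<otimes> E\<close> with Koszul signs for \<open>h\<close> of odd degree: a derivation if \<open>E\<close> is the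
  identity, and the usual homotopy on tensor powers if \<open>E = I P\<close>.\<close>

definition der_word :: "'c gvs \<Rightarrow> (int \<Rightarrow> 'c \<Rightarrow> 'c tensor) \<Rightarrow> (int \<Rightarrow> 'c \<Rightarrow> 'c tensor) \<Rightarrow> (int \<times> 'c) list \<Rightarrow> 'c tensor"
  where "der_word W E h = word_rec W 0 h (alg_word W E) (\<lambda>p x. tscale (ksign p) (tens W [(p, x)]))"

abbreviation "letter W \<equiv> \<lambda>p x. tens W [(p, x)]"

abbreviation "alg_ext W F \<equiv> lin_ext (alg_word W F)"

abbreviation "der_ext W E h \<equiv> lin_ext (der_word W E h)"

abbreviation "der W d \<equiv> der_ext W (letter W) d"

lemma alg_word_simps [simp]:
  "alg_word W F [] = tens W []"
  "alg_word W F ((p, x) # xs) = tprod W (F p x) (alg_word W F xs)"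
  by (simp_all add: alg_word_def)

lemma der_word_simps [simp]:
  "der_word W E h [] = 0"
  "der_word W E h ((p, x) # xs) = tprod W (h p x) (alg_word W E xs) +
    tscale (ksign p) (tprod W (tens W [(p, x)]) (der_word W E h xs))"
  by (simp_all add: der_word_def tprod_scale_left)

lemma tens_tensors [simp]: "xs \<in> hom_lists V \<Longrightarrow> tens V xs \<in> tensors V"
  by (rule tspan_tens) auto

lemma glin_sgn_tens: "glin W W 1 0 (\<lambda>p x. tscale (ksign p) (tens W [(p, x)]))"
  by (rule glin_sign[OF glin_tens])

lemma
  assumes gv: "graded_vector_space W" and F: "glin V W L e F"
  shows alg_word_tensors: "xs \<in> hom_lists V \<Longrightarrow> alg_word W F xs \<in> tensors W"
    and word_linear_alg_word: "word_linear V (alg_word W F)"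
  using word_rec_tensors[OF gv glin_0[of V W 0 0] F] word_linear_word_rec[OF gv glin_0[of V W 0 0] F]
  by (auto simp: alg_word_def tspan_0 word_linear_0)

lemma
  assumes gv: "graded_vector_space W" and E: "glin W W L e E" and h: "glin W W M f h"
  shows der_word_tensors: "xs \<in> hom_lists W \<Longrightarrow> der_word W E h xs \<in> tensors W"
    and word_linear_der_word: "word_linear W (der_word W E h)"
  using word_rec_tensors[OF gv h glin_sgn_tens] word_linear_word_rec[OF gv h glin_sgn_tens]
    alg_word_tensors[OF gv E] word_linear_alg_word[OF gv E]
  by (auto simp: der_word_def tspan_0)

lemmas alg_ext_tens = lin_ext_tens[OF word_linear_alg_word]
lemmas der_ext_tens = lin_ext_tens[OF word_linear_der_word]

lemma alg_word_letter: "graded_vector_space W \<Longrightarrow> xs \<in> hom_lists W \<Longrightarrow> alg_word W (letter W) xs = tens W xs"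
  by (induction xs) (auto simp: tprod_tens)

lemma alg_word_tfil:
  assumes gv: "graded_vector_space W" and F: "glin V W 1 0 F"
  shows "xs \<in> hom_lists V \<Longrightarrow> alg_word W F xs \<in> tfil W (length xs) (deg xs)"
proof (induction xs)
  case (Cons u us)
  obtain q z where u: "u = (q, z)" by force
  show ?case using Cons glinD(1)[OF F] by (auto simp: u intro!: tprod_tfil[OF gv])
qed (auto intro: tspan_tens)

text \<open>One letter is replaced by a tensor of length at least \<open>L\<close> and the others
  keep length at least one, so the total is at least \<open>length xs - 1 + L\<close>; the bound is
  written additively to avoid truncated subtraction.\<close>

lemma der_word_tfil:
  assumes gv: "graded_vector_space W" and E: "glin W W 1 0 E" and h: "glin W W L e h"
  shows "xs \<in> hom_lists W \<Longrightarrow> K + 1 \<le> length xs + L \<Longrightarrow> der_word W E h xs \<in> tfil W K (deg xs + e)"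
proof (induction xs arbitrary: K)
  case (Cons u us)
  obtain q z where u: "u = (q, z)" by force
  \<comment> \<open>\<open>K - 1\<close> is truncated: for \<open>K = 0\<close> the induction
    hypothesis still asks for a total of 1, which a nonempty \<open>us\<close> provides. On the
    empty word the value is 0.\<close>
  have "der_word W E h us \<in> tfil W (K - 1) (deg us + e)" if "us \<noteq> []" using Cons that by (cases us) (auto simp: u)
  then have "der_word W E h us \<in> tfil W (K - 1) (deg us + e)" by (cases us) (auto simp: tspan_0)
  note us = this
  have "tprod W (tens W [(q, z)]) (der_word W E h us) \<in> tfil W K (deg (u # us) + e)"
    by (rule tprod_tfil[OF gv _ us, where L = 1 and p = q]) (use Cons.prems u in \<open>auto intro: tspan_tens\<close>)
  moreover have "tprod W (h q z) (alg_word W E us) \<in> tfil W K (deg (u # us) + e)"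
    by (rule tprod_tfil[OF gv glinD(1)[OF h] alg_word_tfil[OF gv E]]) (use Cons.prems u in auto)
  ultimately show ?case by (auto simp: u intro: tspan_intros)
qed (auto intro: tspan_0)

lemma
  assumes gv: "graded_vector_space W" and F: "glin V W 1 0 F"
  shows alg_ext_tfil: "T \<in> tfil V n p \<Longrightarrow> alg_ext W F T \<in> tfil W n p"
    and alg_ext_tensors: "T \<in> tensors V \<Longrightarrow> alg_ext W F T \<in> tensors W"
proof -
  show "alg_ext W F T \<in> tfil W n p" if "T \<in> tfil V n p"
    by (rule lin_ext_tspan[OF word_linear_alg_word[OF gv F] that])
      (auto intro: tspan_mono[OF alg_word_tfil[OF gv F]])
  show "alg_ext W F T \<in> tensors W" if "T \<in> tensors V"
    by (rule lin_ext_tspan[OF word_linear_alg_word[OF gv F] that]) (rule alg_word_tensors[OF gv F])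
qed

lemma
  assumes gv: "graded_vector_space W" and E: "glin W W 1 0 E" and h: "glin W W L e h"
  shows der_ext_tfil: "T \<in> tfil W n p \<Longrightarrow> K + 1 \<le> n + L \<Longrightarrow> q = p + e \<Longrightarrow> der_ext W E h T \<in> tfil W K q"
    and der_ext_tensors: "T \<in> tensors W \<Longrightarrow> der_ext W E h T \<in> tensors W"
proof -
  show "der_ext W E h T \<in> tfil W K q" if "T \<in> tfil W n p" "K + 1 \<le> n + L" "q = p + e"
    by (rule lin_ext_tspan[OF word_linear_der_word[OF gv E h] that(1)])
      (use der_word_tfil[OF gv E h] that in auto)
  show "der_ext W E h T \<in> tensors W" if "T \<in> tensors W"
    by (rule lin_ext_tspan[OF word_linear_der_word[OF gv E h] that]) (rule der_word_tensors[OF gv E h])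
qed

lemma alg_ext_gen:
  "graded_vector_space W \<Longrightarrow> glin V W 1 0 F \<Longrightarrow> x \<in> carrier (V p) \<Longrightarrow> alg_ext W F (tens V [(p, x)]) = F p x"
  by (simp add: alg_ext_tens tprod_unit_right glinD)

lemma der_ext_gen:
  "graded_vector_space W \<Longrightarrow> glin W W 1 0 E \<Longrightarrow> glin W W L e h \<Longrightarrow> x \<in> carrier (W p) \<Longrightarrow>
    der_ext W E h (tens W [(p, x)]) = h p x"
  by (simp add: der_ext_tens tprod_unit_right glinD)

lemma alg_word_append:
  assumes gv: "graded_vector_space W" and F: "glin V W 1 0 F"
  shows "xs \<in> hom_lists V \<Longrightarrow> ys \<in> hom_lists V \<Longrightarrow>
    alg_word W F (xs @ ys) = tprod W (alg_word W F xs) (alg_word W F ys)"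
proof (induction xs)
  case (Cons u us)
  obtain q z where u: "u = (q, z)" by force
  show ?case using Cons glinD[OF F]
    by (auto simp: u tprod_assoc[OF gv] alg_word_tensors[OF gv F])
qed (auto simp: tprod_unit_left[OF gv] alg_word_tensors[OF gv F])

lemma alg_ext_tprod:
  assumes gV: "graded_vector_space V" and gv: "graded_vector_space W" and F: "glin V W 1 0 F"
    and S: "S \<in> tensors V" and T: "T \<in> tensors V"
  shows "alg_ext W F (tprod V S T) = tprod W (alg_ext W F S) (alg_ext W F T)"
  using S
proof (induction rule: tspan_induct)
  case (tens xs)
  note xs = tens
  show ?case using T
    by (induction rule: tspan_induct)
      (use xs in \<open>auto simp: tprod_tens[OF gV] alg_ext_tens[OF gv F] alg_word_append[OF gv F] lin_ext_add lin_ext_scale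
        tprod_add_right[OF gV] tprod_scale_right[OF gV] tprod_add_right[OF gv] tprod_scale_right[OF gv]
        alg_word_tensors[OF gv F] alg_ext_tensors[OF gv F]\<close>)
qed (auto simp: tprod_add_left tprod_scale_left lin_ext_add lin_ext_scale)

lemma der_word_append:
  assumes gv: "graded_vector_space W" and E: "glin W W 1 0 E" and h: "glin W W L e h"
  shows "xs \<in> hom_lists W \<Longrightarrow> ys \<in> hom_lists W \<Longrightarrow>
    der_word W E h (xs @ ys) = tprod W (der_word W E h xs) (alg_word W E ys) +
      tscale (ksign (deg xs)) (tprod W (tens W xs) (der_word W E h ys))"
proof (induction xs)
  case (Cons u us)
  obtain q z where u: "u = (q, z)" by force
  have *: "tens W ((q, z) # us) = tprod W (tens W [(q, z)]) (tens W us)"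
    using Cons.prems by (simp add: tprod_tens[OF gv] u)
  show ?case using Cons glinD[OF E] glinD[OF h]
    by (simp add: u * tprod_assoc[OF gv] alg_word_tensors[OF gv E] der_word_tensors[OF gv E h] alg_word_append[OF gv E]
        tprod_add_left tprod_scale_left tprod_add_right[OF gv] tprod_scale_right[OF gv] tspan_scale
        tn.scale_right_distrib ksign_add tprod_tensors[OF gv] mult.commute)
qed (auto simp: tprod_unit_left[OF gv] der_word_tensors[OF gv E h])

text \<open>A Leibniz rule twisted by \<open>E\<close>: letters to the left of the one hit by
  \<open>h\<close> stay, those to its right pass through \<open>E\<close>. The sign is the Koszul
  sign of an odd \<open>h\<close> moving past \<open>S\<close>, hence \<open>S\<close> is
  homogeneous of degree \<open>p\<close>.\<close>

lemma der_ext_tprod: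
  assumes gv: "graded_vector_space W" and E: "glin W W 1 0 E" and h: "glin W W L e h"
    and S: "S \<in> tfil W n p" and T: "T \<in> tensors W"
  shows "der_ext W E h (tprod W S T) = tprod W (der_ext W E h S) (alg_ext W E T) +
    tscale (ksign p) (tprod W S (der_ext W E h T))"
  using S
proof (induction rule: tspan_induct)
  case (tens xs)
  note xs = tens
  show ?case using T
    by (induction rule: tspan_induct)
      (use xs in \<open>auto simp: tprod_tens[OF gv] alg_ext_tens[OF gv E] der_ext_tens[OF gv E h] der_word_append[OF gv E h] lin_ext_add lin_ext_scale
        tprod_add_right[OF gv] tprod_scale_right[OF gv] tn.scale_right_distrib
        alg_word_tensors[OF gv E] der_word_tensors[OF gv E h] alg_ext_tensors[OF gv E] der_ext_tensors[OF gv E h] algebra_simps\<close>)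
qed (auto simp: tprod_add_left tprod_scale_left lin_ext_add lin_ext_scale tn.scale_right_distrib algebra_simps)

lemma alg_ext_letter: "graded_vector_space W \<Longrightarrow> T \<in> tensors W \<Longrightarrow> alg_ext W (letter W) T = T"
  by (subst lin_ext_cong[of W _ "tens W"])
    (auto simp: word_linear_alg_word[OF _ glin_tens] word_linear_tens alg_word_letter lin_ext_id)

lemma der_tprod:
  assumes gv: "graded_vector_space W" and h: "glin W W L e h"
    and S: "S \<in> tfil W n p" and T: "T \<in> tensors W"
  shows "der W h (tprod W S T) = tprod W (der W h S) T + tscale (ksign p) (tprod W S (der W h T))"
  using der_ext_tprod[OF gv glin_tens h S T] T by (simp add: alg_ext_letter[OF gv])

lemma alg_word_cong:
  assumes "\<And>p x. x \<in> carrier (V p) \<Longrightarrow> F p x = G p x"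
  shows "xs \<in> hom_lists V \<Longrightarrow> alg_word W F xs = alg_word W G xs"
  by (induction xs) (auto simp: assms)

lemma alg_ext_cong:
  assumes gv: "graded_vector_space W" and F: "glin V W L e F" and G: "glin V W L' e' G"
    and "\<And>p x. x \<in> carrier (V p) \<Longrightarrow> F p x = G p x" and "T \<in> tspan V Q"
  shows "alg_ext W F T = alg_ext W G T"
  by (rule lin_ext_cong[OF word_linear_alg_word[OF gv F] word_linear_alg_word[OF gv G] assms(5)])
    (rule alg_word_cong[OF assms(4)])

lemma der_word_cong:
  assumes "\<And>p x. x \<in> carrier (W p) \<Longrightarrow> h p x = h' p x"
  shows "xs \<in> hom_lists W \<Longrightarrow> der_word W E h xs = der_word W E h' xs"
  by (induction xs) (auto simp: assms)

lemma der_ext_cong: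
  assumes gv: "graded_vector_space W" and E: "glin W W K a E" and F: "glin W W L e h" and G: "glin W W L' e' h'"
    and "\<And>p x. x \<in> carrier (W p) \<Longrightarrow> h p x = h' p x" and "T \<in> tspan W Q"
  shows "der_ext W E h T = der_ext W E h' T"
  by (rule lin_ext_cong[OF word_linear_der_word[OF gv E F] word_linear_der_word[OF gv E G] assms(6)])
    (rule der_word_cong[OF assms(5)])

lemma alg_ext_comp:
  assumes gV: "graded_vector_space V" and gv: "graded_vector_space W"
    and F: "glin U V 1 0 F" and G: "glin V W 1 0 G"
  shows "glin U W 1 0 (\<lambda>p x. alg_ext W G (F p x))"
    and "T \<in> tensors U \<Longrightarrow> alg_ext W G (alg_ext V F T) = alg_ext W (\<lambda>p x. alg_ext W G (F p x)) T"
proof -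
  let ?H = "\<lambda>p x. alg_ext W G (F p x)"
  show H: "glin U W 1 0 ?H"
    using alg_ext_tfil[OF gv G] F by (auto simp: glin_def lin_ext_add lin_ext_scale)
  have *: "xs \<in> hom_lists U \<Longrightarrow> alg_ext W G (alg_word V F xs) = alg_word W ?H xs" for xs
    by (induction xs) (auto simp: alg_ext_tens[OF gv G] alg_ext_tprod[OF gV gv G] glinD[OF F] alg_word_tensors[OF gV F])
  show "alg_ext W G (alg_ext V F T) = alg_ext W ?H T" if "T \<in> tensors U"
    using that by (induction rule: tspan_induct)
      (auto simp: * lin_ext_add lin_ext_scale alg_ext_tens[OF gV F] alg_ext_tens[OF gv H])
qed

lemma tens_Cons:
  "graded_vector_space V \<Longrightarrow> (p, x) # xs \<in> hom_lists V \<Longrightarrow>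
    tens V ((p, x) # xs) = tprod V (tens V [(p, x)]) (tens V xs)"
  by (simp add: tprod_tens)

subsection \<open>Comparison of algebra maps and derivations\<close>

text \<open>A letterwise map commutes with the twisted derivation once it does so on single letters.
  It must intertwine \<open>E\<close> with \<open>E'\<close> as well, since the letters to the right
  of the active one are changed by \<open>E\<close>.\<close>

lemma alg_ext_der_ext:
  assumes gV: "graded_vector_space V" and gW: "graded_vector_space W"
    and J: "glin V W 1 0 (\<lambda>p x. tens W [(p, j p x)])" and jc: "\<And>p x. x \<in> carrier (V p) \<Longrightarrow> j p x \<in> carrier (W p)"
    and E: "glin V V 1 0 E" and h: "glin V V L e h" and E': "glin W W 1 0 E'" and h': "glin W W L' e' h'"
    and hhom: "\<And>p x. x \<in> carrier (V p) \<Longrightarrow> alg_ext W (\<lambda>p x. tens W [(p, j p x)]) (h p x) = h' p (j p x)"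
    and EE: "\<And>p x. x \<in> carrier (V p) \<Longrightarrow> alg_ext W (\<lambda>p x. tens W [(p, j p x)]) (E p x) = E' p (j p x)"
    and T: "T \<in> tensors V"
  shows "alg_ext W (\<lambda>p x. tens W [(p, j p x)]) (der_ext V E h T) =
    der_ext W E' h' (alg_ext W (\<lambda>p x. tens W [(p, j p x)]) T)"
proof -
  let ?J = "\<lambda>p x. tens W [(p, j p x)]"
  have al: "alg_ext W ?J (alg_word V E xs) = alg_ext W E' (alg_word W ?J xs)" if "xs \<in> hom_lists V" for xs
  proof -
    have "alg_ext W ?J (alg_word V E xs) = alg_word W (\<lambda>p x. alg_ext W ?J (E p x)) xs"
      using alg_ext_comp(2)[OF gV gW E J, of "tens V xs"] that alg_ext_comp(1)[OF gV gW E J]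
      by (simp add: alg_ext_tens[OF gV E] alg_ext_tens[OF gW])
    also have "\<dots> = alg_word W (\<lambda>p x. alg_ext W E' (?J p x)) xs"
      by (rule alg_word_cong[OF _ that]) (simp add: EE alg_ext_gen[OF gW E'] jc)
    also have "\<dots> = alg_ext W E' (alg_word W ?J xs)"
      using alg_ext_comp(2)[OF gW gW J E', of "tens V xs"] alg_ext_comp(1)[OF gW gW J E'] that
      by (simp add: alg_ext_tens[OF gW J] alg_ext_tens[OF gW])
    finally show ?thesis .
  qed
  have w: "xs \<in> hom_lists V \<Longrightarrow> alg_ext W ?J (der_word V E h xs) = der_ext W E' h' (alg_word W ?J xs)" for xs
  proof (induction xs)
    case Nil
    then show ?case by (simp add: der_ext_tens[OF gW E' h'])
  next
    case (Cons u xs)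
    obtain p x where u: "u = (p, x)" by force
    have x: "x \<in> carrier (V p)" "xs \<in> hom_lists V" using Cons.prems u by auto
    have "der_ext W E' h' (tprod W (?J p x) (alg_word W ?J xs)) =
        tprod W (der_ext W E' h' (?J p x)) (alg_ext W E' (alg_word W ?J xs)) +
        tscale (ksign p) (tprod W (?J p x) (der_ext W E' h' (alg_word W ?J xs)))"
      by (rule der_ext_tprod[OF gW E' h', of _ 1])
        (use x jc alg_word_tensors[OF gW J] in \<open>auto intro: tspan_tens\<close>)
    then show ?case using x Cons.IH
      by (simp add: u lin_ext_add lin_ext_scale alg_ext_tprod[OF gV gW J] glinD[OF h] alg_word_tensors[OF gV E]
         der_word_tensors[OF gV E h] hhom al der_ext_gen[OF gW E' h'] jc alg_ext_gen[OF gW J])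
  qed
  show ?thesis using T
    by (induction rule: tspan_induct)
      (auto simp: lin_ext_add lin_ext_scale w der_ext_tens[OF gV E h] alg_ext_tens[OF gW J])
qed

text \<open>The defect \<open>D F - F d\<close> is an \<open>F\<close>-derivation, hence controlled by its values on generators.\<close>

lemma defect_tfil:
  assumes gU: "graded_vector_space U" and gW: "graded_vector_space W"
    and F: "glin U W 1 0 F" and d: "glin U U L1 (-1) d" and D: "glin W W L2 (-1) D"
    and E: "\<And>p x. x \<in> carrier (U p) \<Longrightarrow> der W D (F p x) - alg_ext W F (d p x) \<in> tfil W L (p - 1)"
    and T: "T \<in> tfil U n p" and K: "K + 1 \<le> n + L"
  shows "der W D (alg_ext W F T) - alg_ext W F (der U d T) \<in> tfil W K (p - 1)"
proof -
  have w: "xs \<in> hom_lists U \<Longrightarrow> K + 1 \<le> length xs + L \<Longrightarrow>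
      der W D (alg_word W F xs) - alg_ext W F (der_word U (letter U) d xs) \<in> tfil W K (deg xs - 1)" for xs K
  proof (induction xs arbitrary: K)
    case Nil
    then show ?case by (simp add: der_ext_tens[OF gW glin_tens D] tspan_0)
  next
    case (Cons u xs)
    obtain p x where u: "u = (p, x)" by force
    have x: "x \<in> carrier (U p)" "xs \<in> hom_lists U" using Cons.prems u by auto
    let ?E = "der W D (alg_word W F xs) - alg_ext W F (der_word U (letter U) d xs)"
    have "?E \<in> tfil W (K - 1) (deg xs - 1)"
    proof (cases xs)
      case Nil
      then show ?thesis by (simp add: der_ext_tens[OF gW glin_tens D] tspan_0)
    next
      case (Cons a list)
      then show ?thesis using Cons.IH Cons.prems x by auto
    qed
    note IH = this
    have "der W D (tprod W (F p x) (alg_word W F xs)) - alg_ext W F (der_word U (letter U) d ((p, x) # xs)) =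
      tprod W (der W D (F p x) - alg_ext W F (d p x)) (alg_word W F xs)
      + tscale (ksign p) (tprod W (F p x) ?E)"
      using x glinD[OF F, of x p] der_tprod[OF gW D, of "F p x" 1 p "alg_word W F xs"]
      by (simp add: lin_ext_add lin_ext_scale alg_ext_tprod[OF gU gW F] glinD[OF d] alg_word_letter[OF gU]
        alg_ext_gen[OF gW F] alg_ext_tens[OF gW F] alg_word_tensors[OF gW F] der_word_tensors[OF gU glin_tens d]
        tprod_diff_left tprod_diff_right[OF gW] alg_ext_tensors[OF gW F] der_ext_tensors[OF gW glin_tens D]
        tn.scale_right_diff_distrib tprod_unit_right[OF gW])
    moreover have "tprod W (der W D (F p x) - alg_ext W F (d p x)) (alg_word W F xs) \<in> tfil W K (deg (u # xs) - 1)"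
      by (rule tprod_tfil[OF gW E alg_word_tfil[OF gW F]]) (use Cons.prems u in auto)
    moreover have "tprod W (F p x) ?E \<in> tfil W K (deg (u # xs) - 1)"
      by (rule tprod_tfil[OF gW glinD(1)[OF F] IH]) (use Cons.prems u in auto)
    ultimately show ?case by (auto simp: u intro: tspan_intros)
  qed
  show ?thesis using T
  proof (induction rule: tspan_induct)
    case (add S T)
    then have "(der W D (alg_ext W F S) - alg_ext W F (der U d S)) +
      (der W D (alg_ext W F T) - alg_ext W F (der U d T)) \<in> tfil W K (p - 1)" by (intro tspan_add)
    then show ?case by (simp add: lin_ext_add algebra_simps)
  next
    case (scale c S)
    then have "tscale c (der W D (alg_ext W F S) - alg_ext W F (der U d S)) \<in> tfil W K (p - 1)"
      by (intro tspan_scale)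
    then show ?case by (simp add: lin_ext_scale tn.scale_right_diff_distrib)
  next
    case (tens xs)
    then show ?case using w[of xs K] K by (simp add: alg_ext_tens[OF gW F] der_ext_tens[OF gU glin_tens d])
  qed (auto intro: tspan_0)
qed

text \<open>Telescoping over the letters: each summand has one factor \<open>F' - F\<close>, of
  length at least \<open>L\<close>, and the remaining factors have length at least one.\<close>

lemma alg_ext_diff_tfil:
  assumes gW: "graded_vector_space W" and F: "glin U W 1 0 F" and F': "glin U W 1 0 F'"
    and E: "\<And>p x. x \<in> carrier (U p) \<Longrightarrow> F' p x - F p x \<in> tfil W L p"
    and T: "T \<in> tfil U n p" and K: "K + 1 \<le> n + L"
  shows "alg_ext W F' T - alg_ext W F T \<in> tfil W K p"
proof -
  have w: "xs \<in> hom_lists U \<Longrightarrow> K + 1 \<le> length xs + L \<Longrightarrow>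
      alg_word W F' xs - alg_word W F xs \<in> tfil W K (deg xs)" for xs K
  proof (induction xs arbitrary: K)
    case (Cons u xs)
    obtain p x where u: "u = (p, x)" by force
    have x: "x \<in> carrier (U p)" "xs \<in> hom_lists U" using Cons.prems u by auto
    have IH: "alg_word W F' xs - alg_word W F xs \<in> tfil W (K - 1) (deg xs)"
      using Cons x by (cases xs) (auto simp: tspan_0)
    have "alg_word W F' (u # xs) - alg_word W F (u # xs) =
      tprod W (F' p x - F p x) (alg_word W F' xs) + tprod W (F p x) (alg_word W F' xs - alg_word W F xs)"
      using x by (simp add: u tprod_diff_left tprod_diff_right[OF gW] alg_word_tensors[OF gW F] alg_word_tensors[OF gW F']
        glinD[OF F])
    moreover have "tprod W (F' p x - F p x) (alg_word W F' xs) \<in> tfil W K (deg (u # xs))"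
      by (rule tprod_tfil[OF gW E alg_word_tfil[OF gW F']]) (use Cons.prems u in auto)
    moreover have "tprod W (F p x) (alg_word W F' xs - alg_word W F xs) \<in> tfil W K (deg (u # xs))"
      by (rule tprod_tfil[OF gW glinD(1)[OF F] IH]) (use Cons.prems u in auto)
    ultimately show ?case by (auto intro: tspan_intros)
  qed (simp add: tspan_0)
  show ?thesis using T
  proof (induction rule: tspan_induct)
    case (add S T)
    then have "(alg_ext W F' S - alg_ext W F S) + (alg_ext W F' T - alg_ext W F T) \<in> tfil W K p"
      by (intro tspan_add)
    then show ?case by (simp add: lin_ext_add algebra_simps)
  next
    case (scale c S)
    then have "tscale c (alg_ext W F' S - alg_ext W F S) \<in> tfil W K p"
      by (intro tspan_scale)
    then show ?case by (simp add: lin_ext_scale tn.scale_right_diff_distrib)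
  next
    case (tens xs)
    then show ?case using w[of xs K] K by (simp add: alg_ext_tens[OF gW F] alg_ext_tens[OF gW F'])
  qed (auto intro: tspan_0)
qed

lemma der_ext_add:
  assumes gW: "graded_vector_space W" and E: "glin W W 1 0 E" and d: "glin W W L e d" and d': "glin W W L' e' d'"
    and dd: "glin W W L'' e'' (\<lambda>p x. d p x + d' p x)" and T: "T \<in> tensors W"
  shows "der_ext W E (\<lambda>p x. d p x + d' p x) T = der_ext W E d T + der_ext W E d' T"
proof -
  have w: "xs \<in> hom_lists W \<Longrightarrow> der_word W E (\<lambda>p x. d p x + d' p x) xs = der_word W E d xs + der_word W E d' xs" for xs
    by (induction xs) (auto simp: tprod_add_left tprod_add_right[OF gW] der_word_tensors[OF gW E d]
      der_word_tensors[OF gW E d'] tn.scale_right_distrib algebra_simps)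
  show ?thesis using T
    by (induction rule: tspan_induct)
     (auto simp: w lin_ext_add lin_ext_scale der_ext_tens[OF gW E dd] der_ext_tens[OF gW E d] der_ext_tens[OF gW E d']
       tn.scale_right_distrib algebra_simps)
qed

text \<open>The square of an odd derivation is again a derivation: the mixed terms carry
  \<open>ksign (p - 1)\<close> and \<open>ksign p\<close>, which are opposite. So it vanishes if it
  vanishes on letters.\<close>

lemma der_der:
  assumes gW: "graded_vector_space W" and d: "glin W W L (-1) d"
    and dd: "\<And>p x. x \<in> carrier (W p) \<Longrightarrow> der W d (d p x) = 0" and T: "T \<in> tensors W"
  shows "der W d (der W d T) = 0"
proof -
  have w: "xs \<in> hom_lists W \<Longrightarrow> der W d (der_word W (letter W) d xs) = 0" for xs
  proof (induction xs)
    case (Cons u xs)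
    obtain p x where u: "u = (p, x)" by force
    have x: "x \<in> carrier (W p)" "xs \<in> hom_lists W" using Cons.prems u by auto
    have "der W d (tprod W (d p x) (tens W xs)) =
       tprod W (der W d (d p x)) (tens W xs) + tscale (ksign (p - 1)) (tprod W (d p x) (der W d (tens W xs)))"
      by (rule der_tprod[OF gW d, of _ L]) (use x glinD[OF d, of x p] in auto)
    moreover have "der W d (tprod W (tens W [(p, x)]) (der_word W (letter W) d xs)) =
       tprod W (der W d (tens W [(p, x)])) (der_word W (letter W) d xs) +
       tscale (ksign p) (tprod W (tens W [(p, x)]) (der W d (der_word W (letter W) d xs)))"
      by (rule der_tprod[OF gW d, of _ 1]) (use x der_word_tensors[OF gW glin_tens d] in \<open>auto intro: tspan_tens\<close>)
    ultimately show ?case using x Cons.IH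
      by (simp add: u lin_ext_add lin_ext_scale alg_word_letter[OF gW] dd der_ext_gen[OF gW glin_tens d] ksign_diff
        der_ext_tens[OF gW glin_tens d] tprod_unit_right[OF gW] glinD[OF d])
  qed simp
  show ?thesis using T
    by (induction rule: tspan_induct) (auto simp: w lin_ext_add lin_ext_scale der_ext_tens[OF gW glin_tens d])
qed

text \<open>The tensor trick: a homotopy between the identity and \<open>P\<close> on letters gives
  one on tensor powers. In the application \<open>P\<close> factors through homology with zero
  differential, so \<open>d P\<close> and \<open>P d\<close> both vanish and with them the Leibniz
  terms in which \<open>d\<close> meets \<open>P\<close>.\<close>

lemma homotopy_lin_ext:
  assumes gW: "graded_vector_space W" and d: "glin W W 1 (-1) d" and h: "glin W W 1 1 h" and P: "glin W W 1 0 P"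
    and dP: "\<And>T. T \<in> tensors W \<Longrightarrow> der W d (alg_ext W P T) = 0"
    and Pd: "\<And>T. T \<in> tensors W \<Longrightarrow> alg_ext W P (der W d T) = 0"
    and hd: "\<And>p x. x \<in> carrier (W p) \<Longrightarrow>
      der W d (h p x) + der_ext W P h (d p x) = P p x - tens W [(p, x)]"
    and T: "T \<in> tensors W"
  shows "der W d (der_ext W P h T) + der_ext W P h (der W d T) = alg_ext W P T - T"
proof -
  let ?H = "der_ext W P h"
  have w: "xs \<in> hom_lists W \<Longrightarrow>
     der W d (der_word W P h xs) + ?H (der_word W (letter W) d xs) = alg_word W P xs - tens W xs" for xs
  proof (induction xs)
    case (Cons u xs)
    obtain p x where u: "u = (p, x)" by force
    have x: "x \<in> carrier (W p)" "xs \<in> hom_lists W" using Cons.prems u by auto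
    note tl = alg_word_tensors[OF gW P] der_word_tensors[OF gW P h] der_word_tensors[OF gW glin_tens d] x glinD[OF d] glinD[OF h] glinD[OF P]
    have 1: "der W d (tprod W (h p x) (alg_word W P xs)) = tprod W (der W d (h p x)) (alg_word W P xs)"
      using der_tprod[OF gW d, of "h p x" 1 "p + 1" "alg_word W P xs"] tl dP[of "tens W xs"]
      by (simp add: alg_ext_tens[OF gW P])
    have 2: "der W d (tprod W (tens W [(p, x)]) (der_word W P h xs)) =
       tprod W (d p x) (der_word W P h xs) + tscale (ksign p) (tprod W (tens W [(p, x)]) (der W d (der_word W P h xs)))"
      using der_tprod[OF gW d, of "tens W [(p, x)]" 1 p "der_word W P h xs"] tl
      by (simp add: tspan_tens der_ext_gen[OF gW glin_tens d])
    have 3: "?H (tprod W (d p x) (tens W xs)) =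
        tprod W (?H (d p x)) (alg_word W P xs) - tscale (ksign p) (tprod W (d p x) (der_word W P h xs))"
      using der_ext_tprod[OF gW P h, of "d p x" 1 "p - 1" "tens W xs"] tl
      by (simp add: ksign_diff alg_ext_tens[OF gW P] der_ext_tens[OF gW P h])
    have 4: "?H (tprod W (tens W [(p, x)]) (der_word W (letter W) d xs)) =
        tscale (ksign p) (tprod W (tens W [(p, x)]) (?H (der_word W (letter W) d xs)))"
      using der_ext_tprod[OF gW P h, of "tens W [(p, x)]" 1 p "der_word W (letter W) d xs"] tl Pd[of "tens W xs"]
      by (simp add: tspan_tens der_ext_gen[OF gW P h] der_ext_tens[OF gW glin_tens d])
    \<comment> \<open>The two terms in which \<open>d\<close> hits the first letter and the homotopy
      a later one carry opposite Koszul signs and cancel. What remains is the identity for the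
      letter \<open>x\<close> times \<open>P\<close>, plus \<open>x\<close> times the induction
      hypothesis.\<close>
    have "der W d (der_word W P h (u # xs)) + ?H (der_word W (letter W) d (u # xs)) =
      tprod W (der W d (h p x) + ?H (d p x)) (alg_word W P xs) +
      tprod W (tens W [(p, x)]) (der W d (der_word W P h xs) + ?H (der_word W (letter W) d xs))"
      using tl by (simp add: u lin_ext_add lin_ext_scale 1 2 3 4 alg_word_letter[OF gW] tprod_add_left tprod_add_right[OF gW]
        tn.scale_right_distrib der_ext_tensors[OF gW glin_tens d] der_ext_tensors[OF gW P h])
    also have "\<dots> = alg_word W P (u # xs) - tens W (u # xs)"
      using tl by (simp add: u hd Cons.IH tprod_diff_left tprod_diff_right[OF gW] tens_Cons[OF gW, of p x xs])
    finally show ?case .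
  qed simp
  show ?thesis using T
  proof (induction rule: tspan_induct)
    case (add S T)
    then have "(der W d (?H S) + ?H (der W d S)) + (der W d (?H T) + ?H (der W d T)) =
       (alg_ext W P S - S) + (alg_ext W P T - T)" by simp
    then show ?case by (simp add: lin_ext_add algebra_simps)
  next
    case (scale c S)
    then have "tscale c (der W d (?H S) + ?H (der W d S)) = tscale c (alg_ext W P S - S)" by simp
    then show ?case by (simp add: lin_ext_scale tn.scale_right_distrib tn.scale_right_diff_distrib)
  next
    case (tens xs)
    then show ?case using w[of xs]
      by (simp add: alg_ext_tens[OF gW P] der_ext_tens[OF gW P h] der_ext_tens[OF gW glin_tens d])
  qed simp
qed

subsection \<open>Projection to a fixed tensor length\<close>

definition len_part :: "'b gvs \<Rightarrow> nat \<Rightarrow> 'b tensor \<Rightarrow> 'b tensor"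
  where "len_part V n = lin_ext (\<lambda>xs. if length xs = n then tens V xs else 0)"

lemma word_linear_len_part: "word_linear V (\<lambda>xs. if length xs = n then tens V xs else 0)"
  by (auto simp: word_linear_iff tens_add tens_smult)

lemma len_part_tens: "len_part V n (tens V xs) = (if length xs = n then tens V xs else 0)"
  by (simp add: len_part_def lin_ext_tens[OF word_linear_len_part])

lemma len_part_0 [simp]: "len_part V n 0 = 0"
  and len_part_add: "len_part V n (S + T) = len_part V n S + len_part V n T"
  and len_part_diff: "len_part V n (S - T) = len_part V n S - len_part V n T"
  and len_part_scale: "len_part V n (tscale c S) = tscale c (len_part V n S)"
  and len_part_sum: "len_part V n (sum f I) = (\<Sum>i\<in>I. len_part V n (f i))"
  by (simp_all add: len_part_def lin_ext_add lin_ext_diff lin_ext_scale lin_ext_sum)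

lemma len_part_tensor_power: "T \<in> tfil V L p \<Longrightarrow> len_part V n T \<in> tensor_power V n p"
  unfolding tensor_power_tspan
  by (induction rule: tspan_induct) (auto simp: len_part_add len_part_scale len_part_tens intro!: tspan_intros tspan_tens)

lemma len_part_same: "T \<in> tensor_power V n p \<Longrightarrow> len_part V m T = (if m = n then T else 0)"
  unfolding tensor_power_tspan
  by (induction rule: tspan_induct) (auto simp: len_part_add len_part_scale len_part_tens)

lemma len_part_tfil_0: "T \<in> tfil V L p \<Longrightarrow> n < L \<Longrightarrow> len_part V n T = 0"
  by (induction rule: tspan_induct) (auto simp: len_part_add len_part_scale len_part_tens)

lemma tensor_power_tfil: "T \<in> tensor_power V n p \<Longrightarrow> L \<le> n \<Longrightarrow> T \<in> tfil V L p"
  unfolding tensor_power_tspan by (erule tspan_mono) auto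

lemma tensor_power_tensors: "T \<in> tensor_power V n p \<Longrightarrow> T \<in> tensors V"
  unfolding tensor_power_tspan by (erule tspan_all)

lemma len_part_rest: "T \<in> tfil V n p \<Longrightarrow> T - len_part V n T \<in> tfil V (Suc n) p"
proof (induction rule: tspan_induct)
  case (add S T)
  then have "(S - len_part V n S) + (T - len_part V n T) \<in> tfil V (Suc n) p" by (intro tspan_add)
  then show ?case by (simp add: len_part_add algebra_simps)
next
  case (scale c S)
  then have "tscale c (S - len_part V n S) \<in> tfil V (Suc n) p" by (intro tspan_scale)
  then show ?case by (simp add: len_part_scale tn.scale_right_diff_distrib)
qed (auto simp: len_part_tens tspan_0 intro!: tspan_tens)

text \<open>Length components are independent, so a homogeneous tensor congruent to 0 up to its own
  length is 0. This turns estimates modulo longer tensors into equations.\<close>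

lemma tensor_power_tfil_0: "T \<in> tensor_power V n p \<Longrightarrow> T \<in> tfil V (Suc n) q \<Longrightarrow> T = 0"
  by (metis len_part_same len_part_tfil_0 lessI)

text \<open>Letters go to tensors of length one, so tensor length is preserved; this is what makes
  the selection of leading terms natural.\<close>

lemma alg_ext_len_part:
  assumes gW: "graded_vector_space W" and F: "glin V W 1 0 F"
    and F1: "\<And>p x. x \<in> carrier (V p) \<Longrightarrow> F p x \<in> tensor_power W 1 p" and T: "T \<in> tensors V"
  shows "alg_ext W F (len_part V n T) = len_part W n (alg_ext W F T)"
proof -
  have "xs \<in> hom_lists V \<Longrightarrow> alg_word W F xs \<in> tensor_power W (length xs) (deg xs)" for xs
  proof (induction xs)
    case (Cons u xs)
    obtain p x where u: "u = (p, x)" by force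
    show ?case using Cons F1[of x p] unfolding tensor_power_tspan u
      by (auto intro: tprod_tspan[OF gW])
  qed (auto simp: tensor_power_tspan intro: tspan_tens)
  note w = len_part_same[OF this]
  show ?thesis using T
    by (induction rule: tspan_induct) (auto simp: w lin_ext_add lin_ext_scale len_part_add len_part_scale len_part_tens alg_ext_tens[OF gW F])
qed

lemma tensor_power_alg_ext:
  assumes gW: "graded_vector_space W" and F: "glin V W 1 0 F"
    and F1: "\<And>p x. x \<in> carrier (V p) \<Longrightarrow> F p x \<in> tensor_power W 1 p" and T: "T \<in> tensor_power V n p"
  shows "alg_ext W F T \<in> tensor_power W n p"
proof -
  have "alg_ext W F T = len_part W n (alg_ext W F T)"
    using alg_ext_len_part[OF gW F F1 tensor_power_tensors[OF T], of n] len_part_same[OF T, of n] by simp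
  moreover have "alg_ext W F T \<in> tfil W n p" by (rule alg_ext_tfil[OF gW F tensor_power_tfil[OF T]]) simp
  ultimately show ?thesis using len_part_tensor_power by metis
qed

lemma glin_op:
  assumes A: "glin U V L e A"
    and op: "\<And>S T. op (S + T) = op S + op T" "\<And>c S. op (tscale c S) = tscale c (op S)"
    and m: "\<And>p T. T \<in> tfil V L (p + e) \<Longrightarrow> op T \<in> tfil W L' (p + e')"
  shows "glin U W L' e' (\<lambda>p x. op (A p x))"
  using A by (auto simp: glin_def op m)

lemma tensor_power_intros:
  "0 \<in> tensor_power V n p"
  "S \<in> tensor_power V n p \<Longrightarrow> T \<in> tensor_power V n p \<Longrightarrow> S + T \<in> tensor_power V n p"
  "S \<in> tensor_power V n p \<Longrightarrow> T \<in> tensor_power V n p \<Longrightarrow> S - T \<in> tensor_power V n p"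
  "S \<in> tensor_power V n p \<Longrightarrow> - S \<in> tensor_power V n p"
  "S \<in> tensor_power V n p \<Longrightarrow> tscale c S \<in> tensor_power V n p"
  "(\<And>i. i \<in> I \<Longrightarrow> f i \<in> tensor_power V n p) \<Longrightarrow> sum f I \<in> tensor_power V n p"
  unfolding tensor_power_tspan by (intro tspan_intros; assumption)+

lemma tprod_tensor_power:
  "graded_vector_space V \<Longrightarrow> S \<in> tensor_power V m p \<Longrightarrow> T \<in> tensor_power V n q \<Longrightarrow> k = m + n \<Longrightarrow> r = p + q \<Longrightarrow>
    tprod V S T \<in> tensor_power V k r"
  unfolding tensor_power_tspan by (erule tprod_tspan, assumption, assumption) auto

lemma tens_tensor_power: "xs \<in> hom_lists V \<Longrightarrow> length xs = n \<Longrightarrow> deg xs = p \<Longrightarrow> tens V xs \<in> tensor_power V n p"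
  unfolding tensor_power_tspan by (rule tspan_tens) auto

lemma alg_word_tensor_power:
  assumes gW: "graded_vector_space W"
    and F1: "\<And>p x. x \<in> carrier (V p) \<Longrightarrow> F p x \<in> tensor_power W 1 p"
  shows "xs \<in> hom_lists V \<Longrightarrow> alg_word W F xs \<in> tensor_power W (length xs) (deg xs)"
  by (induction xs) (auto intro!: tprod_tensor_power[OF gW F1] tens_tensor_power)

lemma der_word_tensor_power:
  assumes gW: "graded_vector_space W"
    and E1: "\<And>p x. x \<in> carrier (W p) \<Longrightarrow> E p x \<in> tensor_power W 1 p"
    and h1: "\<And>p x. x \<in> carrier (W p) \<Longrightarrow> h p x \<in> tensor_power W k (p + e)"
  shows "xs \<in> hom_lists W \<Longrightarrow> Suc m = length xs + k \<Longrightarrow> der_word W E h xs \<in> tensor_power W m (deg xs + e)"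
proof (induction xs arbitrary: m)
  case (Cons u xs)
  obtain p x where u: "u = (p, x)" by force
  have x: "x \<in> carrier (W p)" "xs \<in> hom_lists W" using Cons.prems u by auto
  have "tprod W (h p x) (alg_word W E xs) \<in> tensor_power W m (deg (u # xs) + e)"
    by (rule tprod_tensor_power[OF gW h1[OF x(1)] alg_word_tensor_power[OF gW E1 x(2)]]) (use Cons.prems u in auto)
  moreover have "tprod W (tens W [(p, x)]) (der_word W E h xs) \<in> tensor_power W m (deg (u # xs) + e)"
  proof (cases xs)
    case Nil
    then show ?thesis using x by (simp add: tensor_power_intros)
  next
    case (Cons a list)
    show ?thesis
      by (rule tprod_tensor_power[OF gW _ Cons.IH[of "m - 1"], where m = 1 and p = p])
        (use Cons Cons.prems u x in \<open>auto intro: tens_tensor_power\<close>)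
  qed
  ultimately show ?case by (auto simp: u intro: tensor_power_intros)
qed (auto intro: tensor_power_intros)

lemma der_ext_tensor_power:
  assumes gW: "graded_vector_space W" and E: "glin W W 1 0 E" and h: "glin W W L e h"
    and E1: "\<And>p x. x \<in> carrier (W p) \<Longrightarrow> E p x \<in> tensor_power W 1 p"
    and h1: "\<And>p x. x \<in> carrier (W p) \<Longrightarrow> h p x \<in> tensor_power W k (p + e)"
    and T: "T \<in> tensor_power W n p" and m: "Suc m = n + k" and q: "q = p + e"
  shows "der_ext W E h T \<in> tensor_power W m q"
  unfolding tensor_power_tspan q
  by (rule lin_ext_tspan[OF word_linear_der_word[OF gW E h] T[unfolded tensor_power_tspan]])
    (use der_word_tensor_power[OF gW E1 h1] m in \<open>auto simp: tensor_power_tspan\<close>)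

subsection \<open>Homotopy transfer\<close>

definition obstr :: "'c gvs \<Rightarrow> (int \<Rightarrow> 'c \<Rightarrow> 'c tensor) \<Rightarrow> (int \<Rightarrow> 'h \<Rightarrow> 'h tensor) \<Rightarrow> (int \<Rightarrow> 'h \<Rightarrow> 'c tensor) \<Rightarrow>
    int \<Rightarrow> 'h \<Rightarrow> 'c tensor"
  where "obstr W D d F p x = der W D (F p x) - alg_ext W F (d p x)"

text \<open>If the partial sums \<open>d\<close>, \<open>F\<close> have an obstruction of length at least \<open>n\<close>, then its length \<open>n\<close> part is a
  cycle \<open>E\<close>, and adding \<open>P\<^sup>\<otimes>\<^sup>n E\<close> to \<open>d\<close> and the tensor homotopy of \<open>E\<close> to \<open>F\<close> removes it.\<close>

primrec transfer :: "'h gvs \<Rightarrow> 'c gvs \<Rightarrow> (int \<Rightarrow> 'c \<Rightarrow> 'c tensor) \<Rightarrow> (int \<Rightarrow> 'h \<Rightarrow> 'c tensor) \<Rightarrow>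
    (int \<Rightarrow> 'c \<Rightarrow> 'h tensor) \<Rightarrow> (int \<Rightarrow> 'c \<Rightarrow> 'c tensor) \<Rightarrow> nat \<Rightarrow>
    (int \<Rightarrow> 'h \<Rightarrow> 'h tensor) \<times> (int \<Rightarrow> 'h \<Rightarrow> 'c tensor)"
  where
    "transfer U W D I P h 0 = (\<lambda>p x. 0, I)"
  | "transfer U W D I P h (Suc N) =
      (let d = fst (transfer U W D I P h N); F = snd (transfer U W D I P h N) in
       (\<lambda>p x. d p x + alg_ext U P (len_part W (N + 2) (obstr W D d F p x)),
        \<lambda>p x. F p x + der_ext W (\<lambda>p x. alg_ext W I (P p x)) h (len_part W (N + 2) (obstr W D d F p x))))"

declare transfer.simps(2) [simp del]

text \<open>\<open>\<delta>\<close> is the linear part of \<open>D\<close>; \<open>I\<close>, \<open>P\<close>, \<open>h\<close> take values in tensors of length one.\<close>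

locale contraction =
  fixes U :: "'h gvs" and W :: "'c gvs" and D :: "int \<Rightarrow> 'c \<Rightarrow> 'c tensor" and \<delta> :: "int \<Rightarrow> 'c \<Rightarrow> 'c tensor"
    and I :: "int \<Rightarrow> 'h \<Rightarrow> 'c tensor" and P :: "int \<Rightarrow> 'c \<Rightarrow> 'h tensor" and h :: "int \<Rightarrow> 'c \<Rightarrow> 'c tensor"
  assumes gU: "graded_vector_space U" and gW: "graded_vector_space W"
    and D: "glin W W 1 (-1) D"
    and \<delta>: "glin W W 1 (-1) \<delta>" and \<delta>1: "\<And>p x. x \<in> carrier (W p) \<Longrightarrow> \<delta> p x \<in> tensor_power W 1 (p - 1)"
    and D\<delta>: "\<And>p x. x \<in> carrier (W p) \<Longrightarrow> D p x - \<delta> p x \<in> tfil W 2 (p - 1)"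
    and DD: "\<And>p x. x \<in> carrier (W p) \<Longrightarrow> der W D (D p x) = 0"
    and I: "glin U W 1 0 I" and I1: "\<And>p x. x \<in> carrier (U p) \<Longrightarrow> I p x \<in> tensor_power W 1 p"
    and P: "glin W U 1 0 P" and P1: "\<And>p x. x \<in> carrier (W p) \<Longrightarrow> P p x \<in> tensor_power U 1 p"
    and h: "glin W W 1 1 h" and h1: "\<And>p x. x \<in> carrier (W p) \<Longrightarrow> h p x \<in> tensor_power W 1 (p + 1)"
    and PI: "\<And>p x. x \<in> carrier (U p) \<Longrightarrow> alg_ext U P (I p x) = tens U [(p, x)]"
    and P\<delta>: "\<And>p x. x \<in> carrier (W p) \<Longrightarrow> alg_ext U P (\<delta> p x) = 0"
    and \<delta>I: "\<And>p x. x \<in> carrier (U p) \<Longrightarrow> der W \<delta> (I p x) = 0"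
    and homotopy: "\<And>p x. x \<in> carrier (W p) \<Longrightarrow>
      der W \<delta> (h p x) + der_ext W (\<lambda>p x. alg_ext W I (P p x)) h (\<delta> p x) = alg_ext W I (P p x) - tens W [(p, x)]"
begin

abbreviation "IP \<equiv> \<lambda>p x. alg_ext W I (P p x)"

abbreviation "dsums N \<equiv> fst (transfer U W D I P h N)"

abbreviation "fsums N \<equiv> snd (transfer U W D I P h N)"

text \<open>Stage \<open>N\<close> has components of length at most \<open>N + 1\<close>, stage 0
  being \<open>I\<close> alone; the first length that can still fail is therefore
  \<open>N + 2\<close>.\<close>

definition "lead_obstr N p x = len_part W (N + 2) (obstr W D (dsums N) (fsums N) p x)"

lemma dsums_Suc: "dsums (Suc N) = (\<lambda>p x. dsums N p x + alg_ext U P (lead_obstr N p x))"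
  and fsums_Suc: "fsums (Suc N) = (\<lambda>p x. fsums N p x + der_ext W IP h (lead_obstr N p x))"
  by (simp_all add: transfer.simps(2) Let_def lead_obstr_def)

lemma IP: "glin W W 1 0 IP"
  by (rule alg_ext_comp(1)[OF gU gW P I])

lemma IP1: "x \<in> carrier (W p) \<Longrightarrow> IP p x \<in> tensor_power W 1 p"
  by (rule tensor_power_alg_ext[OF gW I I1 P1])

lemma alg_IP: "T \<in> tensors W \<Longrightarrow> alg_ext W I (alg_ext U P T) = alg_ext W IP T"
  by (rule alg_ext_comp(2)[OF gU gW P I])

lemma alg_PI:
  assumes "T \<in> tensors U"
  shows "alg_ext U P (alg_ext W I T) = T"
proof -
  have "alg_ext U P (alg_ext W I T) = alg_ext U (\<lambda>p x. alg_ext U P (I p x)) T"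
    by (rule alg_ext_comp(2)[OF gW gU I P assms])
  also have "\<dots> = alg_ext U (letter U) T"
    by (rule alg_ext_cong[OF gU alg_ext_comp(1)[OF gW gU I P] glin_tens PI assms])
  finally show ?thesis by (simp add: alg_ext_letter[OF gU assms])
qed

lemma alg_P_der:
  assumes "T \<in> tensors W"
  shows "alg_ext U P (der W \<delta> T) = 0"
proof -
  have "xs \<in> hom_lists W \<Longrightarrow> alg_ext U P (der_word W (letter W) \<delta> xs) = 0" for xs
  proof (induction xs)
    case (Cons u xs)
    obtain p x where u: "u = (p, x)" by force
    show ?case using Cons
      by (auto simp: u lin_ext_add lin_ext_scale alg_ext_tprod[OF gW gU P] glinD[OF \<delta>] alg_word_letter[OF gW]
          der_word_tensors[OF gW glin_tens \<delta>] P\<delta> alg_ext_gen[OF gU P] glinD[OF P])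
  qed simp
  note w = this
  show ?thesis using assms by (induction rule: tspan_induct) (auto simp: w lin_ext_add lin_ext_scale der_ext_tens[OF gW glin_tens \<delta>])
qed

lemma der_alg_I:
  assumes "T \<in> tensors U"
  shows "der W \<delta> (alg_ext W I T) = 0"
proof -
  have "xs \<in> hom_lists U \<Longrightarrow> der W \<delta> (alg_word W I xs) = 0" for xs
  proof (induction xs)
    case Nil
    show ?case by (simp add: der_ext_tens[OF gW glin_tens \<delta>])
  next
    case (Cons u xs)
    obtain p x where u: "u = (p, x)" by force
    show ?case using Cons der_tprod[OF gW \<delta>, of "I p x" 1 p "alg_word W I xs"] glinD[OF I, of x p]
      by (auto simp: u \<delta>I alg_word_tensors[OF gW I])
  qed
  note w = this
  show ?thesis using assms by (induction rule: tspan_induct) (auto simp: w lin_ext_add lin_ext_scale alg_ext_tens[OF gW I])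
qed

text \<open>\<open>D - \<delta>\<close> has values of length at least 2 on letters, so it raises the
  length by at least one: on leading terms \<open>D\<close> may be replaced by its linear
  part.\<close>

lemma der_D_leading:
  assumes "T \<in> tfil W n p"
  shows "der W D T - der W \<delta> T \<in> tfil W (Suc n) (p - 1)"
proof -
  have g: "glin W W 2 (-1) (\<lambda>p x. D p x - \<delta> p x)"
    using glin_diff[OF D \<delta>] D\<delta> unfolding glin_def by auto
  have "der W D T = der W \<delta> T + der W (\<lambda>p x. D p x - \<delta> p x) T"
    using der_ext_add[OF gW glin_tens \<delta> g, of 1 "-1" T] D tspan_all[OF assms] by simp
  then show ?thesis using der_ext_tfil[OF gW glin_tens g assms, of "Suc n"] by simp
qed

lemma der_IP: "T \<in> tensors W \<Longrightarrow> der W \<delta> (alg_ext W IP T) = 0"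
  and IP_der: "T \<in> tensors W \<Longrightarrow> alg_ext W IP (der W \<delta> T) = 0"
  by (simp_all add: alg_IP[symmetric] der_alg_I alg_P_der alg_ext_tensors[OF gU P] der_ext_tensors[OF gW glin_tens \<delta>])

text \<open>Only the obstruction is corrected actively. The estimate on \<open>d d\<close> is
  carried along because it bounds the error in showing that the leading obstruction is a
  \<open>\<delta>\<close>-cycle; the leading part of \<open>d d\<close> itself is shown to vanish in
  the same step.\<close>

definition "transfer_stage N \<longleftrightarrow> glin U U 2 (-1) (dsums N) \<and> glin U W 1 0 (fsums N) \<and>
  (\<forall>p. \<forall>x\<in>carrier (U p). fsums N p x - I p x \<in> tfil W 2 p \<and>
    obstr W D (dsums N) (fsums N) p x \<in> tfil W (N + 2) (p - 1) \<and>
    der U (dsums N) (dsums N p x) \<in> tfil U (N + 2) (p - 2))"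

lemma transfer_stage_0: "transfer_stage 0"
proof -
  have "der W D (I p x) \<in> tfil W 2 (p - 1)" if "x \<in> carrier (U p)" for p x
    using der_D_leading[OF glinD(1)[OF I that]] \<delta>I[OF that] by (simp add: numeral_2_eq_2)
  then show ?thesis using I by (auto simp: transfer_stage_def obstr_def glin_0 tspan_0 numeral_2_eq_2)
qed

lemma glin_lead_obstr:
  assumes "transfer_stage N"
  shows "glin U W (N + 2) (-1) (lead_obstr N)"
    and "x \<in> carrier (U p) \<Longrightarrow> lead_obstr N p x \<in> tensor_power W (N + 2) (p - 1)"
proof -
  have d: "glin U U 1 (-1) (dsums N)" and F: "glin U W 1 0 (fsums N)"
    using assms glin_mono[of U U 2 "-1" _ 1] by (auto simp: transfer_stage_def)
  have "glin U W 1 (-1) (obstr W D (dsums N) (fsums N))"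
    unfolding obstr_def[abs_def]
    by (intro glin_diff glin_op[OF d, of "alg_ext W (fsums N)"] glin_op[OF F, of "der W D"] lin_ext_add lin_ext_scale
       alg_ext_tfil[OF gW F] der_ext_tfil[OF gW glin_tens D]) auto
  then have "glin U W (N + 2) (-1) (\<lambda>p x. len_part W (N + 2) (obstr W D (dsums N) (fsums N) p x))"
    by (rule glin_op)
     (auto simp: len_part_add len_part_scale intro!: tensor_power_tfil[OF len_part_tensor_power])
  then show "glin U W (N + 2) (-1) (lead_obstr N)" by (simp add: lead_obstr_def[abs_def])
  show "x \<in> carrier (U p) \<Longrightarrow> lead_obstr N p x \<in> tensor_power W (N + 2) (p - 1)"
    using assms unfolding transfer_stage_def lead_obstr_def by (blast intro: len_part_tensor_power)
qed

text \<open>With \<open>o\<close> the leading obstruction and \<open>q\<close> the leading part of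
  \<open>d d\<close>, the leading terms of \<open>D D F = 0\<close> give
  \<open>\<delta> o + I q = 0\<close>. Projecting to homology kills the boundary and returns
  \<open>q\<close>, so \<open>q = 0\<close> and \<open>o\<close> is a cycle. The homotopy then
  writes \<open>o\<close> as \<open>I P o\<close> minus a boundary, and the new components of
  \<open>d\<close> and \<open>F\<close> absorb these two terms.\<close>

lemma transfer_stage_Suc:
  assumes transfer_stage: "transfer_stage N"
  shows "transfer_stage (Suc N)"
proof -
  define L where "L = N + 2"
  let ?d = "dsums N" and ?F = "fsums N" and ?d' = "dsums (Suc N)" and ?F' = "fsums (Suc N)"
  have d: "glin U U 2 (-1) ?d" and F: "glin U W 1 0 ?F"
    and FI: "\<And>p x. x \<in> carrier (U p) \<Longrightarrow> ?F p x - I p x \<in> tfil W 2 p"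
    and e: "\<And>p x. x \<in> carrier (U p) \<Longrightarrow> obstr W D ?d ?F p x \<in> tfil W L (p - 1)"
    and dd: "\<And>p x. x \<in> carrier (U p) \<Longrightarrow> der U ?d (?d p x) \<in> tfil U L (p - 2)"
    using transfer_stage unfolding transfer_stage_def L_def by auto
  note d1 = glin_mono[OF d, of 1, simplified]
  note lead_obstr = glin_lead_obstr[OF transfer_stage, folded L_def]
  have step: "len_part U L (der U ?d (?d p x)) = 0 \<and> der W \<delta> (lead_obstr N p x) = 0" if x: "x \<in> carrier (U p)" for p x
  proof -
    let ?e = "obstr W D ?d ?F p x" and ?o = "lead_obstr N p x" and ?dd = "der U ?d (?d p x)"
    let ?q = "len_part U L ?dd"
    have o: "?o = len_part W L ?e" by (simp add: lead_obstr_def L_def)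
    have "der W D ?e = - der W D (alg_ext W ?F (?d p x))"
      unfolding obstr_def lin_ext_diff using der_der[OF gW D DD glinD(2)[OF F x]] by simp
    \<comment> \<open>\<open>?d p x\<close> starts in length 2, so a defect of length at least
      \<open>L\<close> on generators becomes one of length at least \<open>L + 1\<close>
      here.\<close>
    moreover have "der W D (alg_ext W ?F (?d p x)) - alg_ext W ?F ?dd \<in> tfil W (Suc L) (p - 1 - 1)"
      by (rule defect_tfil[OF gU gW F d D, where L = L and n = 2])
        (use e[unfolded obstr_def] glinD(1)[OF d x] in auto)
    ultimately have 1: "der W D ?e + alg_ext W ?F ?dd \<in> tfil W (Suc L) (p - 2)"
      using tspan_neg[of "der W D (alg_ext W ?F (?d p x)) - alg_ext W ?F ?dd" W] by simp
    have "?e - ?o \<in> tfil W (Suc L) (p - 1)" unfolding o by (rule len_part_rest[OF e[OF x]])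
    then have 2: "der W D ?e - der W D ?o \<in> tfil W (Suc L) (p - 2)"
      unfolding lin_ext_diff[symmetric] by (rule der_ext_tfil[OF gW glin_tens D]) auto
    have 3: "der W D ?o - der W \<delta> ?o \<in> tfil W (Suc L) (p - 2)"
      using der_D_leading[OF tensor_power_tfil[OF lead_obstr(2)[OF x] order_refl]] by simp
    have 4: "alg_ext W ?F ?dd - alg_ext W I ?dd \<in> tfil W (Suc L) (p - 2)"
      by (rule alg_ext_diff_tfil[OF gW I F FI dd[OF x]]) auto
    have 5: "alg_ext W I ?dd - alg_ext W I ?q \<in> tfil W (Suc L) (p - 2)"
      unfolding lin_ext_diff[symmetric] by (rule alg_ext_tfil[OF gW I len_part_rest[OF dd[OF x]]])
    have "der W \<delta> ?o + alg_ext W I ?q =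
      (der W D ?e + alg_ext W ?F ?dd) - (der W D ?e - der W D ?o) - (der W D ?o - der W \<delta> ?o)
       - (alg_ext W ?F ?dd - alg_ext W I ?dd) - (alg_ext W I ?dd - alg_ext W I ?q)"
      by (simp add: algebra_simps)
    also have "\<dots> \<in> tfil W (Suc L) (p - 2)"
      by (intro tspan_diff 1 2 3 4 5)
    finally have f: "der W \<delta> ?o + alg_ext W I ?q \<in> tfil W (Suc L) (p - 2)" .
    have q: "?q \<in> tensor_power U L (p - 2)" by (rule len_part_tensor_power[OF dd[OF x]])
    have "der W \<delta> ?o \<in> tensor_power W L (p - 2)"
      by (rule der_ext_tensor_power[OF gW glin_tens \<delta> _ _ lead_obstr(2)[OF x], where k = 1])
        (use \<delta>1 in \<open>auto intro: tens_tensor_power\<close>)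
    moreover have "alg_ext W I ?q \<in> tensor_power W L (p - 2)"
      using tensor_power_alg_ext[OF gW I I1 q] by simp
    \<comment> \<open>The left-hand side has exact length \<open>L\<close> but lies in filtration
      \<open>L + 1\<close>.\<close>
    ultimately have z: "der W \<delta> ?o + alg_ext W I ?q = 0"
      by (intro tensor_power_tfil_0[OF _ f] tensor_power_intros(2))
    \<comment> \<open>\<open>P\<close> kills boundaries and is a left inverse of \<open>I\<close>,
      on tensors just as on letters.\<close>
    have "alg_ext U P (der W \<delta> ?o + alg_ext W I ?q) = ?q"
      unfolding lin_ext_add using tensor_power_tensors[OF q] tensor_power_tensors[OF lead_obstr(2)[OF x]] by (simp add: alg_P_der alg_PI)
    with z have "?q = 0" by simp
    with z show ?thesis by simp
  qed
  let ?\<eta> = "\<lambda>p x. der_ext W IP h (lead_obstr N p x)" and ?\<theta> = "\<lambda>p x. alg_ext U P (lead_obstr N p x)"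
  have \<theta>: "glin U U L (-1) ?\<theta>"
    by (rule glin_op[OF lead_obstr(1)]) (auto simp: lin_ext_add lin_ext_scale intro: alg_ext_tfil[OF gU P])
  have \<eta>: "glin U W L 0 ?\<eta>"
    by (rule glin_op[OF lead_obstr(1)]) (auto simp: lin_ext_add lin_ext_scale intro: der_ext_tfil[OF gW IP h])
  have L2: "2 \<le> L" by (simp add: L_def)
  have d': "glin U U 2 (-1) ?d'" unfolding dsums_Suc by (rule glin_add[OF d glin_mono[OF \<theta> L2]])
  have F': "glin U W 1 0 ?F'" unfolding fsums_Suc by (rule glin_add[OF F glin_mono[OF \<eta>]]) (use L2 in simp)
  have F'I: "?F' p x - I p x \<in> tfil W 2 p" if x: "x \<in> carrier (U p)" for p x
  proof -
    have "(?F p x - I p x) + ?\<eta> p x \<in> tfil W 2 p"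
      using glinD(1)[OF glin_mono[OF \<eta> L2] x] by (intro tspan_add FI x) simp
    then show ?thesis by (simp add: fsums_Suc algebra_simps)
  qed
  have e': "obstr W D ?d' ?F' p x \<in> tfil W (Suc L) (p - 1)" if x: "x \<in> carrier (U p)" for p x
  proof -
    let ?e = "obstr W D ?d ?F p x" and ?o = "lead_obstr N p x"
    have o: "?o \<in> tensors W" by (rule tensor_power_tensors[OF lead_obstr(2)[OF x]])
    have \<theta>x: "?\<theta> p x \<in> tfil U L (p - 1)" using glinD(1)[OF \<theta> x] by simp
    have 1: "?e - ?o \<in> tfil W (Suc L) (p - 1)"
      unfolding lead_obstr_def L_def[symmetric] by (rule len_part_rest[OF e[OF x]])
    have 2: "der W D (?\<eta> p x) - der W \<delta> (?\<eta> p x) \<in> tfil W (Suc L) (p - 1)"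
      using der_D_leading[OF glinD(1)[OF \<eta> x]] by simp
    have 3: "alg_ext W ?F' (?d p x) - alg_ext W ?F (?d p x) \<in> tfil W (Suc L) (p - 1)"
      by (rule alg_ext_diff_tfil[OF gW F F', where L = L and n = 2])
        (use glinD(1)[OF \<eta>] glinD(1)[OF d x] in \<open>auto simp: fsums_Suc\<close>)
    have 4: "alg_ext W ?F' (?\<theta> p x) - alg_ext W I (?\<theta> p x) \<in> tfil W (Suc L) (p - 1)"
      by (rule alg_ext_diff_tfil[OF gW I F' F'I \<theta>x]) auto
    \<comment> \<open>As \<open>?o\<close> is a cycle, the homotopy identity loses its second
      term.\<close>
    have h: "der W \<delta> (?\<eta> p x) = alg_ext W I (?\<theta> p x) - ?o"
      using homotopy_lin_ext[OF gW \<delta> h IP der_IP IP_der homotopy o] step[OF x]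
      by (simp add: alg_IP[OF o])
    \<comment> \<open>The boundary of \<open>?\<eta> p x\<close> cancels \<open>?o\<close> against
      the \<open>I\<close>-image of the new operation; the four differences left over all have
      length above \<open>L\<close>.\<close>
    have "obstr W D ?d' ?F' p x = (?e - ?o) + (der W D (?\<eta> p x) - der W \<delta> (?\<eta> p x))
        - (alg_ext W ?F' (?d p x) - alg_ext W ?F (?d p x)) - (alg_ext W ?F' (?\<theta> p x) - alg_ext W I (?\<theta> p x))"
    proof -
      have "obstr W D ?d' ?F' p x = der W D (?F p x) + der W D (?\<eta> p x) - alg_ext W ?F' (?d p x) - alg_ext W ?F' (?\<theta> p x)"
        unfolding obstr_def by (simp only: dsums_Suc) (simp only: fsums_Suc lin_ext_add, simp add: algebra_simps)
      then show ?thesis unfolding h by (simp add: obstr_def algebra_simps)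
    qed
    then show ?thesis by (simp only:) (intro tspan_diff tspan_add 1 2 3 4)
  qed
  have dd': "der U ?d' (?d' p x) \<in> tfil U (Suc L) (p - 2)" if x: "x \<in> carrier (U p)" for p x
  proof -
    have s: "der U ?d' T = der U ?d T + der U ?\<theta> T" if "T \<in> tensors U" for T
      unfolding dsums_Suc by (rule der_ext_add[OF gU glin_tens d \<theta> d'[unfolded dsums_Suc] that])
    have \<theta>x: "?\<theta> p x \<in> tfil U L (p - 1)" using glinD(1)[OF \<theta> x] by simp
    have dx: "?d p x \<in> tfil U 2 (p - 1)" using glinD(1)[OF d x] by simp
    have "der U ?d' (?d' p x) = der U ?d (?d p x) + der U ?d (?\<theta> p x) + der U ?\<theta> (?d p x) + der U ?\<theta> (?\<theta> p x)"
      by (subst s[OF glinD(2)[OF d' x]]) (simp add: dsums_Suc lin_ext_add algebra_simps)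
    \<comment> \<open>The leading part of this term has just been shown to vanish. The other three
      terms are long because \<open>?d\<close> starts in length 2 and \<open>?\<theta>\<close> in
      length \<open>L\<close>.\<close>
    moreover have "der U ?d (?d p x) \<in> tfil U (Suc L) (p - 2)"
      using len_part_rest[OF dd[OF x]] step[OF x] by simp
    moreover have "der U ?d (?\<theta> p x) \<in> tfil U (Suc L) (p - 2)"
      by (rule der_ext_tfil[OF gU glin_tens d \<theta>x]) auto
    moreover have "der U ?\<theta> (?d p x) \<in> tfil U (Suc L) (p - 2)"
      by (rule der_ext_tfil[OF gU glin_tens \<theta> dx]) auto
    moreover have "der U ?\<theta> (?\<theta> p x) \<in> tfil U (Suc L) (p - 2)"
      by (rule der_ext_tfil[OF gU glin_tens \<theta> \<theta>x]) (use L2 in auto)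
    ultimately show ?thesis by (auto intro!: tspan_add)
  qed
  show ?thesis unfolding transfer_stage_def using d' F' F'I e' dd' by (simp add: L_def)
qed

lemma transfer_stage: "transfer_stage N"
  by (induction N) (auto intro: transfer_stage_0 transfer_stage_Suc)

end

lemma tprod_sum_right:
  assumes "graded_vector_space V" "S \<in> tensors V" "\<And>i. i \<in> A \<Longrightarrow> f i \<in> tensors V"
  shows "tprod V S (\<Sum>i\<in>A. f i) = (\<Sum>i\<in>A. tprod V S (f i))"
  using assms(3) by (induction A rule: infinite_finite_induct)
    (auto simp: assms(2) tprod_add_right[OF assms(1,2)] tspan_sum)

lemma tprod_sum_left: "tprod V (\<Sum>i\<in>A. f i) T = (\<Sum>i\<in>A. tprod V (f i) T)"
  by (induction A rule: infinite_finite_induct) (auto simp: tprod_add_left)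

lemma tensor_linear_glin:
  assumes "glin V V' L e A" "\<And>p x. x \<in> carrier (V p) \<Longrightarrow> A p x \<in> tensor_power V' n (p + e)"
  shows "tensor_linear V V' n e A"
  using assms by (auto simp: tensor_linear_def glin_def)

section \<open>Length components of the transferred differential and morphism\<close>

context contraction
begin

text \<open>The increment from stage \<open>n - 2\<close> to stage \<open>n - 1\<close> has length
  exactly \<open>n\<close>. The value 0 for \<open>n < 2\<close> is what makes the transferred
  structure minimal.\<close>

definition "dcomp n p x = (if n < 2 then 0 else dsums (n - 1) p x - dsums (n - 2) p x)"

definition "mcomp n p x = (if n = 0 then 0 else if n = 1 then I p x else fsums (n - 1) p x - fsums (n - 2) p x)"

lemma dcomp_Suc: "dcomp (Suc (Suc n)) = (\<lambda>p x. alg_ext U P (lead_obstr n p x))"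
  and mcomp_Suc: "mcomp (Suc (Suc n)) = (\<lambda>p x. der_ext W IP h (lead_obstr n p x))"
  by (auto simp: dcomp_def mcomp_def dsums_Suc fsums_Suc fun_eq_iff fun_applies)

lemma dcomp_sum: "(\<Sum>k=1..Suc N. dcomp k p x) = dsums N p x"
  and mcomp_sum: "(\<Sum>k=1..Suc N. mcomp k p x) = fsums N p x"
proof -
  show "(\<Sum>k=1..Suc N. dcomp k p x) = dsums N p x"
    by (induction N) (simp_all add: dcomp_def)
  show "(\<Sum>k=1..Suc N. mcomp k p x) = fsums N p x"
    by (induction N) (simp_all add: mcomp_def)
qed

lemma tensor_linear_dcomp: "tensor_linear U U n (-1) (dcomp n)"
proof (cases "n < 2")
  case True
  then show ?thesis by (auto simp: tensor_linear_def dcomp_def tensor_power_intros)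
next
  case False
  then obtain m where n: "n = Suc (Suc m)" using not_less_eq_eq numeral_2_eq_2 by (metis Suc_le_D less_Suc_eq_le not_less_iff_gr_or_eq)
  note lead_obstr = glin_lead_obstr[OF transfer_stage[of m]]
  have "glin U U (m + 2) (-1) (\<lambda>p x. alg_ext U P (lead_obstr m p x))"
    by (rule glin_op[OF lead_obstr(1)]) (auto simp: lin_ext_add lin_ext_scale intro: alg_ext_tfil[OF gU P])
  then show ?thesis unfolding n dcomp_Suc
    by (rule tensor_linear_glin) (use tensor_power_alg_ext[OF gU P P1 lead_obstr(2)] in auto)
qed

lemma tensor_linear_mcomp: "tensor_linear U W n 0 (mcomp n)"
proof -
  consider "n = 0" | "n = 1" | m where "n = Suc (Suc m)" by (cases n; cases "n - 1") auto
  then show ?thesis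
  proof cases
    case 1
    then show ?thesis by (auto simp: tensor_linear_def mcomp_def tensor_power_intros)
  next
    case 2
    have "mcomp 1 = I" by (simp add: mcomp_def fun_eq_iff)
    then show ?thesis unfolding 2 using tensor_linear_glin[OF I] I1 by simp
  next
    case (3 m)
    note lead_obstr = glin_lead_obstr[OF transfer_stage[of m]]
    have "glin U W (m + 2) 0 (\<lambda>p x. der_ext W IP h (lead_obstr m p x))"
      by (rule glin_op[OF lead_obstr(1)]) (auto simp: lin_ext_add lin_ext_scale intro: der_ext_tfil[OF gW IP h])
    then show ?thesis unfolding 3 mcomp_Suc
      by (rule tensor_linear_glin) (auto intro!: der_ext_tensor_power[OF gW IP h IP1 h1 lead_obstr(2)])
  qed
qed

text \<open>The first \<open>M\<close> components form stage \<open>M - 1\<close>, whose filtration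
  bound is exactly \<open>Suc M\<close>: enough for all identities of length at most
  \<open>M\<close>.\<close>

lemma transfer_square_zero:
  assumes "1 \<le> M" "x \<in> carrier (U p)"
  shows "der U (\<lambda>p x. \<Sum>k=1..M. dcomp k p x) (\<Sum>k=1..M. dcomp k p x) \<in> tfil U (Suc M) (p - 2)"
proof -
  obtain N where M: "M = Suc N" using assms by (cases M) auto
  show ?thesis using transfer_stage[of N] assms unfolding M dcomp_sum by (auto simp: transfer_stage_def)
qed

lemma transfer_morphism:
  assumes "1 \<le> M" "x \<in> carrier (U p)"
  shows "der W D (\<Sum>k=1..M. mcomp k p x) -
    alg_ext W (\<lambda>p x. \<Sum>k=1..M. mcomp k p x) (\<Sum>k=1..M. dcomp k p x) \<in> tfil W (Suc M) (p - 1)"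
proof -
  obtain N where M: "M = Suc N" using assms by (cases M) auto
  show ?thesis using transfer_stage[of N] assms unfolding M dcomp_sum mcomp_sum by (auto simp: transfer_stage_def obstr_def)
qed

end

section \<open>Naturality of the transfer in the contraction\<close>

lemma alg_ext_square:
  assumes gs: "graded_vector_space V'" "graded_vector_space W" "graded_vector_space W'"
    and F: "glin V W 1 0 F" and F': "glin V' W' 1 0 F'"
    and f: "glin V V' 1 0 (\<lambda>p x. tens V' [(p, f p x)])" and j: "glin W W' 1 0 j"
    and fc: "\<And>p x. x \<in> carrier (V p) \<Longrightarrow> f p x \<in> carrier (V' p)"
    and sq: "\<And>p x. x \<in> carrier (V p) \<Longrightarrow> alg_ext W' j (F p x) = F' p (f p x)" and T: "T \<in> tensors V"
  shows "alg_ext W' j (alg_ext W F T) = alg_ext W' F' (alg_ext V' (\<lambda>p x. tens V' [(p, f p x)]) T)"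
proof -
  have "alg_ext W' j (alg_ext W F T) = alg_ext W' (\<lambda>p x. alg_ext W' j (F p x)) T"
    by (rule alg_ext_comp(2)[OF gs(2,3) F j T])
  also have "\<dots> = alg_ext W' (\<lambda>p x. alg_ext W' F' (tens V' [(p, f p x)])) T"
    by (rule alg_ext_cong[OF gs(3) alg_ext_comp(1)[OF gs(2,3) F j] alg_ext_comp(1)[OF gs(1,3) f F'] _ T])
     (simp add: sq alg_ext_gen[OF gs(3) F'] fc)
  also have "\<dots> = alg_ext W' F' (alg_ext V' (\<lambda>p x. tens V' [(p, f p x)]) T)"
    by (rule alg_ext_comp(2)[OF gs(1,3) f F' T, symmetric])
  finally show ?thesis .
qed

text \<open>\<open>f\<close> and \<open>j\<close> send letters to letters. Maps with higher
  components would not respect lengths, whereas the recursion selects leading terms by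
  length.\<close>

locale contraction_map = A: contraction U W D \<delta> I P h + B: contraction U' W' D' \<delta>' I' P' h'
  for U :: "'h gvs" and W :: "'c gvs" and D \<delta> I P h
    and U' :: "'h1 gvs" and W' :: "'c1 gvs" and D' \<delta>' I' P' h' +
  fixes f :: "int \<Rightarrow> 'h \<Rightarrow> 'h1" and j :: "int \<Rightarrow> 'c \<Rightarrow> 'c1"
  assumes f: "glin U U' 1 0 (\<lambda>p x. tens U' [(p, f p x)])" and fc: "\<And>p x. x \<in> carrier (U p) \<Longrightarrow> f p x \<in> carrier (U' p)"
    and j: "glin W W' 1 0 (\<lambda>p x. tens W' [(p, j p x)])" and jc: "\<And>p x. x \<in> carrier (W p) \<Longrightarrow> j p x \<in> carrier (W' p)"
    and jD: "\<And>p x. x \<in> carrier (W p) \<Longrightarrow> alg_ext W' (\<lambda>p x. tens W' [(p, j p x)]) (D p x) = D' p (j p x)"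
    and jh: "\<And>p x. x \<in> carrier (W p) \<Longrightarrow> alg_ext W' (\<lambda>p x. tens W' [(p, j p x)]) (h p x) = h' p (j p x)"
    and jI: "\<And>p x. x \<in> carrier (U p) \<Longrightarrow> alg_ext W' (\<lambda>p x. tens W' [(p, j p x)]) (I p x) = I' p (f p x)"
    and fP: "\<And>p x. x \<in> carrier (W p) \<Longrightarrow> alg_ext U' (\<lambda>p x. tens U' [(p, f p x)]) (P p x) = P' p (j p x)"
begin

abbreviation "fh \<equiv> \<lambda>p x. tens U' [(p, f p x)]"

abbreviation "jh' \<equiv> \<lambda>p x. tens W' [(p, j p x)]"

lemma j1: "x \<in> carrier (W p) \<Longrightarrow> jh' p x \<in> tensor_power W' 1 p"
  by (rule tens_tensor_power) (auto simp: jc)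

text \<open>Each ingredient of the recursion, namely the derivation by \<open>D\<close>, the algebra
  maps, the choice of a length component, \<open>P\<close> and the tensor homotopy, commutes with
  letterwise maps. Both sequences are treated together because each stage uses the previous
  differential and the previous map.\<close>

lemma transfer_natural:
  assumes "x \<in> carrier (U p)"
  shows "alg_ext U' fh (A.dsums N p x) = B.dsums N p (f p x) \<and> alg_ext W' jh' (A.fsums N p x) = B.fsums N p (f p x)"
  using assms
proof (induction N arbitrary: p x)
  case 0
  then show ?case by (simp add: jI)
next
  case (Suc N)
  note sA = A.transfer_stage[of N, unfolded A.transfer_stage_def] and sB = B.transfer_stage[of N, unfolded B.transfer_stage_def]
  have dA: "glin U U 2 (-1) (A.dsums N)" and fA: "glin U W 1 0 (A.fsums N)" and fB: "glin U' W' 1 0 (B.fsums N)"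
    using sA sB by auto
  note x = Suc.prems
  have dx: "A.dsums N p x \<in> tensors U" and fx: "A.fsums N p x \<in> tensors W"
    using glinD(2)[OF dA x] glinD(2)[OF fA x] by auto
  have 1: "alg_ext W' jh' (der W D (A.fsums N p x)) = der W' D' (alg_ext W' jh' (A.fsums N p x))"
    by (rule alg_ext_der_ext[OF A.gW B.gW j jc glin_tens A.D glin_tens B.D jD _ fx])
      (simp_all add: alg_ext_gen[OF B.gW j])
  \<comment> \<open>The algebra map applies the previous stage to every letter of
    \<open>A.dsums N p x\<close>; this is why the induction runs over all generators at
    once.\<close>
  have 2: "alg_ext W' jh' (alg_ext W (A.fsums N) (A.dsums N p x)) = alg_ext W' (B.fsums N) (alg_ext U' fh (A.dsums N p x))"
    by (rule alg_ext_square[OF B.gU A.gW B.gW fA fB f j fc _ dx]) (simp_all add: Suc.IH)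
  have obx: "A.lead_obstr N p x \<in> tensors W" using glinD(2)[OF A.glin_lead_obstr(1)[OF A.transfer_stage] x] .
  have o: "alg_ext W' jh' (A.lead_obstr N p x) = B.lead_obstr N p (f p x)"
    unfolding A.lead_obstr_def B.lead_obstr_def obstr_def
    by (subst alg_ext_len_part[OF B.gW j j1])
      (simp_all add: x Suc.IH lin_ext_diff 1 2 fx dx tspan_diff der_ext_tensors[OF A.gW glin_tens A.D] alg_ext_tensors[OF A.gW fA])
  have 3: "alg_ext U' fh (alg_ext U P T) = alg_ext U' P' (alg_ext W' jh' T)" if "T \<in> tensors W" for T
    by (rule alg_ext_square[OF B.gW A.gU B.gU A.P B.P j f jc fP that])
  have 4: "alg_ext W' jh' (alg_ext W I T) = alg_ext W' I' (alg_ext U' fh T)" if "T \<in> tensors U" for T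
    by (rule alg_ext_square[OF B.gU A.gW B.gW A.I B.I f j fc jI that])
  have 5: "alg_ext W' jh' (der_ext W A.IP h (A.lead_obstr N p x)) = der_ext W' B.IP h' (alg_ext W' jh' (A.lead_obstr N p x))"
    by (rule alg_ext_der_ext[OF A.gW B.gW j jc A.IP A.h B.IP B.h jh _ obx]) (simp_all add: 4 fP glinD[OF A.P])
  show ?case using Suc.IH[OF x] by (simp add: A.dsums_Suc B.dsums_Suc A.fsums_Suc B.fsums_Suc lin_ext_add 3[OF obx] 5 o)
qed

lemma dcomp_natural: "x \<in> carrier (U p) \<Longrightarrow> alg_ext U' fh (A.dcomp n p x) = B.dcomp n p (f p x)"
  by (simp add: A.dcomp_def B.dcomp_def lin_ext_diff transfer_natural)

end

subsection \<open>The operators of the cobar construction\<close>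

lemma map_tensor_lin_ext: "map_tensor W gs = lin_ext (tensor_of_maps W gs)"
  by (simp add: map_tensor_def lin_ext_def fun_eq_iff)

lemma tensor_of_maps_tensors:
  "graded_vector_space W \<Longrightarrow> \<forall>(d, g)\<in>set gs. glin V W 0 d g \<Longrightarrow> xs \<in> hom_lists V \<Longrightarrow> tensor_of_maps W gs xs \<in> tensors W"
  by (induction W gs xs rule: tensor_of_maps.induct)
    (auto intro!: tspan_scale tprod_tensors tspan_0 dest: glinD(2))

lemma word_linear_tensor_of_maps:
  assumes gW: "graded_vector_space W" and gs: "\<forall>(d, g)\<in>set gs. glin V W 0 d g"
  shows "word_linear V (tensor_of_maps W gs)"
proof -
  have "(\<forall>y\<in>carrier (V p). tensor_of_maps W gs (us @ (p, x \<oplus>\<^bsub>V p\<^esub> y) # vs) =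
      tensor_of_maps W gs (us @ (p, x) # vs) + tensor_of_maps W gs (us @ (p, y) # vs)) \<and>
    (\<forall>c. tensor_of_maps W gs (us @ (p, c \<odot>\<^bsub>V p\<^esub> x) # vs) = tscale c (tensor_of_maps W gs (us @ (p, x) # vs)))"
    if "us \<in> hom_lists V" "vs \<in> hom_lists V" "x \<in> carrier (V p)" for us vs p x
    using that(1) gs
  proof (induction us arbitrary: gs)
    case Nil
    show ?case
    proof (cases gs)
      case (Cons a gs')
      obtain d g where a: "a = (d, g)" by force
      then show ?thesis using Nil that Cons
        by (auto simp: glinD tprod_add_left tprod_scale_left tn.scale_right_distrib mult.commute)
    qed simp
  next
    case u: (Cons u us)
    obtain q z where u': "u = (q, z)" by force
    show ?case
    proof (cases gs)
      case (Cons a gs')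
      obtain d g where a: "a = (d, g)" by force
      have "glin V W 0 d g" and gs': "\<forall>(d, g)\<in>set gs'. glin V W 0 d g" using u.prems Cons a by auto
      note t = tensor_of_maps_tensors[OF gW gs']
      note g = glinD(2)[OF \<open>glin V W 0 d g\<close>, of z q]
      have us: "us \<in> hom_lists V" "z \<in> carrier (V q)" using u.prems u' by auto
      show ?thesis using u.IH[OF us(1) gs'] us g that
        by (simp add: u' Cons a t tprod_add_right[OF gW] tprod_scale_right[OF gW] tn.scale_right_distrib mult.commute)
    qed (simp add: u')
  qed
  then show ?thesis unfolding word_linear_iff by blast
qed

lemma tensor_of_maps_id:
  assumes "graded_vector_space W"
  shows "xs \<in> hom_lists W \<Longrightarrow> length xs = n \<Longrightarrow> tensor_of_maps W (replicate n (id_map W)) xs = tens W xs"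
proof (induction xs arbitrary: n)
  case (Cons u xs)
  obtain p x where "u = (p, x)" by force
  with Cons show ?case
    by (cases n) (auto simp: id_map_def sum_list_replicate tprod_tens[OF assms])
qed simp

lemma glin_id_map: "glin W W 0 (fst (id_map W)) (snd (id_map W))"
  using glin_mono[OF glin_tens, of 0] by (simp add: id_map_def)

text \<open>Splitting off the first letter: for \<open>a = 0\<close> it is hit by \<open>g\<close>;
  otherwise a string of maps of total degree -1 moves past it, which gives the sign
  \<open>ksign p\<close> of the recursion.\<close>

lemma der_word_tensor_of_maps:
  assumes gW: "graded_vector_space W" and g: "glin W W L (-1) g"
  shows "xs \<in> hom_lists W \<Longrightarrow> length xs = n \<Longrightarrow>
    (\<Sum>a<n. tensor_of_maps W (replicate a (id_map W) @ [(-1, g)] @ replicate (n - 1 - a) (id_map W)) xs) =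
    der_word W (letter W) g xs"
proof (induction xs arbitrary: n)
  case Nil
  then show ?case by simp
next
  case (Cons u xs)
  obtain p x where u: "u = (p, x)" by force
  have x: "x \<in> carrier (W p)" "xs \<in> hom_lists W" using Cons.prems u by auto
  let ?m = "length xs"
  let ?G = "\<lambda>a. replicate a (id_map W) @ [(-1, g)] @ replicate (?m - 1 - a) (id_map W)"
  have G: "\<forall>(d, h)\<in>set (?G a). glin W W 0 d h" for a
    using glin_mono[OF g, of 0] glin_id_map[of W] by (auto simp: case_prod_unfold)
  have deg: "sum_list (map fst (?G a)) = -1" for a
    by (simp add: id_map_def sum_list_replicate)
  have s: "(\<Sum>a\<in>A. tprod W (tens W [(p, x)]) (tensor_of_maps W (?G a) xs)) =
     tprod W (tens W [(p, x)]) (\<Sum>a\<in>A. tensor_of_maps W (?G a) xs)" for A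
    by (rule tprod_sum_right[OF gW, symmetric]) (simp add: x, rule tensor_of_maps_tensors[OF gW G x(2)])
  have n: "n = Suc ?m" using Cons.prems by simp
  have "(\<Sum>a<n. tensor_of_maps W (replicate a (id_map W) @ [(-1, g)] @ replicate (n - 1 - a) (id_map W)) (u # xs)) =
    tprod W (g p x) (tens W xs) + (\<Sum>a<?m. tscale (ksign p) (tprod W (tens W [(p, x)]) (tensor_of_maps W (?G a) xs)))"
    unfolding n sum.lessThan_Suc_shift
    using tensor_of_maps_id[OF gW x(2) refl] by (simp add: u id_map_def sum_list_replicate)
  also have "\<dots> = der_word W (letter W) g (u # xs)"
    unfolding tn.scale_sum_right[symmetric] s Cons.IH[OF x(2) refl] by (simp add: u alg_word_letter[OF gW x(2)])
  finally show ?case .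
qed

lemma der_map_tensor:
  assumes gW: "graded_vector_space W" and g: "glin W W L (-1) g" and T: "T \<in> tensor_power W n p"
  shows "(\<Sum>a<n. map_tensor W (replicate a (id_map W) @ [(-1, g)] @ replicate (n - 1 - a) (id_map W)) T) = der W g T"
proof -
  let ?G = "\<lambda>a. replicate a (id_map W) @ [(-1, g)] @ replicate (n - 1 - a) (id_map W)"
  have G: "\<forall>(d, h)\<in>set (?G a). glin W W 0 d h" for a
    using glin_mono[OF g, of 0] glin_id_map[of W] by (auto simp: case_prod_unfold)
  note wl = word_linear_tensor_of_maps[OF gW G]
  have "(\<Sum>a<n. lin_ext (tensor_of_maps W (?G a)) T) = der W g T"
    using T unfolding tensor_power_tspan
  proof (induction rule: tspan_induct)
    case (tens xs)
    then show ?case using der_word_tensor_of_maps[OF gW g, of xs n]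
      by (simp add: lin_ext_tens[OF wl, simplified] der_ext_tens[OF gW glin_tens g])
  qed (simp_all add: lin_ext_add lin_ext_scale sum.distrib tn.scale_sum_right[symmetric])
  then show ?thesis by (simp add: map_tensor_lin_ext)
qed

lemma der_0: "graded_vector_space W \<Longrightarrow> T \<in> tensors W \<Longrightarrow> der W (\<lambda>p x. 0) T = 0"
proof -
  assume gW: "graded_vector_space W" and T: "T \<in> tensors W"
  have "xs \<in> hom_lists W \<Longrightarrow> der_word W (letter W) (\<lambda>p x. 0) xs = 0" for xs
    by (induction xs) auto
  note w = this
  show ?thesis using T
    by (induction rule: tspan_induct) (auto simp: w lin_ext_add lin_ext_scale der_ext_tens[OF gW glin_tens glin_0])
qed

lemma der_sum:
  assumes gW: "graded_vector_space W" and d: "\<And>k. k \<in> A \<Longrightarrow> glin W W L e (d k)" and T: "T \<in> tensors W"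
  shows "der W (\<lambda>p x. \<Sum>k\<in>A. d k p x) T = (\<Sum>k\<in>A. der W (d k) T)"
  using d
proof (induction A rule: infinite_finite_induct)
  case (insert k F)
  have 1: "glin W W L e (d k)" "glin W W L e (\<lambda>p x. \<Sum>k\<in>F. d k p x)"
    using insert by (auto intro: glin_sum)
  show ?case using insert der_ext_add[OF gW glin_tens 1 glin_add[OF 1] T] by simp
qed (auto simp: der_0[OF gW T])

text \<open>On words of length \<open>l\<close> the component \<open>d k\<close> produces length
  \<open>l + k - 1\<close>, so length \<open>n\<close> comes from \<open>k = n - l + 1\<close>
  alone. This is the indexing of \<open>cobar_differential\<close>, and the cutoff \<open>M\<close>
  is invisible for \<open>n \<le> M\<close>.\<close>

lemma len_part_der:
  assumes gW: "graded_vector_space W" and d: "\<And>k. 1 \<le> k \<Longrightarrow> k \<le> M \<Longrightarrow> tensor_linear W W k (-1) (d k)"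
    and T: "T \<in> tensors W" and n: "n \<le> M"
  shows "len_part W n (der W (\<lambda>p x. \<Sum>k=1..M. d k p x) T) = (\<Sum>l=1..n. der W (d (n - l + 1)) (len_part W l T))"
  using T
proof (induction rule: tspan_induct)
  case (tens xs)
  have g: "glin W W 1 (-1) (d k)" if "1 \<le> k" "k \<le> M" for k
    by (rule glin_tensor_linear[OF d[OF that]]) (use that in simp)
  have l: "len_part W n (der_word W (letter W) (d k) xs) = (if n + 1 = length xs + k then der_word W (letter W) (d k) xs else 0)"
    if "1 \<le> k" "k \<le> M" for k
  proof (cases xs)
    case (Cons a ys)
    have "der_word W (letter W) (d k) xs \<in> tensor_power W (length xs + k - 1) (deg xs + (-1))"
      by (rule der_word_tensor_power[OF gW, where k = k])
        (use d[OF that] tens that Cons in \<open>auto simp: tensor_linear_def intro: tens_tensor_power\<close>)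
    then show ?thesis using Cons that by (auto simp: len_part_same)
  qed simp
  have ds: "der W (\<lambda>p x. \<Sum>k=1..M. d k p x) (tens W xs) = (\<Sum>k=1..M. der W (d k) (tens W xs))"
    by (rule der_sum[OF gW, where L = 1 and e = "-1"]) (use g tens in auto)
  have "len_part W n (der W (\<lambda>p x. \<Sum>k=1..M. d k p x) (tens W xs)) =
    (\<Sum>k=1..M. if k = n + 1 - length xs \<and> length xs \<le> n then der_word W (letter W) (d k) xs else 0)"
    unfolding ds len_part_sum
    by (rule sum.cong) (auto simp: der_ext_tens[OF gW glin_tens g] l)
  also have "\<dots> = (if 1 \<le> length xs \<and> length xs \<le> n then der_word W (letter W) (d (n + 1 - length xs)) xs else 0)"
  proof (cases "1 \<le> length xs \<and> length xs \<le> n")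
    case True
    then have "n + 1 - length xs \<in> {1..M}" using n by auto
    then show ?thesis using True by (simp add: sum.delta)
  next
    case False
    \<comment> \<open>The empty word would ask for the index \<open>n + 1\<close>, which may exceed
      \<open>M\<close>, but a derivation vanishes on it.\<close>
    then consider "xs = []" | "length xs > n" by (cases xs) auto
    then show ?thesis by cases auto
  qed
  also have "\<dots> = (\<Sum>l=1..n. der W (d (n - l + 1)) (len_part W l (tens W xs)))"
  proof -
    have "(\<Sum>l=1..n. der W (d (n - l + 1)) (len_part W l (tens W xs))) =
      (\<Sum>l=1..n. if l = length xs then der_word W (letter W) (d (n + 1 - length xs)) xs else 0)"
      by (rule sum.cong) (use n in \<open>auto simp: len_part_tens der_ext_tens[OF gW glin_tens g] Suc_diff_le\<close>)
    then show ?thesis by (auto simp: sum.delta)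
  qed
  finally show ?case .
qed (simp_all add: lin_ext_add lin_ext_scale len_part_add len_part_scale sum.distrib tn.scale_sum_right[symmetric])

lemma len_part_tprod:
  assumes gW: "graded_vector_space W" and S: "S \<in> tensor_power W k p" and T: "T \<in> tensors W"
  shows "len_part W m (tprod W S T) = (if k \<le> m then tprod W S (len_part W (m - k) T) else 0)"
  using S unfolding tensor_power_tspan
proof (induction rule: tspan_induct)
  case (tens xs)
  note xs = tens
  have l: "len_part W i S \<in> tensors W" if "S \<in> tensors W" for S i
    unfolding len_part_def by (rule lin_ext_tspan[OF word_linear_len_part that]) (auto intro: tspan_0)
  show ?case using T
    by (induction rule: tspan_induct)
      (use xs in \<open>auto simp: len_part_tens tprod_tens[OF gW] tprod_add_right[OF gW] tprod_scale_right[OF gW] len_part_add len_part_scale l\<close>)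
qed (auto simp: len_part_add len_part_scale tprod_add_left tprod_scale_left)

lemma lists_sum_finite: "finite {ks. length ks = n \<and> sum_list ks = m \<and> (\<forall>k\<in>set ks. (1::nat) \<le> k)}"
proof (rule finite_subset)
  show "{ks. length ks = n \<and> sum_list ks = m \<and> (\<forall>k\<in>set ks. (1::nat) \<le> k)} \<subseteq> {ks. set ks \<subseteq> {..m} \<and> length ks = n}"
    using member_le_sum_list by fastforce
  show "finite {ks. set ks \<subseteq> {..m} \<and> length ks = n}" by (rule finite_lists_length_eq) simp
qed

lemma lists_sum_Suc:
  "{ks. length ks = Suc n \<and> sum_list ks = m \<and> (\<forall>k\<in>set ks. (1::nat) \<le> k)} =
    (\<Union>k\<in>{1..m}. (#) k ` {ks. length ks = n \<and> sum_list ks = m - k \<and> (\<forall>k\<in>set ks. 1 \<le> k)})"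
  by (auto simp: length_Suc_conv image_iff)

text \<open>Expanding the product over the letters, with some \<open>f k\<close> chosen for each,
  sums over all compositions of the resulting length. A composition of \<open>m\<close> has no part
  above \<open>m\<close>, so the truncation at \<open>M\<close> loses nothing.\<close>

lemma alg_word_tensor_of_maps:
  assumes gW: "graded_vector_space W" and f: "\<And>k. 1 \<le> k \<Longrightarrow> tensor_linear V W k 0 (f k)" and M: "m \<le> M"
  shows "xs \<in> hom_lists V \<Longrightarrow> m \<le> M \<Longrightarrow>
    (\<Sum>ks | length ks = length xs \<and> sum_list ks = m \<and> (\<forall>k\<in>set ks. 1 \<le> k). tensor_of_maps W (map (\<lambda>k. (0, f k)) ks) xs) =
    len_part W m (alg_word W (\<lambda>p x. \<Sum>k=1..M. f k p x) xs)"
proof (induction xs arbitrary: m)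
  case Nil
  have "{ks. ks = [] \<and> sum_list ks = m \<and> (\<forall>k\<in>set ks. (1::nat) \<le> k)} = (if m = 0 then {[]} else {})" by auto
  then show ?case by (auto simp: len_part_tens)
next
  case (Cons u xs)
  obtain p x where u: "u = (p, x)" by force
  have x: "x \<in> carrier (V p)" "xs \<in> hom_lists V" using Cons.prems u by auto
  let ?C = "\<lambda>n m. {ks. length ks = n \<and> sum_list ks = m \<and> (\<forall>k\<in>set ks. (1::nat) \<le> k)}"
  let ?g = "map (\<lambda>k. (0, f k))" and ?F = "\<lambda>p x. \<Sum>k=1..M. f k p x"
  have f1: "1 \<le> k \<Longrightarrow> glin V W 1 0 (f k)" for k by (rule glin_tensor_linear[OF f])
  have F: "glin V W 1 0 ?F" by (rule glin_sum) (use f1 in auto)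
  have g: "\<forall>(d, h)\<in>set (?g ks). glin V W 0 d h" if "ks \<in> ?C n m" for ks n m
    using that glin_mono[OF f1] by auto
  have s: "sum_list (map fst (?g ks)) = 0" for ks by (induction ks) auto
  have fk: "f k p x \<in> tensor_power W k p" if "1 \<le> k" for k using f[OF that] x by (auto simp: tensor_linear_def)
  have "(\<Sum>ks\<in>?C (length (u # xs)) m. tensor_of_maps W (?g ks) (u # xs)) =
    (\<Sum>k=1..m. \<Sum>ks\<in>(#) k ` ?C (length xs) (m - k). tensor_of_maps W (?g ks) (u # xs))"
    unfolding length_Cons lists_sum_Suc by (rule sum.UNION_disjoint) (auto simp: lists_sum_finite[simplified])
  also have "\<dots> = (\<Sum>k=1..m. \<Sum>ks\<in>?C (length xs) (m - k). tprod W (f k p x) (tensor_of_maps W (?g ks) xs))"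
    by (rule sum.cong) (simp_all add: sum.reindex u s[simplified] o_def)
  also have "\<dots> = (\<Sum>k=1..m. tprod W (f k p x) (len_part W (m - k) (alg_word W ?F xs)))"
  proof (rule sum.cong[OF refl])
    fix k assume k: "k \<in> {1..m}"
    have "(\<Sum>ks\<in>?C (length xs) (m - k). tprod W (f k p x) (tensor_of_maps W (?g ks) xs)) =
      tprod W (f k p x) (\<Sum>ks\<in>?C (length xs) (m - k). tensor_of_maps W (?g ks) xs)"
      by (rule tprod_sum_right[OF gW, symmetric])
        (use k fk[of k] x tensor_of_maps_tensors[OF gW g] in \<open>auto intro: tensor_power_tensors\<close>)
    also have "\<dots> = tprod W (f k p x) (len_part W (m - k) (alg_word W ?F xs))"
      using Cons.IH[OF x(2), of "m - k"] Cons.prems by simp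
    finally show "(\<Sum>ks\<in>?C (length xs) (m - k). tprod W (f k p x) (tensor_of_maps W (?g ks) xs)) =
      tprod W (f k p x) (len_part W (m - k) (alg_word W ?F xs))" .
  qed
  also have "\<dots> = (\<Sum>k=1..M. if k \<le> m then tprod W (f k p x) (len_part W (m - k) (alg_word W ?F xs)) else 0)"
    by (rule sum.mono_neutral_cong_left) (use Cons.prems in auto)
  also have "\<dots> = (\<Sum>k=1..M. len_part W m (tprod W (f k p x) (alg_word W ?F xs)))"
    by (rule sum.cong[OF refl]) (use fk len_part_tprod[OF gW fk alg_word_tensors[OF gW F x(2)]] in auto)
  also have "\<dots> = len_part W m (alg_word W ?F (u # xs))"
    by (simp add: u tprod_sum_left len_part_sum)
  finally show ?case by simp
qed

lemma alg_ext_map_tensor: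
  assumes gW: "graded_vector_space W" and f: "\<And>k. 1 \<le> k \<Longrightarrow> tensor_linear V W k 0 (f k)" and M: "m \<le> M"
    and T: "T \<in> tensor_power V n p"
  shows "(\<Sum>ks | length ks = n \<and> sum_list ks = m \<and> (\<forall>k\<in>set ks. 1 \<le> k). map_tensor W (map (\<lambda>k. (0, f k)) ks) T) =
    len_part W m (alg_ext W (\<lambda>p x. \<Sum>k=1..M. f k p x) T)"
proof -
  let ?C = "{ks. length ks = n \<and> sum_list ks = m \<and> (\<forall>k\<in>set ks. (1::nat) \<le> k)}"
  let ?g = "map (\<lambda>k. (0, f k))"
  have f1: "1 \<le> k \<Longrightarrow> glin V W 1 0 (f k)" for k by (rule glin_tensor_linear[OF f])
  have F: "glin V W 1 0 (\<lambda>p x. \<Sum>k=1..M. f k p x)" by (rule glin_sum) (use f1 in auto)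
  have g: "word_linear V (tensor_of_maps W (?g ks))" if "ks \<in> ?C" for ks
    by (rule word_linear_tensor_of_maps[OF gW]) (use that glin_mono[OF f1] in auto)
  show ?thesis unfolding map_tensor_lin_ext
    using T unfolding tensor_power_tspan
  proof (induction rule: tspan_induct)
    case (tens xs)
    have "(\<Sum>ks\<in>?C. lin_ext (tensor_of_maps W (?g ks)) (tens V xs)) = (\<Sum>ks\<in>?C. tensor_of_maps W (?g ks) xs)"
      by (rule sum.cong[OF refl]) (rule lin_ext_tens[OF g])
    then show ?case using alg_word_tensor_of_maps[OF gW f M, of xs] tens M by (simp add: alg_ext_tens[OF gW F, simplified])
  qed (simp_all add: lin_ext_add lin_ext_scale sum.distrib tn.scale_sum_right[symmetric] len_part_add len_part_scale)
qed

section \<open>Sequences of components versus finite tensors\<close>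

lemma len_part_sum_rest: "T \<in> tfil V 1 p \<Longrightarrow> T - (\<Sum>n=1..m. len_part V n T) \<in> tfil V (Suc m) p"
proof (induction m)
  case (Suc m)
  then have T: "T - (\<Sum>n=1..m. len_part V n T) \<in> tfil V (Suc m) p" by simp
  have "len_part V (Suc m) (\<Sum>n=1..m. len_part V n T) = 0"
    unfolding len_part_sum by (rule sum.neutral) (use len_part_same[OF len_part_tensor_power[OF Suc.prems]] in auto)
  then show ?case using len_part_rest[OF T] by (simp add: len_part_diff algebra_simps)
qed simp

text \<open>A tensor is a finite combination of words, hence the sum of finitely many of its length
  components.\<close>

lemma tfil_len_part_eq_0:
  assumes T: "T \<in> tfil V 1 p" and "\<And>n. 1 \<le> n \<Longrightarrow> len_part V n T = 0"
  shows "T = 0"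
proof -
  have "\<exists>m. \<forall>k\<ge>m. (\<Sum>n=1..k. len_part V n T) = T"
    using T
  proof (induction rule: tspan_induct)
    case (add S T)
    then obtain m m' where "\<forall>k\<ge>m. (\<Sum>n=1..k. len_part V n S) = S" "\<forall>k\<ge>m'. (\<Sum>n=1..k. len_part V n T) = T" by blast
    then show ?case by (intro exI[of _ "max m m'"]) (simp add: len_part_add sum.distrib)
  next
    case (scale c S)
    then show ?case by (auto simp: len_part_scale tn.scale_sum_right[symmetric])
  next
    case (tens xs)
    then show ?case by (intro exI[of _ "length xs"]) (auto simp: len_part_tens sum.delta' Suc_le_eq)
  qed simp
  then show ?thesis using assms(2) by (metis (no_types, lifting) atLeastAtMost_iff order_refl sum.neutral)
qed

definition "cobar_d V \<Delta> n = snd (cobar_gen V \<Delta> n)"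

definition "cobar_f W f k = snd (cobar_map_gen W f k)"

lemma cobar_gen_eq: "cobar_gen V \<Delta> n = (-1, cobar_d V \<Delta> n)"
  by (simp add: cobar_gen_def cobar_d_def)

lemma cobar_map_gen_eq: "cobar_map_gen W f = (\<lambda>n. (0, cobar_f W f n))"
  by (simp add: cobar_map_gen_def cobar_f_def fun_eq_iff)

text \<open>Component \<open>n\<close> of the differential reads only the first \<open>n\<close>
  components of the sequence, so the sequence may be replaced by a finite tensor \<open>T\<close>
  with the same components, on which the derivation acts in the ordinary sense.\<close>

lemma cobar_differential_len_part:
  assumes gU: "graded_vector_space (desuspension V)"
    and d: "\<And>k. 1 \<le> k \<Longrightarrow> tensor_linear (desuspension V) (desuspension V) k (-1) (cobar_d V \<Delta> k)"
    and t: "\<And>l. 1 \<le> l \<Longrightarrow> l \<le> n \<Longrightarrow> t l = len_part (desuspension V) l T" and T: "T \<in> tfil (desuspension V) 1 p" and n: "n \<le> M"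
  shows "cobar_differential V \<Delta> t n =
    len_part (desuspension V) n (der (desuspension V) (\<lambda>p x. \<Sum>k=1..M. cobar_d V \<Delta> k p x) T)"
proof -
  have "cobar_differential V \<Delta> t n = (\<Sum>l=1..n. der (desuspension V) (cobar_d V \<Delta> (n - l + 1)) (len_part (desuspension V) l T))"
    unfolding cobar_differential_def cobar_gen_eq
  proof (rule sum.cong[OF refl])
    fix l assume l: "l \<in> {1..n}"
    then have tl: "t l = len_part (desuspension V) l T" by (intro t) auto
    have g: "glin (desuspension V) (desuspension V) 0 (-1) (cobar_d V \<Delta> (n - l + 1))"
      by (rule glin_tensor_linear[OF d]) auto
    show "(\<Sum>a<l. map_tensor (desuspension V) (replicate a (id_map (desuspension V)) @ [(-1, cobar_d V \<Delta> (n - l + 1))] @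
        replicate (l - 1 - a) (id_map (desuspension V))) (t l)) =
      der (desuspension V) (cobar_d V \<Delta> (n - l + 1)) (len_part (desuspension V) l T)"
      unfolding tl by (rule der_map_tensor[OF gU g len_part_tensor_power[OF T]])
  qed
  then show ?thesis using len_part_der[OF gU d tspan_all[OF T] n] by simp
qed

lemma cobar_map_len_part:
  assumes gW: "graded_vector_space (desuspension W)"
    and f: "\<And>k. 1 \<le> k \<Longrightarrow> tensor_linear U (desuspension W) k 0 (cobar_f W f k)"
    and t: "\<And>l. 1 \<le> l \<Longrightarrow> l \<le> n \<Longrightarrow> t l = len_part U l T" and T: "T \<in> tfil U 1 p" and n: "n \<le> M"
  shows "cobar_map W f t n =
    len_part (desuspension W) n (alg_ext (desuspension W) (\<lambda>p x. \<Sum>k=1..M. cobar_f W f k p x) T)"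
proof -
  let ?F = "\<lambda>p x. \<Sum>k=1..M. cobar_f W f k p x"
  have F: "glin U (desuspension W) 1 0 ?F" by (rule glin_sum, rule glin_tensor_linear[OF f]) auto
  have "cobar_map W f t n = (\<Sum>l=1..n. len_part (desuspension W) n (alg_ext (desuspension W) ?F (len_part U l T)))"
    unfolding cobar_map_def cobar_map_gen_eq
  proof (rule sum.cong[OF refl])
    fix l assume l: "l \<in> {1..n}"
    then have tl: "t l = len_part U l T" by (intro t) auto
    show "(\<Sum>ks | length ks = l \<and> sum_list ks = n \<and> (\<forall>k\<in>set ks. 1 \<le> k).
        map_tensor (desuspension W) (map (\<lambda>n. (0, cobar_f W f n)) ks) (t l)) =
      len_part (desuspension W) n (alg_ext (desuspension W) ?F (len_part U l T))"
      unfolding tl by (rule alg_ext_map_tensor[OF gW f n len_part_tensor_power[OF T]])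
  qed
  also have "\<dots> = len_part (desuspension W) n (alg_ext (desuspension W) ?F (\<Sum>l=1..n. len_part U l T))"
    by (simp add: len_part_sum lin_ext_sum)
  also have "\<dots> = len_part (desuspension W) n (alg_ext (desuspension W) ?F T)"
  proof -
    have "len_part (desuspension W) n (alg_ext (desuspension W) ?F (T - (\<Sum>l=1..n. len_part U l T))) = 0"
      by (rule len_part_tfil_0[OF alg_ext_tfil[OF gW F len_part_sum_rest[OF T]]]) simp
    then show ?thesis by (simp add: lin_ext_diff len_part_diff)
  qed
  finally show ?thesis .
qed

text \<open>Component \<open>m\<close> of both composites depends only on the first \<open>m\<close>
  components of \<open>t\<close> and on operations of arity at most \<open>m\<close>. With
  \<open>t\<close> replaced by the sum of these components, it suffices that the truncated map is a
  chain map on generators up to length \<open>m\<close>.\<close>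

lemma cobar_chain_map:
  fixes V :: "'b gvs" and W :: "'c gvs"
  assumes gV: "graded_vector_space (desuspension V)" and gW: "graded_vector_space (desuspension W)"
    and d: "\<And>k. 1 \<le> k \<Longrightarrow> tensor_linear (desuspension V) (desuspension V) k (-1) (cobar_d V \<Delta> k)"
    and d': "\<And>k. 1 \<le> k \<Longrightarrow> tensor_linear (desuspension W) (desuspension W) k (-1) (cobar_d W \<Delta>' k)"
    and f: "\<And>k. 1 \<le> k \<Longrightarrow> tensor_linear (desuspension V) (desuspension W) k 0 (cobar_f W f k)"
    and E: "\<And>M p x. 1 \<le> M \<Longrightarrow> x \<in> carrier (desuspension V p) \<Longrightarrow>
      der (desuspension W) (\<lambda>p x. \<Sum>k=1..M. cobar_d W \<Delta>' k p x) (\<Sum>k=1..M. cobar_f W f k p x) -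
      alg_ext (desuspension W) (\<lambda>p x. \<Sum>k=1..M. cobar_f W f k p x) (\<Sum>k=1..M. cobar_d V \<Delta> k p x)
       \<in> tfil (desuspension W) (Suc M) (p - 1)"
    and t: "t \<in> complete_tensor_algebra (desuspension V) p"
  shows "cobar_map W f (cobar_differential V \<Delta> t) = cobar_differential W \<Delta>' (cobar_map W f t)"
proof
  fix m
  let ?U = "desuspension V" and ?W = "desuspension W"
  show "cobar_map W f (cobar_differential V \<Delta> t) m = cobar_differential W \<Delta>' (cobar_map W f t) m"
  proof (cases "m = 0")
    case True
    then show ?thesis by (simp add: cobar_map_def cobar_differential_def)
  next
    case False
    then have m: "1 \<le> m" by simp
    let ?d = "\<lambda>p x. \<Sum>k=1..m. cobar_d V \<Delta> k p x" and ?D = "\<lambda>p x. \<Sum>k=1..m. cobar_d W \<Delta>' k p x"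
      and ?F = "\<lambda>p x. \<Sum>k=1..m. cobar_f W f k p x"
    have d1: "glin ?U ?U 1 (-1) ?d" by (rule glin_sum, rule glin_tensor_linear[OF d]) auto
    have D1: "glin ?W ?W 1 (-1) ?D" by (rule glin_sum, rule glin_tensor_linear[OF d']) auto
    have F1: "glin ?U ?W 1 0 ?F" by (rule glin_sum, rule glin_tensor_linear[OF f]) auto
    define T where "T = (\<Sum>l=1..m. t l)"
    have tl: "t l \<in> tensor_power ?U l p" if "1 \<le> l" for l
      using t that by (auto simp: complete_tensor_algebra_def)
    have T: "T \<in> tfil ?U 1 p" unfolding T_def by (intro tspan_sum tensor_power_tfil[OF tl]) auto
    have l: "t l = len_part ?U l T" if "1 \<le> l" "l \<le> m" for l
    proof -
      have "len_part ?U l T = (\<Sum>k=1..m. if k = l then t k else 0)"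
        unfolding T_def len_part_sum by (rule sum.cong) (auto simp: len_part_same[OF tl])
      then show ?thesis using that by (simp add: sum.delta')
    qed
    have dT: "der ?U ?d T \<in> tfil ?U 1 (p - 1)" by (rule der_ext_tfil[OF gV glin_tens d1 T]) auto
    have FT: "alg_ext ?W ?F T \<in> tfil ?W 1 p" by (rule alg_ext_tfil[OF gW F1 T])
    have "cobar_map W f (cobar_differential V \<Delta> t) m = len_part ?W m (alg_ext ?W ?F (der ?U ?d T))"
      by (rule cobar_map_len_part[OF gW f _ dT order_refl], assumption)
        (rule cobar_differential_len_part[OF gV d l T], auto)
    moreover have "cobar_differential W \<Delta>' (cobar_map W f t) m = len_part ?W m (der ?W ?D (alg_ext ?W ?F T))"
      by (rule cobar_differential_len_part[OF gW d' _ FT order_refl], assumption)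
        (rule cobar_map_len_part[OF gW f l T], auto)
    moreover have "der ?W ?D (alg_ext ?W ?F T) - alg_ext ?W ?F (der ?U ?d T) \<in> tfil ?W (Suc m) (p - 1)"
      by (rule defect_tfil[OF gV gW F1 d1 D1 E[OF m] T]) auto
    then have "len_part ?W m (der ?W ?D (alg_ext ?W ?F T) - alg_ext ?W ?F (der ?U ?d T)) = 0"
      by (rule len_part_tfil_0) simp
    ultimately show ?thesis by (simp add: len_part_diff)
  qed
qed

subsection \<open>Desuspension of tensors\<close>

text \<open>The Koszul sign of \<open>(s\<^sup>-\<^sup>1)\<^sup>\<otimes>\<^sup>n\<close> on a word of length \<open>n\<close>.\<close>

fun shift_sign :: "(int \<times> 'b) list \<Rightarrow> rat"
  where
    "shift_sign [] = 1"
  | "shift_sign ((p, x) # xs) = ksign (int (length xs) * p) * shift_sign xs"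

definition shift :: "int \<Rightarrow> (int \<times> 'b) list \<Rightarrow> (int \<times> 'b) list"
  where "shift k xs = map (\<lambda>(p, x). (p + k, x)) xs"

definition desusp :: "'b gvs \<Rightarrow> (int \<times> 'b) list \<Rightarrow> 'b tensor"
  where "desusp V xs = tscale (shift_sign xs) (tens (desuspension V) (shift (-1) xs))"

text \<open>Inverse of \<open>desusp\<close> by construction: its sign is that of the shifted word.
  The Koszul sign of the tensor power of the suspension itself would differ by a factor depending
  only on the length \<open>n\<close>, namely -1 to the power \<open>n (n - 1) / 2\<close>.\<close>

definition susp :: "'b gvs \<Rightarrow> (int \<times> 'b) list \<Rightarrow> 'b tensor"
  where "susp V xs = tscale (shift_sign (shift 1 xs)) (tens V (shift 1 xs))"

lemma shift_simps [simp]: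
  "shift k [] = []" "shift k ((p, x) # xs) = (p + k, x) # shift k xs" "shift k (xs @ ys) = shift k xs @ shift k ys"
  "length (shift k xs) = length xs"
  by (auto simp: shift_def)

lemma deg_shift: "deg (shift k xs) = deg xs + k * int (length xs)"
  by (induction xs) (auto simp: algebra_simps)

lemma shift_shift: "shift k (shift l xs) = shift (k + l) xs"
  by (induction xs) auto

lemma shift_0 [simp]: "shift 0 xs = xs"
  by (induction xs) auto

lemma hom_shift [simp]:
  "shift (-1) xs \<in> hom_lists (desuspension V) \<longleftrightarrow> xs \<in> hom_lists V"
  "shift 1 xs \<in> hom_lists V \<longleftrightarrow> xs \<in> hom_lists (desuspension V)"
  by (induction xs) (auto simp: desuspension_def)

lemma shift_sign_cong: "shift_sign (us @ (p, x) # vs) = shift_sign (us @ (p, y) # vs)"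
  by (induction us) (auto simp: algebra_simps)

lemma shift_sign_append: "shift_sign (xs @ ys) = shift_sign xs * ksign (int (length ys) * deg xs) * shift_sign ys"
  by (induction xs) (auto simp: algebra_simps ksign_add)

lemma shift_sign_square [simp]: "shift_sign xs * shift_sign xs = 1" "shift_sign xs * (shift_sign xs * c) = c"
proof -
  show "shift_sign xs * shift_sign xs = 1" by (induction xs) (auto simp: ksign_def)
  then show "shift_sign xs * (shift_sign xs * c) = c" by (simp add: mult.assoc[symmetric])
qed

lemma word_linear_desusp: "word_linear V (desusp V)"
proof -
  have "desusp V (us @ (p, x \<oplus>\<^bsub>V p\<^esub> y) # vs) = desusp V (us @ (p, x) # vs) + desusp V (us @ (p, y) # vs)"
    if "us \<in> hom_lists V" "vs \<in> hom_lists V" "x \<in> carrier (V p)" "y \<in> carrier (V p)" for us vs p x y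
    using tens_add[of "shift (-1) us" "desuspension V" "shift (-1) vs" x "p - 1" y] that
    unfolding desusp_def shift_sign_cong[of us p "x \<oplus>\<^bsub>V p\<^esub> y" vs x] shift_sign_cong[of us p y vs x]
    by (simp add: desuspension_def[of V "p - 1"] tn.scale_right_distrib)
  moreover have "desusp V (us @ (p, c \<odot>\<^bsub>V p\<^esub> x) # vs) = tscale c (desusp V (us @ (p, x) # vs))"
    if "us \<in> hom_lists V" "vs \<in> hom_lists V" "x \<in> carrier (V p)" for us vs p x c
    using tens_smult[of "shift (-1) us" "desuspension V" "shift (-1) vs" x "p - 1" c] that
    unfolding desusp_def shift_sign_cong[of us p "c \<odot>\<^bsub>V p\<^esub> x" vs x]
    by (simp add: desuspension_def[of V "p - 1"] mult.commute)
  ultimately show ?thesis by (auto simp: word_linear_iff)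
qed

lemma word_linear_susp: "word_linear (desuspension V) (susp V)"
proof -
  have "susp V (us @ (p, x \<oplus>\<^bsub>V (p + 1)\<^esub> y) # vs) = susp V (us @ (p, x) # vs) + susp V (us @ (p, y) # vs)"
    if "us \<in> hom_lists (desuspension V)" "vs \<in> hom_lists (desuspension V)" "x \<in> carrier (V (p + 1))" "y \<in> carrier (V (p + 1))" for us vs p x y
    using tens_add[of "shift 1 us" V "shift 1 vs" x "p + 1" y] that
      shift_sign_cong[of "shift 1 us" "p + 1" "x \<oplus>\<^bsub>V (p + 1)\<^esub> y" "shift 1 vs" x] shift_sign_cong[of "shift 1 us" "p + 1" y "shift 1 vs" x]
    by (simp add: susp_def tn.scale_right_distrib)
  moreover have "susp V (us @ (p, c \<odot>\<^bsub>V (p + 1)\<^esub> x) # vs) = tscale c (susp V (us @ (p, x) # vs))"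
    if "us \<in> hom_lists (desuspension V)" "vs \<in> hom_lists (desuspension V)" "x \<in> carrier (V (p + 1))" for us vs p x c
    using tens_smult[of "shift 1 us" V "shift 1 vs" x "p + 1" c] that
      shift_sign_cong[of "shift 1 us" "p + 1" "c \<odot>\<^bsub>V (p + 1)\<^esub> x" "shift 1 vs" x]
    by (simp add: susp_def mult.commute)
  ultimately show ?thesis unfolding word_linear_iff desuspension_def[of V] by (auto simp: desuspension_def[abs_def])
qed

lemma lin_ext_desusp_tensor_power:
  assumes "T \<in> tensor_power V n p" "q = p - int n"
  shows "lin_ext (desusp V) T \<in> tensor_power (desuspension V) n q"
  unfolding tensor_power_tspan assms(2)
  by (rule lin_ext_tspan[OF word_linear_desusp assms(1)[unfolded tensor_power_tspan]])
    (auto simp: desusp_def deg_shift intro!: tspan_scale tspan_tens)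

lemma lin_ext_susp_tensor_power:
  assumes "T \<in> tensor_power (desuspension V) n p" "q = p + int n"
  shows "lin_ext (susp V) T \<in> tensor_power V n q"
  unfolding tensor_power_tspan assms(2)
  by (rule lin_ext_tspan[OF word_linear_susp assms(1)[unfolded tensor_power_tspan]])
    (auto simp: susp_def deg_shift intro!: tspan_scale tspan_tens)

lemma susp_desusp: "T \<in> tensors V \<Longrightarrow> lin_ext (susp V) (lin_ext (desusp V) T) = T"
proof (induction rule: tspan_induct)
  case (tens xs)
  then show ?case unfolding lin_ext_tens[OF word_linear_desusp]
    by (simp add: desusp_def lin_ext_scale lin_ext_tens[OF word_linear_susp]) (simp add: susp_def shift_shift)
qed (simp_all add: lin_ext_add lin_ext_scale)

lemma desusp_susp: "T \<in> tensors (desuspension V) \<Longrightarrow> lin_ext (desusp V) (lin_ext (susp V) T) = T"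
proof (induction rule: tspan_induct)
  case (tens xs)
  then show ?case unfolding lin_ext_tens[OF word_linear_susp]
    by (simp add: susp_def lin_ext_scale lin_ext_tens[OF word_linear_desusp]) (simp add: desusp_def shift_shift)
qed (simp_all add: lin_ext_add lin_ext_scale)

lemma gvs_desuspension: "graded_vector_space V \<Longrightarrow> graded_vector_space (desuspension V)"
  by (simp add: graded_vector_space_def desuspension_def)

lemma desusp_tensors: "xs \<in> hom_lists V \<Longrightarrow> desusp V xs \<in> tensors (desuspension V)"
  by (auto simp: desusp_def intro!: tspan_scale)

lemma lin_ext_desusp_tensors: "T \<in> tensors V \<Longrightarrow> lin_ext (desusp V) T \<in> tensors (desuspension V)"
  by (erule lin_ext_tspan[OF word_linear_desusp]) (auto intro: desusp_tensors)

lemma desusp_Cons: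
  assumes gV: "graded_vector_space V" and "x \<in> carrier (V p)" "xs \<in> hom_lists V"
  shows "desusp V ((p, x) # xs) =
    tscale (ksign (int (length xs) * p)) (tprod (desuspension V) (tens (desuspension V) [(p - 1, x)]) (desusp V xs))"
  using assms tens_Cons[OF gvs_desuspension[OF gV], of "p - 1" x "shift (-1) xs"]
  by (simp add: desusp_def tprod_scale_right[OF gvs_desuspension[OF gV]] desuspension_def)

text \<open>The sign comes from the \<open>n\<close> desuspensions of degree -1 that belong to
  \<open>T\<close> and move past \<open>S\<close> of degree \<open>p\<close>.\<close>

lemma lin_ext_desusp_tprod:
  assumes gV: "graded_vector_space V" and S: "S \<in> tensor_power V m p" and T: "T \<in> tensor_power V n q"
  shows "lin_ext (desusp V) (tprod V S T) =
    tscale (ksign (int n * p)) (tprod (desuspension V) (lin_ext (desusp V) S) (lin_ext (desusp V) T))"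
  using S unfolding tensor_power_tspan
proof (induction rule: tspan_induct)
  case (tens xs)
  note xs = tens
  note gU = gvs_desuspension[OF gV]
  show ?case using T unfolding tensor_power_tspan
  proof (induction rule: tspan_induct)
    case (tens ys)
    have "tens (desuspension V) (shift (-1) xs @ shift (-1) ys) =
        tprod (desuspension V) (tens (desuspension V) (shift (-1) xs)) (tens (desuspension V) (shift (-1) ys))"
      by (rule tprod_tens[OF gU, symmetric]) (use xs tens in auto)
    then show ?case using xs tens unfolding lin_ext_tens[OF word_linear_desusp]
      by (simp add: tprod_tens[OF gV] lin_ext_tens[OF word_linear_desusp])
        (simp add: desusp_def shift_sign_append tprod_scale_left tprod_scale_right[OF gU] mult_ac)
  next
    case (add S T)
    then have "S \<in> tensors V" "T \<in> tensors V" by (auto intro: tspan_all)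
    with add show ?case using xs
      by (simp add: tprod_add_right[OF gV] tprod_add_right[OF gU] lin_ext_add lin_ext_desusp_tensors tn.scale_right_distrib)
  next
    case (scale c S)
    then have "S \<in> tensors V" by (auto intro: tspan_all)
    with scale show ?case using xs
      by (simp add: tprod_scale_right[OF gV] tprod_scale_right[OF gU] lin_ext_scale lin_ext_desusp_tensors mult_ac)
  qed (use xs in \<open>simp_all add: lin_ext_desusp_tensors\<close>)
qed (simp_all add: lin_ext_add lin_ext_scale tprod_add_left tprod_scale_left tn.scale_right_distrib mult_ac)

lemma glin_desusp_map:
  "glin V (desuspension V) 0 (fst (desusp_map V)) (snd (desusp_map V))"
proof -
  have "tens (desuspension V) [(p - 1, x \<oplus>\<^bsub>V p\<^esub> y)] = tens (desuspension V) [(p - 1, x)] + tens (desuspension V) [(p - 1, y)]"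
    if "x \<in> carrier (V p)" "y \<in> carrier (V p)" for p x y
    using tens_add[of "[]" "desuspension V" "[]" x "p - 1" y] that by (simp add: desuspension_def[of V "p - 1"])
  moreover have "tens (desuspension V) [(p - 1, c \<odot>\<^bsub>V p\<^esub> x)] = tscale c (tens (desuspension V) [(p - 1, x)])"
    if "x \<in> carrier (V p)" for p x c
    using tens_smult[of "[]" "desuspension V" "[]" x "p - 1" c] that by (simp add: desuspension_def[of V "p - 1"])
  ultimately show ?thesis
    by (auto simp: glin_def desusp_map_def desuspension_def[of V "_ - 1"] intro!: tspan_tens)
qed

lemma tensor_of_maps_desusp:
  assumes gV: "graded_vector_space V"
  shows "xs \<in> hom_lists V \<Longrightarrow>
    tensor_of_maps (desuspension V) (replicate (length xs) (desusp_map V)) xs = desusp V xs"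
proof (induction xs)
  case Nil
  then show ?case by (simp add: desusp_def)
next
  case (Cons u xs)
  obtain p x where u: "u = (p, x)" by force
  show ?case using Cons desusp_Cons[OF gV, of x p xs]
    by (auto simp: u desusp_map_def sum_list_replicate)
qed

lemma map_tensor_desusp:
  assumes gV: "graded_vector_space V" and T: "T \<in> tensor_power V n p"
  shows "map_tensor (desuspension V) (replicate n (desusp_map V)) T = lin_ext (desusp V) T"
  unfolding map_tensor_lin_ext
proof (rule lin_ext_cong[OF word_linear_tensor_of_maps[OF gvs_desuspension[OF gV]] word_linear_desusp T[unfolded tensor_power_tspan]])
  show "\<forall>(d, g)\<in>set (replicate n (desusp_map V)). glin V (desuspension V) 0 d g"
    using glin_desusp_map[of V] by (auto simp: case_prod_unfold)
qed (use tensor_of_maps_desusp[OF gV] in auto)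

subsection \<open>The Stasheff identities and the square of the cobar differential\<close>

text \<open>\<open>\<Sum> (-1)\<^sup>a\<^sup>+\<^sup>i\<^sup>b 1\<^sup>\<otimes>\<^sup>a \<otimes> g \<otimes> 1\<^sup>\<otimes>\<^sup>b\<close> for \<open>g\<close> of degree \<open>i - 2\<close>: the Stasheff signs up to the global factor
  \<open>(-1)\<^sup>n\<close>, since \<open>n = i + a + b\<close>.\<close>

fun stasheff_word :: "'b gvs \<Rightarrow> nat \<Rightarrow> (int \<Rightarrow> 'b \<Rightarrow> 'b tensor) \<Rightarrow> (int \<times> 'b) list \<Rightarrow> 'b tensor"
  where
    "stasheff_word V i g [] = 0"
  | "stasheff_word V i g ((p, x) # xs) = tscale ((-1) ^ (i * length xs)) (tprod V (g p x) (tens V xs))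
      - tscale (ksign (int i * p)) (tprod V (tens V [(p, x)]) (stasheff_word V i g xs))"

lemma stasheff_word_tensor_power:
  assumes gV: "graded_vector_space V" and g: "tensor_linear V V i (int i - 2) g"
  shows "xs \<in> hom_lists V \<Longrightarrow> Suc m = length xs + i \<Longrightarrow> stasheff_word V i g xs \<in> tensor_power V m (deg xs + (int i - 2))"
proof (induction xs arbitrary: m)
  case (Cons u xs)
  obtain p x where u: "u = (p, x)" by force
  have x: "x \<in> carrier (V p)" "xs \<in> hom_lists V" using Cons.prems u by auto
  have gx: "g p x \<in> tensor_power V i (p + (int i - 2))" using g x by (auto simp: tensor_linear_def)
  have "tprod V (g p x) (tens V xs) \<in> tensor_power V m (deg (u # xs) + (int i - 2))"
    by (rule tprod_tensor_power[OF gV gx tens_tensor_power[OF x(2) refl refl]]) (use Cons.prems u in auto)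
  moreover have "tprod V (tens V [(p, x)]) (stasheff_word V i g xs) \<in> tensor_power V m (deg (u # xs) + (int i - 2))"
  proof (cases xs)
    case Nil
    then show ?thesis using x by (simp add: tensor_power_intros)
  next
    case (Cons a list)
    show ?thesis
      by (rule tprod_tensor_power[OF gV _ Cons.IH[of "m - 1"], where m = 1 and p = p])
        (use Cons Cons.prems u x in \<open>auto intro: tens_tensor_power\<close>)
  qed
  ultimately show ?case by (auto simp: u intro: tensor_power_intros)
qed (auto intro: tensor_power_intros)

lemma stasheff_word_tensor_of_maps:
  assumes gV: "graded_vector_space V" and g: "glin V V 0 (int i - 2) g"
  shows "xs \<in> hom_lists V \<Longrightarrow> length xs = n \<Longrightarrow>
    (\<Sum>a<n. tscale ((-1) ^ (i * (n - 1 - a) + a)) (tensor_of_maps V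
       (replicate a (id_map V) @ [(int i - 2, g)] @ replicate (n - 1 - a) (id_map V)) xs)) = stasheff_word V i g xs"
proof (induction xs arbitrary: n)
  case (Cons u xs)
  obtain p x where u: "u = (p, x)" by force
  have x: "x \<in> carrier (V p)" "xs \<in> hom_lists V" using Cons.prems u by auto
  let ?m = "length xs"
  let ?G = "\<lambda>a. replicate a (id_map V) @ [(int i - 2, g)] @ replicate (?m - 1 - a) (id_map V)"
  let ?e = "\<lambda>a. (-1) ^ (i * (?m - 1 - a) + a) :: rat"
  have G: "\<forall>(d, h)\<in>set (?G a). glin V V 0 d h" for a
    using g glin_id_map[of V] by (auto simp: case_prod_unfold)
  have s: "(\<Sum>a\<in>A. tscale (?e a) (tprod V (tens V [(p, x)]) (tensor_of_maps V (?G a) xs))) =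
     tprod V (tens V [(p, x)]) (\<Sum>a\<in>A. tscale (?e a) (tensor_of_maps V (?G a) xs))" for A
    by (subst tprod_sum_right[OF gV])
      (use x tensor_of_maps_tensors[OF gV G x(2)] in \<open>auto simp: tprod_scale_right[OF gV] intro!: tspan_scale\<close>)
  have n: "n = Suc ?m" using Cons.prems by simp
  have kp: "ksign (p * (int i - 2)) = ksign (p * int i)" by (simp add: ksign_def)
  have "(\<Sum>a<n. tscale ((-1) ^ (i * (n - 1 - a) + a)) (tensor_of_maps V
       (replicate a (id_map V) @ [(int i - 2, g)] @ replicate (n - 1 - a) (id_map V)) (u # xs))) =
    tscale ((-1) ^ (i * ?m)) (tprod V (g p x) (tens V xs)) +
    (\<Sum>a<?m. tscale (- ksign (int i * p)) (tscale (?e a) (tprod V (tens V [(p, x)]) (tensor_of_maps V (?G a) xs))))"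
    unfolding n sum.lessThan_Suc_shift
    using tensor_of_maps_id[OF gV x(2) refl]
    by (simp add: u id_map_def sum_list_replicate kp mult.commute)
  also have "\<dots> = stasheff_word V i g (u # xs)"
    unfolding tn.scale_sum_right[symmetric] s Cons.IH[OF x(2) refl] by (simp add: u)
  finally show ?case .
qed simp

lemma power_minus_one_ksign: "(-1) ^ n = ksign (int n)"
  by (auto simp: ksign_def)

text \<open>Conjugation by desuspension converts a map of degree \<open>i - 2\<close>, inserted with
  the Stasheff signs, into a map of degree -1 inserted with Koszul signs only. In the induction the
  first letter is either hit by the map or passed by it.\<close>

lemma der_desusp:
  assumes gV: "graded_vector_space V" and g: "tensor_linear V V i (int i - 2) g" and i: "1 \<le> i"
    and d: "glin (desuspension V) (desuspension V) 0 (-1) d"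
    and dg: "\<And>p x. x \<in> carrier (V p) \<Longrightarrow> d (p - 1) x = - lin_ext (desusp V) (g p x)"
  shows "xs \<in> hom_lists V \<Longrightarrow> der (desuspension V) d (desusp V xs) = - lin_ext (desusp V) (stasheff_word V i g xs)"
proof (induction xs)
  case Nil
  then show ?case by (simp add: desusp_def lin_ext_scale der_ext_tens[OF gvs_desuspension[OF gV] glin_tens d])
next
  case (Cons u xs)
  let ?U = "desuspension V"
  note gU = gvs_desuspension[OF gV]
  obtain p x where u: "u = (p, x)" by force
  have x: "x \<in> carrier (V p)" "xs \<in> hom_lists V" using Cons.prems u by auto
  have xU: "x \<in> carrier (?U (p - 1))" using x by (simp add: desuspension_def)
  have gx: "g p x \<in> tensor_power V i (p + (int i - 2))" using g x by (auto simp: tensor_linear_def)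
  let ?n = "length xs"
  have sx: "stasheff_word V i g xs \<in> tensor_power V (?n + i - 1) (deg xs + (int i - 2))"
    by (rule stasheff_word_tensor_power[OF gV g x(2)]) (use i in auto)
  have 1: "der ?U d (desusp V (u # xs)) =
    tscale (ksign (int ?n * p)) (tprod ?U (- lin_ext (desusp V) (g p x)) (desusp V xs)) +
    tscale (ksign (int ?n * p) * ksign p) (tprod ?U (tens ?U [(p - 1, x)]) (lin_ext (desusp V) (stasheff_word V i g xs)))"
  proof -
    have "tprod ?U (tens ?U [(p - 1, x)]) (- lin_ext (desusp V) (stasheff_word V i g xs)) =
        - tprod ?U (tens ?U [(p - 1, x)]) (lin_ext (desusp V) (stasheff_word V i g xs))"
      using tprod_scale_right[OF gU, of "tens ?U [(p - 1, x)]" "lin_ext (desusp V) (stasheff_word V i g xs)" "-1"] xU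
        lin_ext_desusp_tensors[OF tensor_power_tensors[OF sx]] by simp
    then show ?thesis
      using der_tprod[OF gU d, of "tens ?U [(p - 1, x)]" 1 "p - 1" "desusp V xs"] xU x
      by (simp add: u desusp_Cons[OF gV] lin_ext_scale tspan_tens desusp_tensors der_ext_gen[OF gU glin_tens d] dg Cons.IH
          ksign_diff tn.scale_right_distrib)
  qed
  have 2: "lin_ext (desusp V) (tprod V (g p x) (tens V xs)) =
      tscale (ksign (int ?n * (p + (int i - 2)))) (tprod ?U (lin_ext (desusp V) (g p x)) (desusp V xs))"
    using lin_ext_desusp_tprod[OF gV gx tens_tensor_power[OF x(2) refl refl]] by (simp add: lin_ext_tens[OF word_linear_desusp])
  have 3: "lin_ext (desusp V) (tprod V (tens V [(p, x)]) (stasheff_word V i g xs)) =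
      tscale (ksign (int (?n + i - 1) * p)) (tprod ?U (tens ?U [(p - 1, x)]) (lin_ext (desusp V) (stasheff_word V i g xs)))"
    using lin_ext_desusp_tprod[OF gV tens_tensor_power[of "[(p, x)]" V 1 p] sx] x
    by (simp add: lin_ext_tens[OF word_linear_desusp]) (simp add: desusp_def)
  \<comment> \<open>Sign bookkeeping for the two cases: a value of degree \<open>p + i - 2\<close>
    passed by the \<open>n\<close> desuspensions of the rest, and a letter of degree
    \<open>p\<close> passed by the \<open>n + i - 1\<close> desuspensions of a rest whose length has
    changed.\<close>
  have 4: "(-1) ^ (i * ?n) * ksign (int ?n * (p + (int i - 2))) = ksign (int ?n * p)"
    unfolding power_minus_one_ksign ksign_add[symmetric] by (auto simp: ksign_def)
  have 5: "ksign (int i * p) * ksign (int (?n + i - 1) * p) = ksign (int ?n * p) * ksign p"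
    unfolding ksign_add[symmetric] using i by (auto simp: ksign_def)
  have 6: "tscale (ksign (int i * p)) (tscale (ksign (int (?n + i - 1) * p)) T) = tscale (ksign (int ?n * p) * ksign p) T"
    "tscale ((-1) ^ (i * ?n)) (tscale (ksign (int ?n * (p + (int i - 2)))) T) = tscale (ksign (int ?n * p)) T" for T :: "'a tensor"
    by (simp_all only: tn.scale_scale 4 5)
  show ?case unfolding 1 unfolding u stasheff_word.simps lin_ext_diff lin_ext_scale 2 3 6 by (simp add: tprod_neg_left)
qed

definition stasheff :: "'b gvs \<Rightarrow> (nat \<Rightarrow> int \<Rightarrow> 'b \<Rightarrow> 'b tensor) \<Rightarrow> nat \<Rightarrow> int \<Rightarrow> 'b \<Rightarrow> 'b tensor"
  where "stasheff V \<Delta> n p x = (\<Sum>i=1..n. \<Sum>j=0..n-i. tscale ((-1) ^ (i + j + i * j))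
         (map_tensor V
            (replicate (n - i - j) (id_map V) @ [(int i - 2, \<Delta> i)] @ replicate j (id_map V))
            (\<Delta> (n - i + 1) p x)))"

context
  fixes V :: "'b gvs" and \<Delta> :: "nat \<Rightarrow> int \<Rightarrow> 'b \<Rightarrow> 'b tensor"
  assumes gV: "graded_vector_space V" and \<Delta>: "\<And>n. 1 \<le> n \<Longrightarrow> tensor_linear V V n (int n - 2) (\<Delta> n)"
begin

private abbreviation (input) "U \<equiv> desuspension V"

lemma cobar_d_desusp: "1 \<le> n \<Longrightarrow> x \<in> carrier (V p) \<Longrightarrow> cobar_d V \<Delta> n (p - 1) x = - lin_ext (desusp V) (\<Delta> n p x)"
  using map_tensor_desusp[OF gV, of "\<Delta> n p x" n "p + (int n - 2)"] \<Delta>[of n]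
  by (simp add: cobar_d_def cobar_gen_def tensor_linear_def)

lemma tensor_linear_cobar_d:
  assumes "1 \<le> n"
  shows "tensor_linear U U n (-1) (cobar_d V \<Delta> n)"
proof -
  have "cobar_d V \<Delta> n p x = - lin_ext (desusp V) (\<Delta> n (p + 1) x)" if "x \<in> carrier (V (p + 1))" for p x
    using cobar_d_desusp[OF assms that] by simp
  moreover have "lin_ext (desusp V) (\<Delta> n (p + 1) x) \<in> tensor_power U n (p - 1)" if "x \<in> carrier (V (p + 1))" for p x
  proof -
    have "\<Delta> n (p + 1) x \<in> tensor_power V n (p + 1 + (int n - 2))"
      using \<Delta>[OF assms] that by (auto simp only: tensor_linear_def)
    then show ?thesis by (rule lin_ext_desusp_tensor_power) simp
  qed
  ultimately show ?thesis using \<Delta>[OF assms] gvs_closed[OF gV]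
    unfolding tensor_linear_def desuspension_def[of V]
    by (auto simp: lin_ext_add lin_ext_scale desuspension_def[abs_def, symmetric] intro: tensor_power_intros)
qed

lemma der_cobar_d_desusp:
  assumes i: "1 \<le> i" and T: "T \<in> tensor_power V k p"
  shows "der U (cobar_d V \<Delta> i) (lin_ext (desusp V) T) = - lin_ext (desusp V) (\<Sum>a<k. tscale ((-1) ^ (i * (k - 1 - a) + a))
    (map_tensor V (replicate a (id_map V) @ [(int i - 2, \<Delta> i)] @ replicate (k - 1 - a) (id_map V)) T))"
proof -
  let ?G = "\<lambda>a. replicate a (id_map V) @ [(int i - 2, \<Delta> i)] @ replicate (k - 1 - a) (id_map V)"
  have g: "glin V V 0 (int i - 2) (\<Delta> i)" by (rule glin_tensor_linear[OF \<Delta>[OF i]]) simp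
  have d: "glin U U 0 (-1) (cobar_d V \<Delta> i)" by (rule glin_tensor_linear[OF tensor_linear_cobar_d[OF i]]) simp
  have G: "\<forall>(d, h)\<in>set (?G a). glin V V 0 d h" for a
    using g glin_id_map[of V] by (auto simp: case_prod_unfold)
  note wl = word_linear_tensor_of_maps[OF gV G]
  show ?thesis unfolding map_tensor_lin_ext
    using T unfolding tensor_power_tspan
  proof (induction rule: tspan_induct)
    case (tens xs)
    have "(\<Sum>a<k. tscale ((-1) ^ (i * (k - 1 - a) + a)) (lin_ext (tensor_of_maps V (?G a)) (tens V xs))) = stasheff_word V i (\<Delta> i) xs"
      using stasheff_word_tensor_of_maps[OF gV g, of xs k] tens by (simp add: lin_ext_tens[OF wl, simplified])
    then show ?case using der_desusp[OF gV \<Delta>[OF i] i d cobar_d_desusp[OF i]] tens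
      by (simp add: lin_ext_tens[OF word_linear_desusp])
  qed (simp_all add: lin_ext_add lin_ext_scale sum.distrib tn.scale_sum_right tn.scale_right_distrib mult.commute lin_ext_sum)
qed

text \<open>With \<open>a\<close> identities on the left and \<open>b\<close> on the right,
  \<open>n = i + a + b\<close>. Hence the Stasheff sign is \<open>(-1) ^ n\<close> times the sign
  produced by desuspension, and this common factor can be pulled out of the sum.\<close>

lemma stasheff_cobar:
  assumes x: "x \<in> carrier (V p)" and n: "1 \<le> n"
  shows "lin_ext (desusp V) (stasheff V \<Delta> n p x) =
    tscale ((-1) ^ n) (\<Sum>i=1..n. der U (cobar_d V \<Delta> i) (cobar_d V \<Delta> (n - i + 1) (p - 1) x))"
proof -
  have "lin_ext (desusp V) (\<Sum>j=0..n-i. tscale ((-1) ^ (i + j + i * j)) (map_tensor V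
      (replicate (n - i - j) (id_map V) @ [(int i - 2, \<Delta> i)] @ replicate j (id_map V)) (\<Delta> (n - i + 1) p x))) =
    tscale ((-1) ^ n) (der U (cobar_d V \<Delta> i) (cobar_d V \<Delta> (n - i + 1) (p - 1) x))" if i: "i \<in> {1..n}" for i
  proof -
    let ?k = "n - i + 1"
    let ?M = "\<lambda>a j. map_tensor V (replicate a (id_map V) @ [(int i - 2, \<Delta> i)] @ replicate j (id_map V)) (\<Delta> ?k p x)"
    have T: "\<Delta> ?k p x \<in> tensor_power V ?k (p + (int ?k - 2))"
      using \<Delta>[of ?k] x by (auto simp: tensor_linear_def)
    have "(\<Sum>j=0..n-i. tscale ((-1) ^ (i + j + i * j)) (?M (n - i - j) j)) =
      (\<Sum>j<?k. tscale ((-1) ^ (i + j + i * j)) (?M (n - i - j) j))"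
      by (rule sum.cong) auto
    \<comment> \<open>Summation by the number \<open>a\<close> of identities on the left instead of
      the number \<open>j\<close> on the right.\<close>
    also have "\<dots> = (\<Sum>a<?k. tscale ((-1) ^ (i + (?k - Suc a) + i * (?k - Suc a))) (?M (n - i - (?k - Suc a)) (?k - Suc a)))"
      by (rule sum.nat_diff_reindex[symmetric])
    also have "\<dots> = (\<Sum>a<?k. tscale ((-1) ^ n) (tscale ((-1) ^ (i * (?k - 1 - a) + a)) (?M a (?k - 1 - a))))"
    proof (rule sum.cong[OF refl])
      fix a assume a: "a \<in> {..<?k}"
      have "((-1) ^ (i + (?k - Suc a) + i * (?k - Suc a)) :: rat) = (-1) ^ n * (-1) ^ (i * (?k - 1 - a) + a)"
      proof -
        define b where "b = ?k - Suc a"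
        have "n = i + b + a" "?k - 1 - a = b" using a i by (auto simp: b_def)
        then show ?thesis unfolding b_def[symmetric] by (auto simp: minus_one_power_iff)
      qed
      moreover have "n - i - (?k - Suc a) = a" using a i by auto
      ultimately show "tscale ((-1) ^ (i + (?k - Suc a) + i * (?k - Suc a))) (?M (n - i - (?k - Suc a)) (?k - Suc a)) =
        tscale ((-1) ^ n) (tscale ((-1) ^ (i * (?k - 1 - a) + a)) (?M a (?k - 1 - a)))"
        by simp
    qed
    also have "\<dots> = tscale ((-1) ^ n) (\<Sum>a<?k. tscale ((-1) ^ (i * (?k - 1 - a) + a)) (?M a (?k - 1 - a)))"
      by (rule tn.scale_sum_right[symmetric])
    finally have s: "(\<Sum>j=0..n-i. tscale ((-1) ^ (i + j + i * j)) (?M (n - i - j) j)) = \<dots>" .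
    have "1 \<le> i" using i by simp
    have "lin_ext (desusp V) (\<Sum>j=0..n-i. tscale ((-1) ^ (i + j + i * j)) (?M (n - i - j) j)) =
       tscale ((-1) ^ n) (- der U (cobar_d V \<Delta> i) (lin_ext (desusp V) (\<Delta> ?k p x)))"
      unfolding s lin_ext_scale der_cobar_d_desusp[OF \<open>1 \<le> i\<close> T] by (simp only: minus_minus)
    then show ?thesis using cobar_d_desusp[of ?k x p] x by (simp add: lin_ext_neg)
  qed
  then show ?thesis unfolding stasheff_def lin_ext_sum tn.scale_sum_right by (simp add: lin_ext_sum)
qed

text \<open>In the square of the derivation on a generator, a first application of arity
  \<open>n - i + 1\<close> followed by one of arity \<open>i\<close> gives length \<open>n\<close>;
  collecting that length yields the quadratic sum.\<close>

lemma sum_der_cobar_d: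
  assumes x: "x \<in> carrier (U p)" and n: "1 \<le> n" "n \<le> M"
  shows "(\<Sum>i=1..n. der U (cobar_d V \<Delta> i) (cobar_d V \<Delta> (n - i + 1) p x)) =
    len_part U n (der U (\<lambda>p x. \<Sum>k=1..M. cobar_d V \<Delta> k p x) (\<Sum>k=1..M. cobar_d V \<Delta> k p x))"
proof -
  note gU = gvs_desuspension[OF gV]
  let ?T = "\<Sum>k=1..M. cobar_d V \<Delta> k p x"
  have dk: "cobar_d V \<Delta> k p x \<in> tensor_power U k (p - 1)" if "1 \<le> k" for k
    using tensor_linear_cobar_d[OF that] x by (auto simp: tensor_linear_def)
  have T: "?T \<in> tensors U" by (intro tspan_sum tensor_power_tensors[OF dk]) auto
  have l: "len_part U l ?T = cobar_d V \<Delta> l p x" if "1 \<le> l" "l \<le> M" for l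
  proof -
    have "len_part U l ?T = (\<Sum>k=1..M. if k = l then cobar_d V \<Delta> k p x else 0)"
      unfolding len_part_sum by (rule sum.cong) (auto simp: len_part_same[OF dk])
    then show ?thesis using that by (simp add: sum.delta')
  qed
  have "len_part U n (der U (\<lambda>p x. \<Sum>k=1..M. cobar_d V \<Delta> k p x) ?T) =
     (\<Sum>l=1..n. der U (cobar_d V \<Delta> (n - l + 1)) (len_part U l ?T))"
    by (rule len_part_der[OF gU tensor_linear_cobar_d T n(2)])
  also have "\<dots> = (\<Sum>l=1..n. der U (cobar_d V \<Delta> (n - l + 1)) (cobar_d V \<Delta> l p x))"
    by (rule sum.cong) (use n l in auto)
  also have "\<dots> = (\<Sum>i=1..n. der U (cobar_d V \<Delta> i) (cobar_d V \<Delta> (n - i + 1) p x))"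
    by (rule sum.reindex_bij_witness[of _ "\<lambda>i. n - i + 1" "\<lambda>i. n - i + 1"]) auto
  finally show ?thesis by simp
qed

text \<open>Desuspension is injective on tensors, so the Stasheff expression vanishes as soon as its
  desuspension does, and the latter is up to sign a length component of the squared
  derivation.\<close>

lemma ainf_coalgebraI:
  assumes "\<And>n p x. 1 \<le> n \<Longrightarrow> x \<in> carrier (U p) \<Longrightarrow>
    der U (\<lambda>p x. \<Sum>k=1..n. cobar_d V \<Delta> k p x) (\<Sum>k=1..n. cobar_d V \<Delta> k p x) \<in> tfil U (Suc n) (p - 2)"
  shows "ainf_coalgebra V \<Delta>"
proof -
  have "stasheff V \<Delta> n p x = 0" if n: "1 \<le> n" and x: "x \<in> carrier (V p)" for n p x
  proof -
    have "x \<in> carrier (U (p - 1))" using x by (simp add: desuspension_def)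
    then have "lin_ext (desusp V) (stasheff V \<Delta> n p x) = 0"
      using stasheff_cobar[OF x n] sum_der_cobar_d[OF _ n order_refl] len_part_tfil_0[OF assms[OF n]] by simp
    moreover have "stasheff V \<Delta> n p x \<in> tensors V"
    proof -
      have mt: "map_tensor V (replicate a (id_map V) @ [(int i - 2, \<Delta> i)] @ replicate j (id_map V)) T \<in> tensors V"
        if "1 \<le> i" "T \<in> tensors V" for i a j T
      proof -
        have G: "\<forall>(d, h)\<in>set (replicate a (id_map V) @ [(int i - 2, \<Delta> i)] @ replicate j (id_map V)). glin V V 0 d h"
          using glin_tensor_linear[OF \<Delta>[OF that(1)], of 0] glin_id_map[of V] by (auto simp: case_prod_unfold)
        show ?thesis unfolding map_tensor_lin_ext
          by (rule lin_ext_tspan[OF word_linear_tensor_of_maps[OF gV G] that(2) tensor_of_maps_tensors[OF gV G]])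
      qed
      then show ?thesis unfolding stasheff_def
        by (intro tspan_sum tspan_scale mt glinD(2)[OF glin_tensor_linear[OF \<Delta> le0] x]) auto
    qed
    ultimately show ?thesis using susp_desusp[of "stasheff V \<Delta> n p x" V] by simp
  qed
  then show ?thesis using gV \<Delta> by (simp add: ainf_coalgebra_def stasheff_def)
qed

text \<open>With finitely many nonzero operations the cobar derivation stays within finite tensors,
  and its square vanishes outright because each of its length components does.\<close>

lemma cobar_square_zero:
  assumes co: "ainf_coalgebra V \<Delta>" and x: "x \<in> carrier (U p)"
    and z: "\<And>k p x. M < k \<Longrightarrow> x \<in> carrier (V p) \<Longrightarrow> \<Delta> k p x = 0"
  shows "der U (\<lambda>p x. \<Sum>k=1..M. cobar_d V \<Delta> k p x) (\<Sum>k=1..M. cobar_d V \<Delta> k p x) = 0"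
proof (rule tfil_len_part_eq_0)
  note gU = gvs_desuspension[OF gV]
  have d: "glin U U 1 (-1) (\<lambda>p x. \<Sum>k=1..M. cobar_d V \<Delta> k p x)"
    by (rule glin_sum, rule glin_tensor_linear[OF tensor_linear_cobar_d]) auto
  let ?T = "\<Sum>k=1..M. cobar_d V \<Delta> k p x"
  have T: "?T \<in> tfil U 1 (p - 1)" using glinD(1)[OF d x] by simp
  show "der U (\<lambda>p x. \<Sum>k=1..M. cobar_d V \<Delta> k p x) ?T \<in> tfil U 1 (p - 2)"
    by (rule der_ext_tfil[OF gU glin_tens d T]) auto
  fix n :: nat assume n: "1 \<le> n"
  \<comment> \<open>The comparison in length \<open>n\<close> involves operations up to arity
    \<open>n\<close>; padding with the zero operations beyond \<open>M\<close> does not change the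
    derivation.\<close>
  let ?N = "max M n"
  have eq: "(\<Sum>k=1..?N. cobar_d V \<Delta> k q y) = (\<Sum>k=1..M. cobar_d V \<Delta> k q y)" if "y \<in> carrier (U q)" for q y
  proof (rule sum.mono_neutral_right)
    have y: "y \<in> carrier (V (q + 1))" using that by (simp add: desuspension_def)
    have "cobar_d V \<Delta> i q y = 0" if "M < i" for i
      using cobar_d_desusp[OF _ y, of i] z[OF that y] that by simp
    then show "\<forall>i\<in>{1..?N} - {1..M}. cobar_d V \<Delta> i q y = 0" by auto
  qed auto
  have d': "glin U U 1 (-1) (\<lambda>p x. \<Sum>k=1..?N. cobar_d V \<Delta> k p x)"
    by (rule glin_sum, rule glin_tensor_linear[OF tensor_linear_cobar_d]) auto
  have "len_part U n (der U (\<lambda>p x. \<Sum>k=1..M. cobar_d V \<Delta> k p x) ?T) = len_part U n (der U (\<lambda>p x. \<Sum>k=1..?N. cobar_d V \<Delta> k p x) ?T)"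
    by (rule arg_cong[of _ _ "len_part U n"], rule der_ext_cong[OF gU glin_tens d d' _ T]) (rule eq[symmetric])
  also have "\<dots> = (\<Sum>i=1..n. der U (cobar_d V \<Delta> i) (cobar_d V \<Delta> (n - i + 1) p x))"
    using sum_der_cobar_d[OF x n, of ?N] eq[OF x] by simp
  also have "\<dots> = 0"
  proof -
    have x': "x \<in> carrier (V (p + 1))" using x by (simp add: desuspension_def)
    have "stasheff V \<Delta> n (p + 1) x = 0" using co n x' by (simp add: ainf_coalgebra_def stasheff_def)
    then have "tscale ((-1) ^ n) (\<Sum>i=1..n. der U (cobar_d V \<Delta> i) (cobar_d V \<Delta> (n - i + 1) p x)) = 0"
      using stasheff_cobar[OF x' n] by simp
    then show ?thesis by simp
  qed
  finally show "len_part U n (der U (\<lambda>p x. \<Sum>k=1..M. cobar_d V \<Delta> k p x) ?T) = 0" .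
qed

end

subsection \<open>Rational chains\<close>

abbreviation (input) "bas \<sigma> \<equiv> Poly_Mapping.single \<sigma> (1::rat)"

lemma lookup_qscale: "Poly_Mapping.lookup (qscale c a) \<sigma> = c * Poly_Mapping.lookup a \<sigma>"
  by (simp add: qscale_def Poly_Mapping.map.rep_eq when_def)

interpretation qv: vector_space "qscale :: rat \<Rightarrow> ('x \<Rightarrow>\<^sub>0 rat) \<Rightarrow> ('x \<Rightarrow>\<^sub>0 rat)"
  by unfold_locales (auto intro!: poly_mapping_eqI simp: lookup_qscale lookup_add algebra_simps)

lemma qscale_single: "qscale c (Poly_Mapping.single \<sigma> r) = Poly_Mapping.single \<sigma> (c * r)"
  by (rule poly_mapping_eqI) (simp add: lookup_qscale lookup_single when_def)

lemma keys_qscale: "Poly_Mapping.keys (qscale c a) \<subseteq> Poly_Mapping.keys a"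
  by (auto simp: in_keys_iff lookup_qscale)

lemma keys_add_subset: "Poly_Mapping.keys (a + b) \<subseteq> Poly_Mapping.keys a \<union> Poly_Mapping.keys (b :: 'x \<Rightarrow>\<^sub>0 rat)"
  by (auto simp: in_keys_iff lookup_add)

lemma qchain_sum: "c = (\<Sum>\<sigma>\<in>Poly_Mapping.keys c. qscale (Poly_Mapping.lookup c \<sigma>) (bas \<sigma>))"
proof (rule poly_mapping_eqI)
  fix \<tau>
  have "(\<Sum>\<sigma>\<in>Poly_Mapping.keys c. Poly_Mapping.lookup c \<sigma> * (if \<sigma> = \<tau> then 1 else 0)) =
    (\<Sum>\<sigma>\<in>Poly_Mapping.keys c. if \<sigma> = \<tau> then Poly_Mapping.lookup c \<tau> else 0)"
    by (rule sum.cong) auto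
  then show "Poly_Mapping.lookup c \<tau> =
    Poly_Mapping.lookup (\<Sum>\<sigma>\<in>Poly_Mapping.keys c. qscale (Poly_Mapping.lookup c \<sigma>) (bas \<sigma>)) \<tau>"
    by (auto simp: lookup_sum lookup_qscale lookup_single when_def in_keys_iff)
qed

lemma qchain_induct [consumes 1, case_names zero add scale single]:
  assumes "Poly_Mapping.keys c \<subseteq> S" and z: "P 0"
    and a: "\<And>a b. Poly_Mapping.keys a \<subseteq> S \<Longrightarrow> Poly_Mapping.keys b \<subseteq> S \<Longrightarrow> P a \<Longrightarrow> P b \<Longrightarrow> P (a + b)"
    and s: "\<And>r a. Poly_Mapping.keys a \<subseteq> S \<Longrightarrow> P a \<Longrightarrow> P (qscale r a)"
    and t: "\<And>\<sigma>. \<sigma> \<in> S \<Longrightarrow> P (bas \<sigma>)"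
  shows "P c"
proof -
  have "F \<subseteq> S \<Longrightarrow> Poly_Mapping.keys (\<Sum>\<sigma>\<in>F. qscale (r \<sigma>) (bas \<sigma>)) \<subseteq> S \<and> P (\<Sum>\<sigma>\<in>F. qscale (r \<sigma>) (bas \<sigma>))" for F r
  proof (induction F rule: infinite_finite_induct)
    case (insert \<sigma> F)
    have "Poly_Mapping.keys (qscale (r \<sigma>) (bas \<sigma>)) \<subseteq> S" "P (qscale (r \<sigma>) (bas \<sigma>))"
      using insert.prems keys_qscale[of "r \<sigma>" "bas \<sigma>"] s[of "bas \<sigma>" "r \<sigma>"] t[of \<sigma>] by auto
    with insert show ?case using keys_add_subset[of "qscale (r \<sigma>) (bas \<sigma>)" "\<Sum>\<sigma>\<in>F. qscale (r \<sigma>) (bas \<sigma>)"] a by auto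
  qed (auto simp: z)
  then show ?thesis using qchain_sum[of c] assms(1) by metis
qed

text \<open>The index set of these sums is the support of the chain, which is not additive; on a
  common larger support the extra coefficients are 0. Linear extensions, the augmentation and the
  diagonal are all of this form.\<close>

lemma
  fixes scl :: "rat \<Rightarrow> 'v::ab_group_add \<Rightarrow> 'v" and h :: "'x \<Rightarrow> 'v"
  assumes vs: "vector_space scl"
  defines "L \<equiv> \<lambda>c. \<Sum>\<sigma>\<in>Poly_Mapping.keys c. scl (Poly_Mapping.lookup c \<sigma>) (h \<sigma>)"
  shows keys_sum_add: "L (a + b) = L a + L b"
    and keys_sum_scale: "L (qscale r a) = scl r (L a)"
    and keys_sum_single: "L (bas \<sigma>) = h \<sigma>"
proof -
  interpret vector_space scl by (rule vs)
  have L: "L c = (\<Sum>\<sigma>\<in>S. scl (Poly_Mapping.lookup c \<sigma>) (h \<sigma>))"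
    if "finite S" "Poly_Mapping.keys c \<subseteq> S" for c S
    unfolding L_def by (rule sum.mono_neutral_left) (use that in \<open>auto simp: in_keys_iff\<close>)
  let ?S = "Poly_Mapping.keys a \<union> Poly_Mapping.keys b"
  show "L (a + b) = L a + L b"
    using L[of ?S "a + b"] L[of ?S a] L[of ?S b] keys_add_subset[of a b]
    by (simp add: lookup_add scale_left_distrib sum.distrib)
  show "L (qscale r a) = scl r (L a)"
    using L[of "Poly_Mapping.keys a" "qscale r a"] keys_qscale[of r a]
    by (simp add: lookup_qscale scale_sum_right L_def)
  show "L (bas \<sigma>) = h \<sigma>" by (simp add: L_def)
qed

lemma vector_space_rat: "vector_space ((*) :: rat \<Rightarrow> rat \<Rightarrow> rat)"
  by unfold_locales (auto simp: algebra_simps)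

lemmas qextend_add = keys_sum_add[OF qv.vector_space_axioms, folded qextend_def]
lemmas qextend_scale = keys_sum_scale[OF qv.vector_space_axioms, folded qextend_def]
lemmas qextend_single = keys_sum_single[OF qv.vector_space_axioms, folded qextend_def]

lemma augmentation_add: "augmentation (a + b) = augmentation a + augmentation b"
  and augmentation_scale: "augmentation (qscale r a) = r * augmentation a"
  and augmentation_single: "augmentation (bas \<sigma>) = 1"
  using keys_sum_add[OF vector_space_rat, of a b "\<lambda>_. 1"] keys_sum_scale[OF vector_space_rat, of r a "\<lambda>_. 1"]
    keys_sum_single[OF vector_space_rat, of \<sigma> "\<lambda>_. 1"]
  by (simp_all add: augmentation_def)

lemma augmentation_diff: "augmentation (a - b) = augmentation a - augmentation b"
  using augmentation_add[of "a - b" b] by simp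

lemma augmentation_0 [simp]: "augmentation 0 = 0"
  by (simp add: augmentation_def)

lemma boundary_add: "boundary p (a + b) = boundary p a + boundary p b"
  and boundary_scale: "boundary p (qscale r a) = qscale r (boundary p a)"
  by (auto simp: boundary_def qextend_add qextend_scale)

lemma boundary_0 [simp]: "boundary p 0 = 0"
  by (auto simp: boundary_def qextend_def)

lemma boundary_diff: "boundary p (a - b) = boundary p a - boundary p b"
  using boundary_add[of p "a - b" b] by (simp add: algebra_simps)

lemma boundary_nonpos: "p \<le> 0 \<Longrightarrow> boundary p a = 0"
  by (simp add: boundary_def)

lemma boundary_single:
  "0 < p \<Longrightarrow> boundary p (bas \<sigma>) = (\<Sum>k\<le>nat p. qscale ((-1) ^ k) (bas (singular_face (nat p) k \<sigma>)))"
  by (simp add: boundary_def qextend_single qscale_single)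

lemma chain_push_add: "chain_push g p (a + b) = chain_push g p a + chain_push g p b"
  and chain_push_scale: "chain_push g p (qscale r a) = qscale r (chain_push g p a)"
  and chain_push_single: "chain_push g p (bas \<sigma>) = bas (simplex_map (nat p) g \<sigma>)"
  by (auto simp: chain_push_def qextend_add qextend_scale qextend_single)

lemma chain_push_0 [simp]: "chain_push g p 0 = 0"
  by (simp add: chain_push_def qextend_def)

lemma chain_push_sum: "chain_push g p (sum f I) = (\<Sum>i\<in>I. chain_push g p (f i))"
  by (induction I rule: infinite_finite_induct) (auto simp: chain_push_add)

lemma chains_simps [simp]:
  "c \<in> carrier (chains X p) \<longleftrightarrow> Poly_Mapping.keys c \<subseteq> singular_simplex_set (nat p) X \<and> (p < 0 \<longrightarrow> c = 0)"
  "\<zero>\<^bsub>chains X p\<^esub> = 0" "x \<oplus>\<^bsub>chains X p\<^esub> y = x + y" "r \<odot>\<^bsub>chains X p\<^esub> x = qscale r x"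
  by (simp_all add: chains_def)

lemma reduced_chains_simps [simp]:
  "c \<in> carrier (reduced_chains X p) \<longleftrightarrow> c \<in> carrier (chains X p) \<and> (p = 0 \<longrightarrow> augmentation c = 0)"
  "\<zero>\<^bsub>reduced_chains X p\<^esub> = 0" "x \<oplus>\<^bsub>reduced_chains X p\<^esub> y = x + y" "r \<odot>\<^bsub>reduced_chains X p\<^esub> x = qscale r x"
  by (simp_all add: reduced_chains_def chains_def)

lemma subspace_chains: "qv.subspace (carrier (chains X p))"
  using keys_qscale by (fastforce simp: qv.subspace_def dest: subsetD[OF keys_add_subset])

lemma subspace_reduced_chains: "qv.subspace (carrier (reduced_chains X p))"
  using subspace_chains[of X p] by (simp add: qv.subspace_def augmentation_add augmentation_scale)

lemma cring_rat_ring: "cring rat_ring"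
proof (rule cringI)
  show "abelian_group rat_ring"
    by (rule abelian_groupI) (auto simp: rat_ring_def intro: exI[of _ "- _"] ab_left_minus)
  show "comm_monoid rat_ring" by (rule comm_monoidI) (auto simp: rat_ring_def)
qed (auto simp: rat_ring_def algebra_simps)

lemma module_subspace:
  fixes M :: "(rat, 'x \<Rightarrow>\<^sub>0 rat) module"
  assumes sub: "qv.subspace (carrier M)"
    and ops: "\<zero>\<^bsub>M\<^esub> = 0" "\<And>x y. x \<oplus>\<^bsub>M\<^esub> y = x + y" "\<And>r x. r \<odot>\<^bsub>M\<^esub> x = qscale r x"
  shows "module rat_ring M"
proof (rule moduleI[OF cring_rat_ring])
  note s = qv.subspace_0[OF sub] qv.subspace_add[OF sub] qv.subspace_scale[OF sub]
  show "abelian_group M"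
  proof (rule abelian_groupI)
    show "\<exists>y\<in>carrier M. y \<oplus>\<^bsub>M\<^esub> x = \<zero>\<^bsub>M\<^esub>" if "x \<in> carrier M" for x
      using s(3)[OF that, of "-1"] by (intro bexI[of _ "qscale (-1) x"]) (simp_all add: ops)
  qed (auto simp: ops s)
qed (auto simp: ops qv.subspace_0[OF sub] qv.subspace_add[OF sub] rat_ring_def qv.scale_left_distrib qv.scale_right_distrib qv.subspace_scale[OF sub])

lemma gvs_chains: "graded_vector_space (chains X)"
  unfolding graded_vector_space_def by (auto intro!: module_subspace subspace_chains)

lemma gvs_reduced_chains: "graded_vector_space (reduced_chains X)"
  unfolding graded_vector_space_def by (auto intro!: module_subspace subspace_reduced_chains)

lemma chains_induct [consumes 1, case_names zero add scale single]:
  assumes "c \<in> carrier (chains X p)" "P 0"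
    and "\<And>a b. a \<in> carrier (chains X p) \<Longrightarrow> b \<in> carrier (chains X p) \<Longrightarrow> P a \<Longrightarrow> P b \<Longrightarrow> P (a + b)"
    and "\<And>r a. a \<in> carrier (chains X p) \<Longrightarrow> P a \<Longrightarrow> P (qscale r a)"
    and "\<And>\<sigma>. 0 \<le> p \<Longrightarrow> singular_simplex (nat p) X \<sigma> \<Longrightarrow> P (bas \<sigma>)"
  shows "P c"
proof (cases "p < 0")
  case True
  then show ?thesis using assms(1,2) by simp
next
  case False
  have "Poly_Mapping.keys c \<subseteq> singular_simplex_set (nat p) X" using assms(1) by simp
  then show ?thesis by (induction rule: qchain_induct) (use assms False in auto)
qed

lemma bas_chains [simp]: "bas \<sigma> \<in> carrier (chains X p) \<longleftrightarrow> 0 \<le> p \<and> singular_simplex (nat p) X \<sigma>"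
proof -
  have "bas \<sigma> \<noteq> 0" by (metis lookup_single_eq lookup_zero zero_neq_one)
  then show ?thesis by auto
qed

lemma chains_closed:
  "0 \<in> carrier (chains X p)"
  "a \<in> carrier (chains X p) \<Longrightarrow> b \<in> carrier (chains X p) \<Longrightarrow> a + b \<in> carrier (chains X p)"
  "a \<in> carrier (chains X p) \<Longrightarrow> b \<in> carrier (chains X p) \<Longrightarrow> a - b \<in> carrier (chains X p)"
  "a \<in> carrier (chains X p) \<Longrightarrow> qscale r a \<in> carrier (chains X p)"
  "(\<And>i. i \<in> I \<Longrightarrow> f i \<in> carrier (chains X p)) \<Longrightarrow> sum f I \<in> carrier (chains X p)"
  using subspace_chains[of X p] by (blast intro: qv.subspace_0 qv.subspace_add qv.subspace_diff qv.subspace_scale qv.subspace_sum)+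

declare chains_simps(1) [simp del]

lemma boundary_chains: "c \<in> carrier (chains X p) \<Longrightarrow> boundary p c \<in> carrier (chains X (p - 1))"
proof (induction rule: chains_induct)
  case (single \<sigma>)
  show ?case
  proof (cases "p = 0")
    case False
    then have p: "0 < p" "1 \<le> nat p" "nat (p - 1) = nat p - Suc 0" using single by auto
    show ?thesis unfolding boundary_single[OF p(1)]
      by (intro chains_closed) (use single p singular_simplex_singular_face[OF single(2) p(2)] in auto)
  qed (simp add: boundary_nonpos chains_closed)
qed (auto simp: boundary_add boundary_scale chains_closed)

lemma boundary_augmentation: "c \<in> carrier (chains X 1) \<Longrightarrow> augmentation (boundary 1 c) = 0"
proof (induction rule: chains_induct)
  case (single \<sigma>)
  then show ?case by (simp add: boundary_single augmentation_diff augmentation_single)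
qed (auto simp: boundary_add boundary_scale augmentation_add augmentation_scale)

lemma boundary_reduced_chains: "c \<in> carrier (reduced_chains X p) \<Longrightarrow> boundary p c \<in> carrier (reduced_chains X (p - 1))"
  using boundary_chains[of c X p] boundary_augmentation[of c X] by auto

text \<open>Used to import \<open>\<partial>\<partial> = 0\<close> from the integral chains of the library.\<close>

definition rat_chain :: "('x \<Rightarrow>\<^sub>0 int) \<Rightarrow> ('x \<Rightarrow>\<^sub>0 rat)"
  where "rat_chain = Poly_Mapping.map of_int"

lemma lookup_rat_chain: "Poly_Mapping.lookup (rat_chain c) \<sigma> = of_int (Poly_Mapping.lookup c \<sigma>)"
  by (simp add: rat_chain_def Poly_Mapping.map.rep_eq when_def)

lemma rat_chain_diff: "rat_chain (a - b) = rat_chain a - rat_chain b"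
  and rat_chain_0 [simp]: "rat_chain 0 = 0"
  and rat_chain_of: "rat_chain (frag_of \<sigma>) = bas \<sigma>"
  and rat_chain_cmul: "rat_chain (frag_cmul k c) = qscale (of_int k) (rat_chain c)"
  by (auto intro!: poly_mapping_eqI simp: lookup_rat_chain lookup_minus lookup_single when_def lookup_qscale)

lemma rat_chain_sum: "rat_chain (sum f I) = (\<Sum>i\<in>I. rat_chain (f i))"
proof (induction I rule: infinite_finite_induct)
  case (insert x F)
  have "rat_chain (a + b) = rat_chain a + rat_chain b" for a b :: "'a \<Rightarrow>\<^sub>0 int"
    by (rule poly_mapping_eqI) (simp add: lookup_rat_chain lookup_add)
  with insert show ?case by simp
qed auto

lemma boundary_rat_chain: "0 < p \<Longrightarrow> boundary p (rat_chain c) = rat_chain (chain_boundary (nat p) c)"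
proof -
  assume p: "0 < p"
  have "Poly_Mapping.keys c \<subseteq> UNIV" by simp
  then show ?thesis
    by (induction c rule: frag_induction)
      (use p in \<open>auto simp: rat_chain_diff boundary_diff chain_boundary_diff rat_chain_of boundary_single
        chain_boundary_of rat_chain_sum rat_chain_cmul\<close>)
qed

lemma boundary_boundary: "c \<in> carrier (chains X p) \<Longrightarrow> boundary (p - 1) (boundary p c) = 0"
proof (induction rule: chains_induct)
  case (single \<sigma>)
  show ?case
  proof (cases "p \<le> 1")
    case False
    then have p: "0 < p" "0 < p - 1" "nat p = Suc (nat (p - 1))" by auto
    have "boundary (p - 1) (boundary p (bas \<sigma>)) = rat_chain (chain_boundary (nat (p - 1)) (chain_boundary (nat p) (frag_of \<sigma>)))"
      using p by (simp add: rat_chain_of[symmetric] boundary_rat_chain)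
    also have "\<dots> = 0" using single unfolding p(3)
      by (subst chain_boundary_boundary_alt) (auto simp: singular_chain_of)
    finally show ?thesis .
  qed (simp add: boundary_nonpos)
qed (auto simp: boundary_add boundary_scale)

lemma chain_push_chains:
  assumes g: "continuous_map X Y g" and "c \<in> carrier (chains X p)"
  shows "chain_push g p c \<in> carrier (chains Y p)"
  using assms(2)
proof (induction rule: chains_induct)
  case (single \<sigma>)
  then show ?case using singular_simplex_simplex_map[OF _ g] by (simp add: chain_push_single)
qed (auto simp: chain_push_add chain_push_scale chains_closed)

lemma augmentation_chain_push: "c \<in> carrier (chains X p) \<Longrightarrow> augmentation (chain_push g p c) = augmentation c"
  by (induction rule: chains_induct)
    (auto simp: chain_push_add chain_push_scale chain_push_single augmentation_add augmentation_scale augmentation_single)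

lemma chain_push_reduced_chains:
  "continuous_map X Y g \<Longrightarrow> c \<in> carrier (reduced_chains X p) \<Longrightarrow> chain_push g p c \<in> carrier (reduced_chains Y p)"
  using augmentation_chain_push[of c X p g] by (auto simp: chain_push_chains)

lemma chain_push_boundary:
  "c \<in> carrier (chains X p) \<Longrightarrow> boundary p (chain_push g p c) = chain_push g (p - 1) (boundary p c)"
proof (induction rule: chains_induct)
  case (single \<sigma>)
  show ?case
  proof (cases "p = 0")
    case False
    then have p: "0 < p" "1 \<le> nat p" "nat (p - 1) = nat p - Suc 0" using single by auto
    have "simplex_map (nat p - Suc 0) g (\<sigma> \<circ> simplical_face k) =
        simplex_map (nat p - Suc 0) g (singular_face (nat p) k \<sigma>)" for k
      by (auto simp: simplex_map_def singular_face_def fun_eq_iff restrict_def)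
    then show ?thesis
      using p by (simp add: chain_push_single boundary_single chain_push_sum chain_push_scale singular_face_simplex_map)
  qed (simp add: boundary_nonpos)
qed (auto simp: boundary_add boundary_scale chain_push_add chain_push_scale)

lemma chain_push_id: "c \<in> carrier (chains X p) \<Longrightarrow> (\<And>x. x \<in> topspace X \<Longrightarrow> g x = x) \<Longrightarrow> chain_push g p c = c"
proof (induction rule: chains_induct)
  case (single \<sigma>)
  then show ?case by (simp add: chain_push_single simplex_map_id_gen[of _ X])
qed (auto simp: chain_push_add chain_push_scale)

text \<open>With \<open>id\<close> continuous from \<open>X\<close> to \<open>Y\<close>, a singular
  simplex of \<open>X\<close> is, as a function, also one of \<open>Y\<close>; on chains the
  inclusion is therefore literally the identity.\<close>

lemma chains_mono:
  assumes "continuous_map X Y id" "c \<in> carrier (chains X p)"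
  shows "c \<in> carrier (chains Y p)"
  using chain_push_chains[OF assms] chain_push_id[OF assms(2), of id] by simp

lemma reduced_chains_mono:
  assumes "continuous_map X Y id" "c \<in> carrier (reduced_chains X p)"
  shows "c \<in> carrier (reduced_chains Y p)"
  using chains_mono[OF assms(1)] assms(2) by simp

subsection \<open>Faces of singular simplices\<close>

definition vshift :: "nat \<Rightarrow> (nat \<Rightarrow> real) \<Rightarrow> nat \<Rightarrow> real"
  where "vshift k x = (\<lambda>i. if i < k then 0 else x (i - k))"

lemma back_face_vshift: "back_face p k \<sigma> = restrict (\<lambda>x. \<sigma> (vshift k x)) (standard_simplex (p - k))"
  by (simp add: back_face_def vshift_def)

lemma vshift_standard_simplex: "k \<le> p \<Longrightarrow> x \<in> standard_simplex (p - k) \<Longrightarrow> vshift k x \<in> standard_simplex p"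
proof -
  assume k: "k \<le> p" and x: "x \<in> standard_simplex (p - k)"
  have "(\<Sum>i\<le>p. vshift k x i) = (\<Sum>i\<in>{k..p}. x (i - k))"
    unfolding vshift_def by (rule sum.mono_neutral_cong_right) auto
  also have "\<dots> = (\<Sum>i\<le>p - k. x i)"
    by (rule sum.reindex_bij_witness[of _ "\<lambda>i. i + k" "\<lambda>i. i - k"]) (use k in auto)
  finally have "(\<Sum>i\<le>p. vshift k x i) = 1" using x by (simp add: standard_simplex_def)
  moreover have "x (i - k) = 0" if "i > p" for i
    using x that k by (auto simp: standard_simplex_def)
  ultimately show ?thesis using x by (auto simp: standard_simplex_def) (auto simp: vshift_def)
qed

lemma in_simplex_mono: "x \<in> standard_simplex k \<Longrightarrow> k \<le> l \<Longrightarrow> x \<in> standard_simplex l"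
  using standard_simplex_mono by blast

lemma singular_simplex_front_face:
  assumes "singular_simplex p X \<sigma>" "k \<le> p"
  shows "singular_simplex k X (front_face k \<sigma>)"
  using assms standard_simplex_mono[OF assms(2)]
  by (auto simp: singular_simplex_def front_face_def intro: continuous_map_from_subtopology_mono)

lemma singular_simplex_back_face:
  assumes "singular_simplex p X \<sigma>" "k \<le> p"
  shows "singular_simplex (p - k) X (back_face p k \<sigma>)"
proof -
  have "continuous_map (powertop_real UNIV) (powertop_real UNIV) (vshift k)"
    unfolding vshift_def continuous_map_componentwise_UNIV
    using continuous_map_product_projection[of _ UNIV "\<lambda>_. euclideanreal"] by auto
  then have "continuous_map (subtopology (powertop_real UNIV) (standard_simplex (p - k)))
      (subtopology (powertop_real UNIV) (standard_simplex p)) (vshift k)"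
    using vshift_standard_simplex[OF assms(2)]
    by (auto simp: continuous_map_in_subtopology intro: continuous_map_from_subtopology)
  then have "continuous_map (subtopology (powertop_real UNIV) (standard_simplex (p - k))) X (\<sigma> \<circ> vshift k)"
    using assms(1) by (auto simp: singular_simplex_def intro: continuous_map_compose)
  then show ?thesis by (auto simp: singular_simplex_def back_face_vshift o_def)
qed

lemma vshift_vshift: "vshift k (vshift l x) = vshift (k + l) x"
  by (auto simp: vshift_def fun_eq_iff)

lemma front_front: "l \<le> k \<Longrightarrow> front_face l (front_face k \<sigma>) = front_face l \<sigma>"
  by (auto simp: front_face_def fun_eq_iff restrict_def dest: in_simplex_mono)

lemma back_front: "l \<le> k \<Longrightarrow> k \<le> p \<Longrightarrow> back_face k l (front_face k \<sigma>) = front_face (k - l) (back_face p l \<sigma>)"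
  using vshift_standard_simplex[of l k]
  by (auto simp: front_face_def back_face_vshift fun_eq_iff restrict_def dest: in_simplex_mono[of _ "k - l" "p - l"])

lemma back_back: "k + l \<le> p \<Longrightarrow> back_face (p - k) l (back_face p k \<sigma>) = back_face p (k + l) \<sigma>"
  using vshift_standard_simplex[of l "p - k"]
  by (auto simp: back_face_vshift fun_eq_iff restrict_def vshift_vshift)

lemma simplical_face_above: "x \<in> standard_simplex k \<Longrightarrow> k < i \<Longrightarrow> simplical_face i x = x"
  by (auto simp: simplical_face_def standard_simplex_def fun_eq_iff)

lemma simplical_face_vshift:
  "i \<le> k \<Longrightarrow> simplical_face i (vshift k x) = vshift (Suc k) x"
  "k \<le> i \<Longrightarrow> simplical_face i (vshift k x) = vshift k (simplical_face (i - k) x)"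
  by (auto simp: simplical_face_def vshift_def fun_eq_iff)

text \<open>Face \<open>i\<close> of a simplex, cut at position \<open>k\<close>: for
  \<open>i \<le> k\<close> the removed vertex lies in the front part, which becomes a face of the
  front \<open>Suc k\<close>-face; for \<open>k < i\<close> it lies in the back part. The four
  lemmas from here on describe both parts in both cases.\<close>

lemma front_singular_face_le:
  "i \<le> k \<Longrightarrow> k < p \<Longrightarrow> front_face k (singular_face p i \<sigma>) = singular_face (Suc k) i (front_face (Suc k) \<sigma>)"
  using simplical_face_in_standard_simplex[of "Suc k" i]
  by (auto simp: front_face_def singular_face_def fun_eq_iff restrict_def dest: in_simplex_mono[of _ k "p - Suc 0"])

lemma front_singular_face_gt:
  "k < i \<Longrightarrow> i \<le> p \<Longrightarrow> front_face k (singular_face p i \<sigma>) = front_face k \<sigma>"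
  by (auto simp: front_face_def singular_face_def fun_eq_iff restrict_def simplical_face_above dest: in_simplex_mono[of _ k "p - Suc 0"])

lemma back_singular_face_le:
  "i \<le> k \<Longrightarrow> k < p \<Longrightarrow> back_face (p - 1) k (singular_face p i \<sigma>) = back_face p (Suc k) \<sigma>"
  using vshift_standard_simplex[of k "p - 1"]
  by (auto simp: back_face_vshift singular_face_def fun_eq_iff restrict_def simplical_face_vshift)

lemma back_singular_face_gt:
  "k < i \<Longrightarrow> i \<le> p \<Longrightarrow> back_face (p - 1) k (singular_face p i \<sigma>) = singular_face (p - k) (i - k) (back_face p k \<sigma>)"
  using vshift_standard_simplex[of k "p - 1"] simplical_face_in_standard_simplex[of "p - k" "i - k"]
  by (auto simp: back_face_vshift singular_face_def fun_eq_iff restrict_def simplical_face_vshift diff_commute)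

text \<open>The last face of a front face and, in the next lemma, the first face of a back face
  remove the vertex at which the simplex is cut; these are the terms that cancel in the boundary of
  the Alexander-Whitney diagonal.\<close>

lemma singular_face_front: "singular_face (Suc k) (Suc k) (front_face (Suc k) \<sigma>) = front_face k \<sigma>"
  by (auto simp: front_face_def singular_face_def fun_eq_iff restrict_def simplical_face_above dest: in_simplex_mono[of _ k "Suc k"])

lemma singular_face_back:
  assumes "k < p"
  shows "singular_face (p - k) 0 (back_face p k \<sigma>) = back_face p (Suc k) \<sigma>"
proof -
  have v: "vshift k (simplical_face 0 x) = vshift (Suc k) x" for x
    using simplical_face_vshift(1)[of k k x] simplical_face_vshift(2)[of k k x] by simp
  show ?thesis
    using simplical_face_in_standard_simplex[of "p - k" 0] assms
    by (auto simp: v back_face_vshift singular_face_def fun_eq_iff restrict_def)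
qed

lemma front_face_full: "singular_simplex p X \<sigma> \<Longrightarrow> front_face p \<sigma> = \<sigma>"
  by (auto simp: front_face_def singular_simplex_def extensional_restrict)

lemma back_face_0: "singular_simplex p X \<sigma> \<Longrightarrow> back_face p 0 \<sigma> = \<sigma>"
  by (auto simp: back_face_vshift vshift_def singular_simplex_def extensional_restrict)

subsection \<open>The Alexander-Whitney coalgebra\<close>

lemma map_tensor_pair:
  assumes gW: "graded_vector_space W" and g: "glin V W 0 d g" and h: "glin V W 0 e h"
    and ab: "a \<in> carrier (V p)" "b \<in> carrier (V q)"
  shows "map_tensor W [(d, g), (e, h)] (tens V [(p, a), (q, b)]) = tscale (ksign (e * p)) (tprod W (g p a) (h q b))"
proof -
  have wl: "word_linear V (tensor_of_maps W [(d, g), (e, h)])"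
    by (rule word_linear_tensor_of_maps[OF gW]) (use g h in auto)
  show ?thesis
    unfolding map_tensor_lin_ext lin_ext_tens[OF wl]
    using ab tprod_unit_right[OF gW glinD(2)[OF h ab(2)]] by simp
qed

lemma map_tensor_pair_sum: "map_tensor W gs (sum f I) = (\<Sum>i\<in>I. map_tensor W gs (f i))"
  by (simp add: map_tensor_lin_ext lin_ext_sum)

lemma tensor_square_induct [consumes 1, case_names zero add scale tens]:
  assumes "T \<in> tensor_power V 2 r" "P 0"
    and "\<And>S T. S \<in> tensor_power V 2 r \<Longrightarrow> T \<in> tensor_power V 2 r \<Longrightarrow> P S \<Longrightarrow> P T \<Longrightarrow> P (S + T)"
    and "\<And>c S. S \<in> tensor_power V 2 r \<Longrightarrow> P S \<Longrightarrow> P (tscale c S)"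
    and t: "\<And>p a q b. a \<in> carrier (V p) \<Longrightarrow> b \<in> carrier (V q) \<Longrightarrow> r = p + q \<Longrightarrow> P (tens V [(p, a), (q, b)])"
  shows "P T"
  using assms(1) unfolding tensor_power_tspan
proof (induction rule: tspan_induct)
  case (tens xs)
  then have "length xs = Suc (Suc 0)" by simp
  then obtain u v where "xs = [u, v]" by (auto simp: length_Suc_conv)
  with tens show ?case using t[of "snd u" "fst u" "snd v" "fst v"] by simp
qed (use assms in \<open>auto simp: tensor_power_tspan\<close>)

lemma tens_pair: "graded_vector_space V \<Longrightarrow> a \<in> carrier (V p) \<Longrightarrow> b \<in> carrier (V q) \<Longrightarrow>
    tens V [(p, a), (q, b)] = tprod V (tens V [(p, a)]) (tens V [(q, b)])"
  by (simp add: tprod_tens)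

lemma tens_zero: "graded_vector_space V \<Longrightarrow> tens V [(p, \<zero>\<^bsub>V p\<^esub>)] = 0"
  using tens_smult[of "[]" V "[]" "\<zero>\<^bsub>V p\<^esub>" p 0] gvs_zero_closed[of V p] gvs_closed(3)[of V "\<zero>\<^bsub>V p\<^esub>" p] by simp

abbreviation (input) "bdry_map V \<equiv> \<lambda>p x. tens V [(p - 1, boundary p x)]"

lemma tens_chains_0 [simp]: "tens (chains X) [(p, 0)] = 0"
  using tens_zero[OF gvs_chains, of X p] by simp

lemma tens_chains_sum:
  "(\<And>i. i \<in> I \<Longrightarrow> a i \<in> carrier (chains X p)) \<Longrightarrow>
    tens (chains X) [(p, \<Sum>i\<in>I. qscale (r i) (a i))] = (\<Sum>i\<in>I. tscale (r i) (tens (chains X) [(p, a i)]))"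
proof (induction I rule: infinite_finite_induct)
  case (insert i F)
  then have "qscale (r i) (a i) \<in> carrier (chains X p)" "(\<Sum>i\<in>F. qscale (r i) (a i)) \<in> carrier (chains X p)"
    by (auto intro!: chains_closed)
  from glinD(3)[OF glin_tens[of "chains X"] this] glinD(4)[OF glin_tens[of "chains X"], of "a i" p "r i"]
  show ?case using insert by simp
qed auto

lemma glin_tens_map:
  assumes gW: "graded_vector_space W" and "\<And>p x. x \<in> carrier (V p) \<Longrightarrow> f p x \<in> carrier (W (p + e))"
    and "\<And>p x y. x \<in> carrier (V p) \<Longrightarrow> y \<in> carrier (V p) \<Longrightarrow> f p (x \<oplus>\<^bsub>V p\<^esub> y) = f p x \<oplus>\<^bsub>W (p + e)\<^esub> f p y"
    and "\<And>p x c. x \<in> carrier (V p) \<Longrightarrow> f p (c \<odot>\<^bsub>V p\<^esub> x) = c \<odot>\<^bsub>W (p + e)\<^esub> f p x"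
  shows "glin V W 1 e (\<lambda>p x. tens W [(p + e, f p x)])"
  using assms glinD(3,4)[OF glin_tens[of W]] by (auto simp: glin_def intro!: tspan_tens)

lemma glin_bdry_map: "glin (chains X) (chains X) 1 (-1) (bdry_map (chains X))"
  and glin_bdry_map_reduced: "glin (reduced_chains X) (reduced_chains X) 1 (-1) (bdry_map (reduced_chains X))"
  using glin_tens_map[OF gvs_chains, where e = "-1" and f = boundary and V = "chains X" and X1 = X]
    glin_tens_map[OF gvs_reduced_chains, where e = "-1" and f = boundary and V = "reduced_chains X" and X1 = X]
    boundary_reduced_chains[of _ X]
  by (simp_all add: boundary_chains boundary_add boundary_scale)

lemma aw_comult_alt: "aw_comult X p c = (\<Sum>\<sigma>\<in>Poly_Mapping.keys c. tscale (Poly_Mapping.lookup c \<sigma>)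
    (\<Sum>k\<le>nat p. tens (chains X) [(int k, bas (front_face k \<sigma>)), (p - int k, bas (back_face (nat p) k \<sigma>))]))"
  by (simp add: aw_comult_def tn.scale_sum_right)

lemma aw_comult_add: "aw_comult X p (a + b) = aw_comult X p a + aw_comult X p b"
  unfolding aw_comult_alt by (rule keys_sum_add[OF tn.vector_space_axioms])

lemma aw_comult_scale: "aw_comult X p (qscale r a) = tscale r (aw_comult X p a)"
  unfolding aw_comult_alt by (rule keys_sum_scale[OF tn.vector_space_axioms])

lemma aw_comult_single: "aw_comult X p (bas \<sigma>) =
    (\<Sum>k\<le>nat p. tens (chains X) [(int k, bas (front_face k \<sigma>)), (p - int k, bas (back_face (nat p) k \<sigma>))])"
  unfolding aw_comult_alt by (rule keys_sum_single[OF tn.vector_space_axioms])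

lemma aw_comult_0 [simp]: "aw_comult X p 0 = 0"
  by (simp add: aw_comult_def)

lemma aw_comult_sum: "aw_comult X p (\<Sum>i\<in>I. qscale (r i) (a i)) = (\<Sum>i\<in>I. tscale (r i) (aw_comult X p (a i)))"
  by (induction I rule: infinite_finite_induct) (auto simp: aw_comult_add aw_comult_scale)

lemma aw_comult_tensor_power: "c \<in> carrier (chains X p) \<Longrightarrow> aw_comult X p c \<in> tensor_power (chains X) 2 p"
proof (induction rule: chains_induct)
  case (single \<sigma>)
  show ?case unfolding aw_comult_single
    by (intro tensor_power_intros tens_tensor_power)
     (use single in \<open>auto simp: singular_simplex_front_face singular_simplex_back_face nat_diff_distrib\<close>)
qed (auto simp: aw_comult_add aw_comult_scale intro: tensor_power_intros)

lemma tensor_linear_aw: "tensor_linear (chains X) (chains X) 2 0 (aw_comult X)"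
  by (auto simp: tensor_linear_def aw_comult_tensor_power aw_comult_add aw_comult_scale)

lemma glin_aw: "glin (chains X) (chains X) 1 0 (aw_comult X)"
  by (rule glin_tensor_linear[OF tensor_linear_aw]) simp

text \<open>The summation pattern of the Leibniz rule for Alexander-Whitney: \<open>A k i\<close> is
  face \<open>i\<close> of the front part and \<open>B k j\<close> face \<open>j\<close> of the back
  part. The two faces at the cut cancel, and the others are regrouped by the face index
  \<open>i\<close> in the whole simplex.\<close>

lemma alternating_split:
  fixes A :: "nat \<Rightarrow> nat \<Rightarrow> 'v::ab_group_add" and B :: "nat \<Rightarrow> nat \<Rightarrow> 'v"
  assumes AB: "\<And>k. k \<le> m \<Longrightarrow> A k (Suc k) = - B k 0"
  shows "(\<Sum>k\<le>m. \<Sum>i\<le>Suc k. A k i) + (\<Sum>k\<le>m. \<Sum>j\<le>Suc m - k. B k j) =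
     (\<Sum>i\<le>Suc m. \<Sum>k\<le>m. if i \<le> k then A k i else B k (i - k))"
proof -
  have "(\<Sum>i\<le>Suc k. A k i) + (\<Sum>j\<le>Suc m - k. B k j) = (\<Sum>i\<le>Suc m. if i \<le> k then A k i else B k (i - k))"
    if "k \<le> m" for k
  proof -
    have "(\<Sum>j\<le>Suc m - k. B k j) = B k 0 + (\<Sum>j=1..Suc m - k. B k j)"
      by (simp add: atMost_atLeast0 sum.atLeast_Suc_atMost)
    also have "(\<Sum>j=1..Suc m - k. B k j) = (\<Sum>i=Suc k..Suc m. B k (i - k))"
      by (rule sum.reindex_bij_witness[of _ "\<lambda>i. i - k" "\<lambda>j. j + k"]) (use that in auto)
    also have "\<dots> = (\<Sum>i=Suc k..Suc m. if i \<le> k then A k i else B k (i - k))"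
      by (rule sum.cong) auto
    finally have 1: "(\<Sum>j\<le>Suc m - k. B k j) = B k 0 + (\<Sum>i=Suc k..Suc m. if i \<le> k then A k i else B k (i - k))" .
    have "{..Suc m} = {..k} \<union> {Suc k..Suc m}" "{..k} \<inter> {Suc k..Suc m} = {}" using that by auto
    then have "(\<Sum>i\<le>Suc m. if i \<le> k then A k i else B k (i - k)) =
      (\<Sum>i\<le>k. if i \<le> k then A k i else B k (i - k)) + (\<Sum>i=Suc k..Suc m. if i \<le> k then A k i else B k (i - k))"
      by (simp only: sum.union_disjoint finite_atMost finite_atLeastAtMost)
    then show ?thesis unfolding 1 using AB[OF that] by simp
  qed
  then have "(\<Sum>k\<le>m. \<Sum>i\<le>Suc k. A k i) + (\<Sum>k\<le>m. \<Sum>j\<le>Suc m - k. B k j) =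
    (\<Sum>k\<le>m. \<Sum>i\<le>Suc m. if i \<le> k then A k i else B k (i - k))"
    by (simp add: sum.distrib[symmetric])
  then show ?thesis by (simp only: sum.swap[of _ "{..m}" "{..Suc m}"])
qed

lemma der_bdry_map_pair:
  assumes "a \<in> carrier (chains X p)" "b \<in> carrier (chains X q)"
  shows "der (chains X) (bdry_map (chains X)) (tens (chains X) [(p, a), (q, b)]) =
    tprod (chains X) (tens (chains X) [(p - 1, boundary p a)]) (tens (chains X) [(q, b)]) +
    tscale (ksign p) (tprod (chains X) (tens (chains X) [(p, a)]) (tens (chains X) [(q - 1, boundary q b)]))"
  unfolding tens_pair[OF gvs_chains assms]
  using der_tprod[OF gvs_chains glin_bdry_map, of "tens (chains X) [(p, a)]" X 1 p "tens (chains X) [(q, b)]"] assms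
  by (simp add: tspan_tens der_ext_gen[OF gvs_chains glin_tens glin_bdry_map])

lemma aw_comult_boundary:
  "c \<in> carrier (chains X p) \<Longrightarrow>
    der (chains X) (bdry_map (chains X)) (aw_comult X p c) = aw_comult X (p - 1) (boundary p c)"
proof (induction rule: chains_induct)
  case (single \<sigma>)
  let ?C = "chains X"
  define n where "n = nat p"
  have p: "p = int n" using single by (simp add: n_def)
  have \<sigma>: "singular_simplex n X \<sigma>" using single by (simp add: n_def)
  note ff = singular_simplex_front_face[OF \<sigma>] and bf = singular_simplex_back_face[OF \<sigma>]
  let ?f = "\<lambda>k. tens ?C [(int k, bas (front_face k \<sigma>))]" and ?b = "\<lambda>k. tens ?C [(int n - int k, bas (back_face n k \<sigma>))]"
  let ?Df = "\<lambda>k i. tens ?C [(int k - 1, bas (singular_face k i (front_face k \<sigma>)))]"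
  let ?Db = "\<lambda>k j. tens ?C [(int n - int k - 1, bas (singular_face (n - k) j (back_face n k \<sigma>)))]"
  have f: "bas (front_face k \<sigma>) \<in> carrier (?C (int k))" if "k \<le> n" for k using ff[OF that] by simp
  have b: "bas (back_face n k \<sigma>) \<in> carrier (?C (int n - int k))" if "k \<le> n" for k
    using bf[OF that] that by (simp add: nat_diff_distrib)
  have Df: "bas (singular_face k i (front_face k \<sigma>)) \<in> carrier (?C (int k - 1))" if "k \<le> n" "1 \<le> k" "i \<le> k" for k i
    using singular_simplex_singular_face[OF ff[OF that(1)] that(2,3)] that by (simp add: nat_diff_distrib)
  have Db: "bas (singular_face (n - k) i (back_face n k \<sigma>)) \<in> carrier (?C (int n - int k - 1))" if "k < n" "i \<le> n - k" for k i
    using singular_simplex_singular_face[OF bf, of k i] that by (simp add: nat_diff_distrib)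
  show ?case
  proof (cases n)
    case 0
    then show ?thesis
      using f[of 0] b[of 0] unfolding aw_comult_single p
      by (simp add: der_bdry_map_pair boundary_nonpos)
  next
    case (Suc m)
    have df: "tens ?C [(int k - 1, boundary (int k) (bas (front_face k \<sigma>)))] = (\<Sum>i\<le>k. tscale ((-1) ^ i) (?Df k i))"
      if "k \<le> n" "1 \<le> k" for k
      using that Df[OF that] by (simp add: boundary_single del: bas_chains) (subst tens_chains_sum, auto simp del: bas_chains)
    have db: "tens ?C [(int n - int k - 1, boundary (int n - int k) (bas (back_face n k \<sigma>)))] =
        (\<Sum>j\<le>n - k. tscale ((-1) ^ j) (?Db k j))"
      if "k < n" for k
      using that Db[OF that] by (simp add: boundary_single nat_diff_distrib del: bas_chains) (subst tens_chains_sum, auto simp del: bas_chains)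
    have db0: "boundary (int n - int n) (bas (back_face n n \<sigma>)) = 0" by (simp add: boundary_nonpos)
    \<comment> \<open>The front index is shifted to \<open>Suc k\<close>, as the 0-dimensional front
      face has boundary 0; likewise the back face at \<open>k = n\<close> drops out of
      \<open>?B\<close>. Both sums then run over \<open>k \<le> m\<close>.\<close>
    let ?A = "\<lambda>k i. tscale ((-1) ^ i) (tprod ?C (?Df (Suc k) i) (?b (Suc k)))"
    let ?B = "\<lambda>k j. tscale ((-1) ^ (k + j)) (tprod ?C (?f k) (?Db k j))"
    have "der ?C (bdry_map ?C) (aw_comult X p (bas \<sigma>)) =
      (\<Sum>k\<le>n. tprod ?C (tens ?C [(int k - 1, boundary (int k) (bas (front_face k \<sigma>)))]) (?b k)) +
      (\<Sum>k\<le>n. tscale (ksign (int k)) (tprod ?C (?f k) (tens ?C [(int n - int k - 1, boundary (int n - int k) (bas (back_face n k \<sigma>)))])))"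
      unfolding aw_comult_single lin_ext_sum p nat_int sum.distrib[symmetric]
      by (rule sum.cong[OF refl]) (use f b in \<open>simp add: der_bdry_map_pair del: bas_chains\<close>)
    also have "(\<Sum>k\<le>n. tprod ?C (tens ?C [(int k - 1, boundary (int k) (bas (front_face k \<sigma>)))]) (?b k)) =
      (\<Sum>k\<le>m. \<Sum>i\<le>Suc k. ?A k i)"
    proof -
      have "tprod ?C (tens ?C [(int (Suc k) - 1, boundary (int (Suc k)) (bas (front_face (Suc k) \<sigma>)))]) (?b (Suc k)) =
          (\<Sum>i\<le>Suc k. ?A k i)" if "k \<le> m" for k
      proof -
        have k: "Suc k \<le> n" "1 \<le> Suc k" using that Suc by auto
        show ?thesis unfolding df[OF k] tprod_sum_left tprod_scale_left by (rule refl)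
      qed
      moreover have "tprod ?C (tens ?C [(int 0 - 1, boundary (int 0) (bas (front_face 0 \<sigma>)))]) (?b 0) = 0"
        by (simp add: boundary_nonpos)
      ultimately show ?thesis unfolding Suc sum.atMost_Suc_shift by (simp only: Suc[symmetric] add_0_left) (rule sum.cong, auto simp only: atMost_iff)
    qed
    also have "(\<Sum>k\<le>n. tscale (ksign (int k)) (tprod ?C (?f k) (tens ?C [(int n - int k - 1, boundary (int n - int k) (bas (back_face n k \<sigma>)))]))) =
      (\<Sum>k\<le>m. \<Sum>j\<le>Suc m - k. ?B k j)"
    proof -
      have "tscale (ksign (int k)) (tprod ?C (?f k) (tens ?C [(int n - int k - 1, boundary (int n - int k) (bas (back_face n k \<sigma>)))])) =
        (\<Sum>j\<le>Suc m - k. ?B k j)" if "k \<le> m" for k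
      proof -
        have k: "k < n" "k \<le> n" using that Suc by auto
        have "tprod ?C (?f k) (\<Sum>j\<le>n - k. tscale ((-1) ^ j) (?Db k j)) = (\<Sum>j\<le>n - k. tscale ((-1) ^ j) (tprod ?C (?f k) (?Db k j)))"
          using f[OF k(2)] Db[OF k(1)]
          by (subst tprod_sum_right[OF gvs_chains])
            (auto simp: tprod_scale_right[OF gvs_chains] intro!: tspan_scale simp del: bas_chains)
        then show ?thesis unfolding db[OF k(1)]
          by (simp add: tn.scale_sum_right power_minus_one_ksign ksign_add Suc)
      qed
      moreover have "tprod ?C (?f n) (tens ?C [(int n - int n - 1, boundary (int n - int n) (bas (back_face n n \<sigma>)))]) = 0"
        unfolding db0 using f[of n] by simp
      moreover have "sum g {..n} = g n + sum g {..m}" for g :: "nat \<Rightarrow> 'a qchain tensor"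
      proof -
        have "{..n} = insert n {..m}" "n \<notin> {..m}" using Suc by auto
        then show ?thesis by simp
      qed
      ultimately show ?thesis by (simp only: tn.scale_zero_right add_0_left) (rule sum.cong, auto simp only: atMost_iff)
    qed
    also have "(\<Sum>k\<le>m. \<Sum>i\<le>Suc k. ?A k i) + (\<Sum>k\<le>m. \<Sum>j\<le>Suc m - k. ?B k j) =
      (\<Sum>i\<le>Suc m. \<Sum>k\<le>m. if i \<le> k then ?A k i else ?B k (i - k))"
    proof (rule alternating_split)
      fix k assume "k \<le> m"
      \<comment> \<open>Both are the front \<open>k\<close>-face tensor the back face starting at
        vertex \<open>Suc k\<close>, with signs \<open>(-1) ^ Suc k\<close> and
        \<open>(-1) ^ k\<close>.\<close>
      then show "?A k (Suc k) = - ?B k 0"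
        using singular_face_back[of k n \<sigma>] by (simp add: singular_face_front Suc)
    qed
    also have "\<dots> = (\<Sum>i\<le>Suc m. tscale ((-1) ^ i) (aw_comult X (int m) (bas (singular_face n i \<sigma>))))"
    proof (rule sum.cong[OF refl])
      fix i assume i: "i \<in> {..Suc m}"
      have "(if j \<le> k then ?A k j else ?B k (j - k)) = tscale ((-1) ^ j)
          (tens ?C [(int k, bas (front_face k (singular_face n j \<sigma>))), (int m - int k, bas (back_face m k (singular_face n j \<sigma>)))])"
        if "k \<le> m" "j \<le> Suc m" for j k
      proof (cases "j \<le> k")
        case True
        have k: "Suc k \<le> n" "k < n" using that Suc by auto
        have "tprod ?C (?Df (Suc k) j) (?b (Suc k)) = tens ?C [(int k, bas (singular_face (Suc k) j (front_face (Suc k) \<sigma>))),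
            (int m - int k, bas (back_face n (Suc k) \<sigma>))]"
          using Df[OF k(1), of j] b[OF k(1)] True Suc by (subst tens_pair[OF gvs_chains]) (simp_all del: bas_chains)
        then show ?thesis
          using True front_singular_face_le[OF True k(2), of \<sigma>] back_singular_face_le[OF True k(2), of \<sigma>] by (simp add: Suc)
      next
        case False
        then have j: "k < j" "j \<le> n" "k < n" using that Suc by auto
        have "tprod ?C (?f k) (?Db k (j - k)) = tens ?C [(int k, bas (front_face k \<sigma>)),
            (int m - int k, bas (singular_face (n - k) (j - k) (back_face n k \<sigma>)))]"
          using f[of k] Db[OF j(3), of "j - k"] j Suc by (subst tens_pair[OF gvs_chains]) (simp_all del: bas_chains)
        then show ?thesis
          using False j front_singular_face_gt[OF j(1,2), of \<sigma>] back_singular_face_gt[OF j(1,2), of \<sigma>] by (simp add: Suc)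
      qed
      then show "(\<Sum>k\<le>m. if i \<le> k then ?A k i else ?B k (i - k)) =
         tscale ((-1) ^ i) (aw_comult X (int m) (bas (singular_face n i \<sigma>)))"
        using i unfolding aw_comult_single tn.scale_sum_right by (intro sum.cong) (auto simp only: nat_int atMost_iff)
    qed
    also have "\<dots> = aw_comult X (p - 1) (boundary p (bas \<sigma>))"
      using Suc unfolding p by (simp add: boundary_single aw_comult_sum nat_add_distrib del: sum.atMost_Suc)
    finally show ?thesis .
  qed
qed (auto simp: aw_comult_add aw_comult_scale lin_ext_add lin_ext_scale boundary_add boundary_scale)

text \<open>Both iterations list all pairs of cut points \<open>a \<le> b\<close> and give the
  front, middle and back part of the simplex; they differ only in the order in which the cuts are
  made.\<close>

lemma aw_comult_coassoc:
  "c \<in> carrier (chains X p) \<Longrightarrow>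
    map_tensor (chains X) [(0, aw_comult X), id_map (chains X)] (aw_comult X p c) =
    map_tensor (chains X) [id_map (chains X), (0, aw_comult X)] (aw_comult X p c)"
proof (induction rule: chains_induct)
  case (single \<sigma>)
  let ?C = "chains X"
  define n where "n = nat p"
  have p: "p = int n" using single by (simp add: n_def)
  have \<sigma>: "singular_simplex n X \<sigma>" using single by (simp add: n_def)
  note ff = singular_simplex_front_face[OF \<sigma>] and bf = singular_simplex_back_face[OF \<sigma>]
  note g0 = glin_mono[OF glin_aw le0, of X] glin_mono[OF glin_tens le0, of ?C]
  have f: "bas (front_face k \<sigma>) \<in> carrier (?C (int k))" if "k \<le> n" for k using ff[OF that] by simp
  have b: "bas (back_face n k \<sigma>) \<in> carrier (?C (int n - int k))" if "k \<le> n" for k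
    using bf[OF that] that by (simp add: nat_diff_distrib)
  let ?g = "\<lambda>a b. tens ?C [(int a, bas (front_face a \<sigma>)), (int b - int a, bas (front_face (b - a) (back_face n a \<sigma>))),
      (int n - int b, bas (back_face n b \<sigma>))]"
  have m: "bas (front_face (k - a) (back_face n a \<sigma>)) \<in> carrier (?C (int k - int a))" if "a \<le> k" "k \<le> n" for a k
    using singular_simplex_front_face[OF bf, of a "k - a"] that by (simp add: nat_diff_distrib)
  have 1: "map_tensor ?C [(0, aw_comult X), (0, letter ?C)] (tens ?C [(int k, bas (front_face k \<sigma>)), (int n - int k, bas (back_face n k \<sigma>))]) =
     (\<Sum>a\<le>k. ?g a k)" if k: "k \<le> n" for k
    using f[OF k] b[OF k]
    by (simp add: map_tensor_pair[OF gvs_chains g0] aw_comult_single tprod_sum_left del: bas_chains)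
      (rule sum.cong[OF refl], subst tprod_tens[OF gvs_chains],
        use k f m in \<open>auto simp: front_front back_front simp del: bas_chains\<close>)
  have 2: "map_tensor ?C [(0, letter ?C), (0, aw_comult X)] (tens ?C [(int a, bas (front_face a \<sigma>)), (int n - int a, bas (back_face n a \<sigma>))]) =
     (\<Sum>l\<le>n - a. ?g a (a + l))" if a: "a \<le> n" for a
  proof -
    have na: "nat (int n - int a) = n - a" using a by simp
    have t: "bas (front_face l (back_face n a \<sigma>)) \<in> carrier (?C (int l))"
        "bas (back_face (n - a) l (back_face n a \<sigma>)) \<in> carrier (?C (int n - int a - int l))" if "l \<le> n - a" for l
      using m[of a "a + l"] b[of "a + l"] that a back_back[of a l n \<sigma>] by (simp_all add: algebra_simps del: bas_chains)
    have "map_tensor ?C [(0, letter ?C), (0, aw_comult X)] (tens ?C [(int a, bas (front_face a \<sigma>)), (int n - int a, bas (back_face n a \<sigma>))]) =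
      tprod ?C (tens ?C [(int a, bas (front_face a \<sigma>))]) (\<Sum>l\<le>n - a. tens ?C [(int l, bas (front_face l (back_face n a \<sigma>))),
         (int n - int a - int l, bas (back_face (n - a) l (back_face n a \<sigma>)))])"
      using f[OF a] b[OF a] by (simp add: map_tensor_pair[OF gvs_chains g0(2,1)] aw_comult_single na del: bas_chains)
    also have "\<dots> = (\<Sum>l\<le>n - a. ?g a (a + l))"
      using f[OF a] t a
      by (subst tprod_sum_right[OF gvs_chains])
        (auto simp: tprod_tens[OF gvs_chains] back_back algebra_simps intro!: sum.cong simp del: bas_chains)
    finally show ?thesis .
  qed
  have "(\<Sum>k\<le>n. \<Sum>a\<le>k. ?g a k) = (\<Sum>a\<le>n. \<Sum>l\<le>n - a. ?g a (a + l))"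
    unfolding sum.Sigma[OF finite_atMost ballI[OF finite_atMost]]
    by (rule sum.reindex_bij_witness[of _ "\<lambda>(a, l). (a + l, a)" "\<lambda>(k, a). (a, k - a)"]) auto
  then show ?case
    unfolding id_map_def aw_comult_single p nat_int map_tensor_pair_sum using 1 2 by simp
qed (auto simp: aw_comult_add aw_comult_scale map_tensor_lin_ext lin_ext_add lin_ext_scale)

subsection \<open>The reduced coalgebra\<close>

lemma alg_ext_pair:
  assumes "graded_vector_space W" "glin V W 1 0 F" "a \<in> carrier (V p)" "b \<in> carrier (V q)"
  shows "alg_ext W F (tens V [(p, a), (q, b)]) = tprod W (F p a) (F q b)"
  using assms by (simp add: alg_ext_tens tprod_unit_right glinD)

lemma point_chain_chains: "x0 \<in> topspace X \<Longrightarrow> point_chain x0 \<in> carrier (chains X 0)"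
  and point_simplex: "x0 \<in> topspace X \<Longrightarrow> singular_simplex 0 X (restrict (\<lambda>_. x0) (standard_simplex 0))"
  by (auto simp: point_chain_def singular_simplex_def)

lemma augmentation_point: "augmentation (point_chain x0) = 1"
  by (simp add: point_chain_def augmentation_single)

lemma aw_comult_point:
  assumes "x0 \<in> topspace X"
  shows "aw_comult X 0 (point_chain x0) = tens (chains X) [(0, point_chain x0), (0, point_chain x0)]"
  unfolding point_chain_def aw_comult_single
  using front_face_full[OF point_simplex[OF assms]] back_face_0[OF point_simplex[OF assms]] by simp

definition unpoint :: "'a \<Rightarrow> int \<Rightarrow> 'a qchain \<Rightarrow> 'a qchain"
  where "unpoint x0 p c = (if p = 0 then c - qscale (augmentation c) (point_chain x0) else c)"

text \<open>With \<open>\<rho> c = c - \<epsilon>(c) x\<^sub>0\<close> the reduced comultiplication is \<open>(\<rho> \<otimes> \<rho>) \<Delta>\<close>; as \<open>\<rho> x\<^sub>0 = 0\<close> and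
  \<open>\<Delta> x\<^sub>0 = x\<^sub>0 \<otimes> x\<^sub>0\<close>, coassociativity and compatibility with \<open>\<partial>\<close> are inherited from \<open>\<Delta>\<close>.\<close>

definition red_comult :: "'a topology \<Rightarrow> 'a \<Rightarrow> int \<Rightarrow> 'a qchain \<Rightarrow> 'a qchain tensor"
  where "red_comult X x0 p c = alg_ext (reduced_chains X) (\<lambda>p x. tens (reduced_chains X) [(p, unpoint x0 p x)]) (aw_comult X p c)"

lemma unpoint_add: "unpoint x0 p (a + b) = unpoint x0 p a + unpoint x0 p b"
  and unpoint_scale: "unpoint x0 p (qscale r a) = qscale r (unpoint x0 p a)"
  by (simp_all add: unpoint_def augmentation_add augmentation_scale qv.scale_left_distrib qv.scale_right_diff_distrib)

lemma unpoint_point: "unpoint x0 0 (point_chain x0) = 0"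
  by (simp add: unpoint_def augmentation_point)

lemma unpoint_reduced: "c \<in> carrier (reduced_chains X p) \<Longrightarrow> unpoint x0 p c = c"
  by (simp add: unpoint_def)

lemma tens_chains_diff:
  assumes "a \<in> carrier (chains X p)" "b \<in> carrier (chains X p)"
  shows "tens (chains X) [(p, a - b)] = tens (chains X) [(p, a)] - tens (chains X) [(p, b)]"
  using glinD(3)[OF glin_tens[of "chains X"], of "a - b" p b] assms by (simp add: chains_closed)

context
  fixes X :: "'a topology" and x0 :: 'a
  assumes x0: "x0 \<in> topspace X"
begin

private abbreviation (input) "C \<equiv> chains X"
private abbreviation (input) "R \<equiv> reduced_chains X"
private abbreviation (input) "unpoint_map \<equiv> \<lambda>p x. tens R [(p, unpoint x0 p x)]"

lemma unpoint_in_reduced: "c \<in> carrier (C p) \<Longrightarrow> unpoint x0 p c \<in> carrier (R p)"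
  using point_chain_chains[OF x0]
  by (auto simp: unpoint_def augmentation_diff augmentation_scale augmentation_point intro: chains_closed)

lemma unpoint_boundary:
  assumes c: "c \<in> carrier (C p)"
  shows "boundary p (unpoint x0 p c) = unpoint x0 (p - 1) (boundary p c)"
proof -
  consider "p = 0" | "p = 1" | "p \<noteq> 0" "p \<noteq> 1" by blast
  then show ?thesis
  proof cases
    case 1
    then show ?thesis by (simp add: boundary_nonpos unpoint_def)
  next
    case 2
    then show ?thesis using boundary_augmentation[of c X] c by (simp add: unpoint_def)
  qed (auto simp: unpoint_def)
qed

lemma glin_unpoint_map: "glin C R 1 0 unpoint_map"
  using glin_tens_map[OF gvs_reduced_chains, where e = 0 and f = "unpoint x0" and V = C and X1 = X] unpoint_in_reduced
  by (simp add: unpoint_add unpoint_scale)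

lemma glin_incl: "glin R C 1 0 (\<lambda>p x. tens C [(p, x)])"
  using glin_tens_map[OF gvs_chains, where e = 0 and f = "\<lambda>p x. x" and V = R and X1 = X] by simp

lemma rhm1: "x \<in> carrier (C p) \<Longrightarrow> unpoint_map p x \<in> tensor_power R 1 p"
  using unpoint_in_reduced[of x p] by (intro tens_tensor_power) auto

lemma red_comult_add: "red_comult X x0 p (a + b) = red_comult X x0 p a + red_comult X x0 p b"
  and red_comult_scale: "red_comult X x0 p (qscale r a) = tscale r (red_comult X x0 p a)"
  by (simp_all add: red_comult_def aw_comult_add aw_comult_scale lin_ext_add lin_ext_scale)

lemma red_comult_tensor_power: "c \<in> carrier (C p) \<Longrightarrow> red_comult X x0 p c \<in> tensor_power R 2 p"
  unfolding red_comult_def by (rule tensor_power_alg_ext[OF gvs_reduced_chains glin_unpoint_map rhm1 aw_comult_tensor_power])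

lemma tensor_linear_red_comult: "tensor_linear R R 2 0 (red_comult X x0)"
  by (auto simp: tensor_linear_def red_comult_tensor_power red_comult_add red_comult_scale)

lemma red_comult_unpoint:
  assumes "c \<in> carrier (C p)"
  shows "red_comult X x0 p (unpoint x0 p c) = red_comult X x0 p c"
proof (cases "p = 0")
  case True
  have "red_comult X x0 0 (point_chain x0) = 0"
    unfolding red_comult_def aw_comult_point[OF x0] using point_chain_chains[OF x0]
    by (simp add: alg_ext_pair[OF gvs_reduced_chains glin_unpoint_map] unpoint_point tens_zero[OF gvs_reduced_chains, simplified])
  then have "red_comult X x0 0 (c + qscale (- augmentation c) (point_chain x0)) = red_comult X x0 0 c"
    unfolding red_comult_add red_comult_scale by simp
  then show ?thesis using True by (simp add: unpoint_def)
qed (simp add: unpoint_def)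

text \<open>Expanding the reduction in both factors gives four terms. The claim is proved for all
  chains because 0-simplices are not reduced, so induction over simplices needs the larger space;
  the price is the last term, which vanishes on reduced chains.\<close>

lemma incl_red_comult:
  assumes "c \<in> carrier (C p)"
  shows "alg_ext C (\<lambda>p x. tens C [(p, x)]) (red_comult X x0 p c) = aw_comult X p c
     - tens C [(0, point_chain x0), (p, c)] - tens C [(p, c), (0, point_chain x0)]
     + (if p = 0 then tscale (augmentation c) (tens C [(0, point_chain x0), (0, point_chain x0)]) else 0)"
proof -
  let ?q = "point_chain x0"
  note q = point_chain_chains[OF x0]
  have comp: "alg_ext C (\<lambda>p x. tens C [(p, x)]) (red_comult X x0 p c) = alg_ext C (\<lambda>p x. tens C [(p, unpoint x0 p x)]) (aw_comult X p c)"
    if "c \<in> carrier (C p)" for c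
  proof -
    have "glin C C 1 0 (\<lambda>p x. tens C [(p, unpoint x0 p x)])"
      using glin_tens_map[OF gvs_chains, where e = 0 and f = "unpoint x0" and V = C and X1 = X] unpoint_in_reduced
      by (simp add: unpoint_add unpoint_scale)
    note g = this
    have "alg_ext C (\<lambda>p x. tens C [(p, x)]) (red_comult X x0 p c) =
      alg_ext C (\<lambda>p x. alg_ext C (\<lambda>p x. tens C [(p, x)]) (unpoint_map p x)) (aw_comult X p c)"
      unfolding red_comult_def by (rule alg_ext_comp(2)[OF gvs_reduced_chains gvs_chains glin_unpoint_map glin_incl tensor_power_tensors[OF aw_comult_tensor_power[OF that]]])
    also have "\<dots> = alg_ext C (\<lambda>p x. tens C [(p, unpoint x0 p x)]) (aw_comult X p c)"
      by (rule alg_ext_cong[OF gvs_chains alg_ext_comp(1)[OF gvs_reduced_chains gvs_chains glin_unpoint_map glin_incl] g _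
        tensor_power_tensors[OF aw_comult_tensor_power[OF that]]])
        (rule alg_ext_gen[OF gvs_chains glin_incl], rule unpoint_in_reduced)
    finally show ?thesis .
  qed
  have g: "glin C C 1 0 (\<lambda>p x. tens C [(p, unpoint x0 p x)])"
    using glin_tens_map[OF gvs_chains, where e = 0 and f = "unpoint x0" and V = C and X1 = X] unpoint_in_reduced
    by (simp add: unpoint_add unpoint_scale)
  show ?thesis
    unfolding comp[OF assms] using assms
  proof (induction rule: chains_induct)
    case zero
    have "tens C [(0, ?q), (p, 0)] = 0" "tens C [(p, 0), (0, ?q)] = 0"
      using tens_smult[of "[(0, ?q)]" C "[]" 0 p 0] tens_smult[of "[]" C "[(0, ?q)]" 0 p 0] q by (simp_all add: chains_closed)
    then show ?case by simp
  next
    case (add a b)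
    have "tens C [(0, ?q), (p, a + b)] = tens C [(0, ?q), (p, a)] + tens C [(0, ?q), (p, b)]"
      "tens C [(p, a + b), (0, ?q)] = tens C [(p, a), (0, ?q)] + tens C [(p, b), (0, ?q)]"
      using tens_add[of "[(0, ?q)]" C "[]" a p b] tens_add[of "[]" C "[(0, ?q)]" a p b] q add by simp_all
    then show ?case using add by (simp add: aw_comult_add lin_ext_add augmentation_add tn.scale_left_distrib)
  next
    case (scale r a)
    have "tens C [(0, ?q), (p, qscale r a)] = tscale r (tens C [(0, ?q), (p, a)])"
      "tens C [(p, qscale r a), (0, ?q)] = tscale r (tens C [(p, a), (0, ?q)])"
      using tens_smult[of "[(0, ?q)]" C "[]" a p r] tens_smult[of "[]" C "[(0, ?q)]" a p r] q scale by simp_all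
    then show ?case using scale
      by (simp add: aw_comult_scale lin_ext_scale augmentation_scale tn.scale_right_distrib tn.scale_right_diff_distrib)
  next
    case (single \<sigma>)
    define n where "n = nat p"
    have p: "p = int n" using single by (simp add: n_def)
    have \<sigma>: "singular_simplex n X \<sigma>" using single by (simp add: n_def)
    let ?f = "\<lambda>k. bas (front_face k \<sigma>)" and ?b = "\<lambda>k. bas (back_face n k \<sigma>)"
    have f: "?f k \<in> carrier (C (int k))" if "k \<le> n" for k
      using singular_simplex_front_face[OF \<sigma> that] by simp
    have b: "?b k \<in> carrier (C (int n - int k))" if "k \<le> n" for k
      using singular_simplex_back_face[OF \<sigma> that] that by (simp add: nat_diff_distrib)
    \<comment> \<open>The correction by the base point affects only factors of degree 0: the front
      face for \<open>k = 0\<close> and the back face for \<open>k = n\<close>.\<close>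
    let ?u = "\<lambda>k. if k = 0 then tens C [(0, ?q)] else 0" and ?v = "\<lambda>k. if k = n then tens C [(0, ?q)] else 0"
    have qt: "tens C [(0, ?q)] \<in> tensors C" using q by simp
    have F: "tens C [(int k, unpoint x0 (int k) (?f k))] = tens C [(int k, ?f k)] - ?u k" if "k \<le> n" for k
      using tens_chains_diff[of "?f k" X "int k" ?q] f[OF that] q
      by (auto simp: unpoint_def augmentation_single simp del: bas_chains)
    have B: "tens C [(int n - int k, unpoint x0 (int n - int k) (?b k))] = tens C [(int n - int k, ?b k)] - ?v k" if "k \<le> n" for k
      using tens_chains_diff[of "?b k" X "int n - int k" ?q] b[OF that] q that
      by (auto simp: unpoint_def augmentation_single simp del: bas_chains)
    let ?P = "tprod C"
    have "alg_ext C (\<lambda>p x. tens C [(p, unpoint x0 p x)]) (aw_comult X p (bas \<sigma>)) =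
      (\<Sum>k\<le>n. ?P (tens C [(int k, ?f k)]) (tens C [(int n - int k, ?b k)]) - ?P (?u k) (tens C [(int n - int k, ?b k)])
        - ?P (tens C [(int k, ?f k)]) (?v k) + ?P (?u k) (?v k))"
      unfolding p aw_comult_single lin_ext_sum nat_int
    proof (rule sum.cong[OF refl])
      fix k assume k: "k \<in> {..n}"
      have m: "tens C [(int k, ?f k)] \<in> tensors C" "tens C [(int n - int k, ?b k)] \<in> tensors C" "?u k \<in> tensors C" "?v k \<in> tensors C"
        using k f[of k] b[of k] qt by (auto simp: tspan_0 simp del: bas_chains)
      have "alg_ext C (\<lambda>p x. tens C [(p, unpoint x0 p x)]) (tens C [(int k, ?f k), (int n - int k, ?b k)]) =
        ?P (tens C [(int k, ?f k)] - ?u k) (tens C [(int n - int k, ?b k)] - ?v k)"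
        using k f[of k] b[of k] by (simp add: alg_ext_pair[OF gvs_chains g] F B del: bas_chains)
      also have "\<dots> = ?P (tens C [(int k, ?f k)]) (tens C [(int n - int k, ?b k)]) - ?P (?u k) (tens C [(int n - int k, ?b k)])
        - ?P (tens C [(int k, ?f k)]) (?v k) + ?P (?u k) (?v k)"
        unfolding tprod_diff_left tprod_diff_right[OF gvs_chains m(1,2,4)] tprod_diff_right[OF gvs_chains m(3,2,4)]
        by (simp add: algebra_simps)
      finally show "alg_ext C (\<lambda>p x. tens C [(p, unpoint x0 p x)]) (tens C [(int k, ?f k), (int n - int k, ?b k)]) =
        ?P (tens C [(int k, ?f k)]) (tens C [(int n - int k, ?b k)]) - ?P (?u k) (tens C [(int n - int k, ?b k)])
        - ?P (tens C [(int k, ?f k)]) (?v k) + ?P (?u k) (?v k)" .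
    qed
    also have "\<dots> = (\<Sum>k\<le>n. ?P (tens C [(int k, ?f k)]) (tens C [(int n - int k, ?b k)])) -
      (\<Sum>k\<le>n. ?P (?u k) (tens C [(int n - int k, ?b k)])) - (\<Sum>k\<le>n. ?P (tens C [(int k, ?f k)]) (?v k)) + (\<Sum>k\<le>n. ?P (?u k) (?v k))"
      by (simp only: sum.distrib sum_subtractf)
    also have "(\<Sum>k\<le>n. ?P (tens C [(int k, ?f k)]) (tens C [(int n - int k, ?b k)])) = aw_comult X p (bas \<sigma>)"
      unfolding p aw_comult_single nat_int
      by (rule sum.cong) (use f b in \<open>auto simp: tens_pair[OF gvs_chains] simp del: bas_chains\<close>)
    also have "(\<Sum>k\<le>n. ?P (?u k) (tens C [(int n - int k, ?b k)])) = tens C [(0, ?q), (p, bas \<sigma>)]"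
    proof -
      have "(\<Sum>k\<le>n. ?P (?u k) (tens C [(int n - int k, ?b k)])) = (\<Sum>k\<le>n. if k = 0 then ?P (tens C [(0, ?q)]) (tens C [(int n, ?b 0)]) else 0)"
        by (rule sum.cong) auto
      also have "\<dots> = ?P (tens C [(0, ?q)]) (tens C [(int n, bas \<sigma>)])" by (simp add: back_face_0[OF \<sigma>])
      finally show ?thesis using q \<sigma> by (simp add: tprod_tens[OF gvs_chains] p)
    qed
    also have "(\<Sum>k\<le>n. ?P (tens C [(int k, ?f k)]) (?v k)) = tens C [(p, bas \<sigma>), (0, ?q)]"
    proof -
      have "(\<Sum>k\<le>n. ?P (tens C [(int k, ?f k)]) (?v k)) = (\<Sum>k\<le>n. if k = n then ?P (tens C [(int n, ?f n)]) (tens C [(0, ?q)]) else 0)"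
        by (rule sum.cong) (use f in \<open>auto simp del: bas_chains\<close>)
      also have "\<dots> = ?P (tens C [(int n, bas \<sigma>)]) (tens C [(0, ?q)])" by (simp add: front_face_full[OF \<sigma>])
      finally show ?thesis using q \<sigma> by (simp add: tprod_tens[OF gvs_chains] p)
    qed
    also have "(\<Sum>k\<le>n. ?P (?u k) (?v k)) = (if p = 0 then tscale (augmentation (bas \<sigma>)) (tens C [(0, ?q), (0, ?q)]) else 0)"
    proof -
      have "(\<Sum>k\<le>n. ?P (?u k) (?v k)) = (\<Sum>k\<le>n. if k = 0 then if n = 0 then ?P (tens C [(0, ?q)]) (tens C [(0, ?q)]) else 0 else 0)"
        by (rule sum.cong) (use qt in auto)
      then show ?thesis using q by (simp add: tprod_tens[OF gvs_chains] p augmentation_single)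
    qed
    finally show ?case .
  qed
qed

text \<open>The description by \<open>THE\<close> is met by \<open>red_comult\<close>, and uniquely
  so, because \<open>unpoint\<close> applied to both factors is a left inverse of the inclusion of
  tensor squares.\<close>

lemma reduced_comult_red_comult:
  assumes c: "c \<in> carrier (R p)"
  shows "reduced_comult X x0 p c = red_comult X x0 p c"
proof -
  let ?i = "\<lambda>p x. tens C [(p, x)]"
  have inc: "map_tensor C [id_map C, id_map C] T = alg_ext C ?i T" if "T \<in> tensor_power R 2 p" for T
    using that
  proof (induction rule: tensor_square_induct)
    case (tens p a q b)
    then show ?case unfolding id_map_def
      by (simp only: map_tensor_pair[OF gvs_chains glin_mono[OF glin_incl le0] glin_mono[OF glin_incl le0] tens(1,2)]
        alg_ext_pair[OF gvs_chains glin_incl tens(1,2)]) simp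
  qed (simp_all add: map_tensor_lin_ext lin_ext_add lin_ext_scale)
  have inj: "alg_ext R unpoint_map (alg_ext C ?i T) = T" if "T \<in> tensor_power R 2 p" for T
    using that
  proof (induction rule: tensor_square_induct)
    case (tens p a q b)
    then have ab: "a \<in> carrier (C p)" "b \<in> carrier (C q)" by auto
    have "alg_ext R unpoint_map (tens C [(p, a), (q, b)]) = tens R [(p, a), (q, b)]"
      unfolding alg_ext_pair[OF gvs_reduced_chains glin_unpoint_map ab] unpoint_reduced[OF tens(1)] unpoint_reduced[OF tens(2)]
      by (rule tens_pair[OF gvs_reduced_chains tens(1,2), symmetric])
    then show ?case
      unfolding alg_ext_pair[OF gvs_chains glin_incl tens(1,2)] tens_pair[OF gvs_chains ab, symmetric] .
  qed (simp_all add: lin_ext_add lin_ext_scale)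
  have cC: "c \<in> carrier (C p)" using c by simp
  have eq: "alg_ext C ?i (red_comult X x0 p c) = aw_comult X p c
         + tscale (-1) (tens (chains X) [(0, point_chain x0), (p, c)])
         + tscale (-1) (tens (chains X) [(p, c), (0, point_chain x0)])"
    using incl_red_comult[OF cC] c by simp
  show ?thesis unfolding reduced_comult_def
  proof (rule the_equality)
    show "red_comult X x0 p c \<in> tensor_power R 2 p \<and> map_tensor C [id_map C, id_map C] (red_comult X x0 p c) = aw_comult X p c
         + tscale (-1) (tens (chains X) [(0, point_chain x0), (p, c)])
         + tscale (-1) (tens (chains X) [(p, c), (0, point_chain x0)])"
      using red_comult_tensor_power[OF cC] inc[OF red_comult_tensor_power[OF cC]] eq by simp
  next
    fix T assume T: "T \<in> tensor_power R 2 p \<and> map_tensor C [id_map C, id_map C] T = aw_comult X p c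
         + tscale (-1) (tens (chains X) [(0, point_chain x0), (p, c)])
         + tscale (-1) (tens (chains X) [(p, c), (0, point_chain x0)])"
    then have e: "alg_ext C ?i T = alg_ext C ?i (red_comult X x0 p c)" using eq inc[of T] by simp
    have "T = alg_ext R unpoint_map (alg_ext C ?i T)" using T inj[of T] by simp
    also have "\<dots> = red_comult X x0 p c" unfolding e by (rule inj[OF red_comult_tensor_power[OF cC]])
    finally show "T = red_comult X x0 p c" .
  qed
qed

lemma red_comult_boundary:
  assumes "c \<in> carrier (C p)"
  shows "der R (bdry_map R) (red_comult X x0 p c) = red_comult X x0 (p - 1) (boundary p c)"
proof -
  have "alg_ext R unpoint_map (der C (bdry_map C) (aw_comult X p c)) = der R (bdry_map R) (alg_ext R unpoint_map (aw_comult X p c))"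
  proof (rule alg_ext_der_ext[OF gvs_chains gvs_reduced_chains glin_unpoint_map _ glin_tens glin_bdry_map glin_tens glin_bdry_map_reduced])
    show "alg_ext R unpoint_map (tens C [(p - 1, boundary p x)]) = tens R [(p - 1, boundary p (unpoint x0 p x))]"
      if "x \<in> carrier (C p)" for p x
      using boundary_chains[OF that] by (simp only: alg_ext_gen[OF gvs_reduced_chains glin_unpoint_map] unpoint_boundary[OF that])
    show "alg_ext R unpoint_map (tens C [(p, x)]) = tens R [(p, unpoint x0 p x)]" if "x \<in> carrier (C p)" for p x
      by (rule alg_ext_gen[OF gvs_reduced_chains glin_unpoint_map that])
    show "unpoint x0 p x \<in> carrier (R p)" if "x \<in> carrier (C p)" for p x
      by (rule unpoint_in_reduced[OF that])
    show "aw_comult X p c \<in> tensors C" by (rule tensor_power_tensors[OF aw_comult_tensor_power[OF assms]])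
  qed
  then show ?thesis by (simp add: red_comult_def aw_comult_boundary[OF assms])
qed

lemma glin_red_comult: "glin R R 0 0 (red_comult X x0)"
  by (rule glin_tensor_linear[OF tensor_linear_red_comult]) simp

text \<open>The reduced diagonal gives the same result before and after \<open>unpoint\<close>, so
  each iterated reduced diagonal is the image of the full one under \<open>unpoint\<close> on all
  three factors.\<close>

lemma red_comult_coassoc:
  assumes "c \<in> carrier (C p)"
  shows "map_tensor R [(0, red_comult X x0), (0, letter R)] (red_comult X x0 p c) = map_tensor R [(0, letter R), (0, red_comult X x0)] (red_comult X x0 p c)"
proof -
  note gR = glin_red_comult glin_mono[OF glin_tens le0, of R]
  note gC = glin_mono[OF glin_aw le0, of X] glin_mono[OF glin_tens le0, of C]
  have 1: "map_tensor R [(0, red_comult X x0), (0, letter R)] (alg_ext R unpoint_map T) = alg_ext R unpoint_map (map_tensor C [(0, aw_comult X), (0, letter C)] T) \<and>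
     map_tensor R [(0, letter R), (0, red_comult X x0)] (alg_ext R unpoint_map T) = alg_ext R unpoint_map (map_tensor C [(0, letter C), (0, aw_comult X)] T)"
    if "T \<in> tensor_power C 2 p" for T
    using that
  proof (induction rule: tensor_square_induct)
    case (tens p a q b)
    have u: "unpoint x0 p a \<in> carrier (R p)" "unpoint x0 q b \<in> carrier (R q)"
      using tens by (blast intro: unpoint_in_reduced)+
    have A: "alg_ext R unpoint_map (tens C [(p, a), (q, b)]) = tens R [(p, unpoint x0 p a), (q, unpoint x0 q b)]"
      unfolding alg_ext_pair[OF gvs_reduced_chains glin_unpoint_map tens(1,2)] by (rule tens_pair[OF gvs_reduced_chains u, symmetric])
    have t: "tens C [(p, a)] \<in> tensors C" "tens C [(q, b)] \<in> tensors C" using tens by auto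
    show ?case
      unfolding A map_tensor_pair[OF gvs_reduced_chains gR u] map_tensor_pair[OF gvs_reduced_chains gR(2,1) u]
        map_tensor_pair[OF gvs_chains gC tens(1,2)] map_tensor_pair[OF gvs_chains gC(2,1) tens(1,2)]
      using glinD(2)[OF gC(1)] tens t
      by (simp add: alg_ext_tprod[OF gvs_chains gvs_reduced_chains glin_unpoint_map] red_comult_unpoint
         alg_ext_gen[OF gvs_reduced_chains glin_unpoint_map]) (simp add: red_comult_def)
  qed (simp_all add: map_tensor_lin_ext lin_ext_add lin_ext_scale)
  show ?thesis
    using 1[OF aw_comult_tensor_power[OF assms]] aw_comult_coassoc[OF assms]
    unfolding red_comult_def[of X x0 p c] id_map_def by simp
qed

private abbreviation (input) "ops \<equiv> dg_coalgebra_ops R boundary (reduced_comult X x0)"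

lemma ops_tensor_linear: "1 \<le> n \<Longrightarrow> tensor_linear R R n (int n - 2) (ops n)"
proof -
  assume "1 \<le> n"
  then consider "n = 1" | "n = 2" | "n > 2" by linarith
  then show ?thesis
  proof cases
    case 1
    have o: "ops 1 = bdry_map R" by (simp add: dg_coalgebra_ops_def fun_eq_iff)
    have "tensor_linear R R 1 (-1) (bdry_map R)"
    proof (rule tensor_linear_glin[OF glin_bdry_map_reduced])
      fix p x assume "x \<in> carrier (R p)"
      from boundary_reduced_chains[OF this] show "tens R [(p - 1, boundary p x)] \<in> tensor_power R 1 (p + - 1)"
        by (intro tens_tensor_power) (simp_all del: reduced_chains_simps(1))
    qed
    with o show ?thesis using 1 by simp
  next
    case 2
    have cl: "x + y \<in> carrier (R p)" "qscale r x \<in> carrier (R p)" if "x \<in> carrier (R p)" "y \<in> carrier (R p)" for x y p r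
      using qv.subspace_add[OF subspace_reduced_chains that] qv.subspace_scale[OF subspace_reduced_chains that(1)] .
    have "tensor_linear R R 2 0 (reduced_comult X x0)"
      unfolding tensor_linear_def reduced_chains_simps(3,4)
    proof (intro allI ballI conjI)
      fix p x y r assume x: "x \<in> carrier (R p)"
      then have xC: "x \<in> carrier (C p)" by simp
      show "reduced_comult X x0 p x \<in> tensor_power R 2 (p + 0)"
        unfolding reduced_comult_red_comult[OF x] add_0_right by (rule red_comult_tensor_power[OF xC])
      show "reduced_comult X x0 p (qscale r x) = tscale r (reduced_comult X x0 p x)"
        unfolding reduced_comult_red_comult[OF x] reduced_comult_red_comult[OF cl(2)[OF x x]] by (rule red_comult_scale)
      show "reduced_comult X x0 p (x + y) = reduced_comult X x0 p x + reduced_comult X x0 p y" if y: "y \<in> carrier (R p)"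
        unfolding reduced_comult_red_comult[OF x] reduced_comult_red_comult[OF y] reduced_comult_red_comult[OF cl(1)[OF x y]] by (rule red_comult_add)
    qed
    moreover have "ops 2 = reduced_comult X x0" by (simp add: dg_coalgebra_ops_def fun_eq_iff)
    ultimately show ?thesis using 2 by simp
  next
    case 3
    then have "ops n = (\<lambda>p x. 0)" by (simp add: dg_coalgebra_ops_def fun_eq_iff)
    then show ?thesis by (simp add: tensor_linear_def tensor_power_intros)
  qed
qed

lemma ops_zero: "2 < n \<Longrightarrow> ops n p x = 0"
  by (simp add: dg_coalgebra_ops_def)

lemma map_tensor_0: "map_tensor V gs 0 = 0"
  by (simp add: map_tensor_lin_ext)

text \<open>In arities 1, 2 and 3 the identities say that the boundary squares to 0, is a
  coderivation, and that the diagonal is coassociative. Beyond that each summand involves an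
  operation of arity above 2.\<close>

lemma ainf_coalgebra_reduced_chains: "ainf_coalgebra R ops"
proof -
  have o1: "ops (Suc 0) = bdry_map R" and o2: "ops 2 = reduced_comult X x0"
    by (simp_all add: dg_coalgebra_ops_def fun_eq_iff)
  have g2: "glin R R 0 0 (reduced_comult X x0)"
    using glin_tensor_linear[OF ops_tensor_linear[of 2], of 0] by (simp add: o2)
  note g1 = glin_mono[OF glin_bdry_map_reduced le0, of X]
  note gi = glin_mono[OF glin_tens le0, of R]
  have bd: "boundary p x \<in> carrier (R (p - 1))" if "x \<in> carrier (R p)" for p x
    by (rule boundary_reduced_chains[OF that])
  have st: "(\<Sum>i=1..n. \<Sum>j=0..n-i. tscale ((-1) ^ (i + j + i * j))
         (map_tensor R (replicate (n - i - j) (id_map R) @ [(int i - 2, ops i)] @ replicate j (id_map R)) (ops (n - i + 1) p x))) = 0"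
    if n: "1 \<le> n" and x: "x \<in> carrier (R p)" for n p x
  proof -
    have xC: "x \<in> carrier (C p)" using x by simp
    consider "n = 1" | "n = 2" | "n = 3" | "n > 3" using n by linarith
    then show ?thesis
    proof cases
      case 1
      have wl: "word_linear R (tensor_of_maps R [(-1, bdry_map R)])"
        by (rule word_linear_tensor_of_maps[OF gvs_reduced_chains]) (use g1 in auto)
      have "map_tensor R [(-1, bdry_map R)] (tens R [(p - 1, boundary p x)]) = 0"
        unfolding map_tensor_lin_ext lin_ext_tens[OF wl] using boundary_boundary[OF xC]
        by (simp add: tens_zero[OF gvs_reduced_chains, simplified])
      then show ?thesis using 1 by (simp add: o1)
    next
      case 2
      have wl: "word_linear R (tensor_of_maps R [(0, reduced_comult X x0)])"
        by (rule word_linear_tensor_of_maps[OF gvs_reduced_chains]) (use g2 in auto)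
      have a: "map_tensor R [(0, reduced_comult X x0)] (tens R [(p - 1, boundary p x)]) = red_comult X x0 (p - 1) (boundary p x)"
        unfolding map_tensor_lin_ext lin_ext_tens[OF wl] using glinD(2)[OF g2 bd[OF x]] reduced_comult_red_comult[OF bd[OF x]]
        by (simp add: tprod_unit_right[OF gvs_reduced_chains])
      have "map_tensor R [(-1, bdry_map R), id_map R] (red_comult X x0 p x) + map_tensor R [id_map R, (-1, bdry_map R)] (red_comult X x0 p x) =
         red_comult X x0 (p - 1) (boundary p x)"
        using der_map_tensor[OF gvs_reduced_chains glin_bdry_map_reduced red_comult_tensor_power[OF xC]] red_comult_boundary[OF xC]
        by (simp add: numeral_2_eq_2)
      then have b: "map_tensor R [(-1, bdry_map R), id_map R] (red_comult X x0 p x) =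
         red_comult X x0 (p - 1) (boundary p x) - map_tensor R [id_map R, (-1, bdry_map R)] (red_comult X x0 p x)"
        by (simp add: algebra_simps)
      have "{1..2::nat} = {1, 2}" "{0..Suc 0} = {0, 1}" by auto
      then show ?thesis using 2 x by (simp add: o1 o2 a b reduced_comult_red_comult numeral_2_eq_2[symmetric] del: reduced_chains_simps(1))
    next
      case 3
      have cg: "map_tensor R [(0, reduced_comult X x0), id_map R] T = map_tensor R [(0, red_comult X x0), (0, letter R)] T \<and>
        map_tensor R [id_map R, (0, reduced_comult X x0)] T = map_tensor R [(0, letter R), (0, red_comult X x0)] T"
        if "T \<in> tensor_power R 2 p" for T
        using that
      proof (induction rule: tensor_square_induct)
        case (tens p a q b)
        then show ?case unfolding id_map_def
          by (simp add: map_tensor_pair[OF gvs_reduced_chains g2 gi] map_tensor_pair[OF gvs_reduced_chains gi g2]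
            map_tensor_pair[OF gvs_reduced_chains glin_red_comult gi] map_tensor_pair[OF gvs_reduced_chains gi glin_red_comult] reduced_comult_red_comult
            del: reduced_chains_simps(1))
      qed (simp_all add: map_tensor_lin_ext lin_ext_add lin_ext_scale)
      have "{1..3::nat} = {1, 2, 3}" "{0..2::nat} = {0, 1, 2}" "{0..Suc 0} = {0, 1}" by auto
      moreover have "map_tensor R [(1, ops 3)] (tens R [(p - 1, boundary p x)]) = 0"
      proof -
        have "tensor_of_maps R [(1, ops 3)] xs = 0" for xs
          by (cases xs) (auto simp: ops_zero)
        then have "tensor_of_maps R [(1, ops 3)] = (\<lambda>xs. 0)" by (simp add: fun_eq_iff)
        then show ?thesis by (simp only: map_tensor_lin_ext lin_ext_tens[OF word_linear_0])
      qed
      ultimately show ?thesis using 3 x red_comult_coassoc[OF xC] cg[OF red_comult_tensor_power[OF xC]]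
        by (simp add: o2 o1 ops_zero map_tensor_0 reduced_comult_red_comult numeral_2_eq_2[symmetric] del: reduced_chains_simps(1))
    next
      case 4
      have "map_tensor R (replicate (n - i - j) (id_map R) @ [(int i - 2, ops i)] @ replicate j (id_map R)) (ops (n - i + 1) p x) = 0"
        if i: "i \<in> {1..n}" and j: "j \<in> {0..n - i}" for i j
      \<comment> \<open>The arities \<open>i\<close> and \<open>n - i + 1\<close> add up to
        \<open>n + 1 > 4\<close>, so they cannot both be at most 2.\<close>
      proof (cases "i \<le> 2")
        case True
        then show ?thesis using 4 by (simp add: ops_zero map_tensor_0)
      next
        case False
        have z: "tensor_of_maps R (gs @ (d, \<lambda>p x. 0) # hs) xs = 0"
          if "\<forall>(d, g)\<in>set gs. glin R R 0 d g" "xs \<in> hom_lists R" for gs hs xs d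
          using that
        proof (induction gs arbitrary: xs)
          case Nil
          then show ?case by (cases xs) auto
        next
          case (Cons g gs)
          then show ?case by (cases xs; cases g) (auto simp: glinD)
        qed
        have oi: "ops i = (\<lambda>p x. 0)" using False by (simp add: fun_eq_iff ops_zero)
        have "map_tensor R (replicate a (id_map R) @ (int i - 2, \<lambda>p x. 0) # replicate j (id_map R)) T = 0"
          if T: "T \<in> tensors R" for T a
          unfolding map_tensor_lin_ext
        proof -
          let ?gs = "replicate (a) (id_map R) @ (int i - 2, \<lambda>p x. 0) # replicate j (id_map R)"
          have gs: "\<forall>(d, g)\<in>set ?gs. glin R R 0 d g" "\<forall>(d, g)\<in>set (replicate a (id_map R)). glin R R 0 d g"
            using glin_id_map[of R] glin_0[of R R 0 "int i - 2"] by (auto simp: case_prod_unfold)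
          note wl = word_linear_tensor_of_maps[OF gvs_reduced_chains gs(1)]
          show "lin_ext (tensor_of_maps R ?gs) T = 0" using T
            by (induction rule: tspan_induct) (simp_all add: lin_ext_add lin_ext_scale lin_ext_tens[OF wl] z[OF gs(2)])
        qed
        note z0 = this
        have Tm: "ops (n - i + 1) p x \<in> tensors R"
          by (rule glinD(2)[OF glin_tensor_linear[OF ops_tensor_linear le0] x]) simp
        show ?thesis using z0[OF Tm, of "n - i - j"] by (simp add: oi)
      qed
      then show ?thesis by (intro sum.neutral) (simp add: sum.neutral)
    qed
  qed
  show ?thesis unfolding ainf_coalgebra_def
    using gvs_reduced_chains ops_tensor_linear st by blast
qed

end

text \<open>Both spaces use the same base point, so \<open>unpoint\<close> and the Alexander-Whitney
  formula are given by the same expressions in either space.\<close>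

lemma red_comult_natural:
  assumes XY: "continuous_map X Y id" and x0: "x0 \<in> topspace X" and c: "c \<in> carrier (chains X p)"
  shows "alg_ext (reduced_chains Y) (\<lambda>p x. tens (reduced_chains Y) [(p, x)]) (red_comult X x0 p c) = red_comult Y x0 p c"
proof -
  let ?RX = "reduced_chains X" and ?RY = "reduced_chains Y" and ?CX = "chains X" and ?CY = "chains Y"
  have y0: "x0 \<in> topspace Y" using continuous_map_image_subset_topspace[OF XY] x0 by auto
  note cm = chains_mono[OF XY] and rm = reduced_chains_mono[OF XY]
  have jR: "glin ?RX ?RY 1 0 (\<lambda>p x. tens ?RY [(p, x)])"
    by (rule glin_tens_map[where e = 0 and f = "\<lambda>p x. x", unfolded add_0_right, OF gvs_reduced_chains])
      (simp_all add: rm del: reduced_chains_simps(1))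
  have jC: "glin ?CX ?CY 1 0 (\<lambda>p x. tens ?CY [(p, x)])"
    by (rule glin_tens_map[where e = 0 and f = "\<lambda>p x. x", unfolded add_0_right, OF gvs_chains]) (simp_all add: cm)
  note ax = tensor_power_tensors[OF aw_comult_tensor_power[OF c]]
  have sq: "alg_ext ?RY (\<lambda>p x. tens ?RY [(p, x)]) (tens ?RX [(p, unpoint x0 p x)]) = tens ?RY [(p, unpoint x0 p x)]"
    if "x \<in> carrier (?CX p)" for p x
    by (rule alg_ext_gen[OF gvs_reduced_chains jR unpoint_in_reduced[OF x0 that]])
  have "alg_ext ?RY (\<lambda>p x. tens ?RY [(p, x)]) (red_comult X x0 p c) =
      alg_ext ?RY (\<lambda>p x. tens ?RY [(p, unpoint x0 p x)]) (alg_ext ?CY (\<lambda>p x. tens ?CY [(p, x)]) (aw_comult X p c))"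
    unfolding red_comult_def
    by (rule alg_ext_square[where f = "\<lambda>p x. x", OF gvs_chains gvs_reduced_chains gvs_reduced_chains glin_unpoint_map[OF x0] glin_unpoint_map[OF y0] jC jR _ _ ax])
      (fact cm, fact sq)
  also have "alg_ext ?CY (\<lambda>p x. tens ?CY [(p, x)]) (aw_comult X p c) = aw_comult Y p c"
    using c
  proof (induction rule: chains_induct)
    case (single \<sigma>)
    have "bas (front_face k \<sigma>) \<in> carrier (?CX (int k))" "bas (back_face (nat p) k \<sigma>) \<in> carrier (?CX (p - int k))" if "k \<le> nat p" for k
      using singular_simplex_front_face[OF single(2) that] singular_simplex_back_face[OF single(2) that] that single(1)
      by (simp_all add: nat_diff_distrib)
    then show ?case unfolding aw_comult_single lin_ext_sum
      by (intro sum.cong) (auto simp: alg_ext_pair[OF gvs_chains jC] tprod_tens[OF gvs_chains] cm simp del: bas_chains)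
  qed (simp_all add: aw_comult_add aw_comult_scale lin_ext_add lin_ext_scale)
  finally show ?thesis by (simp add: red_comult_def)
qed

declare reduced_chains_simps(1) [simp del]

subsection \<open>Reduced homology\<close>

abbreviation "bds X p \<equiv> boundaries (reduced_chains X) boundary p"

abbreviation "cyc X p \<equiv> cycles (reduced_chains X) boundary p"

definition hclass :: "'a topology \<Rightarrow> int \<Rightarrow> 'a qchain \<Rightarrow> 'a qchain set"
  where "hclass X p z = bds X p +>\<^bsub>reduced_chains X p\<^esub> z"

lemma reduced_chains_closed:
  "0 \<in> carrier (reduced_chains X p)"
  "a \<in> carrier (reduced_chains X p) \<Longrightarrow> b \<in> carrier (reduced_chains X p) \<Longrightarrow> a + b \<in> carrier (reduced_chains X p)"
  "a \<in> carrier (reduced_chains X p) \<Longrightarrow> b \<in> carrier (reduced_chains X p) \<Longrightarrow> a - b \<in> carrier (reduced_chains X p)"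
  "a \<in> carrier (reduced_chains X p) \<Longrightarrow> qscale r a \<in> carrier (reduced_chains X p)"
  using subspace_reduced_chains[of X p] by (blast intro: qv.subspace_0 qv.subspace_add qv.subspace_diff qv.subspace_scale)+

lemma reduced_chains_chains: "c \<in> carrier (reduced_chains X p) \<Longrightarrow> c \<in> carrier (chains X p)"
  by (simp add: reduced_chains_simps)

lemma bds_iff: "b \<in> bds X p \<longleftrightarrow> (\<exists>c\<in>carrier (reduced_chains X (p + 1)). b = boundary (p + 1) c)"
  by (auto simp: boundaries_def)

lemma cyc_iff: "z \<in> cyc X p \<longleftrightarrow> z \<in> carrier (reduced_chains X p) \<and> boundary p z = 0"
  by (auto simp: cycles_def)

lemma subspace_bds: "qv.subspace (bds X p)"
proof (rule qv.subspaceI)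
  show "0 \<in> bds X p" unfolding bds_iff by (rule bexI[of _ 0]) (simp_all add: reduced_chains_closed)
  fix a b r assume "a \<in> bds X p"
  then obtain c where c: "c \<in> carrier (reduced_chains X (p + 1))" "a = boundary (p + 1) c" by (auto simp: bds_iff)
  show "qscale r a \<in> bds X p" unfolding bds_iff
    by (rule bexI[of _ "qscale r c"]) (simp_all add: c boundary_scale reduced_chains_closed)
  assume "b \<in> bds X p"
  then obtain d where d: "d \<in> carrier (reduced_chains X (p + 1))" "b = boundary (p + 1) d" by (auto simp: bds_iff)
  show "a + b \<in> bds X p" unfolding bds_iff
    by (rule bexI[of _ "c + d"]) (simp_all add: c d boundary_add reduced_chains_closed)
qed

lemmas bds_closed = qv.subspace_0[OF subspace_bds] qv.subspace_add[OF subspace_bds] qv.subspace_diff[OF subspace_bds]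
  qv.subspace_scale[OF subspace_bds] qv.subspace_neg[OF subspace_bds]

lemma boundary_bds: "c \<in> carrier (reduced_chains X p) \<Longrightarrow> boundary p c \<in> bds X (p - 1)"
  unfolding bds_iff by (rule bexI[of _ c]) simp_all

lemma boundary_boundary_reduced: "c \<in> carrier (reduced_chains X p) \<Longrightarrow> boundary (p - 1) (boundary p c) = 0"
  by (rule boundary_boundary[OF reduced_chains_chains])

lemma bds_cyc: "b \<in> bds X p \<Longrightarrow> b \<in> cyc X p"
  using boundary_boundary_reduced[of _ X "p + 1"] boundary_reduced_chains[of _ X "p + 1"] by (auto simp: bds_iff cyc_iff)

lemma cyc_closed:
  "a \<in> cyc X p \<Longrightarrow> b \<in> cyc X p \<Longrightarrow> a + b \<in> cyc X p"
  "a \<in> cyc X p \<Longrightarrow> b \<in> cyc X p \<Longrightarrow> a - b \<in> cyc X p"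
  "a \<in> cyc X p \<Longrightarrow> qscale r a \<in> cyc X p"
  by (auto simp: cyc_iff reduced_chains_closed boundary_add boundary_diff boundary_scale)

lemma hclass_alt: "hclass X p z = (\<lambda>b. b + z) ` bds X p"
  by (auto simp: hclass_def a_r_coset_def')

lemma hclass_eq_iff: "hclass X p z = hclass X p w \<longleftrightarrow> z - w \<in> bds X p"
proof
  assume "hclass X p z = hclass X p w"
  then have "0 + z \<in> hclass X p w" using bds_closed(1)[of X p] unfolding hclass_alt by blast
  then show "z - w \<in> bds X p" by (auto simp: hclass_alt)
next
  have sub: "hclass X p z \<subseteq> hclass X p w" if "z - w \<in> bds X p" for z w
  proof
    fix y assume "y \<in> hclass X p z"
    then obtain b where "b \<in> bds X p" "y = b + z" by (auto simp: hclass_alt)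
    then show "y \<in> hclass X p w" using bds_closed(2)[of b X p "z - w"] that
      by (auto simp: hclass_alt algebra_simps intro!: image_eqI[of _ _ "b + (z - w)"])
  qed
  assume a: "z - w \<in> bds X p"
  then have "w - z \<in> bds X p" using bds_closed(5)[of "z - w" X p] by simp
  with a sub show "hclass X p z = hclass X p w" by blast
qed

lemma hclass_self: "z \<in> hclass X p z"
  using bds_closed(1)[of X p] by (force simp: hclass_alt)

lemma hclass_member: "w \<in> hclass X p z \<Longrightarrow> w - z \<in> bds X p"
  by (auto simp: hclass_alt)

lemma reduced_homology_simps:
  "carrier (reduced_homology X p) = hclass X p ` cyc X p"
  "\<zero>\<^bsub>reduced_homology X p\<^esub> = hclass X p 0"
  "hclass X p z \<oplus>\<^bsub>reduced_homology X p\<^esub> hclass X p w = hclass X p (z + w)"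
  "r \<odot>\<^bsub>reduced_homology X p\<^esub> hclass X p z = hclass X p (qscale r z)"
proof -
  show "carrier (reduced_homology X p) = hclass X p ` cyc X p"
    by (simp add: reduced_homology_def homology_def hclass_def)
  show "\<zero>\<^bsub>reduced_homology X p\<^esub> = hclass X p 0"
    by (simp add: reduced_homology_def homology_def hclass_alt)
  have "(\<Union>h\<in>hclass X p z. \<Union>k\<in>hclass X p w. {h + k}) = hclass X p (z + w)"
  proof (intro equalityI subsetI)
    fix y assume "y \<in> (\<Union>h\<in>hclass X p z. \<Union>k\<in>hclass X p w. {h + k})"
    then obtain b c where "b \<in> bds X p" "c \<in> bds X p" "y = (b + z) + (c + w)" by (auto simp: hclass_alt)
    then show "y \<in> hclass X p (z + w)" unfolding hclass_alt
      by (intro image_eqI[of _ _ "b + c"]) (auto simp: algebra_simps bds_closed)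
  next
    fix y assume "y \<in> hclass X p (z + w)"
    then obtain b where b: "b \<in> bds X p" "y = (b + z) + (0 + w)" by (auto simp: hclass_alt algebra_simps)
    then show "y \<in> (\<Union>h\<in>hclass X p z. \<Union>k\<in>hclass X p w. {h + k})"
      using bds_closed(1)[of X p] unfolding hclass_alt by blast
  qed
  then show "hclass X p z \<oplus>\<^bsub>reduced_homology X p\<^esub> hclass X p w = hclass X p (z + w)"
    by (simp add: reduced_homology_def homology_def set_add_def')
  have "(\<Union>h\<in>bds X p. \<Union>k\<in>qscale r ` hclass X p z. {h + k}) = hclass X p (qscale r z)"
  proof (intro equalityI subsetI)
    fix y assume "y \<in> (\<Union>h\<in>bds X p. \<Union>k\<in>qscale r ` hclass X p z. {h + k})"
    then obtain b c where "b \<in> bds X p" "c \<in> bds X p" "y = b + qscale r (c + z)" by (auto simp: hclass_alt)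
    then show "y \<in> hclass X p (qscale r z)" unfolding hclass_alt
      by (intro image_eqI[of _ _ "b + qscale r c"]) (auto simp: algebra_simps qv.scale_right_distrib bds_closed)
  next
    fix y assume "y \<in> hclass X p (qscale r z)"
    then obtain b where b: "b \<in> bds X p" "y = b + qscale r (0 + z)" by (auto simp: hclass_alt)
    then show "y \<in> (\<Union>h\<in>bds X p. \<Union>k\<in>qscale r ` hclass X p z. {h + k})"
      using bds_closed(1)[of X p] unfolding hclass_alt by blast
  qed
  then show "r \<odot>\<^bsub>reduced_homology X p\<^esub> hclass X p z = hclass X p (qscale r z)"
    by (simp add: reduced_homology_def homology_def set_add_def')
qed

lemma gvs_reduced_homology: "graded_vector_space (reduced_homology X)"
  unfolding graded_vector_space_def
proof
  fix p
  let ?H = "reduced_homology X p"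
  have z0: "0 \<in> cyc X p" by (simp add: cyc_iff reduced_chains_closed)
  note s = reduced_homology_simps
  show "module rat_ring ?H"
  proof (rule moduleI[OF cring_rat_ring])
    show "abelian_group ?H"
    proof (rule abelian_groupI)
      fix x assume "x \<in> carrier ?H"
      then obtain z where z: "z \<in> cyc X p" "x = hclass X p z" by (auto simp: s)
      then have "hclass X p (qscale (-1) z) \<in> carrier ?H"
        unfolding s(1) by (intro imageI cyc_closed(3))
      then show "\<exists>y\<in>carrier ?H. y \<oplus>\<^bsub>?H\<^esub> x = \<zero>\<^bsub>?H\<^esub>"
        by (rule bexI[rotated]) (simp add: z s)
    qed (use z0 in \<open>auto simp: s cyc_closed algebra_simps\<close>)
  qed (auto simp: s cyc_closed rat_ring_def qv.scale_left_distrib qv.scale_right_distrib)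
qed

text \<open>The induced map is a union over all representatives; they differ by boundaries of
  \<open>X\<close>, which are boundaries of \<open>Y\<close>, so all cosets in the union
  coincide.\<close>

lemma reduced_homology_map_hclass:
  assumes XY: "continuous_map X Y id" and z: "z \<in> cyc X p"
  shows "reduced_homology_map Y id p (hclass X p z) = hclass Y p z"
proof -
  have "chain_push id p w = w \<and> hclass Y p w = hclass Y p z" if "w \<in> hclass X p z" for w
  proof
    have wz: "w - z \<in> bds X p" using that by (rule hclass_member)
    then have "w \<in> cyc X p" using cyc_closed(1)[OF bds_cyc[OF wz] z] by simp
    then show "chain_push id p w = w" by (intro chain_push_id[of _ X]) (auto simp: cyc_iff reduced_chains_chains)
    show "hclass Y p w = hclass Y p z" unfolding hclass_eq_iff
      using wz reduced_chains_mono[OF XY] by (auto simp: bds_iff)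
  qed
  then have "reduced_homology_map Y id p (hclass X p z) = (\<Union>w\<in>hclass X p z. hclass Y p z)"
    unfolding reduced_homology_map_def homology_map_def hclass_def[of Y, symmetric] by (intro SUP_cong) auto
  also have "\<dots> = hclass Y p z" using hclass_self[of z X p] by auto
  finally show ?thesis .
qed

lemma cyc_mono: "continuous_map X Y id \<Longrightarrow> z \<in> cyc X p \<Longrightarrow> z \<in> cyc Y p"
  using reduced_chains_mono by (auto simp: cyc_iff)

text \<open>Each coefficient of a linear map \<open>L\<close> into chains gives a multilinear form
  supported on one-letter words of degree \<open>p\<close>, and such forms detect the value of
  \<open>L\<close> on the letter. This settles the uniqueness required by
  \<open>untens\<close>.\<close>

lemma tens_separates:
  assumes add: "\<And>x y. x \<in> carrier (V p) \<Longrightarrow> y \<in> carrier (V p) \<Longrightarrow> L (x \<oplus>\<^bsub>V p\<^esub> y) = L x + (L y :: 'x \<Rightarrow>\<^sub>0 rat)"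
    and scl: "\<And>x c. x \<in> carrier (V p) \<Longrightarrow> L (c \<odot>\<^bsub>V p\<^esub> x) = qscale c (L x)"
    and eq: "tens V [(p, x)] = tens V [(p, y)]"
  shows "L x = L y"
proof (rule poly_mapping_eqI)
  fix \<sigma>
  let ?\<phi> = "\<lambda>xs. if length xs = 1 \<and> fst (hd xs) = p then Poly_Mapping.lookup (L (snd (hd xs))) \<sigma> else 0"
  have "?\<phi> \<in> multiforms V"
    unfolding multiforms_def mem_Collect_eq
  proof (intro ballI allI conjI)
    fix us vs q x y c assume x: "x \<in> carrier (V q)"
    show "?\<phi> (us @ (q, c \<odot>\<^bsub>V q\<^esub> x) # vs) = c * ?\<phi> (us @ (q, x) # vs)"
      using scl x by (cases us) (auto simp: lookup_qscale)
    assume "y \<in> carrier (V q)"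
    then show "?\<phi> (us @ (q, x \<oplus>\<^bsub>V q\<^esub> y) # vs) = ?\<phi> (us @ (q, x) # vs) + ?\<phi> (us @ (q, y) # vs)"
      using add x by (cases us) (auto simp: lookup_add)
  qed
  then show "Poly_Mapping.lookup (L x) \<sigma> = Poly_Mapping.lookup (L y) \<sigma>"
    using fun_cong[OF eq, of ?\<phi>] by (simp add: tens_def)
qed

lemma untens_reduced: "x \<in> carrier (reduced_chains X p) \<Longrightarrow> untens (reduced_chains X) p (tens (reduced_chains X) [(p, x)]) = x"
  unfolding untens_def by (rule the_equality) (auto dest!: tens_separates[where L = "\<lambda>x. x", rotated 2])

subsection \<open>Splittings of the reduced chains\<close>

definition qlinear :: "(('x \<Rightarrow>\<^sub>0 rat) \<Rightarrow> ('x \<Rightarrow>\<^sub>0 rat)) \<Rightarrow> bool"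
  where "qlinear f \<longleftrightarrow> (\<forall>a b. f (a + b) = f a + f b) \<and> (\<forall>r a. f (qscale r a) = qscale r (f a))"

text \<open>A projection \<open>g\<close> onto the boundaries and a section \<open>t\<close> of \<open>\<partial>\<close> determine a contraction onto homology:
  the harmonic representative of \<open>[z]\<close> is \<open>z - g z\<close>, and \<open>c - t (\<partial> c)\<close> is a cycle.\<close>

definition splitting :: "'a topology \<Rightarrow> (int \<Rightarrow> 'a qchain \<Rightarrow> 'a qchain) \<Rightarrow> (int \<Rightarrow> 'a qchain \<Rightarrow> 'a qchain) \<Rightarrow> bool"
  where "splitting X g t \<longleftrightarrow> (\<forall>p. qlinear (g p) \<and> range (g p) \<subseteq> bds X p \<and> (\<forall>b\<in>bds X p. g p b = b) \<and>
    qlinear (t p) \<and> range (t p) \<subseteq> carrier (reduced_chains X (p + 1)) \<and> (\<forall>b\<in>bds X p. boundary (p + 1) (t p b) = b))"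

lemma qlinearD:
  assumes "qlinear f"
  shows "f (a + b) = f a + f b" "f (qscale r a) = qscale r (f a)" "f 0 = 0" "f (a - b) = f a - f b"
proof -
  show a: "f (a + b) = f a + f b" "f (qscale r a) = qscale r (f a)" for a b r using assms by (auto simp: qlinear_def)
  show "f 0 = 0" using a(1)[of 0 0] by simp
  show "f (a - b) = f a - f b" using a(1)[of "a - b" b] by (simp add: algebra_simps)
qed

text \<open>\<open>g\<close> is a left inverse of the inclusion of the boundaries and
  \<open>t\<close> a right inverse of the boundary operator, both supplied by linear algebra over a
  field. They are defined on all finitely supported functions, which spares domain conditions
  later.\<close>

lemma splitting_exists: "\<exists>g t. splitting X g t"
proof -
  interpret vector_space_pair "qscale :: rat \<Rightarrow> 'a qchain \<Rightarrow> 'a qchain" "qscale :: rat \<Rightarrow> 'a qchain \<Rightarrow> 'a qchain"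
    by unfold_locales
  have lin: "qlinear f" if "Vector_Spaces.linear qscale qscale f" for f :: "'a qchain \<Rightarrow> 'a qchain"
    using linear_add[OF that] linear_scale[OF that] by (auto simp: qlinear_def)
  have "\<exists>g. qlinear g \<and> range g \<subseteq> bds X p \<and> (\<forall>b\<in>bds X p. g b = b)" for p
  proof -
    have "Vector_Spaces.linear qscale qscale (\<lambda>c :: 'a qchain. c)"
      using qv.linear_id by (simp add: id_def)
    from linear_exists_left_inverse_on[OF this subspace_bds inj_on_id2[of "bds X p"]]
    show ?thesis using lin by auto
  qed
  then obtain g where g: "\<And>p. qlinear (g p) \<and> range (g p) \<subseteq> bds X p \<and> (\<forall>b\<in>bds X p. g p b = b)" by metis
  have "\<exists>t. qlinear t \<and> range t \<subseteq> carrier (reduced_chains X (p + 1)) \<and> (\<forall>b\<in>bds X p. boundary (p + 1) (t b) = b)" for p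
  proof -
    have "Vector_Spaces.linear qscale qscale (boundary (p + 1) :: 'a qchain \<Rightarrow> 'a qchain)"
      by unfold_locales (auto simp: boundary_add boundary_scale)
    from linear_exists_right_inverse_on[OF this subspace_reduced_chains[of X "p + 1"]]
    show ?thesis using lin unfolding boundaries_def by auto
  qed
  then obtain t where t: "\<And>p. qlinear (t p) \<and> range (t p) \<subseteq> carrier (reduced_chains X (p + 1)) \<and>
      (\<forall>b\<in>bds X p. boundary (p + 1) (t p b) = b)" by metis
  show ?thesis using g t unfolding splitting_def by blast
qed

text \<open>The retraction induces a chain idempotent on the chains of \<open>Y\<close> with image
  the chains of \<open>X\<close>, which makes them a summand as a complex. The given splitting is
  kept on this summand, and an arbitrary one of \<open>Y\<close> is compressed to the
  complement.\<close>

lemma splitting_extend: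
  assumes XY: "continuous_map X Y id" and r: "continuous_map Y X \<rho>" and r_id: "\<And>x. x \<in> topspace X \<Longrightarrow> \<rho> x = x"
    and s: "splitting X g t"
  shows "\<exists>g' t'. splitting Y g' t' \<and> (\<forall>p. \<forall>c\<in>carrier (reduced_chains X p). g' p c = g p c \<and> t' p c = t p c)"
proof -
  let ?r = "chain_push \<rho>"
  obtain g0 t0 where s0: "splitting Y g0 t0" using splitting_exists by blast
  have g: "qlinear (g p)" "g p c \<in> bds X p" "b \<in> bds X p \<Longrightarrow> g p b = b"
    and t: "qlinear (t p)" "t p c \<in> carrier (reduced_chains X (p + 1))" "b \<in> bds X p \<Longrightarrow> boundary (p + 1) (t p b) = b" for p b c
    using s by (auto simp: splitting_def image_subset_iff)
  have g0: "qlinear (g0 p)" "g0 p c \<in> bds Y p" "b \<in> bds Y p \<Longrightarrow> g0 p b = b"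
    and t0: "qlinear (t0 p)" "t0 p c \<in> carrier (reduced_chains Y (p + 1))" "b \<in> bds Y p \<Longrightarrow> boundary (p + 1) (t0 p b) = b" for p b c
    using s0 by (auto simp: splitting_def image_subset_iff)
  have rl: "qlinear (?r p)" for p by (simp add: qlinear_def chain_push_add chain_push_scale)
  have rb: "?r p b \<in> bds X p" if b: "b \<in> bds Y p" for p b
  proof -
    obtain c where c: "c \<in> carrier (reduced_chains Y (p + 1))" "b = boundary (p + 1) c" using b by (auto simp: bds_iff)
    then have "?r p b = boundary (p + 1) (?r (p + 1) c)"
      using chain_push_boundary[OF reduced_chains_chains[OF c(1)], of \<rho>] by simp
    then show ?thesis using chain_push_reduced_chains[OF r c(1)] by (auto simp: bds_iff)
  qed
  have bm: "b \<in> bds Y p" if "b \<in> bds X p" for b p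
    using that reduced_chains_mono[OF XY] by (auto simp: bds_iff)
  have rid: "?r p c = c" if "c \<in> carrier (reduced_chains X p)" for p c
    by (rule chain_push_id[OF reduced_chains_chains[OF that] r_id])
  have bR: "b \<in> carrier (reduced_chains X p)" if "b \<in> bds X p" for b p
    using bds_cyc[OF that] by (simp add: cyc_iff)
  \<comment> \<open>With \<open>r\<close> the map on chains, \<open>G\<close> is
    \<open>g r + (1 - r) g0 (1 - r)\<close>, and \<open>S\<close> is built from \<open>t\<close> and
    \<open>t0\<close> in the same way; on chains of \<open>X\<close> the second summand has argument
    0.\<close>
  define G where "G p c = g p (?r p c) + (g0 p (c - ?r p c) - ?r p (g0 p (c - ?r p c)))" for p c
  define S where "S p c = t p (?r p c) + (t0 p (c - ?r p c) - ?r (p + 1) (t0 p (c - ?r p c)))" for p c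
  have diff: "b - ?r p b \<in> bds Y p" "?r p (b - ?r p b) = 0" if "b \<in> bds Y p" for b p
    using bds_closed(3)[OF that bm[OF rb[OF that]]] rid[OF bR[OF rb[OF that]]] by (auto simp: qlinearD[OF rl])
  have "splitting Y G S"
    unfolding splitting_def
  proof (intro allI conjI ballI subsetI)
    fix p
    show "qlinear (G p)" "qlinear (S p)"
      by (auto simp: qlinear_def G_def S_def qlinearD[OF g(1)] qlinearD[OF g0(1)] qlinearD[OF t(1)] qlinearD[OF t0(1)]
        qlinearD[OF rl] qv.scale_right_distrib qv.scale_right_diff_distrib algebra_simps)
    show "c \<in> bds Y p" if c: "c \<in> range (G p)" for c
    proof -
      obtain x where "c = G p x" using c by blast
      then show ?thesis unfolding G_def
        using bds_closed(2)[OF bm[OF g(2)] bds_closed(3)[OF g0(2) bm[OF rb[OF g0(2)]]]] by simp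
    qed
    show "c \<in> carrier (reduced_chains Y (p + 1))" if c: "c \<in> range (S p)" for c
    proof -
      obtain x where "c = S p x" using c by blast
      then show ?thesis unfolding S_def
        using reduced_chains_closed(2)[OF reduced_chains_mono[OF XY t(2)]
          reduced_chains_closed(3)[OF t0(2) reduced_chains_mono[OF XY chain_push_reduced_chains[OF r t0(2)]]]] by simp
    qed
    fix b assume b: "b \<in> bds Y p"
    show "G p b = b"
      using diff[OF b] g(3)[OF rb[OF b]] g0(3)[OF diff(1)[OF b]] by (simp add: G_def)
    \<comment> \<open>The compression remains a section because the retraction commutes with the
      boundary and kills \<open>b - r b\<close>.\<close>
    have "boundary (p + 1) (?r (p + 1) (t0 p (b - ?r p b))) = ?r p (boundary (p + 1) (t0 p (b - ?r p b)))"
      using chain_push_boundary[OF reduced_chains_chains[OF t0(2)], of p \<rho> "b - ?r p b"] by simp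
    then show "boundary (p + 1) (S p b) = b"
      using diff[OF b] t(3)[OF rb[OF b]] t0(3)[OF diff(1)[OF b]] by (simp add: S_def boundary_add boundary_diff)
  qed
  moreover have "G p c = g p c" "S p c = t p c" if "c \<in> carrier (reduced_chains X p)" for p c
    using rid[OF that] by (simp_all add: G_def S_def qlinearD[OF g0(1)] qlinearD[OF t0(1)])
  ultimately show ?thesis by blast
qed

subsection \<open>The transferred coalgebra\<close>

locale split_chains =
  fixes X :: "'a topology" and x0 :: 'a and g t :: "int \<Rightarrow> 'a qchain \<Rightarrow> 'a qchain"
  assumes x0: "x0 \<in> topspace X" and splitting: "splitting X g t"
begin

abbreviation "RX \<equiv> reduced_chains X"
abbreviation "HX \<equiv> reduced_homology X"
abbreviation "WX \<equiv> desuspension (reduced_chains X)"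
abbreviation "UX \<equiv> desuspension (reduced_homology X)"
abbreviation "opX \<equiv> dg_coalgebra_ops RX boundary (reduced_comult X x0)"

lemma g: "qlinear (g p)" "g p c \<in> bds X p" "b \<in> bds X p \<Longrightarrow> g p b = b"
  and t: "qlinear (t p)" "t p c \<in> carrier (RX (p + 1))" "b \<in> bds X p \<Longrightarrow> boundary (p + 1) (t p b) = b"
  using splitting by (auto simp: splitting_def image_subset_iff)

text \<open>Two members of a class differ by a boundary, which \<open>z - g p z\<close> does not
  see, so the choice is harmless.\<close>

definition "hsec p Z = (let z = (SOME z. z \<in> Z) in z - g p z)"

definition "cyc_part p c = c - t (p - 1) (boundary p c)"

definition "hproj p c = hclass X p (cyc_part p c)"

definition "hhom p c = t p (g p (cyc_part p c))"

lemma hsec_hclass: "hsec p (hclass X p z) = z - g p z"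
proof -
  define w where "w = (SOME w. w \<in> hclass X p z)"
  have "w \<in> hclass X p z" unfolding w_def by (rule someI, rule hclass_self)
  then have "g p (w - z) = w - z" by (intro g(3) hclass_member)
  then show ?thesis unfolding hsec_def Let_def w_def[symmetric] by (simp add: qlinearD[OF g(1)] algebra_simps)
qed

lemma g_cyc: "g p c \<in> cyc X p"
  by (rule bds_cyc[OF g(2)])

lemma hsec_cyc: "\<xi> \<in> carrier (HX p) \<Longrightarrow> hsec p \<xi> \<in> cyc X p"
  by (auto simp: reduced_homology_simps hsec_hclass intro!: cyc_closed(2) g_cyc)

lemma hclass_hsec:
  assumes "\<xi> \<in> carrier (HX p)"
  shows "hclass X p (hsec p \<xi>) = \<xi>"
proof -
  obtain z where "\<xi> = hclass X p z" using assms by (auto simp: reduced_homology_simps)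
  moreover have "hclass X p (z - g p z) = hclass X p z"
    unfolding hclass_eq_iff using bds_closed(5)[OF g(2), of p z] by simp
  ultimately show ?thesis by (simp add: hsec_hclass)
qed

lemma cyc_part_cyc: "c \<in> carrier (RX p) \<Longrightarrow> cyc_part p c \<in> cyc X p"
  using t(2)[of "p - 1" "boundary p c"] t(3)[OF boundary_bds, of c p]
  by (simp add: cyc_part_def cyc_iff reduced_chains_closed boundary_diff)

lemma cyc_part_boundary: "c \<in> carrier (RX p) \<Longrightarrow> cyc_part (p - 1) (boundary p c) = boundary p c"
  by (simp add: cyc_part_def boundary_boundary_reduced qlinearD[OF t(1)])

lemma cyc_part_cycle: "c \<in> cyc X p \<Longrightarrow> cyc_part p c = c"
  by (simp add: cyc_part_def cyc_iff qlinearD[OF t(1)])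

text \<open>A chain is \<open>t\<close> of its boundary, plus the \<open>g\<close>-component of its
  cycle part, plus the harmonic representative of that cycle part; the two terms on the left are the
  non-harmonic summands.\<close>

lemma hhom_homotopy:
  assumes c: "c \<in> carrier (RX p)"
  shows "boundary (p + 1) (hhom p c) + hhom (p - 1) (boundary p c) = c - hsec p (hproj p c)"
proof -
  have "boundary (p + 1) (hhom p c) = g p (cyc_part p c)" unfolding hhom_def by (rule t(3)[OF g(2)])
  moreover have "hhom (p - 1) (boundary p c) = t (p - 1) (boundary p c)"
    using g(3)[OF boundary_bds[OF c]] by (simp add: hhom_def cyc_part_boundary[OF c])
  ultimately show ?thesis by (simp add: hproj_def hsec_hclass) (simp add: cyc_part_def)
qed

lemma gU: "graded_vector_space UX" and gW: "graded_vector_space WX"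
  by (simp_all add: gvs_desuspension gvs_reduced_homology gvs_reduced_chains)

lemma W_simps [simp]: "carrier (WX q) = carrier (RX (q + 1))" "x \<oplus>\<^bsub>WX q\<^esub> y = x + y" "r \<odot>\<^bsub>WX q\<^esub> x = qscale r x" "\<zero>\<^bsub>WX q\<^esub> = 0"
  and U_simps [simp]: "carrier (UX q) = carrier (HX (q + 1))" "\<xi> \<oplus>\<^bsub>UX q\<^esub> \<eta> = \<xi> \<oplus>\<^bsub>HX (q + 1)\<^esub> \<eta>" "r \<odot>\<^bsub>UX q\<^esub> \<xi> = r \<odot>\<^bsub>HX (q + 1)\<^esub> \<xi>"
     "\<zero>\<^bsub>UX q\<^esub> = \<zero>\<^bsub>HX (q + 1)\<^esub>"
  by (simp_all add: desuspension_def)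

abbreviation "hsec_map \<equiv> \<lambda>q \<xi>. tens WX [(q, hsec (q + 1) \<xi>)]"
abbreviation "hproj_map \<equiv> \<lambda>q x. tens UX [(q, hproj (q + 1) x)]"
abbreviation "hhom_map \<equiv> \<lambda>q x. tens WX [(q + 1, hhom (q + 1) x)]"
abbreviation "\<delta>m \<equiv> cobar_d RX opX 1"
abbreviation "Dm \<equiv> \<lambda>q x. \<Sum>k=1..2. cobar_d RX opX k q x"

lemma hsec_linear:
  assumes "\<xi> \<in> carrier (HX p)" "\<eta> \<in> carrier (HX p)"
  shows "hsec p (\<xi> \<oplus>\<^bsub>HX p\<^esub> \<eta>) = hsec p \<xi> + hsec p \<eta>" "hsec p (r \<odot>\<^bsub>HX p\<^esub> \<xi>) = qscale r (hsec p \<xi>)"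
  using assms by (auto simp: reduced_homology_simps hsec_hclass qlinearD[OF g(1)] qv.scale_right_diff_distrib)

lemma cyc_part_linear: "cyc_part p (a + b) = cyc_part p a + cyc_part p b" "cyc_part p (qscale r a) = qscale r (cyc_part p a)"
  by (simp_all add: cyc_part_def boundary_add boundary_scale qlinearD[OF t(1)] qv.scale_right_diff_distrib)

lemma glin_hsec_map: "glin UX WX 1 0 hsec_map"
  by (rule glin_tens_map[where e = 0 and f = "\<lambda>q. hsec (q + 1)", unfolded add_0_right, OF gW])
    (use hsec_cyc in \<open>auto simp: cyc_iff hsec_linear\<close>)

lemma glin_hproj_map: "glin WX UX 1 0 hproj_map"
  by (rule glin_tens_map[where e = 0 and f = "\<lambda>q. hproj (q + 1)", unfolded add_0_right, OF gU])
    (use cyc_part_cyc in \<open>auto simp: hproj_def reduced_homology_simps cyc_part_linear\<close>)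

lemma hhom_reduced: "hhom p c \<in> carrier (RX (p + 1))"
  by (simp add: hhom_def t)

lemma glin_hhom_map: "glin WX WX 1 1 hhom_map"
proof (rule glin_tens_map[where e = 1 and f = "\<lambda>q. hhom (q + 1)", OF gW])
  show "hhom (q + 1) x \<in> carrier (WX (q + 1))" for q x
    unfolding W_simps by (rule hhom_reduced)
qed (auto simp: hhom_def cyc_part_linear qlinearD[OF g(1)] qlinearD[OF t(1)])

lemmas cobar_d_R = tensor_linear_cobar_d[OF gvs_reduced_chains ops_tensor_linear[OF x0]]

lemma \<delta>m_eq: "x \<in> carrier (RX (q + 1)) \<Longrightarrow> \<delta>m q x = - tens WX [(q - 1, boundary (q + 1) x)]"
  using cobar_d_desusp[OF gvs_reduced_chains ops_tensor_linear[OF x0], of 1 x "q + 1"]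
  by (simp add: dg_coalgebra_ops_def lin_ext_tens[OF word_linear_desusp]) (simp add: desusp_def)

lemma dgen2_eq: "x \<in> carrier (RX (q + 1)) \<Longrightarrow> cobar_d RX opX 2 q x = - lin_ext (desusp RX) (red_comult X x0 (q + 1) x)"
  using cobar_d_desusp[OF gvs_reduced_chains ops_tensor_linear[OF x0], of 2 x "q + 1"]
  by (simp add: dg_coalgebra_ops_def reduced_comult_red_comult[OF x0])

lemma cobar_d_R_0: "2 < k \<Longrightarrow> x \<in> carrier (RX (q + 1)) \<Longrightarrow> cobar_d RX opX k q x = 0"
  using cobar_d_desusp[OF gvs_reduced_chains ops_tensor_linear[OF x0], of k x "q + 1"]
  by (simp add: ops_zero[OF x0])

lemma glin_\<delta>m: "glin WX WX 1 (-1) \<delta>m"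
  by (rule glin_tensor_linear[OF cobar_d_R]) auto

lemma glin_Dm: "glin WX WX 1 (-1) Dm"
  by (rule glin_sum, rule glin_tensor_linear[OF cobar_d_R]) auto

lemma tens_W_add: "a \<in> carrier (RX (q + 1)) \<Longrightarrow> b \<in> carrier (RX (q + 1)) \<Longrightarrow> tens WX [(q, a + b)] = tens WX [(q, a)] + tens WX [(q, b)]"
  using glinD(3)[OF glin_tens[of WX], of a q b] by simp

lemma tens_W_diff: "a \<in> carrier (RX (q + 1)) \<Longrightarrow> b \<in> carrier (RX (q + 1)) \<Longrightarrow> tens WX [(q, a - b)] = tens WX [(q, a)] - tens WX [(q, b)]"
  using tens_W_add[of "a - b" q b] by (simp add: reduced_chains_closed)

lemma bd_reduced: "x \<in> carrier (RX (q + 1)) \<Longrightarrow> boundary (q + 1) x \<in> carrier (RX q)"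
  using boundary_reduced_chains[of x X "q + 1"] by simp

text \<open>The linear part of the cobar differential is minus the boundary. This sign turns the
  homotopy between 1 and \<open>hsec hproj\<close> on chains into the form
  \<open>hsec hproj - 1\<close> that the locale asks for.\<close>

lemma contraction: "contraction UX WX Dm \<delta>m hsec_map hproj_map hhom_map"
proof unfold_locales
  show "graded_vector_space UX" "graded_vector_space WX" by (rule gU, rule gW)
  show "glin WX WX 1 (-1) Dm" "glin WX WX 1 (-1) \<delta>m" by (rule glin_Dm, rule glin_\<delta>m)
  show "glin UX WX 1 0 hsec_map" "glin WX UX 1 0 hproj_map" "glin WX WX 1 1 hhom_map" by (rule glin_hsec_map, rule glin_hproj_map, rule glin_hhom_map)
  show "\<delta>m q x \<in> tensor_power WX 1 (q - 1)" if "x \<in> carrier (WX q)" for q x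
    using cobar_d_R[of 1] that by (auto simp: tensor_linear_def)
  show "Dm q x - \<delta>m q x \<in> tfil WX 2 (q - 1)" if x: "x \<in> carrier (WX q)" for q x
  proof -
    have "{1..2::nat} = {1, 2}" by auto
    then have "Dm q x - \<delta>m q x = cobar_d RX opX 2 q x" by simp
    moreover have "cobar_d RX opX 2 q x \<in> tensor_power WX 2 (q - 1)"
      using cobar_d_R[of 2] x by (auto simp: tensor_linear_def)
    ultimately show ?thesis by (simp add: tensor_power_tfil)
  qed
  show "der WX Dm (Dm q x) = 0" if "x \<in> carrier (WX q)" for q x
    by (rule cobar_square_zero[OF gvs_reduced_chains ops_tensor_linear[OF x0] ainf_coalgebra_reduced_chains[OF x0] that])
      (auto simp: ops_zero[OF x0])
  show "hsec_map q \<xi> \<in> tensor_power WX 1 q" if "\<xi> \<in> carrier (UX q)" for q \<xi>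
    by (rule tens_tensor_power) (use that hsec_cyc in \<open>auto simp: cyc_iff\<close>)
  show "hproj_map q x \<in> tensor_power UX 1 q" if "x \<in> carrier (WX q)" for q x
    by (rule tens_tensor_power) (use that cyc_part_cyc in \<open>auto simp: hproj_def reduced_homology_simps\<close>)
  show "hhom_map q x \<in> tensor_power WX 1 (q + 1)" if "x \<in> carrier (WX q)" for q x
    by (rule tens_tensor_power) (use hhom_reduced[of "q + 1" x] in auto)
  show "alg_ext UX hproj_map (hsec_map q \<xi>) = tens UX [(q, \<xi>)]" if "\<xi> \<in> carrier (UX q)" for q \<xi>
  proof -
    have "\<xi> \<in> carrier (HX (q + 1))" using that by simp
    note s = hsec_cyc[OF this] hclass_hsec[OF this]
    have "alg_ext UX hproj_map (hsec_map q \<xi>) = hproj_map q (hsec (q + 1) \<xi>)"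
      by (rule alg_ext_gen[OF gU glin_hproj_map]) (use s in \<open>simp add: cyc_iff\<close>)
    then show ?thesis by (simp add: hproj_def cyc_part_cycle[OF s(1)] s(2))
  qed
  show "alg_ext UX hproj_map (\<delta>m q x) = 0" if "x \<in> carrier (WX q)" for q x
  proof -
    have x: "x \<in> carrier (RX (q + 1))" using that by simp
    have "alg_ext UX hproj_map (tens WX [(q - 1, boundary (q + 1) x)]) = tens UX [(q - 1, hproj (q - 1 + 1) (boundary (q + 1) x))]"
      by (rule alg_ext_gen[OF gU glin_hproj_map]) (use bd_reduced[OF x] in simp)
    also have "hproj (q - 1 + 1) (boundary (q + 1) x) = hclass X q 0"
      using cyc_part_boundary[OF x] boundary_bds[OF x] by (simp add: hproj_def hclass_eq_iff)
    also have "tens UX [(q - 1, hclass X q 0)] = 0"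
      using tens_zero[OF gU, of "q - 1"] by (simp add: reduced_homology_simps)
    finally show ?thesis unfolding \<delta>m_eq[OF x] lin_ext_neg by simp
  qed
  show "der WX \<delta>m (hsec_map q \<xi>) = 0" if "\<xi> \<in> carrier (UX q)" for q \<xi>
  proof -
    have "\<xi> \<in> carrier (HX (q + 1))" using that by simp
    note s = hsec_cyc[OF this]
    have "der WX \<delta>m (hsec_map q \<xi>) = \<delta>m q (hsec (q + 1) \<xi>)"
      by (rule der_ext_gen[OF gW glin_tens glin_\<delta>m]) (use s in \<open>simp add: cyc_iff\<close>)
    also have "\<dots> = - tens WX [(q - 1, boundary (q + 1) (hsec (q + 1) \<xi>))]"
      by (rule \<delta>m_eq) (use s in \<open>simp add: cyc_iff\<close>)
    finally show ?thesis using s tens_zero[OF gW, of "q - 1"] by (simp add: cyc_iff)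
  qed
  show "der WX \<delta>m (hhom_map q x) + der_ext WX (\<lambda>p x. alg_ext WX hsec_map (hproj_map p x)) hhom_map (\<delta>m q x) = alg_ext WX hsec_map (hproj_map q x) - tens WX [(q, x)]"
    if "x \<in> carrier (WX q)" for q x
  proof -
    have x: "x \<in> carrier (RX (q + 1))" using that by simp
    have c: "hproj (q + 1) x \<in> carrier (HX (q + 1))" using cyc_part_cyc[OF x] by (simp add: hproj_def reduced_homology_simps)
    have sR: "hsec (q + 1) (hproj (q + 1) x) \<in> carrier (RX (q + 1))" using hsec_cyc[OF c] by (simp add: cyc_iff)
    have IP: "glin WX WX 1 0 (\<lambda>p x. alg_ext WX hsec_map (hproj_map p x))" by (rule alg_ext_comp(1)[OF gU gW glin_hproj_map glin_hsec_map])
    have hR: "hhom (q + 1) x \<in> carrier (RX (q + 1 + 1))" by (rule hhom_reduced)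
    have "der WX \<delta>m (hhom_map q x) = \<delta>m (q + 1) (hhom (q + 1) x)"
      by (rule der_ext_gen[OF gW glin_tens glin_\<delta>m]) (use hR in simp)
    also have "\<dots> = - tens WX [(q, boundary (q + 1 + 1) (hhom (q + 1) x))]"
      using \<delta>m_eq[OF hR] by simp
    finally have 1: "der WX \<delta>m (hhom_map q x) = - tens WX [(q, boundary (q + 1 + 1) (hhom (q + 1) x))]" .
    have "der_ext WX (\<lambda>p x. alg_ext WX hsec_map (hproj_map p x)) hhom_map (tens WX [(q - 1, boundary (q + 1) x)]) = hhom_map (q - 1) (boundary (q + 1) x)"
      by (rule der_ext_gen[OF gW IP glin_hhom_map]) (use bd_reduced[OF x] in simp)
    then have 2: "der_ext WX (\<lambda>p x. alg_ext WX hsec_map (hproj_map p x)) hhom_map (\<delta>m q x) = - tens WX [(q, hhom q (boundary (q + 1) x))]"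
      unfolding \<delta>m_eq[OF x] lin_ext_neg by simp
    have 3: "alg_ext WX hsec_map (hproj_map q x) = tens WX [(q, hsec (q + 1) (hproj (q + 1) x))]"
      by (rule alg_ext_gen[OF gW glin_hsec_map]) (use c in simp)
    have b: "boundary (q + 1 + 1) (hhom (q + 1) x) \<in> carrier (RX (q + 1))"
      using boundary_reduced_chains[OF hR] by (simp only: add_diff_cancel_right')
    have h': "hhom q (boundary (q + 1) x) \<in> carrier (RX (q + 1))" by (rule hhom_reduced)
    have "tens WX [(q, boundary (q + 1 + 1) (hhom (q + 1) x))] + tens WX [(q, hhom q (boundary (q + 1) x))] =
      tens WX [(q, x)] - tens WX [(q, hsec (q + 1) (hproj (q + 1) x))]"
      unfolding tens_W_add[OF b h', symmetric] tens_W_diff[OF x sR, symmetric] using hhom_homotopy[OF x] by simp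
    then show ?thesis unfolding 1 2 3 by (simp add: algebra_simps)
  qed
qed

sublocale C: contraction UX WX Dm \<delta>m hsec_map hproj_map hhom_map
  by (rule contraction)

text \<open>Solves \<open>cobar_d HX tr_ops n = C.dcomp n\<close> for the operations: the minus sign
  undoes the one in the cobar generators, and \<open>p - 1\<close> is the degree after desuspension.
  Morphism components carry no such sign.\<close>

definition "tr_ops n p x = - lin_ext (susp HX) (C.dcomp n (p - 1) x)"

definition "tr_map n p x = lin_ext (susp RX) (C.mcomp n (p - 1) x)"

lemma dcomp_tensor_power:
  assumes "x \<in> carrier (HX p)"
  shows "C.dcomp n (p - 1) x \<in> tensor_power UX n (p - 2)"
proof -
  have "x \<in> carrier (UX (p - 1))" using assms by simp
  then have "C.dcomp n (p - 1) x \<in> tensor_power UX n (p - 1 + - 1)"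
    using C.tensor_linear_dcomp[of n] unfolding tensor_linear_def by blast
  then show ?thesis by simp
qed

lemma mcomp_tensor_power:
  assumes "x \<in> carrier (HX p)"
  shows "C.mcomp n (p - 1) x \<in> tensor_power WX n (p - 1)"
proof -
  have "x \<in> carrier (UX (p - 1))" using assms by simp
  then have "C.mcomp n (p - 1) x \<in> tensor_power WX n (p - 1 + 0)"
    using C.tensor_linear_mcomp[of n] unfolding tensor_linear_def by blast
  then show ?thesis by simp
qed

lemma tensor_linear_tr_ops: "tensor_linear HX HX n (int n - 2) (tr_ops n)"
  unfolding tensor_linear_def
proof (intro allI ballI conjI)
  fix p x y r assume x: "x \<in> carrier (HX p)"
  have x': "x \<in> carrier (UX (p - 1))" using x by simp
  note l = C.tensor_linear_dcomp[of n, unfolded tensor_linear_def, rule_format, OF x']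
  show "tr_ops n p x \<in> tensor_power HX n (p + (int n - 2))"
    unfolding tr_ops_def by (intro tensor_power_intros lin_ext_susp_tensor_power[OF dcomp_tensor_power[OF x]]) simp
  show "tr_ops n p (r \<odot>\<^bsub>HX p\<^esub> x) = tscale r (tr_ops n p x)"
    using l x' by (simp add: tr_ops_def lin_ext_scale)
  show "tr_ops n p (x \<oplus>\<^bsub>HX p\<^esub> y) = tr_ops n p x + tr_ops n p y" if "y \<in> carrier (HX p)"
    using l x' that by (simp add: tr_ops_def lin_ext_add)
qed

lemma tensor_linear_tr_map: "tensor_linear HX RX n (int n - 1) (tr_map n)"
  unfolding tensor_linear_def
proof (intro allI ballI conjI)
  fix p x y r assume x: "x \<in> carrier (HX p)"
  have x': "x \<in> carrier (UX (p - 1))" using x by simp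
  note l = C.tensor_linear_mcomp[of n, unfolded tensor_linear_def, rule_format, OF x']
  show "tr_map n p x \<in> tensor_power RX n (p + (int n - 1))"
    unfolding tr_map_def by (intro lin_ext_susp_tensor_power[OF mcomp_tensor_power[OF x]]) simp
  show "tr_map n p (r \<odot>\<^bsub>HX p\<^esub> x) = tscale r (tr_map n p x)"
    using l x' by (simp add: tr_map_def lin_ext_scale)
  show "tr_map n p (x \<oplus>\<^bsub>HX p\<^esub> y) = tr_map n p x + tr_map n p y" if "y \<in> carrier (HX p)"
    using l x' that by (simp add: tr_map_def lin_ext_add)
qed

lemma cobar_d_tr_ops: "1 \<le> n \<Longrightarrow> x \<in> carrier (UX q) \<Longrightarrow> cobar_d HX tr_ops n q x = C.dcomp n q x"
  using cobar_d_desusp[OF gvs_reduced_homology tensor_linear_tr_ops, of n x "q + 1"]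
    desusp_susp[OF tensor_power_tensors[OF dcomp_tensor_power, of x "q + 1" n]]
  by (simp add: tr_ops_def lin_ext_neg)

lemma cobar_f_tr_map:
  assumes x: "x \<in> carrier (UX q)"
  shows "cobar_f RX tr_map n q x = C.mcomp n q x"
proof -
  have x': "x \<in> carrier (HX (q + 1))" using x by simp
  then have "tr_map n (q + 1) x \<in> tensor_power RX n (q + 1 + (int n - 1))"
    using tensor_linear_tr_map[of n] unfolding tensor_linear_def by blast
  then have "cobar_f RX tr_map n q x = lin_ext (desusp RX) (tr_map n (q + 1) x)"
    using map_tensor_desusp[OF gvs_reduced_chains] by (simp add: cobar_f_def cobar_map_gen_def)
  also have "\<dots> = C.mcomp n (q + 1 - 1) x"
    unfolding tr_map_def by (rule desusp_susp[OF tensor_power_tensors[OF mcomp_tensor_power[OF x']]])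
  finally show ?thesis by simp
qed

lemmas cobar_d_H = tensor_linear_cobar_d[OF gvs_reduced_homology tensor_linear_tr_ops]

lemma sum_cobar_d_tr_ops: "x \<in> carrier (UX q) \<Longrightarrow> (\<Sum>k=1..M. cobar_d HX tr_ops k q x) = (\<Sum>k=1..M. C.dcomp k q x)"
  by (rule sum.cong) (auto simp: cobar_d_tr_ops simp del: U_simps)

lemma glin_dcomp_sum: "glin UX UX 1 (-1) (\<lambda>p x. \<Sum>k=1..M. C.dcomp k p x)"
  by (rule glin_sum, rule glin_tensor_linear[OF C.tensor_linear_dcomp]) auto

lemma glin_mcomp_sum: "glin UX WX 1 0 (\<lambda>p x. \<Sum>k=1..M. C.mcomp k p x)"
  by (rule glin_sum, rule glin_tensor_linear[OF C.tensor_linear_mcomp]) auto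

lemma glin_cobar_d_sum: "glin UX UX 1 (-1) (\<lambda>p x. \<Sum>k=1..M. cobar_d HX tr_ops k p x)"
  by (rule glin_sum, rule glin_tensor_linear[OF cobar_d_H]) auto

lemma ainf_coalgebra_tr_ops: "ainf_coalgebra HX tr_ops"
proof (rule ainf_coalgebraI[OF gvs_reduced_homology tensor_linear_tr_ops])
  fix n q x assume n: "1 \<le> (n::nat)" and x: "x \<in> carrier (UX q)"
  have "der UX (\<lambda>p x. \<Sum>k=1..n. cobar_d HX tr_ops k p x) (\<Sum>k=1..n. cobar_d HX tr_ops k q x) =
    der UX (\<lambda>p x. \<Sum>k=1..n. C.dcomp k p x) (\<Sum>k=1..n. C.dcomp k q x)"
    unfolding sum_cobar_d_tr_ops[OF x]
    by (rule der_ext_cong[OF gU glin_tens glin_cobar_d_sum glin_dcomp_sum sum_cobar_d_tr_ops glinD(2)[OF glin_dcomp_sum x]])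
  then show "der UX (\<lambda>p x. \<Sum>k=1..n. cobar_d HX tr_ops k p x) (\<Sum>k=1..n. cobar_d HX tr_ops k q x) \<in> tfil UX (Suc n) (q - 2)"
    using C.transfer_square_zero[OF n x] by simp
qed

lemma tensor_linear_cobar_f: "1 \<le> k \<Longrightarrow> tensor_linear UX WX k 0 (cobar_f RX tr_map k)"
proof -
  have "x \<oplus>\<^bsub>UX q\<^esub> y \<in> carrier (UX q)" "r \<odot>\<^bsub>UX q\<^esub> x \<in> carrier (UX q)" if "x \<in> carrier (UX q)" "y \<in> carrier (UX q)" for x y q r
    using gvs_closed[OF gU that(1)] that(2) by auto
  then show ?thesis using C.tensor_linear_mcomp[of k] unfolding tensor_linear_def
    by (auto simp: cobar_f_tr_map simp del: U_simps W_simps)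
qed

lemma ainf_morphism_tr_map: "ainf_morphism HX tr_ops RX opX tr_map"
  unfolding ainf_morphism_def
proof (intro conjI allI impI ballI)
  show "ainf_coalgebra HX tr_ops" by (rule ainf_coalgebra_tr_ops)
  show "ainf_coalgebra RX opX" by (rule ainf_coalgebra_reduced_chains[OF x0])
  show "tensor_linear HX RX k (int k - 1) (tr_map k)" for k by (rule tensor_linear_tr_map)
  fix p s assume s: "s \<in> complete_tensor_algebra UX p"
  show "cobar_map RX tr_map (cobar_differential HX tr_ops s) = cobar_differential RX opX (cobar_map RX tr_map s)"
  proof (rule cobar_chain_map[OF gU gW cobar_d_H cobar_d_R tensor_linear_cobar_f _ s])
    fix M q x assume M: "1 \<le> (M::nat)" and x: "x \<in> carrier (UX q)"
    let ?D = "\<lambda>p x. \<Sum>k=1..M. cobar_d RX opX k p x" and ?F = "\<lambda>p x. \<Sum>k=1..M. C.mcomp k p x"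
    have Fs: "(\<Sum>k=1..M. cobar_f RX tr_map k p y) = ?F p y" if "y \<in> carrier (UX p)" for p y
      by (rule sum.cong) (auto simp: cobar_f_tr_map[OF that])
    have gF: "glin UX WX 1 0 (\<lambda>p x. \<Sum>k=1..M. cobar_f RX tr_map k p x)"
      by (rule glin_sum, rule glin_tensor_linear[OF tensor_linear_cobar_f]) auto
    have gD: "glin WX WX 1 (-1) ?D" by (rule glin_sum, rule glin_tensor_linear[OF cobar_d_R]) auto
    have a: "alg_ext WX (\<lambda>p x. \<Sum>k=1..M. cobar_f RX tr_map k p x) T = alg_ext WX ?F T" if "T \<in> tensors UX" for T
      by (rule alg_ext_cong[OF gW gF glin_mcomp_sum Fs that])
    have "der WX ?D (?F q x) - alg_ext WX ?F (\<Sum>k=1..M. C.dcomp k q x) \<in> tfil WX (Suc M) (q - 1)"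
    \<comment> \<open>For \<open>M = 1\<close> the truncated differential lacks the diagonal, while
      the transfer estimate is about the full \<open>Dm\<close>; the claim is then that harmonic
      representatives are cycles. From \<open>M = 2\<close> on the truncation equals
      \<open>Dm\<close>.\<close>
    proof (cases "M = 1")
      case True
      have "C.mcomp 1 q x = hsec_map q x" "C.dcomp 1 q x = 0" unfolding C.mcomp_def C.dcomp_def by simp_all
      then show ?thesis using C.\<delta>I[OF x] True by (simp add: tspan_0)
    next
      case False
      have "?D p y = Dm p y" if "y \<in> carrier (WX p)" for p y
        by (rule sum.mono_neutral_right) (use M False that in \<open>auto simp: cobar_d_R_0\<close>)
      then have "der WX ?D (?F q x) = der WX Dm (?F q x)"
        by (intro der_ext_cong[OF gW glin_tens gD glin_Dm _ glinD(2)[OF glin_mcomp_sum x]])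
      then show ?thesis using C.transfer_morphism[OF M x] by simp
    qed
    then show "der WX ?D (\<Sum>k=1..M. cobar_f RX tr_map k q x) -
       alg_ext WX (\<lambda>p x. \<Sum>k=1..M. cobar_f RX tr_map k p x) (\<Sum>k=1..M. cobar_d HX tr_ops k q x) \<in> tfil WX (Suc M) (q - 1)"
      unfolding Fs[OF x] sum_cobar_d_tr_ops[OF x] a[OF glinD(2)[OF glin_dcomp_sum x]] .
  qed
qed

lemma tr_ops_1: "tr_ops 1 p x = 0"
  unfolding tr_ops_def C.dcomp_def by simp

lemma tr_map_1: "tr_map 1 p \<xi> = tens RX [(p, hsec p \<xi>)]"
  unfolding tr_map_def C.mcomp_def by (simp add: lin_ext_tens[OF word_linear_susp]) (simp add: susp_def)

text \<open>Uniqueness in \<open>untens\<close> is obtained by testing with the linear map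
  \<open>hsec p\<close>, which is injective on homology classes.\<close>

lemma untens_homology_0: "untens HX p 0 = \<zero>\<^bsub>HX p\<^esub>"
  unfolding untens_def
proof (rule the_equality)
  note z = gvs_zero_closed[OF gvs_reduced_homology, of X p] tens_zero[OF gvs_reduced_homology, of X p]
  show "\<zero>\<^bsub>HX p\<^esub> \<in> carrier (HX p) \<and> 0 = tens HX [(p, \<zero>\<^bsub>HX p\<^esub>)]" using z by simp
  fix x assume x: "x \<in> carrier (HX p) \<and> 0 = tens HX [(p, x)]"
  have "hsec p x = hsec p \<zero>\<^bsub>HX p\<^esub>"
    by (rule tens_separates[where V = HX and p = p and L = "hsec p", OF _ _ trans[OF conjunct2[OF x, symmetric] z(2)[symmetric]]])
      (simp_all add: hsec_linear)
  then show "x = \<zero>\<^bsub>HX p\<^esub>" using hclass_hsec[OF conjunct1[OF x]] hclass_hsec[OF z(1)] by metis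
qed

text \<open>Minimality makes the homology of \<open>HX\<close> consist of singletons, and the linear
  part of the morphism sends the singleton of \<open>\<xi>\<close> to the class of the harmonic
  representative of \<open>\<xi>\<close>, which is \<open>\<xi>\<close> itself.\<close>

lemma transferred_coalgebra: "transferred_coalgebra X x0 tr_ops"
  unfolding transferred_coalgebra_def ainf_quasi_isomorphic_def ainf_quasi_isomorphism_def
proof (intro conjI exI[of _ tr_map] allI)
  show "ainf_coalgebra HX tr_ops" by (rule ainf_coalgebra_tr_ops)
  show "ainf_minimal HX tr_ops" by (simp add: ainf_minimal_def tr_ops_1[simplified])
  show "ainf_morphism HX tr_ops RX opX tr_map" by (rule ainf_morphism_tr_map)
  fix p
  let ?dH = "ainf_differential HX tr_ops" and ?dR = "ainf_differential RX opX"
  have dH: "?dH q x = \<zero>\<^bsub>HX (q - 1)\<^esub>" for q x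
    by (simp add: ainf_differential_def tr_ops_1[simplified] untens_homology_0)
  have dR: "?dR q x = boundary q x" if "x \<in> carrier (RX q)" for q x
    using untens_reduced[OF boundary_reduced_chains[OF that]] by (simp add: ainf_differential_def dg_coalgebra_ops_def)
  have bH: "boundaries HX ?dH p = {\<zero>\<^bsub>HX p\<^esub>}"
    using gvs_zero_closed[OF gvs_reduced_homology, of X "p + 1"] by (auto simp: boundaries_def dH)
  have cH: "cycles HX ?dH p = carrier (HX p)" by (auto simp: cycles_def dH)
  have mH: "abelian_monoid (HX p)"
    using gvs_reduced_homology[of X] by (simp add: graded_vector_space_def module_def abelian_group_def)
  have HH: "carrier (homology HX ?dH p) = (\<lambda>\<xi>. {\<xi>}) ` carrier (HX p)"
    unfolding homology_def bH cH by (auto simp: a_r_coset_def' abelian_monoid.l_zero[OF mH] intro!: image_cong)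
  have bR: "boundaries RX ?dR p = bds X p" unfolding boundaries_def by (rule image_cong) (auto simp: dR)
  have cR: "cycles RX ?dR p = cyc X p" by (auto simp: cycles_def dR)
  have HR: "carrier (homology RX ?dR p) = carrier (HX p)"
    by (simp add: homology_def bR cR reduced_homology_simps hclass_def)
  have map: "homology_map RX ?dR (\<lambda>p x. untens RX p (tr_map 1 p x)) p {\<xi>} = \<xi>" if "\<xi> \<in> carrier (HX p)" for \<xi>
    using untens_reduced[of "hsec p \<xi>" X p] hsec_cyc[OF that] hclass_hsec[OF that]
    unfolding homology_map_def bR tr_map_1 by (simp add: hclass_def[symmetric] cyc_iff)
  show "bij_betw (homology_map RX ?dR (\<lambda>p x. untens RX p (tr_map 1 p x)) p)
     (carrier (homology HX ?dH p)) (carrier (homology RX ?dR p))"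
    unfolding HH HR
    by (rule bij_betw_byWitness[where f' = "\<lambda>\<xi>. {\<xi>}"]) (auto simp: map simp del: One_nat_def)
qed

text \<open>Suspension is injective on tensors, so kernels may be compared on the components
  delivered by the transfer.\<close>

lemma tr_ops_eq_0_iff: "x \<in> carrier (HX p) \<Longrightarrow> tr_ops n p x = 0 \<longleftrightarrow> C.dcomp n (p - 1) x = 0"
  using desusp_susp[OF tensor_power_tensors[OF dcomp_tensor_power, of x p n]] by (auto simp: tr_ops_def)

end

section \<open>Inclusions of spaces with agreeing splittings\<close>

lemma desusp_incl:
  assumes XY: "continuous_map X Y id" and T: "T \<in> tensor_power (reduced_chains X) 2 r"
    and jW: "glin (desuspension (reduced_chains X)) (desuspension (reduced_chains Y)) 1 0 (letter (desuspension (reduced_chains Y)))"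
    and jR: "glin (reduced_chains X) (reduced_chains Y) 1 0 (letter (reduced_chains Y))"
  shows "alg_ext (desuspension (reduced_chains Y)) (letter (desuspension (reduced_chains Y))) (lin_ext (desusp (reduced_chains X)) T) =
    lin_ext (desusp (reduced_chains Y)) (alg_ext (reduced_chains Y) (letter (reduced_chains Y)) T)"
  using T
proof (induction rule: tensor_square_induct)
  case (tens p a q b)
  note gY = gvs_reduced_chains[of Y]
  have ab: "a \<in> carrier (reduced_chains Y p)" "b \<in> carrier (reduced_chains Y q)"
    using reduced_chains_mono[OF XY] tens by blast+
  have d: "desusp V [(p, a), (q, b)] = tscale (ksign p) (tens (desuspension V) [(p - 1, a), (q - 1, b)])" for V :: "'a qchain gvs"
    by (simp add: desusp_def)
  have "alg_ext (desuspension (reduced_chains Y)) (letter (desuspension (reduced_chains Y)))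
      (tens (desuspension (reduced_chains X)) [(p - 1, a), (q - 1, b)]) = tens (desuspension (reduced_chains Y)) [(p - 1, a), (q - 1, b)]"
    using tens ab by (simp add: alg_ext_pair[OF gvs_desuspension[OF gY] jW] tprod_tens[OF gvs_desuspension[OF gY]] desuspension_def)
  moreover have "alg_ext (reduced_chains Y) (letter (reduced_chains Y)) (tens (reduced_chains X) [(p, a), (q, b)]) =
      tens (reduced_chains Y) [(p, a), (q, b)]"
    using tens ab by (simp add: alg_ext_pair[OF gY jR] tprod_tens[OF gY])
  ultimately show ?case by (simp add: lin_ext_tens[OF word_linear_desusp] d lin_ext_scale)
qed (simp_all add: lin_ext_add lin_ext_scale)

locale split_chains_extension = A: split_chains X x0 g t + B: split_chains Y x0 g' t'
  for X Y :: "'a topology" and x0 g t g' t' +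
  assumes XY: "continuous_map X Y id"
    and agree: "\<And>p c. c \<in> carrier (reduced_chains X p) \<Longrightarrow> g' p c = g p c"
      "\<And>p c. c \<in> carrier (reduced_chains X p) \<Longrightarrow> t' p c = t p c"
begin

abbreviation "incl_hom \<equiv> reduced_homology_map Y id"

lemma incl_hom_hclass: "z \<in> cyc X p \<Longrightarrow> incl_hom p (hclass X p z) = hclass Y p z"
  by (rule reduced_homology_map_hclass[OF XY])

lemma incl_hom_closed: "\<xi> \<in> carrier (reduced_homology X p) \<Longrightarrow> incl_hom p \<xi> \<in> carrier (reduced_homology Y p)"
  using cyc_mono[OF XY] by (auto simp: reduced_homology_simps incl_hom_hclass)

lemma cyc_part_agree: "c \<in> carrier (reduced_chains X p) \<Longrightarrow> B.cyc_part p c = A.cyc_part p c"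
  by (simp add: A.cyc_part_def B.cyc_part_def agree boundary_reduced_chains)

lemma hhom_agree:
  assumes c: "c \<in> carrier (reduced_chains X p)"
  shows "B.hhom p c = A.hhom p c"
proof -
  have "A.cyc_part p c \<in> carrier (reduced_chains X p)" "g p (A.cyc_part p c) \<in> carrier (reduced_chains X p)"
    using A.cyc_part_cyc[OF c] A.g_cyc[of p "A.cyc_part p c"] by (auto simp: cyc_iff)
  then show ?thesis by (simp add: A.hhom_def B.hhom_def cyc_part_agree[OF c] agree)
qed

lemma incl_WX: "x \<in> carrier (A.WX q) \<Longrightarrow> x \<in> carrier (B.WX q)"
  using reduced_chains_mono[OF XY] by simp

lemma glin_incl_WX: "glin A.WX B.WX 1 0 (letter B.WX)"
  by (rule glin_tens_map[where e = 0 and f = "\<lambda>p x. x", unfolded add_0_right, OF B.gW]) (use incl_WX in simp_all)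

lemma glin_incl_RX: "glin A.RX B.RX 1 0 (letter B.RX)"
  by (rule glin_tens_map[where e = 0 and f = "\<lambda>p x. x", unfolded add_0_right, OF gvs_reduced_chains])
    (use reduced_chains_mono[OF XY] in simp_all)

lemma alg_incl: "x \<in> carrier (A.RX (q + 1)) \<Longrightarrow> alg_ext B.WX (letter B.WX) (tens A.WX [(q, x)]) = tens B.WX [(q, x)]"
  by (rule alg_ext_gen[OF B.gW glin_incl_WX]) simp

lemma glin_incl_hom: "glin A.UX B.UX 1 0 (\<lambda>q \<xi>. tens B.UX [(q, incl_hom (q + 1) \<xi>)])"
proof (rule glin_tens_map[where e = 0 and f = "\<lambda>q. incl_hom (q + 1)", unfolded add_0_right, OF B.gU])
  show "incl_hom (q + 1) \<xi> \<in> carrier (B.UX q)" if "\<xi> \<in> carrier (A.UX q)" for q \<xi>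
    using incl_hom_closed that by simp
qed (auto simp: reduced_homology_simps incl_hom_hclass cyc_closed)

text \<open>Since the splittings agree on the chains of \<open>X\<close>, cycle parts, homotopies
  and harmonic representatives of such chains come out the same in both spaces; the inclusion on
  chains and the induced map on homology thus form a map of contractions.\<close>

sublocale M: contraction_map A.UX A.WX A.Dm A.\<delta>m A.hsec_map A.hproj_map A.hhom_map B.UX B.WX B.Dm B.\<delta>m B.hsec_map B.hproj_map B.hhom_map
  "\<lambda>q. incl_hom (q + 1)" "\<lambda>q x. x"
proof (rule contraction_map.intro[OF A.contraction B.contraction], unfold_locales)
  show "glin A.UX B.UX 1 0 (\<lambda>q \<xi>. tens B.UX [(q, incl_hom (q + 1) \<xi>)])" by (rule glin_incl_hom)
  show "glin A.WX B.WX 1 0 (letter B.WX)" by (rule glin_incl_WX)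
  show "incl_hom (q + 1) \<xi> \<in> carrier (B.UX q)" if "\<xi> \<in> carrier (A.UX q)" for q \<xi>
    using incl_hom_closed that by simp
  show "x \<in> carrier (B.WX q)" if "x \<in> carrier (A.WX q)" for q x by (rule incl_WX[OF that])
  show "alg_ext B.WX (letter B.WX) (A.Dm q x) = B.Dm q x" if "x \<in> carrier (A.WX q)" for q x
  proof -
    have x: "x \<in> carrier (A.RX (q + 1))" using that by simp
    have y: "x \<in> carrier (B.RX (q + 1))" by (rule reduced_chains_mono[OF XY x])
    have s: "{1..2::nat} = {1, 2}" by auto
    have 1: "alg_ext B.WX (letter B.WX) (A.\<delta>m q x) = B.\<delta>m q x"
      unfolding A.\<delta>m_eq[OF x] B.\<delta>m_eq[OF y] lin_ext_neg
      using alg_incl[of "boundary (q + 1) x" "q - 1"] A.bd_reduced[OF x] by simp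
    have 2: "alg_ext B.WX (letter B.WX) (cobar_d A.RX A.opX 2 q x) = cobar_d B.RX B.opX 2 q x"
      unfolding A.dgen2_eq[OF x] B.dgen2_eq[OF y] lin_ext_neg
        desusp_incl[OF XY red_comult_tensor_power[OF A.x0 reduced_chains_chains[OF x]] glin_incl_WX glin_incl_RX]
        red_comult_natural[OF XY A.x0 reduced_chains_chains[OF x]] ..
    show ?thesis unfolding s using 1 2 by (simp add: lin_ext_add)
  qed
  show "alg_ext B.WX (letter B.WX) (A.hhom_map q x) = B.hhom_map q x" if "x \<in> carrier (A.WX q)" for q x
  proof -
    have x: "x \<in> carrier (A.RX (q + 1))" using that by simp
    show ?thesis unfolding hhom_agree[OF x] by (rule alg_incl[OF A.hhom_reduced])
  qed
  show "alg_ext B.WX (letter B.WX) (A.hsec_map q \<xi>) = B.hsec_map q (incl_hom (q + 1) \<xi>)" if "\<xi> \<in> carrier (A.UX q)" for q \<xi>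
  proof -
    have \<xi>: "\<xi> \<in> carrier (A.HX (q + 1))" using that by simp
    then obtain z where z: "z \<in> cyc X (q + 1)" "\<xi> = hclass X (q + 1) z" by (auto simp: reduced_homology_simps)
    then have "B.hsec (q + 1) (incl_hom (q + 1) \<xi>) = A.hsec (q + 1) \<xi>"
      using agree(1)[of z "q + 1"] by (simp add: incl_hom_hclass A.hsec_hclass B.hsec_hclass cyc_iff)
    then show ?thesis using alg_incl[of "A.hsec (q + 1) \<xi>" q] A.hsec_cyc[OF \<xi>] by (simp add: cyc_iff)
  qed
  show "alg_ext B.UX (\<lambda>q \<xi>. tens B.UX [(q, incl_hom (q + 1) \<xi>)]) (A.hproj_map q x) = B.hproj_map q x" if "x \<in> carrier (A.WX q)" for q x
  proof -
    have x: "x \<in> carrier (A.RX (q + 1))" using that by simp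
    have "alg_ext B.UX (\<lambda>q \<xi>. tens B.UX [(q, incl_hom (q + 1) \<xi>)]) (A.hproj_map q x) = tens B.UX [(q, incl_hom (q + 1) (A.hproj (q + 1) x))]"
      by (rule alg_ext_gen[OF B.gU glin_incl_hom]) (use A.cyc_part_cyc[OF x] in \<open>simp add: A.hproj_def reduced_homology_simps\<close>)
    also have "incl_hom (q + 1) (A.hproj (q + 1) x) = B.hproj (q + 1) x"
      using A.cyc_part_cyc[OF x] by (simp add: A.hproj_def B.hproj_def incl_hom_hclass cyc_part_agree[OF x])
    finally show ?thesis .
  qed
qed

text \<open>By naturality the operation on the image of \<open>x\<close> is the letterwise image of
  the operation on \<open>x\<close>, and a letterwise map sends 0 to 0.\<close>

lemma tr_ops_incl_hom:
  assumes x: "x \<in> carrier (reduced_homology X p)" and z: "A.tr_ops n p x = 0"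
  shows "B.tr_ops n p (incl_hom p x) = 0"
proof -
  have x': "x \<in> carrier (A.UX (p - 1))" using x by simp
  have "B.C.dcomp n (p - 1) (incl_hom (p - 1 + 1) x) = 0"
    using M.dcomp_natural[OF x', of n] z unfolding A.tr_ops_eq_0_iff[OF x] by simp
  then show ?thesis using B.tr_ops_eq_0_iff[OF incl_hom_closed[OF x], of n] by simp
qed

end

subsection \<open>Wedges\<close>

lemma topspace_wedge: "topspace (wedge X Y) = topspace X \<union> topspace Y"
proof
  show "topspace (wedge X Y) \<subseteq> topspace X \<union> topspace Y"
    using openin_wedge[of X Y "topspace (wedge X Y)"] by auto
  have "openin (wedge X Y) (topspace X \<union> topspace Y)"
    unfolding openin_wedge by (simp add: Int_absorb1)
  then show "topspace X \<union> topspace Y \<subseteq> topspace (wedge X Y)" by (rule openin_subset)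
qed

lemma continuous_map_wedge_incl: "continuous_map X (wedge X Y) id"
proof -
  have "{x \<in> topspace X. id x \<in> U} = U \<inter> topspace X" for U by auto
  then show ?thesis by (auto simp: continuous_map_def topspace_wedge openin_wedge)
qed

text \<open>The preimage of an open set meets \<open>Y\<close> in all of \<open>Y\<close> or in
  nothing, according to whether it contains the base point, so openness is decided in
  \<open>X\<close>.\<close>

lemma continuous_map_wedge_retract:
  assumes "topspace X \<inter> topspace Y = {x0}"
  shows "continuous_map (wedge X Y) X (\<lambda>x. if x \<in> topspace X then x else x0)"
proof -
  have x0: "x0 \<in> topspace X" "x0 \<in> topspace Y" using assms by auto
  have "openin (wedge X Y) {x \<in> topspace (wedge X Y). (if x \<in> topspace X then x else x0) \<in> U}" if U: "openin X U" for U
  proof -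
    let ?V = "{x \<in> topspace (wedge X Y). (if x \<in> topspace X then x else x0) \<in> U}"
    have "?V \<inter> topspace X = U" using openin_subset[OF U] by (auto simp: topspace_wedge)
    moreover have "?V \<inter> topspace Y = (if x0 \<in> U then topspace Y else {})"
      using assms by (auto simp: topspace_wedge)
    ultimately show ?thesis using U by (auto simp: openin_wedge topspace_wedge)
  qed
  then show ?thesis using x0 by (auto simp: continuous_map_def)
qed

theorem theorem4p2:
  fixes K :: "nat \<Rightarrow> 'a topology"
    and S :: "nat \<Rightarrow> 'a topology"
    and x0 :: 'a
    and N :: nat
    and d :: "nat \<Rightarrow> nat"
  assumes "CW_complex (K 0)"
    and "one_connected (K 0)"
    and "\<And>p::int. p \<ge> 0 \<Longrightarrow> finite_dimensional (rational_homology (K 0) p)"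
    and "x0 \<in> topspace (K 0)"
    and "N > 0"
    and "\<And>i. 0 < i \<Longrightarrow> i \<le> N \<Longrightarrow> d i > 1"
    and "\<And>i. 0 < i \<Longrightarrow> i \<le> N \<Longrightarrow> S i homeomorphic_space nsphere (d i)"
    and "\<And>i. 0 < i \<Longrightarrow> i \<le> N \<Longrightarrow> topspace (K (i - 1)) \<inter> topspace (S i) = {x0}"
    and "\<And>i. 0 < i \<Longrightarrow> i \<le> N \<Longrightarrow> K i = wedge (K (i - 1)) (S i)"
  shows "\<exists>\<Delta> :: nat \<Rightarrow> nat \<Rightarrow> int \<Rightarrow> 'a qchain set \<Rightarrow> 'a qchain set tensor.
    (\<forall>i\<le>N. transferred_coalgebra (K i) x0 (\<Delta> i)) \<and>
    (\<forall>n\<ge>1. \<forall>p\<ge>0. \<forall>i<N.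
       reduced_homology_map (K (i + 1)) id p
         ` {x \<in> carrier (reduced_homology (K i) p). \<Delta> i n p x = 0}
       \<subseteq> {y \<in> carrier (reduced_homology (K (i + 1)) p). \<Delta> (i + 1) n p y = 0})"
proof -
  have K: "K (Suc i) = wedge (K i) (S (Suc i))" "topspace (K i) \<inter> topspace (S (Suc i)) = {x0}" if "i < N" for i
    using assms(8,9)[of "Suc i"] that by auto
  have x0: "x0 \<in> topspace (K i)" if "i \<le> N" for i
    using that by (induction i) (auto simp: assms(4) K topspace_wedge)
  let ?agree = "\<lambda>i s s'. \<forall>p. \<forall>c\<in>carrier (reduced_chains (K i) p).
     fst s' p c = fst s p c \<and> snd s' p c = snd s p c"
  \<comment> \<open>Agreement relates neighbouring indices, so the splittings are chosen
    recursively, each one extending its predecessor along the wedge inclusion. Beyond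
    \<open>N\<close> the choice is arbitrary.\<close>
  have "\<exists>s. \<forall>i. (i \<le> N \<longrightarrow> splitting (K i) (fst (s i)) (snd (s i))) \<and> (i < N \<longrightarrow> ?agree i (s i) (s (Suc i)))"
  proof (rule dependent_nat_choice)
    show "\<exists>s. 0 \<le> N \<longrightarrow> splitting (K 0) (fst s) (snd s)" using splitting_exists[of "K 0"] by auto
    fix s i assume s: "i \<le> N \<longrightarrow> splitting (K i) (fst s) (snd s)"
    show "\<exists>s'. (Suc i \<le> N \<longrightarrow> splitting (K (Suc i)) (fst s') (snd s')) \<and> (i < N \<longrightarrow> ?agree i s s')"
    proof (cases "i < N")
      case True
      obtain g' t' where "splitting (K (Suc i)) g' t'"
        "\<forall>p. \<forall>c\<in>carrier (reduced_chains (K i) p). g' p c = fst s p c \<and> t' p c = snd s p c"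
        using splitting_extend[OF continuous_map_wedge_incl continuous_map_wedge_retract[OF K(2)[OF True]], of "fst s" "snd s"]
          True s K(1)[OF True] by auto
      then show ?thesis by (intro exI[of _ "(g', t')"]) auto
    qed auto
  qed
  then obtain s where s: "\<And>i. i \<le> N \<Longrightarrow> splitting (K i) (fst (s i)) (snd (s i))"
    and agree: "\<And>i. i < N \<Longrightarrow> ?agree i (s i) (s (Suc i))" by blast
  have sc: "split_chains (K i) x0 (fst (s i)) (snd (s i))" if "i \<le> N" for i
    by (rule split_chains.intro[OF x0[OF that] s[OF that]])
  define \<Delta> where "\<Delta> i = split_chains.tr_ops (K i) x0 (fst (s i)) (snd (s i))" for i
  have lin_ext: "split_chains_extension (K i) (K (Suc i)) x0 (fst (s i)) (snd (s i)) (fst (s (Suc i))) (snd (s (Suc i)))"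
    if "i < N" for i
  proof (rule split_chains_extension.intro[OF sc sc], goal_cases)
    case 3
    show ?case
      by unfold_locales (use agree[OF that] K(1)[OF that] continuous_map_wedge_incl in auto)
  qed (use that in auto)
  show ?thesis
  proof (intro exI[of _ \<Delta>] conjI allI impI)
    show "transferred_coalgebra (K i) x0 (\<Delta> i)" if "i \<le> N" for i
      unfolding \<Delta>_def by (rule split_chains.transferred_coalgebra[OF sc[OF that]])
    show "reduced_homology_map (K (i + 1)) id p ` {x \<in> carrier (reduced_homology (K i) p). \<Delta> i n p x = 0}
       \<subseteq> {y \<in> carrier (reduced_homology (K (i + 1)) p). \<Delta> (i + 1) n p y = 0}" if "i < N" for n p i
      using split_chains_extension.incl_hom_closed[OF lin_ext[OF that]] split_chains_extension.tr_ops_incl_hom[OF lin_ext[OF that]]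
      by (auto simp: \<Delta>_def)
  qed
qed

end
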